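(* Let $\sigma:\mathbb{R}_+\times\mathbb{R}^n\to M_n(\mathbb{R})$ be continuous and bounded with $a=\sigma\sigma^*$ strictly elliptic, and let $\Lambda$ be a closed convex multivalued Borel mapping from $\mathbb{R}_+\times\mathbb{R}^n$ into $\mathbb{R}^n$. Let $g:\mathbb{R}_+\times\mathbb{R}^n\times\mathbb{R}^n\to[0,+\infty]$ be Borel with $\{\lambda:g(u,x,\lambda)<\infty\}=\Lambda(u,x)$ and $g(u,x,0)=0$ for all $(u,x)$. Let $0\le r\le T$, $y\in\mathbb{R}^n$. For $r$-stopping times $r\le s\le t\le T$ taking finitely many values, the formula $$\Pi^{r,y}_{s,t}(Y)=\operatorname{ess\,sup}_{P^{\sigma,\mu}_{r,y}\in(\tilde{\mathcal Q}_{r,y})_S(\Lambda)}\big(E_{P^{\sigma,\mu}_{r,y}}(Y\mid\mathcal B^r_s)-\alpha_{s,t}(P^{\sigma,\mu}_{r,y})\big),\qquad \alpha_{s,t}(P^{\sigma,\mu}_{r,y})=E_{P^{\sigma,\mu}_{r,y}}\Big(\int_s^tg(u,X_u,\mu(u,\omega))du\Big|\mathcal B^r_s\Big),$$ for $Y\in L^\infty(\Omega^r,\mathcal B^r_t,Q^a_{r,y})$, defines a normalized convex dynamic process which is time consistent for $r$-stopping times taking finitely many values: $\Pi^{r,y}_{s_0,s}(\Pi^{r,y}_{s,t}(Y))=\Pi^{r,y}_{s_0,t}(Y)$ for all such $s_0\le s\le t$. Furthermore, for fixed $s$ and $t$, the map $\Pi^{r,y}_{s,t}$ on $L^\infty(\Omega^r,\mathcal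 B^r_t,Q^a_{r,y})$ is convex, monotone and continuous from below.
   Context: For $r\ge0$, $\Omega^r=C([r,\infty),\mathbb{R}^n)$ with the topology of uniform convergence on compact sets; $X$ is the coordinate process; $\mathcal B^r=\sigma(X_u:u\ge r)$. Strictly elliptic means $a(t,x)$ is positive definite for every $(t,x)$. $^*$ denotes transpose. For $\lambda:\mathbb{R}_+\times\mathbb{R}^n\to\mathbb{R}^n$ bounded Borel, $Q^{\sigma,\lambda}_{r,y}$ is the unique probability measure on $(\Omega^r,\mathcal B^r)$ (existence and uniqueness are due to Stroock and Varadhan) such that $Q^{\sigma,\lambda}_{r,y}(X_r=y)=1$ and, for every $\theta\in\mathbb{R}^n$, $\exp\{\theta^*(X_t-y)-\int_r^t\theta^*(\sigma\lambda)(u,X_u)du-\frac12\int_r^t\theta^*a(u,X_u)\theta\,du\}$, $t\ge r$, is a martingale for the filtration generated by $X$. $Q^a_{r,y}:=Q^{\sigma,0}_{r,y}$. $(\mathcal B^r_s)_{s\ge r}$ denotes the $Q^a_{r,y}$-completion of the filtration $\sigma(X_u:r\le u\le s)$ (it is right-continuous). An $r$-stopping time is a stopping time with values $\ge r$ for this filtration. A multivalued Borel mapping $\Lambda$ assigns to each $(t,x)$ a subset $\Lambda(t,x)$ of $\mathbb{R}^n$ containing $0$, with Borel graph; it is closed (convex) if each $\Lambda(t,x)$ is. $L(\Lambda)$ is the set of bounded Borel maps $\lambda$ with $\lambda(t,x)\in\Lambda(t,x)$ for all $(t,x)$. For a bounded predictable process $\mu$ on $[r,T]$, $P^{\sigma,\mu}_{r,y}$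 is the probability measure on $\mathcal B^r_T$ with density with respect to $Q^a_{r,y}$ equal to $\exp(\int_r^T\mu^*(u,\omega)\sigma^{-1}(u,X_u)dX_u-\frac12\int_r^T\|\mu(u,\omega)\|^2du)$. $\tilde{\mathcal S}^r_T(\Lambda)$ is the set of processes $\mu$ for which there are a finite subdivision $r=s_0<\dots<s_N=T$ and, for each $i<N$, a finite partition $(A_{i,j})_{j\in I_i}$ of $\Omega^r$ into $\mathcal B^r_{s_i}$-measurable sets and continuous maps $\lambda_{i,j}\in L(\Lambda)$ with $\mu(u,\omega)=\sum_{j\in I_i}\lambda_{i,j}(u,X_u(\omega))1_{A_{i,j}}(\omega)$ for $s_i<u\le s_{i+1}$. $(\tilde{\mathcal Q}_{r,y})_S(\Lambda)=\{P^{\sigma,\mu}_{r,y}:\mu\in\tilde{\mathcal S}^r_T(\Lambda)\}$ (the smallest set of measures on $\mathcal B^r_T$, stable by composition and bifurcation, containing all $Q^{\sigma,\lambda}_{r,y}$ with $\lambda\in L(\Lambda)$ continuous). A convex dynamic process is a family of maps $\Pi_{s,t}:L^\infty(\mathcal B^r_t)\to L^\infty(\mathcal B^r_s)$, $s\le t$, that are monotone ($X\le Y\Rightarrow\Pi_{s,t}(X)\le\Pi_{s,t}(Y)$), translation invariant ($\Pi_{s,t}(X+Z)=\Pi_{s,t}(X)+Z$ for $Z\in L^\infty(\mathcal B^r_s)$), convex, and continuous from below (if $X_n\uparrow X$ in $L^\infty(\mathcal B^r_t)$ a.s., then $\Pi_{s,t}(X_n)\uparrow\Pi_{s,t}(X)$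 a.s.). Normalized means $\Pi_{s,t}(0)=0$. *)

theory Defs
  imports "HOL-Probability.Probability"
begin

type_synonym 'n path = "real \<Rightarrow> real ^ 'n"


subsection \<open>Path space, martingale problem, filtration\<close>

text \<open>Elements of \<open>C([r,\<infinity>), \<real>\<^sup>n)\<close> are represented by functions on \<open>\<real>\<close> that are
  \<open>undefined\<close> to the left of \<open>r\<close>. The coordinate process is \<open>X\<^sub>u(\<omega>) = \<omega> u\<close>.\<close>

definition path_space :: "real \<Rightarrow> 'n::finite path set" where
  "path_space r = {\<omega> \<in> extensional {r..}. continuous_on {r..} \<omega>}"

definition coord_algebra :: "real \<Rightarrow> real set \<Rightarrow> 'n::finite path measure" where
  "coord_algebra r I = sigma (path_space r)
     {(\<lambda>\<omega>. \<omega> u) -` A \<inter> path_space r | u A. u \<in> I \<and> A \<in> sets borel}"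

definition martingale_from ::
  "'a measure \<Rightarrow> (real \<Rightarrow> 'a measure) \<Rightarrow> real \<Rightarrow> (real \<Rightarrow> 'a \<Rightarrow> real) \<Rightarrow> bool" where
  "martingale_from M F r Z \<longleftrightarrow>
     (\<forall>t\<ge>r. subalgebra M (F t) \<and> Z t \<in> borel_measurable (F t) \<and> integrable M (Z t)) \<and>
     (\<forall>s\<ge>r. \<forall>t\<ge>s. AE \<omega> in M. real_cond_exp M (F s) (Z t) \<omega> = Z s \<omega>)"

definition diffusion_matrix :: "(real \<Rightarrow> real ^ 'n \<Rightarrow> real ^ 'n ^ 'n) \<Rightarrow> real \<Rightarrow> real ^ 'n \<Rightarrow> real ^ 'n ^ 'n::finite" where
  "diffusion_matrix \<sigma> t x = \<sigma> t x ** transpose (\<sigma> t x)"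

definition positive_definite :: "real ^ 'n ^ 'n::finite \<Rightarrow> bool" where
  "positive_definite A \<longleftrightarrow> transpose A = A \<and> (\<forall>v. v \<noteq> 0 \<longrightarrow> v \<bullet> (A *v v) > 0)"

definition strictly_elliptic :: "(real \<Rightarrow> real ^ 'n \<Rightarrow> real ^ 'n ^ 'n::finite) \<Rightarrow> bool" where
  "strictly_elliptic a \<longleftrightarrow> (\<forall>t\<ge>0. \<forall>x. positive_definite (a t x))"

text \<open>\<open>Q\<close> is (the) law \<open>Q\<^sup>\<sigma>\<^sup>,\<^sup>\<lambda>\<close> started at time \<open>r\<close> from \<open>y\<close>.\<close>

definition solves_martingale_problem ::
  "(real \<Rightarrow> real ^ 'n \<Rightarrow> real ^ 'n ^ 'n) \<Rightarrow> (real \<Rightarrow> real ^ 'n \<Rightarrow> real ^ 'n)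
     \<Rightarrow> real \<Rightarrow> real ^ 'n::finite \<Rightarrow> 'n path measure \<Rightarrow> bool" where
  "solves_martingale_problem \<sigma> lam r y Q \<longleftrightarrow>
     prob_space Q \<and> space Q = path_space r \<and> sets Q = sets (coord_algebra r {r..}) \<and>
     (AE \<omega> in Q. \<omega> r = y) \<and>
     (\<forall>\<theta>. martingale_from Q (\<lambda>t. coord_algebra r {r..t}) r
        (\<lambda>t \<omega>. exp (\<theta> \<bullet> (\<omega> t - y)
           - (LINT u:{r..t}|lborel. \<theta> \<bullet> (\<sigma> u (\<omega> u) *v lam u (\<omega> u)))
           - (1 / 2) * (LINT u:{r..t}|lborel. \<theta> \<bullet> (diffusion_matrix \<sigma> u (\<omega> u) *v \<theta>)))))"

text \<open>The completed filtration: all null sets of the completion of \<open>Q\<close> on the full path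
  \<open>\<sigma>\<close>-algebra are adjoined at every time. For \<open>s < r\<close> (a case which only arises because
  \<^const>\<open>stopping_time\<close> ranges over all real times) only null sets and their complements remain.\<close>

definition cfilt :: "'n::finite path measure \<Rightarrow> real \<Rightarrow> real \<Rightarrow> 'n path measure" where
  "cfilt Q r s = sigma (path_space r) (sets (coord_algebra r {r..s}) \<union> null_sets (completion Q))"

definition simple_stopping_times :: "'n::finite path measure \<Rightarrow> real \<Rightarrow> real \<Rightarrow> ('n path \<Rightarrow> real) set" where
  "simple_stopping_times Q r T =
     {\<tau>. stopping_time (cfilt Q r) \<tau> \<and> finite (\<tau> ` path_space r) \<and>
         (\<forall>\<omega>\<in>path_space r. r \<le> \<tau> \<omega> \<and> \<tau> \<omega> \<le> T)}"

definition stopped_algebra :: "'n::finite path measure \<Rightarrow> real \<Rightarrow> ('n path \<Rightarrow> real) \<Rightarrow> 'n path measure" where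
  "stopped_algebra Q r \<tau> = filtration.pre_sigma (path_space r) (cfilt Q r) \<tau>"


subsection \<open>Stochastic integral with respect to the coordinate process\<close>

text \<open>Under \<open>Q\<^sup>a\<close> the coordinate process is a continuous square integrable martingale with
  \<open>d\<langle>X\<rangle> = a(u, X\<^sub>u) du\<close>. The Ito integral over \<open>(r,T]\<close> of a predictable integrand is the
  \<open>L\<^sup>2\<close>-limit of the elementary integrals of bounded simple predictable processes approximating the
  integrand in the norm \<open>E \<integral> h\<^sup>* a h du\<close>.\<close>

definition predictable_algebra :: "(real \<Rightarrow> 'a measure) \<Rightarrow> 'a set \<Rightarrow> real \<Rightarrow> real \<Rightarrow> (real \<times> 'a) measure" where
  "predictable_algebra F \<Omega> r T = sigma ({r<..T} \<times> \<Omega>)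
     {{s<..t} \<times> A | s t A. r \<le> s \<and> s \<le> t \<and> t \<le> T \<and> A \<in> sets (F s)}"

definition simple_integrand ::
  "(real \<Rightarrow> 'a measure) \<Rightarrow> 'a set \<Rightarrow> real \<Rightarrow> real \<Rightarrow> nat \<Rightarrow> (nat \<Rightarrow> real) \<Rightarrow> (nat \<Rightarrow> 'a \<Rightarrow> real ^ 'n::finite) \<Rightarrow> bool" where
  "simple_integrand F \<Omega> r T N p \<xi> \<longleftrightarrow>
     p 0 = r \<and> p N = T \<and>
     (\<forall>i<N. p i \<le> p (Suc i) \<and> \<xi> i \<in> borel_measurable (F (p i)) \<and> bounded (\<xi> i ` \<Omega>))"

definition simple_process ::
  "nat \<Rightarrow> (nat \<Rightarrow> real) \<Rightarrow> (nat \<Rightarrow> 'a \<Rightarrow> real ^ 'n::finite) \<Rightarrow> real \<Rightarrow> 'a \<Rightarrow> real ^ 'n" where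
  "simple_process N p \<xi> u \<omega> = (\<Sum>i<N. indicator {p i<..p (Suc i)} u *\<^sub>R \<xi> i \<omega>)"

definition simple_integral ::
  "nat \<Rightarrow> (nat \<Rightarrow> real) \<Rightarrow> (nat \<Rightarrow> 'n path \<Rightarrow> real ^ 'n::finite) \<Rightarrow> 'n path \<Rightarrow> real" where
  "simple_integral N p \<xi> \<omega> = (\<Sum>i<N. \<xi> i \<omega> \<bullet> (\<omega> (p (Suc i)) - \<omega> (p i)))"

definition is_ito_integral ::
  "'n path measure \<Rightarrow> (real \<Rightarrow> real ^ 'n \<Rightarrow> real ^ 'n ^ 'n) \<Rightarrow> real \<Rightarrow> real
     \<Rightarrow> (real \<Rightarrow> 'n::finite path \<Rightarrow> real ^ 'n) \<Rightarrow> ('n path \<Rightarrow> real) \<Rightarrow> bool" where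
  "is_ito_integral Q \<sigma> r T H Z \<longleftrightarrow>
     (\<lambda>(u, \<omega>). H u \<omega>) \<in> borel_measurable (predictable_algebra (cfilt Q r) (path_space r) r T) \<and>
     Z \<in> borel_measurable (cfilt Q r T) \<and>
     (\<exists>N p \<xi>. (\<forall>k. simple_integrand (cfilt Q r) (path_space r) r T (N k) (p k) (\<xi> k)) \<and>
        (\<lambda>k. \<integral>\<^sup>+\<omega>. (\<integral>\<^sup>+u\<in>{r<..T}.
             (let h = H u \<omega> - simple_process (N k) (p k) (\<xi> k) u \<omega>
              in ennreal (h \<bullet> (diffusion_matrix \<sigma> u (\<omega> u) *v h))) \<partial>lborel) \<partial>completion Q)
          \<longlonglongrightarrow> 0 \<and>
        (\<lambda>k. \<integral>\<^sup>+\<omega>. ennreal ((simple_integral (N k) (p k) (\<xi> k) \<omega> - Z \<omega>)\<^sup>2) \<partial>completion Q)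
          \<longlonglongrightarrow> 0)"

definition ito_integral ::
  "'n path measure \<Rightarrow> (real \<Rightarrow> real ^ 'n \<Rightarrow> real ^ 'n ^ 'n) \<Rightarrow> real \<Rightarrow> real
     \<Rightarrow> (real \<Rightarrow> 'n::finite path \<Rightarrow> real ^ 'n) \<Rightarrow> 'n path \<Rightarrow> real" where
  "ito_integral Q \<sigma> r T H = (SOME Z. is_ito_integral Q \<sigma> r T H Z)"


subsection \<open>The measures \<open>P\<^sup>\<sigma>\<^sup>,\<^sup>\<mu>\<close> and the stable set they form\<close>

definition girsanov_measure ::
  "'n path measure \<Rightarrow> (real \<Rightarrow> real ^ 'n \<Rightarrow> real ^ 'n ^ 'n) \<Rightarrow> real \<Rightarrow> real
     \<Rightarrow> (real \<Rightarrow> 'n::finite path \<Rightarrow> real ^ 'n) \<Rightarrow> 'n path measure" where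
  "girsanov_measure Q \<sigma> r T \<mu> =
     density (restr_to_subalg (completion Q) (cfilt Q r T))
       (\<lambda>\<omega>. ennreal (exp
          (ito_integral Q \<sigma> r T (\<lambda>u \<omega>. \<mu> u \<omega> v* matrix_inv (\<sigma> u (\<omega> u))) \<omega>
           - (1 / 2) * (LINT u:{r<..T}|lborel. (norm (\<mu> u \<omega>))\<^sup>2))))"

definition multivalued_borel :: "(real \<Rightarrow> real ^ 'n::finite \<Rightarrow> (real ^ 'n) set) \<Rightarrow> bool" where
  "multivalued_borel \<Lambda> \<longleftrightarrow>
     (\<forall>t\<ge>0. \<forall>x. 0 \<in> \<Lambda> t x) \<and> {(t, x, v). t \<ge> 0 \<and> v \<in> \<Lambda> t x} \<in> sets borel"

definition bounded_selections ::
  "(real \<Rightarrow> real ^ 'n::finite \<Rightarrow> (real ^ 'n) set) \<Rightarrow> (real \<Rightarrow> real ^ 'n \<Rightarrow> real ^ 'n) set" where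
  "bounded_selections \<Lambda> =
     {lam. (\<lambda>(t, x). lam t x) \<in> borel_measurable (restrict_space borel ({0..} \<times> UNIV)) \<and>
           bounded ((\<lambda>(t, x). lam t x) ` ({0..} \<times> UNIV)) \<and>
           (\<forall>t\<ge>0. \<forall>x. lam t x \<in> \<Lambda> t x)}"

text \<open>Values of \<open>\<mu>\<close> at times outside \<open>(r,T]\<close> are left arbitrary; nothing below depends on them.\<close>

definition simple_controls ::
  "'n path measure \<Rightarrow> (real \<Rightarrow> real ^ 'n::finite \<Rightarrow> (real ^ 'n) set) \<Rightarrow> real \<Rightarrow> real
     \<Rightarrow> (real \<Rightarrow> 'n path \<Rightarrow> real ^ 'n) set" where
  "simple_controls Q \<Lambda> r T =
     {\<mu>. \<exists>(N::nat) s (I :: nat \<Rightarrow> nat set) A lam.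
        s 0 = r \<and> s N = T \<and> (\<forall>i<N. s i < s (Suc i)) \<and>
        (\<forall>i<N. finite (I i) \<and> disjoint_family_on (A i) (I i) \<and> (\<Union>j\<in>I i. A i j) = path_space r \<and>
           (\<forall>j\<in>I i. A i j \<in> sets (cfilt Q r (s i)) \<and> lam i j \<in> bounded_selections \<Lambda> \<and>
              continuous_on ({0..} \<times> UNIV) (\<lambda>(t, x). lam i j t x))) \<and>
        (\<forall>i<N. \<forall>u\<in>{s i<..s (Suc i)}. \<forall>\<omega>\<in>path_space r.
           \<mu> u \<omega> = (\<Sum>j\<in>I i. indicator (A i j) \<omega> *\<^sub>R lam i j u (\<omega> u)))}"


subsection \<open>Essential suprema and dynamic processes\<close>

text \<open>Elements of \<open>L\<^sup>\<infinity>\<close> are represented by functions; operators between \<open>L\<^sup>\<infinity>\<close> spaces act on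
  representatives, and all identities and inequalities are almost sure. Almost sure monotonicity
  makes such an operator compatible with almost sure equality.\<close>

definition Linfty :: "'a measure \<Rightarrow> 'a measure \<Rightarrow> ('a \<Rightarrow> real) set" where
  "Linfty M G = {Y \<in> borel_measurable G. \<exists>C. AE \<omega> in M. \<bar>Y \<omega>\<bar> \<le> C}"

definition is_ess_sup :: "'a measure \<Rightarrow> ('a \<Rightarrow> ereal) set \<Rightarrow> ('a \<Rightarrow> ereal) \<Rightarrow> bool" where
  "is_ess_sup M S Z \<longleftrightarrow> Z \<in> borel_measurable M \<and> (\<forall>f\<in>S. AE \<omega> in M. f \<omega> \<le> Z \<omega>) \<and>
     (\<forall>W\<in>borel_measurable M. (\<forall>f\<in>S. AE \<omega> in M. f \<omega> \<le> W \<omega>) \<longrightarrow> (AE \<omega> in M. Z \<omega> \<le> W \<omega>))"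

definition ess_sup :: "'a measure \<Rightarrow> ('a \<Rightarrow> ereal) set \<Rightarrow> 'a \<Rightarrow> ereal" where
  "ess_sup M S = (SOME Z. is_ess_sup M S Z)"

definition monotone_on_Linfty :: "'a measure \<Rightarrow> 'a measure \<Rightarrow> (('a \<Rightarrow> real) \<Rightarrow> 'a \<Rightarrow> real) \<Rightarrow> bool" where
  "monotone_on_Linfty M G \<Phi> \<longleftrightarrow>
     (\<forall>X\<in>Linfty M G. \<forall>Y\<in>Linfty M G. (AE \<omega> in M. X \<omega> \<le> Y \<omega>) \<longrightarrow> (AE \<omega> in M. \<Phi> X \<omega> \<le> \<Phi> Y \<omega>))"

definition convex_on_Linfty :: "'a measure \<Rightarrow> 'a measure \<Rightarrow> (('a \<Rightarrow> real) \<Rightarrow> 'a \<Rightarrow> real) \<Rightarrow> bool" where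
  "convex_on_Linfty M G \<Phi> \<longleftrightarrow>
     (\<forall>X\<in>Linfty M G. \<forall>Y\<in>Linfty M G. \<forall>c\<in>{0..1}. AE \<omega> in M.
        \<Phi> (\<lambda>\<omega>. c * X \<omega> + (1 - c) * Y \<omega>) \<omega> \<le> c * \<Phi> X \<omega> + (1 - c) * \<Phi> Y \<omega>)"

definition increases_to :: "'a measure \<Rightarrow> (nat \<Rightarrow> 'a \<Rightarrow> real) \<Rightarrow> ('a \<Rightarrow> real) \<Rightarrow> bool" where
  "increases_to M X Y \<longleftrightarrow> (AE \<omega> in M. incseq (\<lambda>k. X k \<omega>) \<and> (\<lambda>k. X k \<omega>) \<longlonglongrightarrow> Y \<omega>)"

definition continuous_from_below_on_Linfty ::
  "'a measure \<Rightarrow> 'a measure \<Rightarrow> (('a \<Rightarrow> real) \<Rightarrow> 'a \<Rightarrow> real) \<Rightarrow> bool" where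
  "continuous_from_below_on_Linfty M G \<Phi> \<longleftrightarrow>
     (\<forall>X Y. (\<forall>k. X k \<in> Linfty M G) \<longrightarrow> Y \<in> Linfty M G \<longrightarrow> increases_to M X Y \<longrightarrow>
        increases_to M (\<lambda>k. \<Phi> (X k)) (\<Phi> Y))"

text \<open>In the next three definitions \<open>\<T>\<close> is the set of admissible (stopping) times, compared
  pointwise, and \<open>G \<tau>\<close> is the \<open>\<sigma>\<close>-algebra of events up to \<open>\<tau>\<close>.\<close>

definition convex_dynamic_process ::
  "'a measure \<Rightarrow> ('a \<Rightarrow> real) set \<Rightarrow> (('a \<Rightarrow> real) \<Rightarrow> 'a measure)
     \<Rightarrow> (('a \<Rightarrow> real) \<Rightarrow> ('a \<Rightarrow> real) \<Rightarrow> ('a \<Rightarrow> real) \<Rightarrow> 'a \<Rightarrow> real) \<Rightarrow> bool" where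
  "convex_dynamic_process M \<T> G \<Phi> \<longleftrightarrow>
     (\<forall>s\<in>\<T>. \<forall>t\<in>\<T>. (\<forall>\<omega>\<in>space M. s \<omega> \<le> t \<omega>) \<longrightarrow>
        (\<forall>Y\<in>Linfty M (G t). \<Phi> s t Y \<in> Linfty M (G s)) \<and>
        monotone_on_Linfty M (G t) (\<Phi> s t) \<and>
        (\<forall>Y\<in>Linfty M (G t). \<forall>Z\<in>Linfty M (G s).
           AE \<omega> in M. \<Phi> s t (\<lambda>\<omega>. Y \<omega> + Z \<omega>) \<omega> = \<Phi> s t Y \<omega> + Z \<omega>) \<and>
        convex_on_Linfty M (G t) (\<Phi> s t) \<and>
        continuous_from_below_on_Linfty M (G t) (\<Phi> s t))"

definition normalized_process ::
  "'a measure \<Rightarrow> ('a \<Rightarrow> real) set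
     \<Rightarrow> (('a \<Rightarrow> real) \<Rightarrow> ('a \<Rightarrow> real) \<Rightarrow> ('a \<Rightarrow> real) \<Rightarrow> 'a \<Rightarrow> real) \<Rightarrow> bool" where
  "normalized_process M \<T> \<Phi> \<longleftrightarrow>
     (\<forall>s\<in>\<T>. \<forall>t\<in>\<T>. (\<forall>\<omega>\<in>space M. s \<omega> \<le> t \<omega>) \<longrightarrow> (AE \<omega> in M. \<Phi> s t (\<lambda>_. 0) \<omega> = 0))"

definition time_consistent ::
  "'a measure \<Rightarrow> ('a \<Rightarrow> real) set \<Rightarrow> (('a \<Rightarrow> real) \<Rightarrow> 'a measure)
     \<Rightarrow> (('a \<Rightarrow> real) \<Rightarrow> ('a \<Rightarrow> real) \<Rightarrow> ('a \<Rightarrow> real) \<Rightarrow> 'a \<Rightarrow> real) \<Rightarrow> bool" where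
  "time_consistent M \<T> G \<Phi> \<longleftrightarrow>
     (\<forall>q\<in>\<T>. \<forall>s\<in>\<T>. \<forall>t\<in>\<T>. (\<forall>\<omega>\<in>space M. q \<omega> \<le> s \<omega> \<and> s \<omega> \<le> t \<omega>) \<longrightarrow>
        (\<forall>Y\<in>Linfty M (G t). AE \<omega> in M. \<Phi> q s (\<Phi> s t Y) \<omega> = \<Phi> q t Y \<omega>))"


subsection \<open>The penalized process\<close>

text \<open>The penalty \<open>\<alpha>\<^sub>s\<^sub>,\<^sub>t(P\<^sup>\<sigma>\<^sup>,\<^sup>\<mu>)\<close> and the family whose essential supremum is taken are indexed by
  the control \<open>\<mu>\<close> rather than by the measure \<open>P\<^sup>\<sigma>\<^sup>,\<^sup>\<mu>\<close>; the measure determines \<open>\<mu>\<close> up to a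
  \<open>du \<otimes> Q\<close>-null set.\<close>

definition penalty ::
  "'n path measure \<Rightarrow> (real \<Rightarrow> real ^ 'n \<Rightarrow> real ^ 'n ^ 'n) \<Rightarrow> (real \<Rightarrow> real ^ 'n \<Rightarrow> real ^ 'n \<Rightarrow> ennreal)
     \<Rightarrow> real \<Rightarrow> real \<Rightarrow> ('n path \<Rightarrow> real) \<Rightarrow> ('n path \<Rightarrow> real)
     \<Rightarrow> (real \<Rightarrow> 'n::finite path \<Rightarrow> real ^ 'n) \<Rightarrow> 'n path \<Rightarrow> ennreal" where
  "penalty Q \<sigma> g r T s t \<mu> =
     nn_cond_exp (girsanov_measure Q \<sigma> r T \<mu>) (stopped_algebra Q r s)
       (\<lambda>\<omega>. \<integral>\<^sup>+u\<in>{s \<omega><..t \<omega>}. g u (\<omega> u) (\<mu> u \<omega>) \<partial>lborel)"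

definition penalized_expectations ::
  "'n path measure \<Rightarrow> (real \<Rightarrow> real ^ 'n \<Rightarrow> real ^ 'n ^ 'n) \<Rightarrow> (real \<Rightarrow> real ^ 'n \<Rightarrow> (real ^ 'n) set)
     \<Rightarrow> (real \<Rightarrow> real ^ 'n \<Rightarrow> real ^ 'n \<Rightarrow> ennreal) \<Rightarrow> real \<Rightarrow> real
     \<Rightarrow> ('n path \<Rightarrow> real) \<Rightarrow> ('n path \<Rightarrow> real) \<Rightarrow> ('n::finite path \<Rightarrow> real) \<Rightarrow> ('n path \<Rightarrow> ereal) set" where
  "penalized_expectations Q \<sigma> \<Lambda> g r T s t Y =
     (\<lambda>\<mu> \<omega>. ereal (real_cond_exp (girsanov_measure Q \<sigma> r T \<mu>) (stopped_algebra Q r s) Y \<omega>)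
             - enn2ereal (penalty Q \<sigma> g r T s t \<mu> \<omega>)) ` simple_controls Q \<Lambda> r T"

definition penalized_process ::
  "'n path measure \<Rightarrow> (real \<Rightarrow> real ^ 'n \<Rightarrow> real ^ 'n ^ 'n) \<Rightarrow> (real \<Rightarrow> real ^ 'n \<Rightarrow> (real ^ 'n) set)
     \<Rightarrow> (real \<Rightarrow> real ^ 'n \<Rightarrow> real ^ 'n \<Rightarrow> ennreal) \<Rightarrow> real \<Rightarrow> real
     \<Rightarrow> ('n path \<Rightarrow> real) \<Rightarrow> ('n path \<Rightarrow> real) \<Rightarrow> ('n::finite path \<Rightarrow> real) \<Rightarrow> 'n path \<Rightarrow> real" where
  "penalized_process Q \<sigma> \<Lambda> g r T s t Y \<omega> =
     real_of_ereal (ess_sup (completion Q) (penalized_expectations Q \<sigma> \<Lambda> g r T s t Y) \<omega>)"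

end

(* The penalized process is a value function over the simple controls. By the Bayes formula every
   conditional expectation under P^mu can be written under Q with ratios of density processes D(mu).
   These ratios over a stochastic interval depend only on mu on that interval, and simple controls can
   be pasted at a stopping time with finitely many values along an event known at that time. Hence the
   family of penalized expectations is directed upwards, its essential supremum is the limit of an
   increasing sequence, and dynamic programming gives time consistency; the remaining properties
   pass to the supremum from a single control.

   The analytic input is that the Ito integral of mu* sigma^-1 exists, is local in mu, is additive in
   the interval, and that its stochastic exponential is a martingale. All of this follows from the
   exponential martingales defining Q: expanding them to second order gives the first two conditional
   moments of the increments, hence the Ito isometry for step integrands, and multiplying them along
   a partition gives the exponential martingale of a step integrand. Both pass to the limit since the
   integrands mu* sigma^-1 have left continuous paths and bounded energy. *)

theory Submission
  imports Defs "HOL-Probability.Probability"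
begin

section \<open>Dynamic programming for a family of densities\<close>

text \<open>Two features of the statement shape the proof. Simple controls have deterministic
  subdivisions, so a control switched at a stopping time is again simple only if that time has
  finitely many values; for the same reason every claim at a stopping time \<open>s\<close> is cut
  along the events \<open>s = v\<close> and reduced to a fixed time. Secondly, a pasted control
  agrees with its parts only on an event, so locality is required path by path: outside a null set,
  equality of two controls on \<open>{u<..v}\<close> along one path must force equal density ratios
  on that path. Isometry alone does not show this. It comes from approximating sums that are
  computed from the path: wherever the two controls coincide, so do the sums, and mean square limits
  keep this almost surely. Moreover the measures are defined through an arbitrary choice of one Ito
  integral over the whole interval, whereas the densities at earlier times rest on integrals chosen
  separately for each end point; additivity over adjacent intervals ties these choices together up
  to null sets.\<close>

locale complete_filtration = prob_space M + filtration "space M" F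
  for M :: "'a measure" and F :: "real \<Rightarrow> 'a measure" +
  fixes r T :: real
  assumes complete_M: "complete_measure M"
    and null_sets_subset_F: "null_sets M \<subseteq> sets (F t)"
    and sets_F_subset: "sets (F t) \<subseteq> sets M"
    and r_le_T: "r \<le> T"
begin

section \<open>Stopping times with finitely many values in a complete filtration\<close>

definition times :: "('a \<Rightarrow> real) set" where
  "times = {\<tau>. stopping_time F \<tau> \<and> finite (\<tau> ` space M) \<and>
     (\<forall>\<omega>\<in>space M. r \<le> \<tau> \<omega> \<and> \<tau> \<omega> \<le> T)}"

lemma timesD:
  assumes "\<tau> \<in> times"
  shows "stopping_time F \<tau>" "finite (\<tau> ` space M)"
    "\<And>\<omega>. \<omega> \<in> space M \<Longrightarrow> r \<le> \<tau> \<omega>" "\<And>\<omega>. \<omega> \<in> space M \<Longrightarrow> \<tau> \<omega> \<le> T"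
  using assms by (auto simp: times_def)

lemma const_times: "r \<le> v \<Longrightarrow> v \<le> T \<Longrightarrow> (\<lambda>_. v) \<in> times"
  by (simp add: times_def stopping_time_const image_constant_conv)

lemma subalgebra_F: "subalgebra M (F t)"
  using sets_F_subset by (auto simp: subalgebra_def space_F)

lemma measurable_F_mono: "f \<in> measurable (F s) N \<Longrightarrow> s \<le> t \<Longrightarrow> f \<in> measurable (F t) N"
  using sets_F_mono[of s t] by (auto simp: measurable_def space_F)

lemma measurable_F_M: "f \<in> measurable (F s) N \<Longrightarrow> f \<in> measurable M N"
  using sets_F_subset[of s] by (auto simp: measurable_def space_F)

text \<open>With finitely many values, \<open>{\<omega>\<in>A. \<tau> \<omega> \<le> t}\<close> is a
  finite union of the pieces \<open>{\<omega>\<in>A. \<tau> \<omega> = v}\<close>, so the algebra at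
  \<open>\<tau>\<close> can be tested one value at a time. Localisation at stopping times goes
  through this criterion.\<close>

lemma sets_pre_sigma_iff:
  assumes "\<tau> \<in> times"
  shows "A \<in> sets (pre_sigma \<tau>) \<longleftrightarrow>
    A \<subseteq> space M \<and> (\<forall>v\<in>\<tau> ` space M. {\<omega>\<in>A. \<tau> \<omega> = v} \<in> sets (F v))"
proof safe
  assume A: "A \<in> sets (pre_sigma \<tau>)"
  from sets.sets_into_space[OF A] show "x \<in> A \<Longrightarrow> x \<in> space M" for x
    by (auto simp: space_pre_sigma)
  fix \<omega> assume "\<omega> \<in> space M"
  let ?v = "\<tau> \<omega>"
  have 1: "{\<omega>\<in>A. \<tau> \<omega> \<le> ?v} \<in> sets (F ?v)"
    using sets_pre_sigmaD[OF timesD(1)[OF assms] A] .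
  have 2: "{\<omega>\<in>space (F ?v). \<tau> \<omega> = ?v} \<in> sets (F ?v)"
    using stopping_time_eq_const[OF timesD(1)[OF assms]] by (simp add: pred_def)
  have "{\<omega>\<in>A. \<tau> \<omega> = ?v} = {\<omega>\<in>A. \<tau> \<omega> \<le> ?v} \<inter> {\<omega>\<in>space (F ?v). \<tau> \<omega> = ?v}"
    using sets.sets_into_space[OF A] by (auto simp: space_pre_sigma space_F)
  with 1 2 show "{\<omega>'\<in>A. \<tau> \<omega>' = ?v} \<in> sets (F ?v)" by auto
next
  assume A: "A \<subseteq> space M" "\<forall>v\<in>\<tau> ` space M. {\<omega>\<in>A. \<tau> \<omega> = v} \<in> sets (F v)"
  show "A \<in> sets (pre_sigma \<tau>)"
  proof (rule sets_pre_sigmaI[OF timesD(1)[OF assms]])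
    fix t
    have "{\<omega>\<in>A. \<tau> \<omega> \<le> t} = (\<Union>v\<in>{v\<in>\<tau> ` space M. v \<le> t}. {\<omega>\<in>A. \<tau> \<omega> = v})"
      using A(1) by auto
    also have "\<dots> \<in> sets (F t)"
      using A(2) sets_F_mono timesD(2)[OF assms] by (intro sets.finite_UN) auto
    finally show "{\<omega>\<in>A. \<tau> \<omega> \<le> t} \<in> sets (F t)" .
  qed
qed

lemma times_eq_sets: "\<tau> \<in> times \<Longrightarrow> {\<omega>\<in>space M. \<tau> \<omega> = v} \<in> sets (F v)"
  using stopping_time_eq_const[OF timesD(1), of \<tau> v] by (simp add: pred_def space_F)

lemma times_le_sets: "\<tau> \<in> times \<Longrightarrow> {\<omega>\<in>space M. \<tau> \<omega> \<le> v} \<in> sets (F v)"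
  using stopping_timeD[OF timesD(1), of \<tau> v] by (simp add: pred_def space_F)

text \<open>Preimages are cut along the finitely many events \<open>\<tau> = v\<close>, on each of
  which \<open>f\<close> may be replaced by a function measurable at the fixed time
  \<open>v\<close>.\<close>

lemma measurable_pre_sigmaI:
  assumes \<tau>: "\<tau> \<in> times"
    and ex: "\<And>v. v \<in> \<tau> ` space M \<Longrightarrow>
      \<exists>h\<in>measurable (F v) N. \<forall>\<omega>\<in>space M. \<tau> \<omega> = v \<longrightarrow> f \<omega> = h \<omega>"
  shows "f \<in> measurable (pre_sigma \<tau>) N"
proof (rule measurableI)
  fix \<omega> assume "\<omega> \<in> space (pre_sigma \<tau>)"
  then have \<omega>: "\<omega> \<in> space M" by (simp add: space_pre_sigma)
  with ex[of "\<tau> \<omega>"] obtain h where "h \<in> measurable (F (\<tau> \<omega>)) N" "f \<omega> = h \<omega>" by blast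
  then show "f \<omega> \<in> space N" using \<omega> measurable_space[of h "F (\<tau> \<omega>)" N \<omega>] by (simp add: space_F)
next
  fix S assume S: "S \<in> sets N"
  show "f -` S \<inter> space (pre_sigma \<tau>) \<in> sets (pre_sigma \<tau>)"
    unfolding sets_pre_sigma_iff[OF \<tau>] space_pre_sigma
  proof (intro conjI ballI)
    fix v assume v: "v \<in> \<tau> ` space M"
    from ex[OF v] obtain h where h: "h \<in> measurable (F v) N"
      "\<And>\<omega>. \<omega> \<in> space M \<Longrightarrow> \<tau> \<omega> = v \<Longrightarrow> f \<omega> = h \<omega>" by blast
    have "{\<omega> \<in> f -` S \<inter> space M. \<tau> \<omega> = v} = (h -` S \<inter> space (F v)) \<inter> {\<omega>\<in>space M. \<tau> \<omega> = v}"
      using h(2) by (auto simp: space_F)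
    then show "{\<omega> \<in> f -` S \<inter> space M. \<tau> \<omega> = v} \<in> sets (F v)"
      using measurable_sets[OF h(1) S] times_eq_sets[OF \<tau>, of v] by auto
  qed auto
qed

lemma pre_sigma_const: "r \<le> v \<Longrightarrow> v \<le> T \<Longrightarrow> sets (pre_sigma (\<lambda>_. v)) = sets (F v)"
  using sets.sets_into_space[of _ "F v"] not_empty unfolding set_eq_iff
  by (simp add: sets_pre_sigma_iff[OF const_times] space_F image_constant_conv) blast

lemma sets_pre_sigma_mono:
  assumes "s \<in> times" "t \<in> times" "\<forall>\<omega>\<in>space M. s \<omega> \<le> t \<omega>"
  shows "sets (pre_sigma s) \<subseteq> sets (pre_sigma t)"
  using assms by (intro mono_pre_sigma timesD(1)) auto

lemma sets_pre_sigma_F_T: "s \<in> times \<Longrightarrow> sets (pre_sigma s) \<subseteq> sets (F T)"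
  using sets_pre_sigma_mono[OF _ const_times[of T], of s] r_le_T timesD(4)[of s]
  unfolding pre_sigma_const[OF r_le_T order_refl] by simp

lemma subalgebra_pre_sigma: "s \<in> times \<Longrightarrow> subalgebra M (pre_sigma s)"
  using sets_pre_sigma_F_T[of s] sets_F_subset[of T] by (auto simp: subalgebra_def space_pre_sigma)

lemma subalgebra_pre_sigma2:
  "s \<in> times \<Longrightarrow> t \<in> times \<Longrightarrow> \<forall>\<omega>\<in>space M. s \<omega> \<le> t \<omega> \<Longrightarrow> subalgebra (pre_sigma t) (pre_sigma s)"
  using sets_pre_sigma_mono[of s t] by (auto simp: subalgebra_def space_pre_sigma)

lemma measurable_pre_sigma_mono:
  "f \<in> measurable (pre_sigma s) N \<Longrightarrow> s \<in> times \<Longrightarrow> t \<in> times \<Longrightarrow> \<forall>\<omega>\<in>space M. s \<omega> \<le> t \<omega> \<Longrightarrow>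
    f \<in> measurable (pre_sigma t) N"
  using subalgebra_pre_sigma2 measurable_from_subalg by blast

lemma measurable_pre_sigma_F_T: "f \<in> measurable (pre_sigma s) N \<Longrightarrow> s \<in> times \<Longrightarrow> f \<in> measurable (F T) N"
  using sets_pre_sigma_F_T[of s] by (auto simp: measurable_def space_pre_sigma space_F)

lemma measurable_pre_sigma_M: "f \<in> measurable (pre_sigma s) N \<Longrightarrow> s \<in> times \<Longrightarrow> f \<in> measurable M N"
  using measurable_pre_sigma_F_T measurable_F_M by blast

text \<open>By completeness the pieces \<open>{\<omega>\<in>A. s \<omega> = v}\<close> of a null set
  are null sets themselves, and every \<open>F v\<close> contains these.\<close>

lemma null_sets_pre_sigma:
  assumes "s \<in> times" "A \<in> null_sets M"
  shows "A \<in> sets (pre_sigma s)"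
proof -
  interpret complete_measure M by (rule complete_M)
  have "B \<in> sets (F v)" if "B \<subseteq> A" for B v
    using complete2[OF that assms(2)] null_sets_subset_F by blast
  moreover have "A \<subseteq> space M" using assms(2) by (intro sets.sets_into_space) auto
  ultimately show ?thesis
    unfolding sets_pre_sigma_iff[OF assms(1)] by (metis (no_types, lifting) mem_Collect_eq subsetI)
qed

text \<open>Changing a function on a null set alters preimages by subsets of a null set, which lie
  in \<open>G\<close> by completeness. An essential supremum is chosen in \<open>M\<close> only;
  this is how it becomes measurable at the earlier time.\<close>

lemma measurable_AE_cong:
  assumes f: "f \<in> measurable G N" and ae: "AE \<omega> in M. f \<omega> = h \<omega>" and N: "space N = UNIV"
    and G: "space G = space M" "null_sets M \<subseteq> sets G"
  shows "h \<in> measurable G N"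
proof (rule measurableI)
  interpret complete_measure M by (rule complete_M)
  fix S assume S: "S \<in> sets N"
  obtain Z where Z: "Z \<in> null_sets M" "{\<omega>\<in>space M. f \<omega> \<noteq> h \<omega>} \<subseteq> Z"
    using ae unfolding eventually_ae_filter by auto
  have "h -` S \<inter> space G = ((f -` S \<inter> space G) - Z) \<union> (h -` S \<inter> space G \<inter> Z)"
    using Z(2) by (auto simp: G)
  moreover have "h -` S \<inter> space G \<inter> Z \<in> sets G"
    using complete2[OF _ Z(1), of "h -` S \<inter> space G \<inter> Z"] G(2) by blast
  moreover have "Z \<in> sets G" using Z(1) G(2) by blast
  ultimately show "h -` S \<inter> space G \<in> sets G"
    using measurable_sets[OF f S] by (metis sets.Diff sets.Un)
qed (simp add: N)

lemma measurable_pre_sigma_AE_cong: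
  "f \<in> borel_measurable (pre_sigma s) \<Longrightarrow> AE \<omega> in M. f \<omega> = h \<omega> \<Longrightarrow> s \<in> times \<Longrightarrow>
    h \<in> borel_measurable (pre_sigma s)"
  by (rule measurable_AE_cong) (auto simp: space_pre_sigma null_sets_pre_sigma)

end

section \<open>Conditional expectations of nonnegative functions\<close>

lemma (in prob_space) sigma_finite_subalgebraI: "subalgebra M G \<Longrightarrow> sigma_finite_subalgebra M G"
  by (intro finite_measure_subalgebra_is_sigma_finite)
     (simp add: finite_measure_subalgebra_def finite_measure_subalgebra_axioms_def finite_measure_axioms)

lemma (in sigma_finite_subalgebra) nn_cond_exp_eqI:
  assumes "\<And>A. A \<in> sets F \<Longrightarrow> (\<integral>\<^sup>+x\<in>A. f x \<partial>M) = (\<integral>\<^sup>+x\<in>A. g x \<partial>M)"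
    and "f \<in> borel_measurable M" "g \<in> borel_measurable F"
  shows "AE x in M. nn_cond_exp M F f x = g x"
proof -
  have "AE x in M. g x = nn_cond_exp M F f x"
    using assms by (intro nn_cond_exp_charact)
  then show ?thesis by eventually_elim simp
qed

text \<open>Equal integrals over all events of \<open>F\<close> mean equal conditional expectations,
  and these may be tested against any nonnegative \<open>F\<close>-measurable factor. Martingale
  identities over events thus become identities with weights such as inverse densities.\<close>

lemma (in sigma_finite_subalgebra) nn_integral_mult_eq_of_set_eq:
  assumes eq: "\<And>A. A \<in> sets F \<Longrightarrow> (\<integral>\<^sup>+x\<in>A. g x \<partial>M) = (\<integral>\<^sup>+x\<in>A. h x \<partial>M)"
    and [measurable]: "g \<in> borel_measurable M" "h \<in> borel_measurable M" "f \<in> borel_measurable F"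
  shows "(\<integral>\<^sup>+x. f x * g x \<partial>M) = (\<integral>\<^sup>+x. f x * h x \<partial>M)"
proof -
  have "AE x in M. nn_cond_exp M F g x = nn_cond_exp M F h x"
  proof (rule nn_cond_exp_eqI)
    fix A assume A: "A \<in> sets F"
    then show "(\<integral>\<^sup>+x\<in>A. g x \<partial>M) = (\<integral>\<^sup>+x\<in>A. nn_cond_exp M F h x \<partial>M)"
      using nn_cond_exp_intg[of "indicator A" h] eq[OF A] by (simp add: mult.commute)
  qed auto
  then have "(\<integral>\<^sup>+x. f x * nn_cond_exp M F g x \<partial>M) = (\<integral>\<^sup>+x. f x * nn_cond_exp M F h x \<partial>M)"
    by (intro nn_integral_cong_AE) auto
  then show ?thesis
    by (simp add: nn_cond_exp_intg)
qed

text \<open>A finite integral of \<open>f 0\<close> is what makes monotone convergence valid for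
  decreasing sequences. The decreasing form is the relevant one: the costs \<open>C - Y\<close> fall
  when \<open>Y\<close> rises.\<close>

lemma (in sigma_finite_subalgebra) nn_cond_exp_INF:
  fixes f :: "nat \<Rightarrow> 'a \<Rightarrow> ennreal"
  assumes dec: "\<And>k. AE x in M. f (Suc k) x \<le> f k x"
    and [measurable]: "\<And>k. f k \<in> borel_measurable M"
    and fin: "(\<integral>\<^sup>+x. f 0 x \<partial>M) < \<infinity>"
  shows "AE x in M. nn_cond_exp M F (\<lambda>x. INF k. f k x) x = (INF k. nn_cond_exp M F (f k) x)"
proof (rule nn_cond_exp_eqI)
  fix A assume A[measurable]: "A \<in> sets F"
  have A'[measurable]: "A \<in> sets M" using A subalg by (auto simp: subalgebra_def)
  have m: "(\<lambda>x. indicator A x :: ennreal) \<in> borel_measurable F" by measurable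
  have fin0: "(\<integral>\<^sup>+x. indicator A x * f 0 x \<partial>M) < \<infinity>"
    by (rule le_less_trans[OF nn_integral_mono fin]) (auto split: split_indicator)
  have *: "(INF k. h k x) * indicator A x = (INF k. indicator A x * (h k x :: ennreal))"
    for h :: "nat \<Rightarrow> 'a \<Rightarrow> ennreal" and x
    by (auto split: split_indicator)
  have dec': "AE x in M. indicator A x * f (Suc k) x \<le> indicator A x * f k x" for k
    using dec[of k] by eventually_elim (rule mult_left_mono, auto)
  have dec'': "AE x in M. indicator A x * nn_cond_exp M F (f (Suc k)) x \<le> indicator A x * nn_cond_exp M F (f k) x" for k
  proof -
    have "AE x in M. nn_cond_exp M F (f (Suc k)) x \<le> nn_cond_exp M F (f k) x"
      using dec by (intro nn_cond_exp_mono) auto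
    then show ?thesis by eventually_elim (rule mult_left_mono, auto)
  qed
  have "(\<integral>\<^sup>+x\<in>A. (INF k. f k x) \<partial>M) = (INF k. \<integral>\<^sup>+x. indicator A x * f k x \<partial>M)"
    unfolding * using dec' fin0 by (intro nn_integral_monotone_convergence_INF_AE') auto
  also have "\<dots> = (INF k. \<integral>\<^sup>+x. indicator A x * nn_cond_exp M F (f k) x \<partial>M)"
    by (simp add: nn_cond_exp_intg[OF m])
  also have "\<dots> = (\<integral>\<^sup>+x\<in>A. (INF k. nn_cond_exp M F (f k) x) \<partial>M)"
    unfolding *[of "\<lambda>k. nn_cond_exp M F (f k)"] using dec'' fin0 nn_cond_exp_intg[OF m, of "f 0"]
    by (intro sym[OF nn_integral_monotone_convergence_INF_AE']) auto
  finally show "(\<integral>\<^sup>+x\<in>A. (INF k. f k x) \<partial>M) = (\<integral>\<^sup>+x\<in>A. (INF k. nn_cond_exp M F (f k) x) \<partial>M)" .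
qed auto

text \<open>\<open>D \<mu> t\<close> is the density process of the measure controlled by \<open>\<mu>\<close>. The proof of the
  dynamic programming principle only needs that density ratios over an interval depend on the
  control on this interval (\<open>D_local\<close>) and that controls can be pasted at a stopping time.\<close>

locale controlled_densities = complete_filtration M F r T
  for M :: "'a measure" and F r T +
  fixes CC :: "(real \<Rightarrow> 'a \<Rightarrow> 'b::zero) set"
    and D :: "(real \<Rightarrow> 'a \<Rightarrow> 'b) \<Rightarrow> real \<Rightarrow> 'a \<Rightarrow> real"
    and c :: "real \<Rightarrow> 'a \<Rightarrow> 'b \<Rightarrow> ennreal"
    and P :: "(real \<Rightarrow> 'a \<Rightarrow> 'b) \<Rightarrow> 'a measure"
  assumes D_pos: "\<mu> \<in> CC \<Longrightarrow> 0 < D \<mu> t \<omega>"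
    and D_measurable: "\<mu> \<in> CC \<Longrightarrow> r \<le> t \<Longrightarrow> t \<le> T \<Longrightarrow> D \<mu> t \<in> borel_measurable (F t)"
    and D_start: "\<mu> \<in> CC \<Longrightarrow> AE \<omega> in M. D \<mu> r \<omega> = 1"
    and D_martingale: "\<mu> \<in> CC \<Longrightarrow> r \<le> u \<Longrightarrow> u \<le> T \<Longrightarrow> A \<in> sets (F u) \<Longrightarrow>
      (\<integral>\<^sup>+\<omega>\<in>A. D \<mu> T \<omega> \<partial>M) = (\<integral>\<^sup>+\<omega>\<in>A. D \<mu> u \<omega> \<partial>M)"
    and D_local: "\<mu> \<in> CC \<Longrightarrow> \<nu> \<in> CC \<Longrightarrow> r \<le> u \<Longrightarrow> u \<le> v \<Longrightarrow> v \<le> T \<Longrightarrow>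
      AE \<omega> in M. (\<forall>x\<in>{u<..v}. \<mu> x \<omega> = \<nu> x \<omega>) \<longrightarrow> D \<mu> v \<omega> * D \<nu> u \<omega> = D \<nu> v \<omega> * D \<mu> u \<omega>"
    and cost_measurable: "\<mu> \<in> CC \<Longrightarrow> r \<le> v \<Longrightarrow> v \<le> T \<Longrightarrow>
      (\<lambda>(u, \<omega>). indicator {r<..v} u * c u \<omega> (\<mu> u \<omega>)) \<in> borel_measurable (lborel \<Otimes>\<^sub>M F v)"
    and cost_zero: "r < u \<Longrightarrow> u \<le> T \<Longrightarrow> \<omega> \<in> space M \<Longrightarrow> c u \<omega> 0 = 0"
    and zero_CC: "(\<lambda>_ _. 0) \<in> CC"
    and paste_CC: "\<mu> \<in> CC \<Longrightarrow> \<nu> \<in> CC \<Longrightarrow> s \<in> times \<Longrightarrow> A \<in> sets (pre_sigma s) \<Longrightarrow>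
      (\<lambda>u \<omega>. if s \<omega> < u \<and> \<omega> \<in> A then \<nu> u \<omega> else \<mu> u \<omega>) \<in> CC"
    and P_eq: "\<mu> \<in> CC \<Longrightarrow> P \<mu> = density (restr_to_subalg M (F T)) (\<lambda>\<omega>. ennreal (D \<mu> T \<omega>))"
begin

section \<open>Density ratios at stopping times and the Bayes formula\<close>

definition R :: "(real \<Rightarrow> 'a \<Rightarrow> 'b) \<Rightarrow> ('a \<Rightarrow> real) \<Rightarrow> ('a \<Rightarrow> real) \<Rightarrow> 'a \<Rightarrow> ennreal" where
  "R \<mu> s t \<omega> = ennreal (D \<mu> (t \<omega>) \<omega> / D \<mu> (s \<omega>) \<omega>)"

definition G :: "(real \<Rightarrow> 'a \<Rightarrow> 'b) \<Rightarrow> ('a \<Rightarrow> real) \<Rightarrow> ('a \<Rightarrow> real) \<Rightarrow> 'a \<Rightarrow> ennreal" where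
  "G \<mu> s t \<omega> = (\<integral>\<^sup>+u\<in>{s \<omega><..t \<omega>}. c u \<omega> (\<mu> u \<omega>) \<partial>lborel)"

text \<open>Later \<open>f\<close> is \<open>C - Y\<close> for a constant \<open>C\<close> bounding \<open>Y\<close>, so that the essential supremum of the
  penalized expectations becomes \<open>C\<close> minus an essential infimum of nonnegative random variables and
  the possibly infinite penalties never have to be subtracted.\<close>

definition E :: "(real \<Rightarrow> 'a \<Rightarrow> 'b) \<Rightarrow> ('a \<Rightarrow> real) \<Rightarrow> ('a \<Rightarrow> real) \<Rightarrow> ('a \<Rightarrow> ennreal) \<Rightarrow> 'a \<Rightarrow> ennreal" where
  "E \<mu> s t f = nn_cond_exp M (pre_sigma s) (\<lambda>\<omega>. (f \<omega> + G \<mu> s t \<omega>) * R \<mu> s t \<omega>)"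

lemma D_stopped_measurable:
  assumes "\<mu> \<in> CC" "s \<in> times"
  shows "(\<lambda>\<omega>. D \<mu> (s \<omega>) \<omega>) \<in> borel_measurable (pre_sigma s)"
proof (rule measurable_pre_sigmaI[OF assms(2)])
  fix v assume "v \<in> s ` space M"
  then have "D \<mu> v \<in> borel_measurable (F v)"
    using D_measurable[OF assms(1)] timesD[OF assms(2)] by blast
  then show "\<exists>h\<in>borel_measurable (F v). \<forall>\<omega>\<in>space M. s \<omega> = v \<longrightarrow> D \<mu> (s \<omega>) \<omega> = h \<omega>"
    by (intro bexI[of _ "D \<mu> v"]) auto
qed

lemma nn_integral_split_time:
  assumes s: "s \<in> times" and A: "A \<in> sets (pre_sigma s)" and f[measurable]: "f \<in> borel_measurable M"
  shows "(\<integral>\<^sup>+\<omega>\<in>A. f \<omega> \<partial>M) = (\<Sum>v\<in>s ` space M. \<integral>\<^sup>+\<omega>\<in>{\<omega>\<in>A. s \<omega> = v}. f \<omega> \<partial>M)"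
proof -
  have m: "{\<omega>\<in>A. s \<omega> = v} \<in> sets M" if "v \<in> s ` space M" for v
    using A that sets_F_subset[of v] unfolding sets_pre_sigma_iff[OF s] by blast
  have "(\<integral>\<^sup>+\<omega>\<in>A. f \<omega> \<partial>M) = (\<integral>\<^sup>+\<omega>. (\<Sum>v\<in>s ` space M. f \<omega> * indicator {\<omega>\<in>A. s \<omega> = v} \<omega>) \<partial>M)"
  proof (rule nn_integral_cong)
    fix \<omega> assume \<omega>: "\<omega> \<in> space M"
    have "(\<Sum>v\<in>s ` space M. f \<omega> * indicator {\<omega>\<in>A. s \<omega> = v} \<omega>) =
      (\<Sum>v\<in>s ` space M. if v = s \<omega> then f \<omega> * indicator A \<omega> else 0)"
      by (intro sum.cong) (auto split: split_indicator)
    also have "\<dots> = f \<omega> * indicator A \<omega>"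
      using \<omega> timesD(2)[OF s] by (subst sum.delta) auto
    finally show "f \<omega> * indicator A \<omega> = (\<Sum>v\<in>s ` space M. f \<omega> * indicator {\<omega>\<in>A. s \<omega> = v} \<omega>)" ..
  qed
  also have "\<dots> = (\<Sum>v\<in>s ` space M. \<integral>\<^sup>+\<omega>\<in>{\<omega>\<in>A. s \<omega> = v}. f \<omega> \<partial>M)"
    using m by (intro nn_integral_sum) auto
  finally show ?thesis .
qed

lemma D_measurable_M: "\<mu> \<in> CC \<Longrightarrow> r \<le> t \<Longrightarrow> t \<le> T \<Longrightarrow> D \<mu> t \<in> borel_measurable M"
  using D_measurable measurable_F_M by blast

lemma D_stopped_measurable_M: "\<mu> \<in> CC \<Longrightarrow> s \<in> times \<Longrightarrow> (\<lambda>\<omega>. D \<mu> (s \<omega>) \<omega>) \<in> borel_measurable M"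
  using D_stopped_measurable measurable_pre_sigma_M by blast

text \<open>Optional stopping is elementary for finitely many values: on each event
  \<open>s = v\<close> it is the martingale property at the fixed time \<open>v\<close>.\<close>

lemma D_stopped_martingale:
  assumes \<mu>: "\<mu> \<in> CC" and s: "s \<in> times" and A: "A \<in> sets (pre_sigma s)"
  shows "(\<integral>\<^sup>+\<omega>\<in>A. D \<mu> T \<omega> \<partial>M) = (\<integral>\<^sup>+\<omega>\<in>A. D \<mu> (s \<omega>) \<omega> \<partial>M)"
proof -
  have "(\<integral>\<^sup>+\<omega>\<in>{\<omega>\<in>A. s \<omega> = v}. D \<mu> T \<omega> \<partial>M) = (\<integral>\<^sup>+\<omega>\<in>{\<omega>\<in>A. s \<omega> = v}. D \<mu> (s \<omega>) \<omega> \<partial>M)"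
    if v: "v \<in> s ` space M" for v
  proof -
    have "(\<integral>\<^sup>+\<omega>\<in>{\<omega>\<in>A. s \<omega> = v}. D \<mu> T \<omega> \<partial>M) = (\<integral>\<^sup>+\<omega>\<in>{\<omega>\<in>A. s \<omega> = v}. D \<mu> v \<omega> \<partial>M)"
      using v A timesD[OF s] unfolding sets_pre_sigma_iff[OF s]
      by (intro D_martingale \<mu>) auto
    also have "\<dots> = (\<integral>\<^sup>+\<omega>\<in>{\<omega>\<in>A. s \<omega> = v}. D \<mu> (s \<omega>) \<omega> \<partial>M)"
      by (intro nn_integral_cong) (auto split: split_indicator)
    finally show ?thesis .
  qed
  then show ?thesis
    using D_measurable_M[OF \<mu>, of T] r_le_T D_stopped_measurable_M[OF \<mu> s]
    by (simp add: nn_integral_split_time[OF s A])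
qed

lemma sfs_pre_sigma: "s \<in> times \<Longrightarrow> sigma_finite_subalgebra M (pre_sigma s)"
  by (intro sigma_finite_subalgebraI subalgebra_pre_sigma)

lemma nn_integral_D_stopped:
  assumes \<mu>: "\<mu> \<in> CC" and s: "s \<in> times" and f: "f \<in> borel_measurable (pre_sigma s)"
  shows "(\<integral>\<^sup>+\<omega>. f \<omega> * ennreal (D \<mu> T \<omega>) \<partial>M) = (\<integral>\<^sup>+\<omega>. f \<omega> * ennreal (D \<mu> (s \<omega>) \<omega>) \<partial>M)"
  using D_measurable_M[OF \<mu>, of T] r_le_T D_stopped_measurable_M[OF \<mu> s] f
  by (intro sigma_finite_subalgebra.nn_integral_mult_eq_of_set_eq[OF sfs_pre_sigma[OF s]]
      D_stopped_martingale[OF \<mu> s]) auto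

lemma R_measurable:
  assumes "\<mu> \<in> CC" "s \<in> times" "t \<in> times" "\<forall>\<omega>\<in>space M. s \<omega> \<le> t \<omega>"
  shows "R \<mu> s t \<in> borel_measurable (pre_sigma t)"
proof -
  have [measurable]: "(\<lambda>\<omega>. D \<mu> (s \<omega>) \<omega>) \<in> borel_measurable (pre_sigma t)"
    using D_stopped_measurable[OF assms(1,2)] measurable_pre_sigma_mono assms by blast
  have [measurable]: "(\<lambda>\<omega>. D \<mu> (t \<omega>) \<omega>) \<in> borel_measurable (pre_sigma t)"
    using D_stopped_measurable[OF assms(1,3)] .
  show ?thesis unfolding R_def[abs_def] by measurable
qed

lemma R_measurable_M:
  "\<mu> \<in> CC \<Longrightarrow> s \<in> times \<Longrightarrow> t \<in> times \<Longrightarrow> \<forall>\<omega>\<in>space M. s \<omega> \<le> t \<omega> \<Longrightarrow> R \<mu> s t \<in> borel_measurable M"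
  using R_measurable measurable_pre_sigma_M by blast

lemma R_mult: "\<mu> \<in> CC \<Longrightarrow> R \<mu> q t \<omega> = R \<mu> q s \<omega> * R \<mu> s t \<omega>"
  using D_pos[of \<mu> "s \<omega>" \<omega>] D_pos[of \<mu> "q \<omega>" \<omega>] D_pos[of \<mu> "t \<omega>" \<omega>] unfolding R_def
  by (subst ennreal_mult'[symmetric]) (auto simp: less_imp_le)

lemma D_R: "\<mu> \<in> CC \<Longrightarrow> ennreal (D \<mu> (t \<omega>) \<omega>) = ennreal (D \<mu> (s \<omega>) \<omega>) * R \<mu> s t \<omega>"
  using D_pos[of \<mu> "s \<omega>" \<omega>] D_pos[of \<mu> "t \<omega>" \<omega>] unfolding R_def
  by (subst ennreal_mult'[symmetric]) (auto simp: less_imp_le)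

text \<open>The ratio has conditional expectation one given the past of \<open>s\<close>. The
  denominator is absorbed into the weight \<open>h\<close>, the density at \<open>t\<close> is
  traded for the one at \<open>T\<close> and then for the one at \<open>s\<close>, which
  cancels.\<close>

lemma nn_integral_R:
  assumes \<mu>: "\<mu> \<in> CC" and s: "s \<in> times" and t: "t \<in> times" and le: "\<forall>\<omega>\<in>space M. s \<omega> \<le> t \<omega>"
    and f: "f \<in> borel_measurable (pre_sigma s)"
  shows "(\<integral>\<^sup>+\<omega>. (f \<omega> :: ennreal) * R \<mu> s t \<omega> \<partial>M) = (\<integral>\<^sup>+\<omega>. f \<omega> \<partial>M)"
proof -
  have [measurable]: "(\<lambda>\<omega>. D \<mu> (s \<omega>) \<omega>) \<in> borel_measurable (pre_sigma s)"
    using D_stopped_measurable[OF \<mu> s] .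
  define h where "h \<omega> = f \<omega> * ennreal (1 / D \<mu> (s \<omega>) \<omega>)" for \<omega>
  have h: "h \<in> borel_measurable (pre_sigma s)" unfolding h_def using f by measurable
  have "(\<integral>\<^sup>+\<omega>. f \<omega> * R \<mu> s t \<omega> \<partial>M) = (\<integral>\<^sup>+\<omega>. h \<omega> * ennreal (D \<mu> (t \<omega>) \<omega>) \<partial>M)"
    unfolding h_def R_def using D_pos[OF \<mu>]
    by (intro nn_integral_cong) (simp add: mult.assoc ennreal_mult'[symmetric] less_imp_le)
  also have "\<dots> = (\<integral>\<^sup>+\<omega>. h \<omega> * ennreal (D \<mu> T \<omega>) \<partial>M)"
    using nn_integral_D_stopped[OF \<mu> t] measurable_pre_sigma_mono[OF h s t le] by simp
  also have "\<dots> = (\<integral>\<^sup>+\<omega>. h \<omega> * ennreal (D \<mu> (s \<omega>) \<omega>) \<partial>M)"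
    using nn_integral_D_stopped[OF \<mu> s h] by simp
  also have "\<dots> = (\<integral>\<^sup>+\<omega>. f \<omega> \<partial>M)"
    unfolding h_def using D_pos[OF \<mu>] less_imp_neq[OF D_pos[OF \<mu>]]
    by (intro nn_integral_cong) (simp add: mult.assoc ennreal_mult'[symmetric] less_imp_le)
  finally show ?thesis .
qed

lemma cost_section_measurable:
  assumes "\<mu> \<in> CC" "\<omega> \<in> space M"
  shows "(\<lambda>u. indicator {r<..T} u * c u \<omega> (\<mu> u \<omega>)) \<in> borel_measurable lborel"
proof -
  have "(\<lambda>u. (u, \<omega>)) \<in> measurable lborel (lborel \<Otimes>\<^sub>M F T)"
    using assms(2) by (auto intro!: measurable_Pair1' simp: space_F)
  from measurable_compose[OF this cost_measurable[OF assms(1) r_le_T order_refl]]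
  show ?thesis by simp
qed

lemma G_add:
  assumes \<mu>: "\<mu> \<in> CC" and "q \<in> times" "s \<in> times" "t \<in> times" and \<omega>: "\<omega> \<in> space M"
    and le: "q \<omega> \<le> s \<omega>" "s \<omega> \<le> t \<omega>"
  shows "G \<mu> q t \<omega> = G \<mu> q s \<omega> + G \<mu> s t \<omega>"
proof -
  have b: "r \<le> q \<omega>" "t \<omega> \<le> T" using assms timesD by auto
  \<comment> \<open>Measurability of the cost along a path is available on \<open>{r<..T}\<close>
    only, so the indicator of this interval is inserted before the integral is split.\<close>
  let ?c = "\<lambda>u. indicator {r<..T} u * c u \<omega> (\<mu> u \<omega>)"
  have eq: "G \<mu> a b \<omega> = (\<integral>\<^sup>+u. ?c u * indicator {a \<omega><..b \<omega>} u \<partial>lborel)" if "r \<le> a \<omega>" "b \<omega> \<le> T" for a b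
    unfolding G_def using that by (intro nn_integral_cong) (auto split: split_indicator)
  have "G \<mu> q t \<omega> = (\<integral>\<^sup>+u. ?c u * indicator {q \<omega><..s \<omega>} u + ?c u * indicator {s \<omega><..t \<omega>} u \<partial>lborel)"
    using b le by (subst eq) (auto intro!: nn_integral_cong split: split_indicator)
  also have "\<dots> = (\<integral>\<^sup>+u. ?c u * indicator {q \<omega><..s \<omega>} u \<partial>lborel) + (\<integral>\<^sup>+u. ?c u * indicator {s \<omega><..t \<omega>} u \<partial>lborel)"
    using cost_section_measurable[OF \<mu> \<omega>] by (intro nn_integral_add) auto
  also have "\<dots> = G \<mu> q s \<omega> + G \<mu> s t \<omega>"
    using b le by (simp add: eq)
  finally show ?thesis .
qed

lemma G_measurable:
  assumes \<mu>: "\<mu> \<in> CC" and s: "s \<in> times" and t: "t \<in> times" and le: "\<forall>\<omega>\<in>space M. s \<omega> \<le> t \<omega>"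
  shows "G \<mu> s t \<in> borel_measurable (pre_sigma t)"
proof (rule measurable_pre_sigmaI[OF t])
  fix v assume v: "v \<in> t ` space M"
  then have vr: "r \<le> v" "v \<le> T" using timesD[OF t] by auto
  \<comment> \<open>On the event \<open>t = v\<close> the start \<open>s\<close> is at most
    \<open>v\<close> and may be replaced by \<open>min (s \<omega>) v\<close>, which is measurable
    at the fixed time \<open>v\<close>.\<close>
  have sv: "(\<lambda>\<omega>. min (s \<omega>) v) \<in> borel_measurable (F v)"
  proof (rule borel_measurableI_le)
    fix a
    have "{\<omega> \<in> space (F v). min (s \<omega>) v \<le> a} = (if a < v then {\<omega>\<in>space M. s \<omega> \<le> a} else space (F v))"
      by (auto simp: space_F)
    then show "{\<omega> \<in> space (F v). min (s \<omega>) v \<le> a} \<in> sets (F v)"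
      using times_le_sets[OF s, of a] sets_F_mono[of a v] by (auto simp del: space_F)
  qed
  let ?h = "\<lambda>\<omega>. \<integral>\<^sup>+u. indicator {r<..v} u * c u \<omega> (\<mu> u \<omega>) * indicator {w. w > min (s \<omega>) v} u \<partial>lborel"
  have cm: "(\<lambda>(\<omega>, u). indicator {r<..v} u * c u \<omega> (\<mu> u \<omega>)) \<in> borel_measurable (F v \<Otimes>\<^sub>M lborel)"
    using measurable_pair_swap[OF cost_measurable[OF \<mu> vr]] by simp
  have im: "(\<lambda>(\<omega>, u). indicator {w. w > min (s \<omega>) v} u :: ennreal) \<in> borel_measurable (F v \<Otimes>\<^sub>M lborel)"
    unfolding indicator_def using sv by measurable
  have "(\<lambda>(\<omega>, u). indicator {r<..v} u * c u \<omega> (\<mu> u \<omega>) * indicator {w. w > min (s \<omega>) v} u) \<in> borel_measurable (F v \<Otimes>\<^sub>M lborel)"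
    using borel_measurable_times_ennreal[OF cm im] by (simp add: case_prod_beta')
  then have "?h \<in> borel_measurable (F v)"
    by (intro lborel.borel_measurable_nn_integral) simp
  moreover have "G \<mu> s t \<omega> = ?h \<omega>" if "\<omega> \<in> space M" "t \<omega> = v" for \<omega>
    unfolding G_def using that le timesD(3)[OF s] vr
    by (intro nn_integral_cong) (force split: split_indicator)
  ultimately show "\<exists>h\<in>borel_measurable (F v). \<forall>\<omega>\<in>space M. t \<omega> = v \<longrightarrow> G \<mu> s t \<omega> = h \<omega>"
    by (intro bexI[of _ ?h]) auto
qed

lemma G_measurable_M:
  "\<mu> \<in> CC \<Longrightarrow> s \<in> times \<Longrightarrow> t \<in> times \<Longrightarrow> \<forall>\<omega>\<in>space M. s \<omega> \<le> t \<omega> \<Longrightarrow> G \<mu> s t \<in> borel_measurable M"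
  using G_measurable measurable_pre_sigma_M by blast

text \<open>Strict positivity of the density lets almost sure statements pass from
  \<open>P \<mu>\<close> back to \<open>M\<close>, so that conditional expectations under different
  controls can be compared under one measure.\<close>

lemma AE_P: "\<mu> \<in> CC \<Longrightarrow> (AE \<omega> in P \<mu>. Q \<omega>) \<Longrightarrow> (AE \<omega> in M. Q \<omega>)"
proof -
  assume \<mu>: "\<mu> \<in> CC" and Q: "AE \<omega> in P \<mu>. Q \<omega>"
  have "(\<lambda>\<omega>. ennreal (D \<mu> T \<omega>)) \<in> borel_measurable (restr_to_subalg M (F T))"
    using D_measurable[OF \<mu> r_le_T order_refl]
    by (simp add: measurable_cong_sets[OF sets_restr_to_subalg[OF subalgebra_F] refl])
  from Q[unfolded P_eq[OF \<mu>] AE_density[OF this]]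
  have "AE \<omega> in restr_to_subalg M (F T). Q \<omega>"
    by (simp add: D_pos[OF \<mu>])
  then show ?thesis by (rule AE_restr_to_subalg[OF subalgebra_F])
qed

lemma nn_integral_P:
  assumes \<mu>: "\<mu> \<in> CC" and f: "f \<in> borel_measurable (F T)"
  shows "(\<integral>\<^sup>+\<omega>. f \<omega> \<partial>P \<mu>) = (\<integral>\<^sup>+\<omega>. f \<omega> * ennreal (D \<mu> T \<omega>) \<partial>M)"
proof -
  have sub: "sets (restr_to_subalg M (F T)) = sets (F T)" by (rule sets_restr_to_subalg[OF subalgebra_F])
  have [measurable]: "D \<mu> T \<in> borel_measurable (F T)" using D_measurable[OF \<mu> r_le_T order_refl] .
  note [measurable] = f
  have "(\<integral>\<^sup>+\<omega>. f \<omega> \<partial>P \<mu>) = (\<integral>\<^sup>+\<omega>. D \<mu> T \<omega> * f \<omega> \<partial>restr_to_subalg M (F T))"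
    unfolding P_eq[OF \<mu>]
    by (rule nn_integral_density) (simp_all add: measurable_cong_sets[OF sub refl])
  also have "\<dots> = (\<integral>\<^sup>+\<omega>. D \<mu> T \<omega> * f \<omega> \<partial>M)"
    by (rule nn_integral_subalgebra2[OF subalgebra_F]) simp
  finally show ?thesis by (simp add: mult.commute)
qed

lemma sfs_P:
  assumes \<mu>: "\<mu> \<in> CC" and s: "s \<in> times"
  shows "sigma_finite_subalgebra (P \<mu>) (pre_sigma s)" and "sets (P \<mu>) = sets (F T)"
    and "finite_measure (P \<mu>)"
proof -
  show sets: "sets (P \<mu>) = sets (F T)"
    by (simp add: P_eq[OF \<mu>] sets_restr_to_subalg[OF subalgebra_F])
  have sp: "space (P \<mu>) = space M"
    by (simp add: P_eq[OF \<mu>] space_restr_to_subalg)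
  have "emeasure (P \<mu>) (space (P \<mu>)) = (\<integral>\<^sup>+\<omega>. 1 \<partial>P \<mu>)" by simp
  also have "\<dots> = (\<integral>\<^sup>+\<omega>\<in>space M. D \<mu> T \<omega> \<partial>M)"
    by (subst nn_integral_P[OF \<mu>]) (auto intro!: nn_integral_cong)
  also have "\<dots> = (\<integral>\<^sup>+\<omega>\<in>space M. D \<mu> r \<omega> \<partial>M)"
    using sets.top[of "F r"] r_le_T by (intro D_martingale \<mu>) (simp_all add: space_F)
  also have "\<dots> = (\<integral>\<^sup>+\<omega>. 1 \<partial>M)"
    using D_start[OF \<mu>] by (intro nn_integral_cong_AE) auto
  also have "\<dots> = 1" by (simp add: emeasure_space_1)
  finally show fin: "finite_measure (P \<mu>)" by (intro finite_measureI) simp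
  have "subalgebra (P \<mu>) (pre_sigma s)"
    using sets_pre_sigma_F_T[OF s] sets sp by (auto simp: subalgebra_def space_pre_sigma)
  with fin show "sigma_finite_subalgebra (P \<mu>) (pre_sigma s)"
    by (intro finite_measure_subalgebra_is_sigma_finite)
      (simp add: finite_measure_subalgebra_def finite_measure_subalgebra_axioms_def)
qed

text \<open>Bayes formula. The density at \<open>t\<close> factors into the density at
  \<open>s\<close>, which is known there and cancels, and the ratio \<open>R \<mu> s t\<close>,
  which moves inside the conditional expectation under \<open>M\<close>.\<close>

lemma nn_cond_exp_P:
  assumes \<mu>: "\<mu> \<in> CC" and s: "s \<in> times" and t: "t \<in> times" and le: "\<forall>\<omega>\<in>space M. s \<omega> \<le> t \<omega>"
    and f: "f \<in> borel_measurable (pre_sigma t)"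
  shows "AE \<omega> in M. nn_cond_exp (P \<mu>) (pre_sigma s) f \<omega> =
    nn_cond_exp M (pre_sigma s) (\<lambda>\<omega>. f \<omega> * R \<mu> s t \<omega>) \<omega>"
proof (rule AE_P[OF \<mu>], rule sigma_finite_subalgebra.nn_cond_exp_eqI[OF sfs_P(1)[OF \<mu> s]])
  let ?K = "nn_cond_exp M (pre_sigma s) (\<lambda>\<omega>. f \<omega> * R \<mu> s t \<omega>)"
  interpret sigma_finite_subalgebra M "pre_sigma s" by (rule sfs_pre_sigma[OF s])
  have fT: "f \<in> borel_measurable (F T)" using f t measurable_pre_sigma_F_T by blast
  then show "f \<in> borel_measurable (P \<mu>)" using sfs_P(2)[OF \<mu> s] by (simp cong: measurable_cong_sets)
  show "?K \<in> borel_measurable (pre_sigma s)" by simp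
  have fM: "f \<in> borel_measurable M" using f t measurable_pre_sigma_M by blast
  note RM = R_measurable_M[OF \<mu> s t le]
  fix A assume A: "A \<in> sets (pre_sigma s)"
  then have At: "A \<in> sets (pre_sigma t)" and AT: "A \<in> sets (F T)"
    using sets_pre_sigma_mono[OF s t le] sets_pre_sigma_F_T[OF s] by auto
  have KT: "?K \<in> borel_measurable (F T)" by (rule measurable_pre_sigma_F_T[OF borel_measurable_nn_cond_exp s])
  have Ds: "(\<lambda>\<omega>. D \<mu> (s \<omega>) \<omega>) \<in> borel_measurable (pre_sigma s)" using D_stopped_measurable[OF \<mu> s] .
  have "(\<integral>\<^sup>+\<omega>\<in>A. f \<omega> \<partial>P \<mu>) = (\<integral>\<^sup>+\<omega>. (f \<omega> * indicator A \<omega>) * D \<mu> T \<omega> \<partial>M)"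
    using fT AT by (intro nn_integral_P[OF \<mu>]) auto
  also have "\<dots> = (\<integral>\<^sup>+\<omega>. (f \<omega> * indicator A \<omega>) * D \<mu> (t \<omega>) \<omega> \<partial>M)"
    using f At by (intro nn_integral_D_stopped[OF \<mu> t]) auto
  also have "\<dots> = (\<integral>\<^sup>+\<omega>. (indicator A \<omega> * ennreal (D \<mu> (s \<omega>) \<omega>)) * (f \<omega> * R \<mu> s t \<omega>) \<partial>M)"
    by (intro nn_integral_cong) (simp add: D_R[OF \<mu>, of t _ s] mult_ac)
  also have "\<dots> = (\<integral>\<^sup>+\<omega>. (indicator A \<omega> * ennreal (D \<mu> (s \<omega>) \<omega>)) * ?K \<omega> \<partial>M)"
    using A Ds fM RM by (intro nn_cond_exp_intg[symmetric]) auto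
  also have "\<dots> = (\<integral>\<^sup>+\<omega>. (?K \<omega> * indicator A \<omega>) * D \<mu> (s \<omega>) \<omega> \<partial>M)"
    by (simp add: mult_ac)
  also have "\<dots> = (\<integral>\<^sup>+\<omega>. (?K \<omega> * indicator A \<omega>) * D \<mu> T \<omega> \<partial>M)"
    using A by (intro nn_integral_D_stopped[OF \<mu> s, symmetric]) auto
  also have "\<dots> = (\<integral>\<^sup>+\<omega>\<in>A. ?K \<omega> \<partial>P \<mu>)"
    using KT AT by (intro nn_integral_P[OF \<mu>, symmetric]) auto
  finally show "(\<integral>\<^sup>+\<omega>\<in>A. f \<omega> \<partial>P \<mu>) = (\<integral>\<^sup>+\<omega>\<in>A. ?K \<omega> \<partial>P \<mu>)" .
qed

end

text \<open>For infinite \<open>c\<close> positive numbers with infimum zero would be a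
  counterexample. The nontrivial inequality is obtained by dividing by \<open>c\<close>.\<close>

lemma INF_ennreal_mult_const:
  fixes f :: "nat \<Rightarrow> ennreal"
  assumes "c < \<infinity>"
  shows "(INF i. f i * c) = (INF i. f i) * c"
proof (cases "c = 0")
  case False
  show ?thesis
  proof (rule antisym)
    have "(INF i. f i * c) / c \<le> (INF i. f i)"
    proof (rule INF_greatest)
      fix i
      have "(INF i. f i * c) / c \<le> f i * c / c" by (intro divide_right_mono_ennreal INF_lower) simp
      also have "\<dots> = f i" using False assms by (simp add: ennreal_mult_divide_eq)
      finally show "(INF i. f i * c) / c \<le> f i" .
    qed
    then have "(INF i. f i * c) / c * c \<le> (INF i. f i) * c" by (rule mult_right_mono) simp
    also have "(INF i. f i * c) / c * c = (INF i. f i * c)"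
      using False assms by (simp add: ennreal_divide_times ennreal_mult_divide_eq)
    finally show "(INF i. f i * c) \<le> (INF i. f i) * c" .
  qed (intro INF_greatest mult_right_mono INF_lower, auto)
qed simp

context controlled_densities
begin

section \<open>The conditional cost of a single control\<close>

lemma E_measurable [measurable]: "E \<mu> s t f \<in> borel_measurable (pre_sigma s)"
  unfolding E_def by simp

lemma E_measurable_M: "s \<in> times \<Longrightarrow> E \<mu> s t f \<in> borel_measurable M"
  by (rule measurable_pre_sigma_M[OF E_measurable])

lemma E_integrand_measurable:
  assumes "\<mu> \<in> CC" "s \<in> times" "t \<in> times" "\<forall>\<omega>\<in>space M. s \<omega> \<le> t \<omega>"
    "f \<in> borel_measurable (pre_sigma t)"
  shows "(\<lambda>\<omega>. (f \<omega> + G \<mu> s t \<omega>) * R \<mu> s t \<omega>) \<in> borel_measurable M"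
  using R_measurable_M[OF assms(1-4)] G_measurable_M[OF assms(1-4)]
    measurable_pre_sigma_M[OF assms(5,3)] by measurable

lemma E_mono:
  assumes a: "\<mu> \<in> CC" "s \<in> times" "t \<in> times" "\<forall>\<omega>\<in>space M. s \<omega> \<le> t \<omega>"
    and f: "f \<in> borel_measurable (pre_sigma t)" and f': "f' \<in> borel_measurable (pre_sigma t)"
    and le: "AE \<omega> in M. f \<omega> \<le> f' \<omega>"
  shows "AE \<omega> in M. E \<mu> s t f \<omega> \<le> E \<mu> s t f' \<omega>"
  unfolding E_def
proof (rule sigma_finite_subalgebra.nn_cond_exp_mono[OF sfs_pre_sigma[OF a(2)]])
  show "AE x in M. (f x + G \<mu> s t x) * R \<mu> s t x \<le> (f' x + G \<mu> s t x) * R \<mu> s t x"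
    using le by eventually_elim (intro mult_right_mono add_right_mono, auto)
qed (intro E_integrand_measurable a f f')+

lemma nn_cond_exp_R:
  assumes a: "\<mu> \<in> CC" "s \<in> times" "t \<in> times" "\<forall>\<omega>\<in>space M. s \<omega> \<le> t \<omega>"
    and h: "h \<in> borel_measurable (pre_sigma s)"
  shows "AE \<omega> in M. nn_cond_exp M (pre_sigma s) (\<lambda>\<omega>. h \<omega> * R \<mu> s t \<omega>) \<omega> = h \<omega>"
proof (rule sigma_finite_subalgebra.nn_cond_exp_eqI[OF sfs_pre_sigma[OF a(2)]])
  fix A assume [measurable]: "A \<in> sets (pre_sigma s)"
  note [measurable] = h
  have "(\<integral>\<^sup>+\<omega>. (h \<omega> * indicator A \<omega>) * R \<mu> s t \<omega> \<partial>M) = (\<integral>\<^sup>+\<omega>\<in>A. h \<omega> \<partial>M)"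
    by (rule nn_integral_R[OF a]) simp
  then show "(\<integral>\<^sup>+\<omega>\<in>A. h \<omega> * R \<mu> s t \<omega> \<partial>M) = (\<integral>\<^sup>+\<omega>\<in>A. h \<omega> \<partial>M)"
    by (simp add: mult_ac)
qed (use h R_measurable_M[OF a] measurable_pre_sigma_M[OF h a(2)] in auto)

lemma E_split:
  assumes a: "\<mu> \<in> CC" "s \<in> times" "t \<in> times" "\<forall>\<omega>\<in>space M. s \<omega> \<le> t \<omega>"
    and f: "f \<in> borel_measurable (pre_sigma t)"
  shows "AE \<omega> in M. E \<mu> s t f \<omega> = nn_cond_exp M (pre_sigma s) (\<lambda>\<omega>. f \<omega> * R \<mu> s t \<omega>) \<omega> +
    nn_cond_exp M (pre_sigma s) (\<lambda>\<omega>. G \<mu> s t \<omega> * R \<mu> s t \<omega>) \<omega>"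
proof -
  note [measurable] = R_measurable_M[OF a] G_measurable_M[OF a] measurable_pre_sigma_M[OF f a(3)]
  have "AE \<omega> in M. nn_cond_exp M (pre_sigma s) (\<lambda>\<omega>. f \<omega> * R \<mu> s t \<omega>) \<omega> +
    nn_cond_exp M (pre_sigma s) (\<lambda>\<omega>. G \<mu> s t \<omega> * R \<mu> s t \<omega>) \<omega> =
    nn_cond_exp M (pre_sigma s) (\<lambda>\<omega>. f \<omega> * R \<mu> s t \<omega> + G \<mu> s t \<omega> * R \<mu> s t \<omega>) \<omega>"
    by (rule sigma_finite_subalgebra.nn_cond_exp_sum[OF sfs_pre_sigma[OF a(2)]]) auto
  then show ?thesis unfolding E_def by eventually_elim (simp add: distrib_right)
qed

text \<open>\<open>h\<close> is known at \<open>s\<close> and \<open>R \<mu> s t\<close> has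
  conditional expectation one, so \<open>h\<close> comes out unweighted. This is the source of
  translation invariance.\<close>

lemma E_add:
  assumes a: "\<mu> \<in> CC" "s \<in> times" "t \<in> times" "\<forall>\<omega>\<in>space M. s \<omega> \<le> t \<omega>"
    and f: "f \<in> borel_measurable (pre_sigma t)" and h: "h \<in> borel_measurable (pre_sigma s)"
  shows "AE \<omega> in M. E \<mu> s t (\<lambda>\<omega>. f \<omega> + h \<omega>) \<omega> = E \<mu> s t f \<omega> + h \<omega>"
proof -
  note m[measurable] = R_measurable_M[OF a] G_measurable_M[OF a] measurable_pre_sigma_M[OF f a(3)]
    measurable_pre_sigma_M[OF h a(2)]
  have "AE \<omega> in M. nn_cond_exp M (pre_sigma s) (\<lambda>\<omega>. (f \<omega> + G \<mu> s t \<omega>) * R \<mu> s t \<omega>) \<omega> +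
    nn_cond_exp M (pre_sigma s) (\<lambda>\<omega>. h \<omega> * R \<mu> s t \<omega>) \<omega> =
    nn_cond_exp M (pre_sigma s) (\<lambda>\<omega>. (f \<omega> + G \<mu> s t \<omega>) * R \<mu> s t \<omega> + h \<omega> * R \<mu> s t \<omega>) \<omega>"
    by (rule sigma_finite_subalgebra.nn_cond_exp_sum[OF sfs_pre_sigma[OF a(2)]]) auto
  with nn_cond_exp_R[OF a h] show ?thesis
    unfolding E_def by eventually_elim (simp add: distrib_right add_ac)
qed

lemma E_convex:
  assumes a: "\<mu> \<in> CC" "s \<in> times" "t \<in> times" "\<forall>\<omega>\<in>space M. s \<omega> \<le> t \<omega>"
    and f: "f \<in> borel_measurable (pre_sigma t)" and f': "f' \<in> borel_measurable (pre_sigma t)"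
    and ab: "a + b = (1 :: ennreal)"
  shows "AE \<omega> in M. E \<mu> s t (\<lambda>\<omega>. a * f \<omega> + b * f' \<omega>) \<omega> = a * E \<mu> s t f \<omega> + b * E \<mu> s t f' \<omega>"
proof -
  note m[measurable] = R_measurable_M[OF a] G_measurable_M[OF a] measurable_pre_sigma_M[OF f a(3)]
    measurable_pre_sigma_M[OF f' a(3)]
  interpret sigma_finite_subalgebra M "pre_sigma s" by (rule sfs_pre_sigma[OF a(2)])
  let ?h = "\<lambda>f \<omega>. (f \<omega> + G \<mu> s t \<omega>) * R \<mu> s t \<omega>"
  \<comment> \<open>Here \<open>a + b = 1\<close> enters: the penalty is counted once on either
    side.\<close>
  have eq: "a * ?h f \<omega> + b * ?h f' \<omega> = (a * f \<omega> + b * f' \<omega> + G \<mu> s t \<omega>) * R \<mu> s t \<omega>" for \<omega>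
  proof -
    have "a * ?h f \<omega> + b * ?h f' \<omega> = (a * f \<omega> + b * f' \<omega> + (a + b) * G \<mu> s t \<omega>) * R \<mu> s t \<omega>"
      by (simp only: distrib_left distrib_right mult_ac add_ac)
    then show ?thesis by (simp add: ab)
  qed
  have "AE \<omega> in M. nn_cond_exp M (pre_sigma s) (\<lambda>\<omega>. a * ?h f \<omega>) \<omega> + nn_cond_exp M (pre_sigma s) (\<lambda>\<omega>. b * ?h f' \<omega>) \<omega> =
    nn_cond_exp M (pre_sigma s) (\<lambda>\<omega>. a * ?h f \<omega> + b * ?h f' \<omega>) \<omega>"
    by (rule nn_cond_exp_sum) auto
  moreover have "AE \<omega> in M. a * nn_cond_exp M (pre_sigma s) (?h f) \<omega> = nn_cond_exp M (pre_sigma s) (\<lambda>\<omega>. a * ?h f \<omega>) \<omega>"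
    by (rule nn_cond_exp_prod) auto
  moreover have "AE \<omega> in M. b * nn_cond_exp M (pre_sigma s) (?h f') \<omega> = nn_cond_exp M (pre_sigma s) (\<lambda>\<omega>. b * ?h f' \<omega>) \<omega>"
    by (rule nn_cond_exp_prod) auto
  ultimately show ?thesis unfolding E_def eq by eventually_elim simp
qed

text \<open>The zero control has no running cost. It is the one control whose conditional cost is
  known to be bounded; it makes the values finite and starts the minimising sequences.\<close>

lemma E_zero_le:
  assumes s: "s \<in> times" "t \<in> times" "\<forall>\<omega>\<in>space M. s \<omega> \<le> t \<omega>"
    and f: "f \<in> borel_measurable (pre_sigma t)" and le: "AE \<omega> in M. f \<omega> \<le> C"
  shows "AE \<omega> in M. E (\<lambda>_ _. 0) s t f \<omega> \<le> C"
proof -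
  let ?z = "\<lambda>_ _. 0"
  have G0: "G ?z s t \<omega> = 0" if "\<omega> \<in> space M" for \<omega>
  proof -
    have "(\<integral>\<^sup>+u\<in>{s \<omega><..t \<omega>}. c u \<omega> 0 \<partial>lborel) = (\<integral>\<^sup>+u. 0 \<partial>(lborel :: real measure))"
      using cost_zero[OF _ _ that] timesD[OF s(1)] timesD[OF s(2)] that
      by (intro nn_integral_cong) (force split: split_indicator)
    then show ?thesis by (simp add: G_def)
  qed
  have "AE \<omega> in M. E ?z s t f \<omega> \<le> nn_cond_exp M (pre_sigma s) (\<lambda>\<omega>. C * R ?z s t \<omega>) \<omega>"
    unfolding E_def
  proof (rule sigma_finite_subalgebra.nn_cond_exp_mono[OF sfs_pre_sigma[OF s(1)]])
    show "AE x in M. (f x + G ?z s t x) * R ?z s t x \<le> C * R ?z s t x"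
      using le AE_space by eventually_elim (simp add: G0 mult_right_mono)
  qed (use E_integrand_measurable[OF zero_CC s f] R_measurable_M[OF zero_CC s] in auto)
  moreover have "AE \<omega> in M. nn_cond_exp M (pre_sigma s) (\<lambda>\<omega>. C * R ?z s t \<omega>) \<omega> = C"
    by (rule nn_cond_exp_R[OF zero_CC s]) simp
  ultimately show ?thesis by eventually_elim simp
qed

text \<open>The penalty may be infinite and is split off first; monotone convergence is applied to
  the bounded part alone, whose expectation under the ratio is at most \<open>C\<close>, and the
  penalty is added back afterwards.\<close>

lemma E_INF:
  assumes a: "\<mu> \<in> CC" "s \<in> times" "t \<in> times" "\<forall>\<omega>\<in>space M. s \<omega> \<le> t \<omega>"
    and f: "\<And>k::nat. f k \<in> borel_measurable (pre_sigma t)"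
    and dec: "\<And>k. AE \<omega> in M. f (Suc k) \<omega> \<le> f k \<omega>" and bd: "AE \<omega> in M. f 0 \<omega> \<le> C" "C < \<infinity>"
  shows "AE \<omega> in M. E \<mu> s t (\<lambda>\<omega>. INF k. f k \<omega>) \<omega> = (INF k. E \<mu> s t (f k) \<omega>)"
proof -
  note m[measurable] = R_measurable_M[OF a] measurable_pre_sigma_M[OF f a(3)]
  have eq: "(INF k. f k \<omega>) * R \<mu> s t \<omega> = (INF k. f k \<omega> * R \<mu> s t \<omega>)" for \<omega>
    unfolding R_def by (rule INF_ennreal_mult_const[symmetric]) simp
  have "AE \<omega> in M. nn_cond_exp M (pre_sigma s) (\<lambda>\<omega>. INF k. f k \<omega> * R \<mu> s t \<omega>) \<omega> =
    (INF k. nn_cond_exp M (pre_sigma s) (\<lambda>\<omega>. f k \<omega> * R \<mu> s t \<omega>) \<omega>)"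
  proof (rule sigma_finite_subalgebra.nn_cond_exp_INF[OF sfs_pre_sigma[OF a(2)]])
    show "AE \<omega> in M. f (Suc k) \<omega> * R \<mu> s t \<omega> \<le> f k \<omega> * R \<mu> s t \<omega>" for k
      using dec[of k] by eventually_elim (rule mult_right_mono, auto)
    have "(\<integral>\<^sup>+\<omega>. f 0 \<omega> * R \<mu> s t \<omega> \<partial>M) \<le> (\<integral>\<^sup>+\<omega>. C * R \<mu> s t \<omega> \<partial>M)"
      using bd(1) by (intro nn_integral_mono_AE) (auto elim!: eventually_mono intro!: mult_right_mono)
    also have "\<dots> = (\<integral>\<^sup>+\<omega>. C \<partial>M)" by (rule nn_integral_R[OF a]) simp
    also have "\<dots> < \<infinity>" using bd(2) by (simp add: emeasure_space_1)
    finally show "(\<integral>\<^sup>+\<omega>. f 0 \<omega> * R \<mu> s t \<omega> \<partial>M) < \<infinity>" .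
  qed auto
  moreover have "AE \<omega> in M. \<forall>k. E \<mu> s t (f k) \<omega> = nn_cond_exp M (pre_sigma s) (\<lambda>\<omega>. f k \<omega> * R \<mu> s t \<omega>) \<omega> +
    nn_cond_exp M (pre_sigma s) (\<lambda>\<omega>. G \<mu> s t \<omega> * R \<mu> s t \<omega>) \<omega>"
    by (subst AE_all_countable) (intro allI E_split[OF a f])
  moreover have "AE \<omega> in M. E \<mu> s t (\<lambda>\<omega>. INF k. f k \<omega>) \<omega> =
    nn_cond_exp M (pre_sigma s) (\<lambda>\<omega>. (INF k. f k \<omega>) * R \<mu> s t \<omega>) \<omega> +
    nn_cond_exp M (pre_sigma s) (\<lambda>\<omega>. G \<mu> s t \<omega> * R \<mu> s t \<omega>) \<omega>"
    using f by (intro E_split[OF a]) simp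
  ultimately show ?thesis
    unfolding eq by eventually_elim (simp add: INF_ennreal_add_const)
qed

text \<open>At \<open>s\<close> the penalty splits additively and the ratio multiplicatively. The
  penalty incurred before \<open>s\<close> is known there, so its later weight
  \<open>R \<mu> s t\<close> integrates to one; what remains is the inner conditional cost weighted
  by \<open>R \<mu> q s\<close>.\<close>

lemma E_tower:
  assumes \<mu>: "\<mu> \<in> CC" and q: "q \<in> times" and s: "s \<in> times" and t: "t \<in> times"
    and qs: "\<forall>\<omega>\<in>space M. q \<omega> \<le> s \<omega>" and st: "\<forall>\<omega>\<in>space M. s \<omega> \<le> t \<omega>"
    and f: "f \<in> borel_measurable (pre_sigma t)"
  shows "AE \<omega> in M. E \<mu> q t f \<omega> = E \<mu> q s (E \<mu> s t f) \<omega>"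
  unfolding E_def[of \<mu> q t]
proof (rule sigma_finite_subalgebra.nn_cond_exp_eqI[OF sfs_pre_sigma[OF q]])
  have qt: "\<forall>\<omega>\<in>space M. q \<omega> \<le> t \<omega>" using qs st by (meson order_trans)
  show "(\<lambda>\<omega>. (f \<omega> + G \<mu> q t \<omega>) * R \<mu> q t \<omega>) \<in> borel_measurable M"
    by (intro E_integrand_measurable \<mu> q t qt f)
  interpret q: sigma_finite_subalgebra M "pre_sigma q" by (rule sfs_pre_sigma[OF q])
  interpret s: sigma_finite_subalgebra M "pre_sigma s" by (rule sfs_pre_sigma[OF s])
  note m[measurable] = R_measurable_M[OF \<mu> q s qs] R_measurable_M[OF \<mu> s t st]
    G_measurable_M[OF \<mu> q s qs] G_measurable_M[OF \<mu> s t st]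
    measurable_pre_sigma_M[OF f t] E_measurable_M[OF s]
  have Rs: "R \<mu> q s \<in> borel_measurable (pre_sigma s)" "G \<mu> q s \<in> borel_measurable (pre_sigma s)"
    by (intro R_measurable G_measurable \<mu> q s qs)+
  fix A assume A: "A \<in> sets (pre_sigma q)"
  then have As: "A \<in> sets (pre_sigma s)" and AM[measurable]: "A \<in> sets M"
    using sets_pre_sigma_mono[OF q s qs] subalgebra_pre_sigma[OF q] by (auto simp: subalgebra_def)
  have "(\<integral>\<^sup>+\<omega>\<in>A. (f \<omega> + G \<mu> q t \<omega>) * R \<mu> q t \<omega> \<partial>M) =
    (\<integral>\<^sup>+\<omega>. (indicator A \<omega> * (G \<mu> q s \<omega> * R \<mu> q s \<omega>)) * R \<mu> s t \<omega> +
      (indicator A \<omega> * R \<mu> q s \<omega>) * ((f \<omega> + G \<mu> s t \<omega>) * R \<mu> s t \<omega>) \<partial>M)"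
  proof (rule nn_integral_cong)
    fix \<omega> assume \<omega>: "\<omega> \<in> space M"
    show "(f \<omega> + G \<mu> q t \<omega>) * R \<mu> q t \<omega> * indicator A \<omega> =
      (indicator A \<omega> * (G \<mu> q s \<omega> * R \<mu> q s \<omega>)) * R \<mu> s t \<omega> +
      (indicator A \<omega> * R \<mu> q s \<omega>) * ((f \<omega> + G \<mu> s t \<omega>) * R \<mu> s t \<omega>)"
      unfolding R_mult[OF \<mu>, of q t \<omega> s] G_add[OF \<mu> q s t \<omega> bspec[OF qs \<omega>] bspec[OF st \<omega>]]
      by (simp only: distrib_left distrib_right mult_ac add_ac)
  qed
  also have "\<dots> = (\<integral>\<^sup>+\<omega>. (indicator A \<omega> * (G \<mu> q s \<omega> * R \<mu> q s \<omega>)) * R \<mu> s t \<omega> \<partial>M) +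
      (\<integral>\<^sup>+\<omega>. (indicator A \<omega> * R \<mu> q s \<omega>) * ((f \<omega> + G \<mu> s t \<omega>) * R \<mu> s t \<omega>) \<partial>M)"
    by (intro nn_integral_add) auto
  also have "(\<integral>\<^sup>+\<omega>. (indicator A \<omega> * (G \<mu> q s \<omega> * R \<mu> q s \<omega>)) * R \<mu> s t \<omega> \<partial>M) =
    (\<integral>\<^sup>+\<omega>. indicator A \<omega> * (G \<mu> q s \<omega> * R \<mu> q s \<omega>) \<partial>M)"
    using Rs As by (intro nn_integral_R[OF \<mu> s t st]) auto
  also have "(\<integral>\<^sup>+\<omega>. (indicator A \<omega> * R \<mu> q s \<omega>) * ((f \<omega> + G \<mu> s t \<omega>) * R \<mu> s t \<omega>) \<partial>M) =
    (\<integral>\<^sup>+\<omega>. (indicator A \<omega> * R \<mu> q s \<omega>) * E \<mu> s t f \<omega> \<partial>M)"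
    unfolding E_def using Rs As by (intro s.nn_cond_exp_intg[symmetric]) auto
  also have "(\<integral>\<^sup>+\<omega>. indicator A \<omega> * (G \<mu> q s \<omega> * R \<mu> q s \<omega>) \<partial>M) +
      (\<integral>\<^sup>+\<omega>. (indicator A \<omega> * R \<mu> q s \<omega>) * E \<mu> s t f \<omega> \<partial>M) =
    (\<integral>\<^sup>+\<omega>. indicator A \<omega> * (G \<mu> q s \<omega> * R \<mu> q s \<omega>) + (indicator A \<omega> * R \<mu> q s \<omega>) * E \<mu> s t f \<omega> \<partial>M)"
    by (intro nn_integral_add[symmetric]) auto
  also have "\<dots> = (\<integral>\<^sup>+\<omega>. indicator A \<omega> * ((E \<mu> s t f \<omega> + G \<mu> q s \<omega>) * R \<mu> q s \<omega>) \<partial>M)"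
    by (simp only: distrib_left distrib_right mult_ac add_ac)
  also have "\<dots> = (\<integral>\<^sup>+\<omega>. indicator A \<omega> * E \<mu> q s (E \<mu> s t f) \<omega> \<partial>M)"
    unfolding E_def[of \<mu> q s] using A by (intro q.nn_cond_exp_intg[symmetric]) auto
  finally show "(\<integral>\<^sup>+\<omega>\<in>A. (f \<omega> + G \<mu> q t \<omega>) * R \<mu> q t \<omega> \<partial>M) = (\<integral>\<^sup>+\<omega>\<in>A. E \<mu> q s (E \<mu> s t f) \<omega> \<partial>M)"
    by (simp add: mult.commute)
qed simp

lemma R_local:
  assumes \<mu>: "\<mu> \<in> CC" and \<nu>: "\<nu> \<in> CC" and s: "s \<in> times" and t: "t \<in> times"
    and le: "\<forall>\<omega>\<in>space M. s \<omega> \<le> t \<omega>"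
  shows "AE \<omega> in M. (\<forall>x\<in>{s \<omega><..t \<omega>}. \<mu> x \<omega> = \<nu> x \<omega>) \<longrightarrow> R \<mu> s t \<omega> = R \<nu> s t \<omega>"
proof -
  \<comment> \<open>\<open>D_local\<close> has an exceptional null set for each pair of times; as
    \<open>s\<close> and \<open>t\<close> have finitely many values, only finitely many of them
    occur.\<close>
  have "AE \<omega> in M. \<forall>u\<in>s ` space M. \<forall>v\<in>t ` space M. u \<le> v \<longrightarrow>
    (\<forall>x\<in>{u<..v}. \<mu> x \<omega> = \<nu> x \<omega>) \<longrightarrow> D \<mu> v \<omega> * D \<nu> u \<omega> = D \<nu> v \<omega> * D \<mu> u \<omega>"
  proof (intro AE_finite_allI timesD(2) s t)
    fix u v assume "u \<in> s ` space M" "v \<in> t ` space M"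
    then have "r \<le> u" "v \<le> T" using timesD(3)[OF s] timesD(4)[OF t] by blast+
    then show "AE \<omega> in M. u \<le> v \<longrightarrow>
      (\<forall>x\<in>{u<..v}. \<mu> x \<omega> = \<nu> x \<omega>) \<longrightarrow> D \<mu> v \<omega> * D \<nu> u \<omega> = D \<nu> v \<omega> * D \<mu> u \<omega>"
      using D_local[OF \<mu> \<nu>, of u v] by (cases "u \<le> v") simp_all
  qed
  then show ?thesis using AE_space
  proof eventually_elim
    case (elim \<omega>)
    show ?case
    proof
      assume "\<forall>x\<in>{s \<omega><..t \<omega>}. \<mu> x \<omega> = \<nu> x \<omega>"
      then have "D \<mu> (t \<omega>) \<omega> * D \<nu> (s \<omega>) \<omega> = D \<nu> (t \<omega>) \<omega> * D \<mu> (s \<omega>) \<omega>"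
        using elim le by blast
      then have "D \<mu> (t \<omega>) \<omega> / D \<mu> (s \<omega>) \<omega> = D \<nu> (t \<omega>) \<omega> / D \<nu> (s \<omega>) \<omega>"
        using D_pos[OF \<mu>, of "s \<omega>" \<omega>] D_pos[OF \<nu>, of "s \<omega>" \<omega>] by (simp add: frac_eq_eq)
      then show "R \<mu> s t \<omega> = R \<nu> s t \<omega>" by (simp add: R_def)
    qed
  qed
qed

text \<open>The indicator of \<open>A\<close> is known at \<open>s\<close> and commutes with the
  conditioning; on \<open>A\<close> both the ratio and the accumulated penalty depend on the control
  between \<open>s\<close> and \<open>t\<close> only.\<close>

lemma E_local:
  assumes \<mu>: "\<mu> \<in> CC" and \<nu>: "\<nu> \<in> CC" and s: "s \<in> times" and t: "t \<in> times"
    and le: "\<forall>\<omega>\<in>space M. s \<omega> \<le> t \<omega>" and A: "A \<in> sets (pre_sigma s)"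
    and eq: "\<And>\<omega> x. \<omega> \<in> A \<Longrightarrow> s \<omega> < x \<Longrightarrow> x \<le> t \<omega> \<Longrightarrow> \<mu> x \<omega> = \<nu> x \<omega>"
    and f: "f \<in> borel_measurable (pre_sigma t)"
  shows "AE \<omega> in M. \<omega> \<in> A \<longrightarrow> E \<mu> s t f \<omega> = E \<nu> s t f \<omega>"
proof -
  interpret sigma_finite_subalgebra M "pre_sigma s" by (rule sfs_pre_sigma[OF s])
  let ?h = "\<lambda>\<mu> \<omega>. (f \<omega> + G \<mu> s t \<omega>) * R \<mu> s t \<omega>"
  have AM[measurable]: "A \<in> sets M" using A subalg by (auto simp: subalgebra_def)
  note m[measurable] = E_integrand_measurable[OF \<mu> s t le f] E_integrand_measurable[OF \<nu> s t le f]
  have iA: "(\<lambda>\<omega>. indicator A \<omega> :: ennreal) \<in> borel_measurable (pre_sigma s)" using A by simp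
  have "AE \<omega> in M. indicator A \<omega> * nn_cond_exp M (pre_sigma s) (?h \<mu>) \<omega> =
    nn_cond_exp M (pre_sigma s) (\<lambda>\<omega>. indicator A \<omega> * ?h \<mu> \<omega>) \<omega>"
    by (rule nn_cond_exp_prod[OF iA]) simp
  moreover have "AE \<omega> in M. indicator A \<omega> * nn_cond_exp M (pre_sigma s) (?h \<nu>) \<omega> =
    nn_cond_exp M (pre_sigma s) (\<lambda>\<omega>. indicator A \<omega> * ?h \<nu> \<omega>) \<omega>"
    by (rule nn_cond_exp_prod[OF iA]) simp
  moreover have "AE \<omega> in M. nn_cond_exp M (pre_sigma s) (\<lambda>\<omega>. indicator A \<omega> * ?h \<mu> \<omega>) \<omega> =
    nn_cond_exp M (pre_sigma s) (\<lambda>\<omega>. indicator A \<omega> * ?h \<nu> \<omega>) \<omega>"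
  proof (rule nn_cond_exp_cong)
    show "AE \<omega> in M. indicator A \<omega> * ?h \<mu> \<omega> = indicator A \<omega> * ?h \<nu> \<omega>"
      using R_local[OF \<mu> \<nu> s t le]
    proof eventually_elim
      case (elim \<omega>)
      show ?case
      proof (cases "\<omega> \<in> A")
        case True
        then have "R \<mu> s t \<omega> = R \<nu> s t \<omega>" using elim eq by auto
        moreover have "G \<mu> s t \<omega> = G \<nu> s t \<omega>"
          unfolding G_def using eq[OF True] by (intro nn_integral_cong) (auto split: split_indicator)
        ultimately show ?thesis by simp
      qed simp
    qed
  qed auto
  ultimately show ?thesis unfolding E_def by eventually_elim (auto split: split_indicator)
qed

end

section \<open>Essential suprema and value functions\<close>

lemma is_ess_sup_cong:
  assumes "is_ess_sup M S Z" "AE \<omega> in M. Z \<omega> = Z' \<omega>" "Z' \<in> borel_measurable M"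
  shows "is_ess_sup M S Z'"
  unfolding is_ess_sup_def
proof (intro conjI ballI impI)
  fix f assume "f \<in> S"
  then have "AE \<omega> in M. f \<omega> \<le> Z \<omega>" using assms(1) by (simp add: is_ess_sup_def)
  with assms(2) show "AE \<omega> in M. f \<omega> \<le> Z' \<omega>" by eventually_elim simp
next
  fix W assume "W \<in> borel_measurable M" "\<forall>f\<in>S. AE \<omega> in M. f \<omega> \<le> W \<omega>"
  then have "AE \<omega> in M. Z \<omega> \<le> W \<omega>" using assms(1) by (simp add: is_ess_sup_def)
  with assms(2) show "AE \<omega> in M. Z' \<omega> \<le> W \<omega>" by eventually_elim simp
qed (rule assms(3))

lemma is_ess_sup_unique:
  assumes "is_ess_sup M S Z" "is_ess_sup M S Z'"
  shows "AE \<omega> in M. Z \<omega> = Z' \<omega>"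
proof -
  have "AE \<omega> in M. Z \<omega> \<le> Z' \<omega>" "AE \<omega> in M. Z' \<omega> \<le> Z \<omega>"
    using assms by (auto simp: is_ess_sup_def)
  then show ?thesis by eventually_elim simp
qed

text \<open>The reflection \<open>C - x\<close> turns an infimum of costs into a least upper bound
  of rewards; cases are distinguished because single costs and \<open>w\<close> may be
  infinite.\<close>

lemma ereal_minus_INF_le:
  fixes e :: "nat \<Rightarrow> ennreal"
  assumes le: "\<And>k. ereal C - enn2ereal (e k) \<le> w" and fin: "e 0 < \<infinity>"
  shows "ereal C - enn2ereal (INF k. e k) \<le> w"
proof (cases w)
  case (real x)
  have "ennreal (C - x) \<le> e k" for k
  proof (cases "e k")
    case (real y)
    then show ?thesis using le[of k] \<open>w = ereal x\<close> by (simp add: ennreal_leI)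
  qed simp
  then have "ennreal (C - x) \<le> (INF k. e k)" by (rule INF_greatest)
  moreover have "(INF k. e k) < \<infinity>" using fin by (meson INF_lower UNIV_I le_less_trans)
  ultimately show ?thesis
    by (cases "INF k. e k") (auto simp: real ennreal_le_iff2)
next
  case MInf
  then show ?thesis using le[of 0] fin by (cases "e 0") auto
qed simp

context controlled_densities
begin

text \<open>The control switches to \<open>\<nu>\<close> after \<open>s\<close> exactly on the event
  where \<open>\<nu>\<close> is cheaper. This event is known at \<open>s\<close>, so the pasted
  control is admissible, and by locality its cost is the smaller one on and off the event.\<close>

lemma E_min:
  assumes \<mu>: "\<mu> \<in> CC" and \<nu>: "\<nu> \<in> CC" and s: "s \<in> times" and t: "t \<in> times"
    and le: "\<forall>\<omega>\<in>space M. s \<omega> \<le> t \<omega>" and f: "f \<in> borel_measurable (pre_sigma t)"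
  shows "\<exists>\<pi>\<in>CC. AE \<omega> in M. E \<pi> s t f \<omega> = min (E \<mu> s t f \<omega>) (E \<nu> s t f \<omega>)"
proof
  define A where "A = {\<omega>\<in>space (pre_sigma s). E \<nu> s t f \<omega> < E \<mu> s t f \<omega>}"
  define \<pi> where "\<pi> = (\<lambda>u \<omega>. if s \<omega> < u \<and> \<omega> \<in> A then \<nu> u \<omega> else \<mu> u \<omega>)"
  have A: "A \<in> sets (pre_sigma s)" unfolding A_def by measurable
  show \<pi>: "\<pi> \<in> CC" unfolding \<pi>_def by (rule paste_CC[OF \<mu> \<nu> s A])
  have 1: "AE \<omega> in M. \<omega> \<in> A \<longrightarrow> E \<pi> s t f \<omega> = E \<nu> s t f \<omega>"
    by (rule E_local[OF \<pi> \<nu> s t le A _ f]) (simp add: \<pi>_def)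
  have 2: "AE \<omega> in M. \<omega> \<in> space (pre_sigma s) - A \<longrightarrow> E \<pi> s t f \<omega> = E \<mu> s t f \<omega>"
    by (rule E_local[OF \<pi> \<mu> s t le _ _ f]) (use A in \<open>auto simp: \<pi>_def\<close>)
  show "AE \<omega> in M. E \<pi> s t f \<omega> = min (E \<mu> s t f \<omega>) (E \<nu> s t f \<omega>)"
    using 1 2 AE_space by eventually_elim (auto simp: A_def space_pre_sigma min_def)
qed

text \<open>The essential infimum is required to be attained along a decreasing sequence of controls; such
  sequences exist because two controls can be pasted along the event on which one of them is better.\<close>

definition is_value :: "('a \<Rightarrow> real) \<Rightarrow> ('a \<Rightarrow> real) \<Rightarrow> ('a \<Rightarrow> ennreal) \<Rightarrow> ennreal \<Rightarrow> ('a \<Rightarrow> ennreal) \<Rightarrow> bool" where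
  "is_value s t f C V \<longleftrightarrow> V \<in> borel_measurable (pre_sigma s) \<and>
     (\<forall>\<mu>\<in>CC. AE \<omega> in M. V \<omega> \<le> E \<mu> s t f \<omega>) \<and>
     (\<exists>\<pi>. (\<forall>k::nat. \<pi> k \<in> CC) \<and> (\<forall>k. AE \<omega> in M. E (\<pi> (Suc k)) s t f \<omega> \<le> E (\<pi> k) s t f \<omega>) \<and>
       (AE \<omega> in M. E (\<pi> 0) s t f \<omega> \<le> C) \<and> (AE \<omega> in M. V \<omega> = (INF k. E (\<pi> k) s t f \<omega>)))"

lemma is_value_le: "is_value s t f C V \<Longrightarrow> AE \<omega> in M. V \<omega> \<le> C"
proof -
  assume "is_value s t f C V"
  then obtain \<pi> where 1: "AE \<omega> in M. E (\<pi> (0::nat)) s t f \<omega> \<le> C" "AE \<omega> in M. V \<omega> = (INF k. E (\<pi> k) s t f \<omega>)"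
    by (auto simp: is_value_def)
  then show ?thesis
    by eventually_elim (metis INF_lower UNIV_I order_trans)
qed

lemma is_value_greatest:
  assumes "is_value s t f C V" and W: "\<And>\<mu>. \<mu> \<in> CC \<Longrightarrow> AE \<omega> in M. W \<omega> \<le> E \<mu> s t f \<omega>"
  shows "AE \<omega> in M. W \<omega> \<le> V \<omega>"
proof -
  obtain \<pi> where 1: "\<And>k::nat. \<pi> k \<in> CC" "AE \<omega> in M. V \<omega> = (INF k. E (\<pi> k) s t f \<omega>)"
    using assms(1) by (auto simp: is_value_def)
  have "AE \<omega> in M. \<forall>k. W \<omega> \<le> E (\<pi> k) s t f \<omega>"
    using W 1(1) by (simp add: AE_all_countable)
  with 1(2) show ?thesis by eventually_elim (simp add: INF_greatest)
qed

text \<open>Essential infimum of a family directed downwards: a sequence minimising the expected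
  cost is made decreasing by pasting. Its limit \<open>V\<close> cannot be undercut, since the
  minimum with any further control is again the cost of a control and has expectation at least
  \<open>m\<close>.\<close>

lemma ex_is_value:
  assumes s: "s \<in> times" and t: "t \<in> times"
    and le: "\<forall>\<omega>\<in>space M. s \<omega> \<le> t \<omega>" and f: "f \<in> borel_measurable (pre_sigma t)"
    and C: "AE \<omega> in M. f \<omega> \<le> C" "C < \<infinity>"
  shows "\<exists>V. is_value s t f C V"
proof -
  define m where "m = (INF \<mu>\<in>CC. \<integral>\<^sup>+\<omega>. E \<mu> s t f \<omega> \<partial>M)"
  have m_le: "m \<le> (\<integral>\<^sup>+\<omega>. E \<mu> s t f \<omega> \<partial>M)" if "\<mu> \<in> CC" for \<mu>
    unfolding m_def using that by (rule INF_lower)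
  obtain \<phi> :: "nat \<Rightarrow> ennreal" where \<phi>: "range \<phi> \<subseteq> (\<lambda>\<mu>. \<integral>\<^sup>+\<omega>. E \<mu> s t f \<omega> \<partial>M) ` CC" "m = (INF k. \<phi> k)"
    using ennreal_Inf_countable_INF[of "(\<lambda>\<mu>. \<integral>\<^sup>+\<omega>. E \<mu> s t f \<omega> \<partial>M) ` CC"] zero_CC
    unfolding m_def by blast
  have "\<forall>k. \<exists>\<mu>. \<mu> \<in> CC \<and> \<phi> k = (\<integral>\<^sup>+\<omega>. E \<mu> s t f \<omega> \<partial>M)" using \<phi>(1) by blast
  then obtain \<mu> where \<mu>: "\<And>k. \<mu> k \<in> CC" "\<And>k. \<phi> k = (\<integral>\<^sup>+\<omega>. E (\<mu> k) s t f \<omega> \<partial>M)" by metis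
  \<comment> \<open>The sequence starts at the zero control because its cost is at most
    \<open>C\<close>; taking minima keeps all later costs below this bound.\<close>
  have "\<exists>\<pi>. \<forall>n. (\<pi> n \<in> CC \<and> (n = 0 \<longrightarrow> \<pi> n = (\<lambda>_ _. 0))) \<and>
    (AE \<omega> in M. E (\<pi> (Suc n)) s t f \<omega> = min (E (\<pi> n) s t f \<omega>) (E (\<mu> n) s t f \<omega>))"
    by (rule dependent_nat_choice) (use zero_CC E_min[OF _ \<mu>(1) s t le f] in auto)
  then obtain \<pi> where raw: "\<forall>n. (\<pi> n \<in> CC \<and> (n = 0 \<longrightarrow> \<pi> n = (\<lambda>_ _. 0))) \<and>
    (AE \<omega> in M. E (\<pi> (Suc n)) s t f \<omega> = min (E (\<pi> n) s t f \<omega>) (E (\<mu> n) s t f \<omega>))" ..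
  have \<pi>: "\<pi> n \<in> CC" "\<pi> 0 = (\<lambda>_ _. 0)"
    and step: "AE \<omega> in M. E (\<pi> (Suc n)) s t f \<omega> = min (E (\<pi> n) s t f \<omega>) (E (\<mu> n) s t f \<omega>)" for n
    using raw by (blast, blast, blast)
  define V where "V \<omega> = (INF k. E (\<pi> k) s t f \<omega>)" for \<omega>
  have V: "V \<in> borel_measurable (pre_sigma s)" unfolding V_def by measurable
  note m[measurable] = measurable_pre_sigma_M[OF V s] E_measurable_M[OF s]
  have dec: "AE \<omega> in M. E (\<pi> (Suc k)) s t f \<omega> \<le> E (\<pi> k) s t f \<omega>" for k
    using step[of k] by eventually_elim simp
  have bd: "AE \<omega> in M. E (\<pi> 0) s t f \<omega> \<le> C"
    unfolding \<pi>(2) by (rule E_zero_le[OF s t le f C(1)])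
  have fin: "(\<integral>\<^sup>+\<omega>. h \<omega> \<partial>M) < \<infinity>" if "AE \<omega> in M. h \<omega> \<le> E (\<pi> 0) s t f \<omega>" for h
  proof -
    have "(\<integral>\<^sup>+\<omega>. h \<omega> \<partial>M) \<le> (\<integral>\<^sup>+\<omega>. C \<partial>M)"
    proof (rule nn_integral_mono_AE)
      show "AE \<omega> in M. h \<omega> \<le> C" using that bd by eventually_elim simp
    qed
    also have "\<dots> < \<infinity>" using C(2) by (simp add: emeasure_space_1)
    finally show ?thesis .
  qed
  have Vm: "(\<integral>\<^sup>+\<omega>. V \<omega> \<partial>M) \<le> m"
    unfolding \<phi>(2)
  proof (rule INF_greatest)
    fix k
    show "(\<integral>\<^sup>+\<omega>. V \<omega> \<partial>M) \<le> \<phi> k"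
      unfolding \<mu>(2)
    proof (rule nn_integral_mono_AE)
      show "AE \<omega> in M. V \<omega> \<le> E (\<mu> k) s t f \<omega>"
        using step[of k]
      proof eventually_elim
        case (elim \<omega>)
        have "V \<omega> \<le> E (\<pi> (Suc k)) s t f \<omega>" unfolding V_def by (rule INF_lower) simp
        with elim show ?case by simp
      qed
    qed
  qed
  have "AE \<omega> in M. V \<omega> \<le> E \<nu> s t f \<omega>" if \<nu>: "\<nu> \<in> CC" for \<nu>
  proof -
    \<comment> \<open>The cost of \<open>\<nu>\<close> may have infinite expectation; its minimum
      with the cost of \<open>\<pi> k\<close> has a finite one, which permits the subtraction
      below.\<close>
    let ?g = "\<lambda>k \<omega>. min (E (\<pi> k) s t f \<omega>) (E \<nu> s t f \<omega>)"
    have "m \<le> (INF k. \<integral>\<^sup>+\<omega>. ?g k \<omega> \<partial>M)"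
    proof (rule INF_greatest)
      fix k
      obtain \<rho> where \<rho>: "\<rho> \<in> CC" "AE \<omega> in M. E \<rho> s t f \<omega> = ?g k \<omega>"
        using E_min[OF \<pi>(1) \<nu> s t le f] by blast
      have "(\<integral>\<^sup>+\<omega>. ?g k \<omega> \<partial>M) = (\<integral>\<^sup>+\<omega>. E \<rho> s t f \<omega> \<partial>M)"
        using \<rho>(2) by (intro nn_integral_cong_AE) (auto elim!: eventually_mono)
      then show "m \<le> (\<integral>\<^sup>+\<omega>. ?g k \<omega> \<partial>M)" using m_le[OF \<rho>(1)] by simp
    qed
    also have "\<dots> = (\<integral>\<^sup>+\<omega>. (INF k. ?g k \<omega>) \<partial>M)"
    proof (rule nn_integral_monotone_convergence_INF_AE'[symmetric])
      show "AE \<omega> in M. ?g (Suc k) \<omega> \<le> ?g k \<omega>" for k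
        using dec[of k] by eventually_elim (auto simp: min_le_iff_disj)
      show "(\<integral>\<^sup>+\<omega>. ?g 0 \<omega> \<partial>M) < \<infinity>" by (rule fin) simp
    qed simp
    finally have ge: "m \<le> (\<integral>\<^sup>+\<omega>. (INF k. ?g k \<omega>) \<partial>M)" .
    let ?W = "\<lambda>\<omega>. INF k. ?g k \<omega>"
    have W_V: "?W \<omega> \<le> V \<omega>" and W_E: "?W \<omega> \<le> E \<nu> s t f \<omega>" for \<omega>
      unfolding V_def by (auto intro!: INF_greatest intro: INF_lower2)
    have W0: "?W \<omega> \<le> E (\<pi> 0) s t f \<omega>" for \<omega> by (rule INF_lower2[of 0]) auto
    have finV: "(\<integral>\<^sup>+\<omega>. V \<omega> \<partial>M) < \<infinity>" by (rule fin) (auto simp: V_def intro: INF_lower)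
    \<comment> \<open>\<open>?W\<close> lies below \<open>V\<close> pointwise while the expectations
      compare the other way round, so the difference is nonnegative with integral zero.\<close>
    have "(\<integral>\<^sup>+\<omega>. V \<omega> - ?W \<omega> \<partial>M) = (\<integral>\<^sup>+\<omega>. V \<omega> \<partial>M) - (\<integral>\<^sup>+\<omega>. ?W \<omega> \<partial>M)"
    proof (rule nn_integral_diff)
      have "(\<integral>\<^sup>+\<omega>. ?W \<omega> \<partial>M) < \<infinity>" by (rule fin) (simp add: W0)
      then show "(\<integral>\<^sup>+\<omega>. ?W \<omega> \<partial>M) \<noteq> \<infinity>" by simp
    qed (use W_V in simp_all)
    also have "\<dots> = 0"
      using order_trans[OF Vm ge] finV by (simp add: diff_eq_0_iff_ennreal less_top)
    finally have "AE \<omega> in M. V \<omega> - ?W \<omega> = 0"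
      by (subst (asm) nn_integral_0_iff_AE) simp_all
    moreover have "AE \<omega> in M. V \<omega> \<le> C"
      using bd by eventually_elim (metis INF_lower UNIV_I V_def order_trans)
    ultimately show ?thesis
    proof eventually_elim
      case (elim \<omega>)
      have "V \<omega> \<noteq> \<infinity>" using elim(2) C(2) by (auto simp: top_unique)
      then have "V \<omega> \<le> ?W \<omega>" using elim(1) by (simp add: diff_eq_0_iff_ennreal)
      with W_E[of \<omega>] show ?case by simp
    qed
  qed
  then have "is_value s t f C V"
    unfolding is_value_def using V \<pi>(1) dec bd by (intro conjI ballI exI[of _ \<pi>] allI) (simp_all add: V_def)
  then show ?thesis by blast
qed

section \<open>The penalized process as the reflection of a value function\<close>

definition ess_family :: "('a \<Rightarrow> real) \<Rightarrow> ('a \<Rightarrow> real) \<Rightarrow> ('a \<Rightarrow> real) \<Rightarrow> ('a \<Rightarrow> ereal) set" where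
  "ess_family s t Y = (\<lambda>\<mu> \<omega>. ereal (real_cond_exp (P \<mu>) (pre_sigma s) Y \<omega>)
     - enn2ereal (nn_cond_exp (P \<mu>) (pre_sigma s) (G \<mu> s t) \<omega>)) ` CC"

definition Phi :: "('a \<Rightarrow> real) \<Rightarrow> ('a \<Rightarrow> real) \<Rightarrow> ('a \<Rightarrow> real) \<Rightarrow> 'a \<Rightarrow> real" where
  "Phi s t Y \<omega> = real_of_ereal (ess_sup M (ess_family s t Y) \<omega>)"

lemma E_cong:
  assumes a: "\<mu> \<in> CC" "s \<in> times" "t \<in> times" "\<forall>\<omega>\<in>space M. s \<omega> \<le> t \<omega>"
    and f: "f \<in> borel_measurable (pre_sigma t)" and f': "f' \<in> borel_measurable (pre_sigma t)"
    and eq: "AE \<omega> in M. f \<omega> = f' \<omega>"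
  shows "AE \<omega> in M. E \<mu> s t f \<omega> = E \<mu> s t f' \<omega>"
proof -
  have le: "AE \<omega> in M. f \<omega> \<le> f' \<omega>" "AE \<omega> in M. f' \<omega> \<le> f \<omega>"
    using eq by (auto elim!: eventually_mono)
  show ?thesis
    using E_mono[OF a f f' le(1)] E_mono[OF a f' f le(2)] by eventually_elim simp
qed

lemma AE_P_iff:
  assumes \<mu>: "\<mu> \<in> CC" and ae: "AE \<omega> in M. Q \<omega>" and Q: "Measurable.pred (F T) Q"
  shows "AE \<omega> in P \<mu>. Q \<omega>"
proof -
  have "(\<lambda>\<omega>. ennreal (D \<mu> T \<omega>)) \<in> borel_measurable (restr_to_subalg M (F T))"
    using D_measurable[OF \<mu> r_le_T order_refl]
    by (simp add: measurable_cong_sets[OF sets_restr_to_subalg[OF subalgebra_F] refl])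
  with AE_restr_to_subalg2[OF subalgebra_F ae Q] show ?thesis
    unfolding P_eq[OF \<mu>] by (simp add: AE_density D_pos[OF \<mu>])
qed

text \<open>For \<open>\<bar>Y \<omega>\<bar> \<le> C\<close> the function \<open>C - Y\<close> is
  nonnegative, and its conditional expectation is compared with those of the positive and the
  negative part of \<open>Y\<close>, from which \<open>real_cond_exp\<close> is built. An infinite
  conditional penalty gives minus infinity on both sides.\<close>

lemma family_member_eq:
  assumes a: "\<mu> \<in> CC" "s \<in> times" "t \<in> times" "\<forall>\<omega>\<in>space M. s \<omega> \<le> t \<omega>"
    and Y: "Y \<in> borel_measurable (pre_sigma t)" and bd: "AE \<omega> in M. \<bar>Y \<omega>\<bar> \<le> C"
  shows "AE \<omega> in M. ereal (real_cond_exp (P \<mu>) (pre_sigma s) Y \<omega>)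
     - enn2ereal (nn_cond_exp (P \<mu>) (pre_sigma s) (G \<mu> s t) \<omega>) =
     ereal C - enn2ereal (E \<mu> s t (\<lambda>\<omega>. ennreal (C - Y \<omega>)) \<omega>)"
proof -
  let ?B = "pre_sigma s"
  let ?N = "P \<mu>"
  interpret N: sigma_finite_subalgebra ?N ?B by (rule sfs_P(1)[OF a(1,2)])
  have mN: "h \<in> borel_measurable ?N" if "h \<in> borel_measurable (pre_sigma t)" for h :: "'a \<Rightarrow> 'c::topological_space"
    using measurable_pre_sigma_F_T[OF that a(3)] by (simp add: measurable_cong_sets[OF sfs_P(2)[OF a(1,2)] refl])
  note YN[measurable] = mN[OF Y] and GN[measurable] = mN[OF G_measurable[OF a]]
  have YT[measurable]: "Y \<in> borel_measurable (F T)" by (rule measurable_pre_sigma_F_T[OF Y a(3)])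
  have bdN: "AE \<omega> in ?N. \<bar>Y \<omega>\<bar> \<le> C" by (rule AE_P_iff[OF a(1) bd]) measurable
  define ka where "ka = nn_cond_exp ?N ?B (\<lambda>\<omega>. ennreal (Y \<omega>))"
  define kb where "kb = nn_cond_exp ?N ?B (\<lambda>\<omega>. ennreal (- Y \<omega>))"
  define k where "k = nn_cond_exp ?N ?B (\<lambda>\<omega>. ennreal (C - Y \<omega>))"
  define kg where "kg = nn_cond_exp ?N ?B (G \<mu> s t)"
  have const: "AE \<omega> in ?N. ennreal C = nn_cond_exp ?N ?B (\<lambda>_. ennreal C) \<omega>"
    using N.nn_cond_exp_F_meas[of "\<lambda>_. ennreal C"] by (auto elim!: eventually_mono)
  have 1: "AE \<omega> in ?N. k \<omega> + ka \<omega> = nn_cond_exp ?N ?B (\<lambda>\<omega>. ennreal (C - Y \<omega>) + ennreal (Y \<omega>)) \<omega>"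
    unfolding k_def ka_def by (rule N.nn_cond_exp_sum) auto
  have 2: "AE \<omega> in ?N. nn_cond_exp ?N ?B (\<lambda>_. ennreal C) \<omega> + kb \<omega> = nn_cond_exp ?N ?B (\<lambda>\<omega>. ennreal C + ennreal (- Y \<omega>)) \<omega>"
    unfolding kb_def by (rule N.nn_cond_exp_sum) auto
  \<comment> \<open>The decomposition of \<open>Y\<close> into parts is written with sums only,
    \<open>C - Y\<close> plus the positive part against \<open>C\<close> plus the negative part, so
    that no extended numbers are subtracted.\<close>
  have 3: "AE \<omega> in ?N. nn_cond_exp ?N ?B (\<lambda>\<omega>. ennreal (C - Y \<omega>) + ennreal (Y \<omega>)) \<omega> = nn_cond_exp ?N ?B (\<lambda>\<omega>. ennreal C + ennreal (- Y \<omega>)) \<omega>"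
  proof (rule N.nn_cond_exp_cong)
    show "AE \<omega> in ?N. ennreal (C - Y \<omega>) + ennreal (Y \<omega>) = ennreal C + ennreal (- Y \<omega>)"
      using bdN
    proof eventually_elim
      case (elim \<omega>)
      then show ?case
        by (cases "0 \<le> Y \<omega>") (simp_all add: ennreal_plus[symmetric] ennreal_neg del: ennreal_plus)
    qed
  qed auto
  have 4: "AE \<omega> in ?N. ka \<omega> \<le> nn_cond_exp ?N ?B (\<lambda>_. ennreal C) \<omega>"
    unfolding ka_def using bdN
    by (intro N.nn_cond_exp_mono) (auto elim!: eventually_mono intro!: ennreal_leI)
  have 5: "AE \<omega> in ?N. kb \<omega> \<le> nn_cond_exp ?N ?B (\<lambda>_. ennreal C) \<omega>"
    unfolding kb_def using bdN
    by (intro N.nn_cond_exp_mono) (auto elim!: eventually_mono intro!: ennreal_leI)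
  have 6: "AE \<omega> in ?N. k \<omega> + kg \<omega> = nn_cond_exp ?N ?B (\<lambda>\<omega>. ennreal (C - Y \<omega>) + G \<mu> s t \<omega>) \<omega>"
    unfolding k_def kg_def by (rule N.nn_cond_exp_sum) auto
  have 7: "AE \<omega> in M. nn_cond_exp ?N ?B (\<lambda>\<omega>. ennreal (C - Y \<omega>) + G \<mu> s t \<omega>) \<omega> =
    E \<mu> s t (\<lambda>\<omega>. ennreal (C - Y \<omega>)) \<omega>"
    unfolding E_def using Y G_measurable[OF a] by (intro nn_cond_exp_P[OF a]) auto
  have "AE \<omega> in ?N. k \<omega> + ka \<omega> = ennreal C + kb \<omega> \<and> ka \<omega> \<le> ennreal C \<and> kb \<omega> \<le> ennreal C \<and> \<bar>Y \<omega>\<bar> \<le> C"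
    using const 1 2 3 4 5 bdN by eventually_elim simp
  from AE_P[OF a(1) this] AE_P[OF a(1) 6] 7 show ?thesis
  proof eventually_elim
    case (elim \<omega>)
    obtain a' where a': "ka \<omega> = ennreal a'" "0 \<le> a'" using elim(1) by (cases "ka \<omega>") (auto simp: top_unique)
    obtain b' where b': "kb \<omega> = ennreal b'" "0 \<le> b'" using elim(1) by (cases "kb \<omega>") (auto simp: top_unique)
    have "k \<omega> \<le> ennreal C + kb \<omega>" using elim(1) by (metis le_iff_add)
    also have "\<dots> < \<top>" using b' by simp
    finally obtain k' where k': "k \<omega> = ennreal k'" "0 \<le> k'" by (cases "k \<omega>") auto
    have C: "0 \<le> C" using elim(1) by linarith
    have "k' + a' = C + b'"
      using elim(1) a' b' k' C by (simp add: ennreal_plus[symmetric] del: ennreal_plus)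
    then have r: "real_cond_exp ?N ?B Y \<omega> = C - k'"
      using a' b' by (simp add: real_cond_exp_def ka_def[symmetric] kb_def[symmetric])
    have e: "E \<mu> s t (\<lambda>\<omega>. ennreal (C - Y \<omega>)) \<omega> = ennreal k' + kg \<omega>"
      using elim(2,3) k' by simp
    show ?case unfolding r e kg_def[symmetric]
    proof (cases "kg \<omega>")
      case (real g)
      then show "ereal (C - k') - enn2ereal (kg \<omega>) = ereal C - enn2ereal (ennreal k' + kg \<omega>)"
        using k' by (simp add: ennreal_plus[symmetric] del: ennreal_plus)
    next
      case top
      then show "ereal (C - k') - enn2ereal (kg \<omega>) = ereal C - enn2ereal (ennreal k' + kg \<omega>)"
        by simp
    qed
  qed
qed

lemma cost_measurable_t: "Y \<in> borel_measurable (pre_sigma t) \<Longrightarrow> (\<lambda>\<omega>. ennreal (C - Y \<omega>)) \<in> borel_measurable (pre_sigma t)"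
  by measurable

text \<open>Minimality only has to be tested along the countable sequence that attains the value, so
  the exceptional null sets can be collected.\<close>

lemma is_value_ess_sup:
  assumes s: "s \<in> times" "t \<in> times" "\<forall>\<omega>\<in>space M. s \<omega> \<le> t \<omega>"
    and Y: "Y \<in> borel_measurable (pre_sigma t)" and bd: "AE \<omega> in M. \<bar>Y \<omega>\<bar> \<le> C"
    and V: "is_value s t (\<lambda>\<omega>. ennreal (C - Y \<omega>)) K V" and K: "K < \<infinity>"
  shows "is_ess_sup M (ess_family s t Y) (\<lambda>\<omega>. ereal C - enn2ereal (V \<omega>))"
  unfolding is_ess_sup_def
proof (intro conjI ballI impI)
  have "V \<in> borel_measurable M" using V measurable_pre_sigma_M[OF _ s(1)] by (auto simp: is_value_def)
  then show "(\<lambda>\<omega>. ereal C - enn2ereal (V \<omega>)) \<in> borel_measurable M" by measurable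
next
  fix f assume "f \<in> ess_family s t Y"
  then obtain \<mu> where \<mu>: "\<mu> \<in> CC" "f = (\<lambda>\<omega>. ereal (real_cond_exp (P \<mu>) (pre_sigma s) Y \<omega>)
     - enn2ereal (nn_cond_exp (P \<mu>) (pre_sigma s) (G \<mu> s t) \<omega>))" by (auto simp: ess_family_def)
  have "AE \<omega> in M. V \<omega> \<le> E \<mu> s t (\<lambda>\<omega>. ennreal (C - Y \<omega>)) \<omega>" using V \<mu>(1) by (auto simp: is_value_def)
  with family_member_eq[OF \<mu>(1) s Y bd] show "AE \<omega> in M. f \<omega> \<le> ereal C - enn2ereal (V \<omega>)"
    unfolding \<mu>(2) by eventually_elim (simp add: ereal_minus_mono less_eq_ennreal.rep_eq[symmetric])
next
  fix W assume "W \<in> borel_measurable M" and W: "\<forall>f\<in>ess_family s t Y. AE \<omega> in M. f \<omega> \<le> W \<omega>"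
  obtain \<pi> where \<pi>: "\<And>k::nat. \<pi> k \<in> CC" "AE \<omega> in M. E (\<pi> 0) s t (\<lambda>\<omega>. ennreal (C - Y \<omega>)) \<omega> \<le> K"
    "AE \<omega> in M. V \<omega> = (INF k. E (\<pi> k) s t (\<lambda>\<omega>. ennreal (C - Y \<omega>)) \<omega>)"
    using V by (auto simp: is_value_def)
  have "AE \<omega> in M. ereal C - enn2ereal (E (\<pi> k) s t (\<lambda>\<omega>. ennreal (C - Y \<omega>)) \<omega>) \<le> W \<omega>" for k
  proof -
    have "AE \<omega> in M. ereal (real_cond_exp (P (\<pi> k)) (pre_sigma s) Y \<omega>)
     - enn2ereal (nn_cond_exp (P (\<pi> k)) (pre_sigma s) (G (\<pi> k) s t) \<omega>) \<le> W \<omega>"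
      using W \<pi>(1)[of k] by (auto simp: ess_family_def)
    with family_member_eq[OF \<pi>(1) s Y bd, of k] show ?thesis by eventually_elim simp
  qed
  then have "AE \<omega> in M. \<forall>k. ereal C - enn2ereal (E (\<pi> k) s t (\<lambda>\<omega>. ennreal (C - Y \<omega>)) \<omega>) \<le> W \<omega>"
    by (simp add: AE_all_countable)
  with \<pi>(2,3) show "AE \<omega> in M. ereal C - enn2ereal (V \<omega>) \<le> W \<omega>"
  proof eventually_elim
    case (elim \<omega>)
    show ?case unfolding elim(2)
      using elim(3) le_less_trans[OF elim(1) K] by (intro ereal_minus_INF_le) auto
  qed
qed

text \<open>The constant \<open>2 * C\<close> dominates \<open>C - Y\<close>. Since
  \<open>ess_sup\<close> is an arbitrary choice, it is identified with \<open>C - V\<close> up to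
  null sets only; finiteness of \<open>V\<close> makes the passage to real values lossless.\<close>

lemma Phi_value:
  assumes s: "s \<in> times" "t \<in> times" "\<forall>\<omega>\<in>space M. s \<omega> \<le> t \<omega>"
    and Y: "Y \<in> borel_measurable (pre_sigma t)" and bd: "AE \<omega> in M. \<bar>Y \<omega>\<bar> \<le> C"
  obtains V where "is_value s t (\<lambda>\<omega>. ennreal (C - Y \<omega>)) (ennreal (2 * C)) V"
    "AE \<omega> in M. Phi s t Y \<omega> = C - enn2real (V \<omega>)"
    "is_ess_sup M (ess_family s t Y) (\<lambda>\<omega>. ereal (Phi s t Y \<omega>))"
proof -
  have le: "AE \<omega> in M. ennreal (C - Y \<omega>) \<le> ennreal (2 * C)"
    using bd by eventually_elim (auto intro!: ennreal_leI)
  obtain V where V: "is_value s t (\<lambda>\<omega>. ennreal (C - Y \<omega>)) (ennreal (2 * C)) V"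
    using ex_is_value[OF s cost_measurable_t[OF Y] le] by auto
  have e: "is_ess_sup M (ess_family s t Y) (\<lambda>\<omega>. ereal C - enn2ereal (V \<omega>))"
    by (rule is_value_ess_sup[OF s Y bd V]) simp
  then have e2: "is_ess_sup M (ess_family s t Y) (ess_sup M (ess_family s t Y))"
    unfolding ess_sup_def by (metis someI)
  note eq = is_ess_sup_unique[OF e2 e]
  have fin: "AE \<omega> in M. V \<omega> < \<infinity>"
    using is_value_le[OF V] by eventually_elim (auto simp: le_less_trans)
  have eq2: "AE \<omega> in M. ess_sup M (ess_family s t Y) \<omega> = ereal (C - enn2real (V \<omega>))"
    using eq fin
  proof eventually_elim
    case (elim \<omega>)
    then show ?case by (cases "V \<omega>") auto
  qed
  have 1: "AE \<omega> in M. Phi s t Y \<omega> = C - enn2real (V \<omega>)"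
    using eq2 unfolding Phi_def by eventually_elim simp
  have "(ess_sup M (ess_family s t Y)) \<in> borel_measurable M" using e2 by (simp add: is_ess_sup_def)
  then have m: "(\<lambda>\<omega>. ereal (Phi s t Y \<omega>)) \<in> borel_measurable M" unfolding Phi_def by measurable
  have 2: "is_ess_sup M (ess_family s t Y) (\<lambda>\<omega>. ereal (Phi s t Y \<omega>))"
  proof (rule is_ess_sup_cong[OF e2 _ m])
    show "AE \<omega> in M. ess_sup M (ess_family s t Y) \<omega> = ereal (Phi s t Y \<omega>)"
      using eq2 1 by eventually_elim simp
  qed
  show ?thesis by (rule that[OF V 1 2])
qed

lemma LinftyE:
  assumes "Y \<in> Linfty M N"
  obtains C where "Y \<in> borel_measurable N" "0 \<le> C" "AE \<omega> in M. \<bar>Y \<omega>\<bar> \<le> C"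
proof -
  from assms obtain C where C: "Y \<in> borel_measurable N" "AE \<omega> in M. \<bar>Y \<omega>\<bar> \<le> C" by (auto simp: Linfty_def)
  then have "AE \<omega> in M. \<bar>Y \<omega>\<bar> \<le> max C 0" by (auto elim!: eventually_mono)
  with C(1) show ?thesis using that[of "max C 0"] by simp
qed

lemma LinftyE2:
  assumes "Y \<in> Linfty M N" "Z \<in> Linfty M N'"
  obtains C where "Y \<in> borel_measurable N" "Z \<in> borel_measurable N'" "0 \<le> C"
    "AE \<omega> in M. \<bar>Y \<omega>\<bar> \<le> C" "AE \<omega> in M. \<bar>Z \<omega>\<bar> \<le> C"
proof -
  obtain C where C: "Y \<in> borel_measurable N" "0 \<le> C" "AE \<omega> in M. \<bar>Y \<omega>\<bar> \<le> C" using LinftyE[OF assms(1)] .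
  obtain C' where C': "Z \<in> borel_measurable N'" "0 \<le> C'" "AE \<omega> in M. \<bar>Z \<omega>\<bar> \<le> C'" using LinftyE[OF assms(2)] .
  have "AE \<omega> in M. \<bar>Y \<omega>\<bar> \<le> max C C'" using C(3) by eventually_elim simp
  moreover have "AE \<omega> in M. \<bar>Z \<omega>\<bar> \<le> max C C'" using C'(3) by eventually_elim simp
  ultimately show ?thesis using C C' that[of "max C C'"] by simp
qed

lemma value_measurable: "is_value s t f K V \<Longrightarrow> V \<in> borel_measurable (pre_sigma s)"
  by (simp add: is_value_def)

lemma value_le_E: "is_value s t f K V \<Longrightarrow> \<mu> \<in> CC \<Longrightarrow> AE \<omega> in M. V \<omega> \<le> E \<mu> s t f \<omega>"
  by (simp add: is_value_def)

text \<open>\<open>Phi\<close> is a choice measurable in \<open>M\<close>; completeness transfers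
  measurability at \<open>s\<close> from the value \<open>V\<close>. Values between \<open>0\<close>
  and \<open>2 * C\<close> give the bound \<open>C\<close>, so the process does not enlarge
  bounds.\<close>

lemma Phi_Linfty:
  assumes s: "s \<in> times" "t \<in> times" "\<forall>\<omega>\<in>space M. s \<omega> \<le> t \<omega>" and Y: "Y \<in> borel_measurable (pre_sigma t)"
    and C: "0 \<le> C" and bd: "AE \<omega> in M. \<bar>Y \<omega>\<bar> \<le> C"
  shows "Phi s t Y \<in> borel_measurable (pre_sigma s)" and "AE \<omega> in M. \<bar>Phi s t Y \<omega>\<bar> \<le> C"
proof -
  obtain V where V: "is_value s t (\<lambda>\<omega>. ennreal (C - Y \<omega>)) (ennreal (2 * C)) V"
    "AE \<omega> in M. Phi s t Y \<omega> = C - enn2real (V \<omega>)" using Phi_value[OF s Y bd] .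
  have "(\<lambda>\<omega>. C - enn2real (V \<omega>)) \<in> borel_measurable (pre_sigma s)"
    using value_measurable[OF V(1)] by measurable
  then show "Phi s t Y \<in> borel_measurable (pre_sigma s)"
    by (rule measurable_pre_sigma_AE_cong[OF _ _ s(1)]) (use V(2) in \<open>auto elim!: eventually_mono\<close>)
  show "AE \<omega> in M. \<bar>Phi s t Y \<omega>\<bar> \<le> C"
    using V(2) is_value_le[OF V(1)]
  proof eventually_elim
    case (elim \<omega>)
    have "enn2real (V \<omega>) \<le> 2 * C" using elim(2) C enn2real_mono[OF elim(2)] by simp
    then show ?case using elim(1) enn2real_nonneg[of "V \<omega>"] by linarith
  qed
qed

lemma E_ge_const_add:
  assumes a: "\<mu> \<in> CC" "s \<in> times" "t \<in> times" "\<forall>\<omega>\<in>space M. s \<omega> \<le> t \<omega>"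
    and f: "f \<in> borel_measurable (pre_sigma t)" and h: "h \<in> borel_measurable (pre_sigma s)"
    and f': "f' \<in> borel_measurable (pre_sigma t)" and eq: "AE \<omega> in M. f' \<omega> = f \<omega> + h \<omega>"
  shows "AE \<omega> in M. E \<mu> s t f' \<omega> = E \<mu> s t f \<omega> + h \<omega>"
proof -
  have "(\<lambda>\<omega>. f \<omega> + h \<omega>) \<in> borel_measurable (pre_sigma t)"
    using f measurable_pre_sigma_mono[OF h a(2-4)] by measurable
  from E_cong[OF a f' this eq] E_add[OF a f h] show ?thesis by eventually_elim simp
qed

section \<open>Axioms of a convex dynamic process and time consistency\<close>

lemma Phi_monotone:
  assumes s: "s \<in> times" "t \<in> times" "\<forall>\<omega>\<in>space M. s \<omega> \<le> t \<omega>"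
  shows "monotone_on_Linfty M (pre_sigma t) (Phi s t)"
  unfolding monotone_on_Linfty_def
proof (intro ballI impI)
  fix X Y assume XL: "X \<in> Linfty M (pre_sigma t)" and YL: "Y \<in> Linfty M (pre_sigma t)"
    and le: "AE \<omega> in M. X \<omega> \<le> Y \<omega>"
  obtain C where X: "X \<in> borel_measurable (pre_sigma t)" and Y: "Y \<in> borel_measurable (pre_sigma t)"
    and "0 \<le> C" and bd: "AE \<omega> in M. \<bar>X \<omega>\<bar> \<le> C" "AE \<omega> in M. \<bar>Y \<omega>\<bar> \<le> C"
    using LinftyE2[OF XL YL] .
  obtain V where V: "is_value s t (\<lambda>\<omega>. ennreal (C - X \<omega>)) (ennreal (2 * C)) V"
    "AE \<omega> in M. Phi s t X \<omega> = C - enn2real (V \<omega>)" using Phi_value[OF s X bd(1)] .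
  obtain W where W: "is_value s t (\<lambda>\<omega>. ennreal (C - Y \<omega>)) (ennreal (2 * C)) W"
    "AE \<omega> in M. Phi s t Y \<omega> = C - enn2real (W \<omega>)" using Phi_value[OF s Y bd(2)] .
  have le': "AE \<omega> in M. ennreal (C - Y \<omega>) \<le> ennreal (C - X \<omega>)"
    using le by eventually_elim (simp add: ennreal_leI)
  have "AE \<omega> in M. W \<omega> \<le> V \<omega>"
  proof (rule is_value_greatest[OF V(1)])
    fix \<mu> assume \<mu>: "\<mu> \<in> CC"
    from value_le_E[OF W(1) \<mu>] E_mono[OF \<mu> s cost_measurable_t[OF Y] cost_measurable_t[OF X] le']
    show "AE \<omega> in M. W \<omega> \<le> E \<mu> s t (\<lambda>\<omega>. ennreal (C - X \<omega>)) \<omega>" by eventually_elim simp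
  qed
  with V(2) W(2) is_value_le[OF V(1)] show "AE \<omega> in M. Phi s t X \<omega> \<le> Phi s t Y \<omega>"
  proof eventually_elim
    case (elim \<omega>)
    then have "enn2real (W \<omega>) \<le> enn2real (V \<omega>)" by (intro enn2real_mono) (auto simp: le_less_trans)
    with elim show ?case by simp
  qed
qed

lemma Phi_translation:
  assumes s: "s \<in> times" "t \<in> times" "\<forall>\<omega>\<in>space M. s \<omega> \<le> t \<omega>"
    and YL: "Y \<in> Linfty M (pre_sigma t)" and ZL: "Z \<in> Linfty M (pre_sigma s)"
  shows "AE \<omega> in M. Phi s t (\<lambda>\<omega>. Y \<omega> + Z \<omega>) \<omega> = Phi s t Y \<omega> + Z \<omega>"
proof -
  obtain C where Y: "Y \<in> borel_measurable (pre_sigma t)" and Z: "Z \<in> borel_measurable (pre_sigma s)"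
    and C: "0 \<le> C" and bd: "AE \<omega> in M. \<bar>Y \<omega>\<bar> \<le> C" "AE \<omega> in M. \<bar>Z \<omega>\<bar> \<le> C"
    using LinftyE2[OF YL ZL] .
  have YZ: "(\<lambda>\<omega>. Y \<omega> + Z \<omega>) \<in> borel_measurable (pre_sigma t)"
    using Y measurable_pre_sigma_mono[OF Z s] by measurable
  have bdYZ: "AE \<omega> in M. \<bar>Y \<omega> + Z \<omega>\<bar> \<le> 2 * C" using bd by eventually_elim linarith
  obtain V where V: "is_value s t (\<lambda>\<omega>. ennreal (C - Y \<omega>)) (ennreal (2 * C)) V"
    "AE \<omega> in M. Phi s t Y \<omega> = C - enn2real (V \<omega>)" using Phi_value[OF s Y bd(1)] .
  obtain W where W: "is_value s t (\<lambda>\<omega>. ennreal (2 * C - (Y \<omega> + Z \<omega>))) (ennreal (2 * (2 * C))) W"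
    "AE \<omega> in M. Phi s t (\<lambda>\<omega>. Y \<omega> + Z \<omega>) \<omega> = 2 * C - enn2real (W \<omega>)" using Phi_value[OF s YZ bdYZ] .
  \<comment> \<open>The bound \<open>2 * C\<close> for \<open>Y + Z\<close> is shared out so that
    \<open>C - Y\<close> and \<open>C - Z\<close> are both nonnegative; the second is known at
    \<open>s\<close> and comes out of \<open>E\<close>.\<close>
  let ?h = "\<lambda>\<omega>. ennreal (C - Z \<omega>)"
  have eq: "AE \<omega> in M. ennreal (2 * C - (Y \<omega> + Z \<omega>)) = ennreal (C - Y \<omega>) + ?h \<omega>"
    using bd
  proof eventually_elim
    case (elim \<omega>)
    then have "0 \<le> C - Y \<omega>" "0 \<le> C - Z \<omega>" by linarith+
    then show ?case by (subst ennreal_plus[symmetric]) (simp_all add: algebra_simps)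
  qed
  have h: "?h \<in> borel_measurable (pre_sigma s)" using Z by measurable
  note Eeq = E_ge_const_add[OF _ s cost_measurable_t[OF Y] h cost_measurable_t[OF YZ] eq]
  have 1: "AE \<omega> in M. W \<omega> - ?h \<omega> \<le> V \<omega>"
  proof (rule is_value_greatest[OF V(1)])
    fix \<mu> assume \<mu>: "\<mu> \<in> CC"
    from Eeq[OF \<mu>] value_le_E[OF W(1) \<mu>]
    show "AE \<omega> in M. W \<omega> - ?h \<omega> \<le> E \<mu> s t (\<lambda>\<omega>. ennreal (C - Y \<omega>)) \<omega>"
      by eventually_elim (simp add: ennreal_minus_le_iff add.commute)
  qed
  have 2: "AE \<omega> in M. V \<omega> + ?h \<omega> \<le> W \<omega>"
  proof (rule is_value_greatest[OF W(1)])
    fix \<mu> assume \<mu>: "\<mu> \<in> CC"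
    from Eeq[OF \<mu>] value_le_E[OF V(1) \<mu>]
    show "AE \<omega> in M. V \<omega> + ?h \<omega> \<le> E \<mu> s t (\<lambda>\<omega>. ennreal (2 * C - (Y \<omega> + Z \<omega>))) \<omega>"
      by eventually_elim (simp add: add_right_mono)
  qed
  show ?thesis
    using V(2) W(2) 1 2 is_value_le[OF V(1)] bd(2)
  proof eventually_elim
    case (elim \<omega>)
    obtain v where v: "V \<omega> = ennreal v" "0 \<le> v" using elim(5) by (cases "V \<omega>") (auto simp: top_unique)
    have h: "0 \<le> C - Z \<omega>" using elim(6) by linarith
    have "W \<omega> \<le> V \<omega> + ?h \<omega>" using elim(3) by (simp add: ennreal_minus_le_iff add.commute)
    with elim(4) have "W \<omega> = ennreal (v + (C - Z \<omega>))"
      using v h by (simp add: ennreal_plus)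
    then have "enn2real (W \<omega>) = v + (C - Z \<omega>)" using v h by (simp del: ennreal_plus)
    with elim(1,2) v show ?case by simp
  qed
qed

text \<open>For a single control the cost is affine under convex combinations, so the infimum over
  controls is concave in the cost and its reflection is convex in \<open>Y\<close>.\<close>

lemma Phi_convex:
  assumes s: "s \<in> times" "t \<in> times" "\<forall>\<omega>\<in>space M. s \<omega> \<le> t \<omega>"
  shows "convex_on_Linfty M (pre_sigma t) (Phi s t)"
  unfolding convex_on_Linfty_def
proof (intro ballI)
  fix X Y and c :: real assume XL: "X \<in> Linfty M (pre_sigma t)" and YL: "Y \<in> Linfty M (pre_sigma t)"
    and c: "c \<in> {0..1}"
  obtain C where X: "X \<in> borel_measurable (pre_sigma t)" and Y: "Y \<in> borel_measurable (pre_sigma t)"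
    and "0 \<le> C" and bd: "AE \<omega> in M. \<bar>X \<omega>\<bar> \<le> C" "AE \<omega> in M. \<bar>Y \<omega>\<bar> \<le> C"
    using LinftyE2[OF XL YL] .
  let ?U = "\<lambda>\<omega>. c * X \<omega> + (1 - c) * Y \<omega>"
  have U: "?U \<in> borel_measurable (pre_sigma t)" using X Y by measurable
  have c01: "0 \<le> c" "0 \<le> 1 - c" using c by auto
  have bdU: "AE \<omega> in M. \<bar>?U \<omega>\<bar> \<le> C"
    using bd
  proof eventually_elim
    case (elim \<omega>)
    have "\<bar>?U \<omega>\<bar> \<le> c * \<bar>X \<omega>\<bar> + (1 - c) * \<bar>Y \<omega>\<bar>"
      using c01 by (intro order_trans[OF abs_triangle_ineq]) (simp add: abs_mult)
    also have "\<dots> \<le> c * C + (1 - c) * C" using c01 elim by (intro add_mono mult_left_mono) auto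
    finally show ?case by (simp add: algebra_simps)
  qed
  obtain V1 where V1: "is_value s t (\<lambda>\<omega>. ennreal (C - X \<omega>)) (ennreal (2 * C)) V1"
    "AE \<omega> in M. Phi s t X \<omega> = C - enn2real (V1 \<omega>)" using Phi_value[OF s X bd(1)] .
  obtain V2 where V2: "is_value s t (\<lambda>\<omega>. ennreal (C - Y \<omega>)) (ennreal (2 * C)) V2"
    "AE \<omega> in M. Phi s t Y \<omega> = C - enn2real (V2 \<omega>)" using Phi_value[OF s Y bd(2)] .
  obtain W where W: "is_value s t (\<lambda>\<omega>. ennreal (C - ?U \<omega>)) (ennreal (2 * C)) W"
    "AE \<omega> in M. Phi s t ?U \<omega> = C - enn2real (W \<omega>)" using Phi_value[OF s U bdU] .
  let ?f = "\<lambda>\<omega>. ennreal c * ennreal (C - X \<omega>) + ennreal (1 - c) * ennreal (C - Y \<omega>)"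
  have fm: "?f \<in> borel_measurable (pre_sigma t)" using X Y by measurable
  have eq: "AE \<omega> in M. ennreal (C - ?U \<omega>) = ?f \<omega>"
    using bd
  proof eventually_elim
    case (elim \<omega>)
    have nn: "0 \<le> C - X \<omega>" "0 \<le> C - Y \<omega>" using elim by linarith+
    have "?f \<omega> = ennreal (c * (C - X \<omega>) + (1 - c) * (C - Y \<omega>))"
      using nn c01 by (simp add: ennreal_mult' ennreal_plus)
    also have "c * (C - X \<omega>) + (1 - c) * (C - Y \<omega>) = C - ?U \<omega>" by (simp add: algebra_simps)
    finally show ?case by simp
  qed
  have sum1: "ennreal c + ennreal (1 - c) = 1" using c01 by (simp add: ennreal_plus[symmetric] del: ennreal_plus)
  have "AE \<omega> in M. ennreal c * V1 \<omega> + ennreal (1 - c) * V2 \<omega> \<le> W \<omega>"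
  proof (rule is_value_greatest[OF W(1)])
    fix \<mu> assume \<mu>: "\<mu> \<in> CC"
    from E_cong[OF \<mu> s cost_measurable_t[OF U] fm eq]
      E_convex[OF \<mu> s cost_measurable_t[OF X, of C] cost_measurable_t[OF Y, of C] sum1]
      value_le_E[OF V1(1) \<mu>] value_le_E[OF V2(1) \<mu>]
    show "AE \<omega> in M. ennreal c * V1 \<omega> + ennreal (1 - c) * V2 \<omega> \<le> E \<mu> s t (\<lambda>\<omega>. ennreal (C - ?U \<omega>)) \<omega>"
      by eventually_elim (simp add: add_mono mult_left_mono)
  qed
  with V1(2) V2(2) W(2) is_value_le[OF V1(1)] is_value_le[OF V2(1)] is_value_le[OF W(1)]
  show "AE \<omega> in M. Phi s t ?U \<omega> \<le> c * Phi s t X \<omega> + (1 - c) * Phi s t Y \<omega>"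
  proof eventually_elim
    case (elim \<omega>)
    obtain v1 where v1: "V1 \<omega> = ennreal v1" "0 \<le> v1" using elim(4) by (cases "V1 \<omega>") (auto simp: top_unique)
    obtain v2 where v2: "V2 \<omega> = ennreal v2" "0 \<le> v2" using elim(5) by (cases "V2 \<omega>") (auto simp: top_unique)
    obtain w where w: "W \<omega> = ennreal w" "0 \<le> w" using elim(6) by (cases "W \<omega>") (auto simp: top_unique)
    have "ennreal (c * v1 + (1 - c) * v2) \<le> ennreal w"
      using elim(7) v1 v2 w c01 by (simp add: ennreal_plus ennreal_mult')
    then have "c * v1 + (1 - c) * v2 \<le> w" using w by (simp add: ennreal_le_iff)
    then have "C - w \<le> c * (C - v1) + (1 - c) * (C - v2)" by (simp add: algebra_simps)
    then show ?case using elim(1-3) v1 v2 w by simp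
  qed
qed

text \<open>\<open>C = 0\<close> is an admissible bound for \<open>Y = 0\<close>, and the value is
  then squeezed between \<open>0\<close> and \<open>2 * 0\<close>.\<close>

lemma Phi_normalized:
  assumes s: "s \<in> times" "t \<in> times" "\<forall>\<omega>\<in>space M. s \<omega> \<le> t \<omega>"
  shows "AE \<omega> in M. Phi s t (\<lambda>_. 0) \<omega> = 0"
proof -
  obtain V where V: "is_value s t (\<lambda>\<omega>. ennreal (0 - 0)) (ennreal (2 * 0)) V"
    "AE \<omega> in M. Phi s t (\<lambda>_. 0) \<omega> = 0 - enn2real (V \<omega>)"
    using Phi_value[OF s, of "\<lambda>_. 0" 0] by auto
  from V(2) is_value_le[OF V(1)] show ?thesis by eventually_elim simp
qed

text \<open>Two infima are exchanged, over controls and over \<open>k\<close>: for each control the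
  costs decrease with \<open>k\<close> to the limiting cost. Increasing \<open>Y\<close> means
  decreasing costs, and infima over controls are compatible with that direction.\<close>

lemma Phi_continuous_from_below:
  assumes s: "s \<in> times" "t \<in> times" "\<forall>\<omega>\<in>space M. s \<omega> \<le> t \<omega>"
  shows "continuous_from_below_on_Linfty M (pre_sigma t) (Phi s t)"
  unfolding continuous_from_below_on_Linfty_def
proof (intro allI impI)
  fix X :: "nat \<Rightarrow> 'a \<Rightarrow> real" and Y
  assume XL: "\<forall>k. X k \<in> Linfty M (pre_sigma t)" and YL: "Y \<in> Linfty M (pre_sigma t)"
    and inc: "increases_to M X Y"
  obtain C where Y: "Y \<in> borel_measurable (pre_sigma t)" and C: "0 \<le> C"
    and bd: "AE \<omega> in M. \<bar>X 0 \<omega>\<bar> \<le> C" "AE \<omega> in M. \<bar>Y \<omega>\<bar> \<le> C"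
    using LinftyE2[OF XL[rule_format, of 0] YL] .
  have X: "X k \<in> borel_measurable (pre_sigma t)" for k using XL by (simp add: Linfty_def)
  have inc': "AE \<omega> in M. incseq (\<lambda>k. X k \<omega>) \<and> (\<lambda>k. X k \<omega>) \<longlonglongrightarrow> Y \<omega>"
    using inc by (simp add: increases_to_def)
  have bdX: "AE \<omega> in M. \<bar>X k \<omega>\<bar> \<le> C" for k
    using inc' bd
  proof eventually_elim
    case (elim \<omega>)
    have "X 0 \<omega> \<le> X k \<omega>" using elim(1) by (simp add: incseq_def)
    moreover have "X k \<omega> \<le> Y \<omega>" using elim(1) by (intro incseq_le) auto
    ultimately show ?case using elim(2,3) by linarith
  qed
  have "\<exists>V. is_value s t (\<lambda>\<omega>. ennreal (C - X k \<omega>)) (ennreal (2 * C)) V \<and>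
      (AE \<omega> in M. Phi s t (X k) \<omega> = C - enn2real (V \<omega>))" for k
    using Phi_value[OF s X bdX] by metis
  then obtain V where V: "\<And>k. is_value s t (\<lambda>\<omega>. ennreal (C - X k \<omega>)) (ennreal (2 * C)) (V k)"
    "\<And>k. AE \<omega> in M. Phi s t (X k) \<omega> = C - enn2real (V k \<omega>)" by metis
  obtain W where W: "is_value s t (\<lambda>\<omega>. ennreal (C - Y \<omega>)) (ennreal (2 * C)) W"
    "AE \<omega> in M. Phi s t Y \<omega> = C - enn2real (W \<omega>)" using Phi_value[OF s Y bd(2)] .
  let ?f = "\<lambda>k \<omega>. ennreal (C - X k \<omega>)"
  have dec: "AE \<omega> in M. ?f (Suc k) \<omega> \<le> ?f k \<omega>" for k
    using inc' by eventually_elim (auto simp: incseq_Suc_iff intro!: ennreal_leI)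
  have leX: "AE \<omega> in M. ennreal (C - Y \<omega>) \<le> ?f k \<omega>" for k
    using inc'
  proof eventually_elim
    case (elim \<omega>)
    have "X k \<omega> \<le> Y \<omega>" using elim by (intro incseq_le) auto
    then show ?case by (intro ennreal_leI) simp
  qed
  have INFf: "AE \<omega> in M. ennreal (C - Y \<omega>) = (INF k. ?f k \<omega>)"
    using inc'
  proof eventually_elim
    case (elim \<omega>)
    have "(\<lambda>k. ?f k \<omega>) \<longlonglongrightarrow> ennreal (C - Y \<omega>)"
      using elim by (intro tendsto_ennrealI tendsto_intros) auto
    moreover have "decseq (\<lambda>k. ?f k \<omega>)"
      using elim by (auto simp: decseq_def incseq_def intro!: ennreal_leI)
    ultimately show ?case using LIMSEQ_INF LIMSEQ_unique by blast
  qed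
  have Vdec: "AE \<omega> in M. V (Suc k) \<omega> \<le> V k \<omega>" for k
  proof (rule is_value_greatest[OF V(1)])
    fix \<mu> assume \<mu>: "\<mu> \<in> CC"
    from value_le_E[OF V(1)[of "Suc k"] \<mu>] E_mono[OF \<mu> s cost_measurable_t[OF X] cost_measurable_t[OF X] dec, of k]
    show "AE \<omega> in M. V (Suc k) \<omega> \<le> E \<mu> s t (?f k) \<omega>" by eventually_elim simp
  qed
  have WV: "AE \<omega> in M. W \<omega> \<le> V k \<omega>" for k
  proof (rule is_value_greatest[OF V(1)])
    fix \<mu> assume \<mu>: "\<mu> \<in> CC"
    from value_le_E[OF W(1) \<mu>] E_mono[OF \<mu> s cost_measurable_t[OF Y] cost_measurable_t[OF X] leX, of k]
    show "AE \<omega> in M. W \<omega> \<le> E \<mu> s t (?f k) \<omega>" by eventually_elim simp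
  qed
  have bdf: "AE \<omega> in M. ?f 0 \<omega> \<le> ennreal (2 * C)"
    using bd(1) by eventually_elim (auto intro!: ennreal_leI)
  have "AE \<omega> in M. (INF k. V k \<omega>) \<le> W \<omega>"
  proof (rule is_value_greatest[OF W(1)])
    fix \<mu> assume \<mu>: "\<mu> \<in> CC"
    have "(\<lambda>\<omega>. INF k. ?f k \<omega>) \<in> borel_measurable (pre_sigma t)" using cost_measurable_t[OF X] by simp
    note 1 = E_cong[OF \<mu> s cost_measurable_t[OF Y] this INFf]
    note 2 = E_INF[OF \<mu> s cost_measurable_t[OF X] dec bdf]
    have "AE \<omega> in M. \<forall>k. V k \<omega> \<le> E \<mu> s t (?f k) \<omega>"
      using value_le_E[OF V(1) \<mu>] by (simp add: AE_all_countable)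
    moreover have "AE \<omega> in M. E \<mu> s t (\<lambda>\<omega>. INF k. ?f k \<omega>) \<omega> = (INF k. E \<mu> s t (?f k) \<omega>)"
      by (rule 2) simp
    ultimately show "AE \<omega> in M. (INF k. V k \<omega>) \<le> E \<mu> s t (\<lambda>\<omega>. ennreal (C - Y \<omega>)) \<omega>"
      using 1 by eventually_elim (auto intro!: INF_mono)
  qed
  moreover have "AE \<omega> in M. \<forall>k. V (Suc k) \<omega> \<le> V k \<omega> \<and> W \<omega> \<le> V k \<omega> \<and> Phi s t (X k) \<omega> = C - enn2real (V k \<omega>)"
    using Vdec WV V(2) by (simp add: AE_all_countable)
  ultimately show "increases_to M (\<lambda>k. Phi s t (X k)) (Phi s t Y)"
    unfolding increases_to_def using W(2) is_value_le[OF V(1), of 0]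
  proof eventually_elim
    case (elim \<omega>)
    have W: "W \<omega> = (INF k. V k \<omega>)" using elim(1,2) by (intro antisym INF_greatest) auto
    have dec: "decseq (\<lambda>k. V k \<omega>)" using elim(2) by (simp add: decseq_Suc_iff)
    then have le0: "V k \<omega> \<le> V 0 \<omega>" for k by (simp add: decseq_def)
    have fin: "V k \<omega> < \<infinity>" for k using le0[of k] elim(4) by (auto simp: le_less_trans)
    have finW: "W \<omega> < \<infinity>" using elim(2) fin[of 0] by (metis le_less_trans)
    have "(\<lambda>k. V k \<omega>) \<longlonglongrightarrow> W \<omega>" unfolding W by (rule LIMSEQ_INF[OF dec])
    then have "(\<lambda>k. enn2real (V k \<omega>)) \<longlonglongrightarrow> enn2real (W \<omega>)"
      using finW by (intro tendsto_enn2real) (simp_all add: less_top)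
    then have "(\<lambda>k. C - enn2real (V k \<omega>)) \<longlonglongrightarrow> C - enn2real (W \<omega>)" by (intro tendsto_diff tendsto_const)
    moreover have "enn2real (V (Suc k) \<omega>) \<le> enn2real (V k \<omega>)" for k
      using elim(2) fin[of k] by (intro enn2real_mono) auto
    ultimately show ?case using elim(2,3) by (simp add: incseq_Suc_iff)
  qed
qed

text \<open>Dynamic programming. For \<open>U \<le> W\<close> the inner value is at most the cost of
  the given control after \<open>s\<close>. For \<open>W \<le> U\<close> a control
  \<open>\<nu>\<close> up to \<open>s\<close> is followed by nearly optimal controls
  \<open>\<pi> k\<close>, and monotone convergence inside \<open>E \<nu> q s\<close> reaches the
  inner value.\<close>

lemma Phi_time_consistent:
  assumes q: "q \<in> times" and s: "s \<in> times" and t: "t \<in> times"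
    and qs: "\<forall>\<omega>\<in>space M. q \<omega> \<le> s \<omega>" and st: "\<forall>\<omega>\<in>space M. s \<omega> \<le> t \<omega>"
    and YL: "Y \<in> Linfty M (pre_sigma t)"
  shows "AE \<omega> in M. Phi q s (Phi s t Y) \<omega> = Phi q t Y \<omega>"
proof -
  have qt: "\<forall>\<omega>\<in>space M. q \<omega> \<le> t \<omega>" using qs st by (meson order_trans)
  obtain C where Y: "Y \<in> borel_measurable (pre_sigma t)" and C: "0 \<le> C"
    and bd: "AE \<omega> in M. \<bar>Y \<omega>\<bar> \<le> C" using LinftyE[OF YL] .
  let ?f = "\<lambda>\<omega>. ennreal (C - Y \<omega>)"
  note fm = cost_measurable_t[OF Y, of C]
  note Phim = Phi_Linfty[OF s t st Y C bd]
  let ?f' = "\<lambda>\<omega>. ennreal (C - Phi s t Y \<omega>)"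
  note fm' = cost_measurable_t[OF Phim(1), of C]
  obtain V where V: "is_value s t ?f (ennreal (2 * C)) V"
    "AE \<omega> in M. Phi s t Y \<omega> = C - enn2real (V \<omega>)" using Phi_value[OF s t st Y bd] .
  obtain W where W: "is_value q t ?f (ennreal (2 * C)) W"
    "AE \<omega> in M. Phi q t Y \<omega> = C - enn2real (W \<omega>)" using Phi_value[OF q t qt Y bd] .
  obtain U where U: "is_value q s ?f' (ennreal (2 * C)) U"
    "AE \<omega> in M. Phi q s (Phi s t Y) \<omega> = C - enn2real (U \<omega>)" using Phi_value[OF q s qs Phim] .
  note Vm = value_measurable[OF V(1)]
  have fV: "AE \<omega> in M. ?f' \<omega> = V \<omega>"
    using V(2) is_value_le[OF V(1)]
  proof eventually_elim
    case (elim \<omega>)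
    then show ?case by (cases "V \<omega>") (auto simp: top_unique)
  qed
  have UW: "AE \<omega> in M. U \<omega> \<le> W \<omega>"
  proof (rule is_value_greatest[OF W(1)])
    fix \<mu> assume \<mu>: "\<mu> \<in> CC"
    from value_le_E[OF U(1) \<mu>] E_cong[OF \<mu> q s qs fm' Vm fV]
      E_mono[OF \<mu> q s qs Vm E_measurable value_le_E[OF V(1) \<mu>]] E_tower[OF \<mu> q s t qs st fm]
    show "AE \<omega> in M. U \<omega> \<le> E \<mu> q t ?f \<omega>" by eventually_elim simp
  qed
  have WU: "AE \<omega> in M. W \<omega> \<le> U \<omega>"
  proof (rule is_value_greatest[OF U(1)])
    fix \<nu> assume \<nu>: "\<nu> \<in> CC"
    obtain \<pi> :: "nat \<Rightarrow> real \<Rightarrow> 'a \<Rightarrow> 'b" where \<pi>: "\<And>k. \<pi> k \<in> CC" "\<And>k. AE \<omega> in M. E (\<pi> (Suc k)) s t ?f \<omega> \<le> E (\<pi> k) s t ?f \<omega>"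
      "AE \<omega> in M. E (\<pi> 0) s t ?f \<omega> \<le> ennreal (2 * C)" "AE \<omega> in M. V \<omega> = (INF k. E (\<pi> k) s t ?f \<omega>)"
      using V(1) by (auto simp: is_value_def)
    \<comment> \<open>Pasting along the whole space: by locality \<open>\<rho> k\<close> costs as
      much as \<open>\<pi> k\<close> after \<open>s\<close> and as \<open>\<nu>\<close>
      before.\<close>
    define \<rho> where "\<rho> k = (\<lambda>u \<omega>. if s \<omega> < u \<and> \<omega> \<in> space M then \<pi> k u \<omega> else \<nu> u \<omega>)" for k
    have sp: "space M \<in> sets (pre_sigma \<tau>)" for \<tau> using sets.top[of "pre_sigma \<tau>"] by (simp add: space_pre_sigma)
    have \<rho>: "\<rho> k \<in> CC" for k unfolding \<rho>_def by (rule paste_CC[OF \<nu> \<pi>(1) s sp])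
    have W_le: "AE \<omega> in M. W \<omega> \<le> E \<nu> q s (E (\<pi> k) s t ?f) \<omega>" for k
    proof -
      have 1: "AE \<omega> in M. \<omega> \<in> space M \<longrightarrow> E (\<rho> k) s t ?f \<omega> = E (\<pi> k) s t ?f \<omega>"
        by (rule E_local[OF \<rho> \<pi>(1) s t st sp _ fm]) (simp add: \<rho>_def)
      have local_eq: "AE \<omega> in M. E (\<rho> k) s t ?f \<omega> = E (\<pi> k) s t ?f \<omega>"
        using 1 AE_space by eventually_elim simp
      have 2: "AE \<omega> in M. \<omega> \<in> space M \<longrightarrow> E (\<rho> k) q s (E (\<pi> k) s t ?f) \<omega> = E \<nu> q s (E (\<pi> k) s t ?f) \<omega>"
        by (rule E_local[OF \<rho> \<nu> q s qs sp _ E_measurable]) (simp add: \<rho>_def)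
      from value_le_E[OF W(1) \<rho>[of k]] E_tower[OF \<rho> q s t qs st fm, of k]
        E_cong[OF \<rho>[of k] q s qs E_measurable E_measurable local_eq] 2 AE_space
      show ?thesis by eventually_elim simp
    qed
    have W_le_all: "AE \<omega> in M. \<forall>k. W \<omega> \<le> E \<nu> q s (E (\<pi> k) s t ?f) \<omega>" using W_le by (simp add: AE_all_countable)
    have E_INF_\<pi>: "AE \<omega> in M. E \<nu> q s (\<lambda>\<omega>. INF k. E (\<pi> k) s t ?f \<omega>) \<omega> = (INF k. E \<nu> q s (E (\<pi> k) s t ?f) \<omega>)"
      by (rule E_INF[OF \<nu> q s qs E_measurable \<pi>(2,3)]) simp
    have INFm: "(\<lambda>\<omega>. INF k. E (\<pi> k) s t ?f \<omega>) \<in> borel_measurable (pre_sigma s)" by measurable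
    have "AE \<omega> in M. ?f' \<omega> = (INF k. E (\<pi> k) s t ?f \<omega>)" using fV \<pi>(4) by eventually_elim simp
    from E_cong[OF \<nu> q s qs fm' INFm this] W_le_all E_INF_\<pi> show "AE \<omega> in M. W \<omega> \<le> E \<nu> q s ?f' \<omega>"
      by eventually_elim (simp add: INF_greatest)
  qed
  from UW WU U(2) W(2) show ?thesis by eventually_elim simp
qed

theorem Phi_properties:
  shows "(\<forall>s\<in>times. \<forall>t\<in>times. (\<forall>\<omega>\<in>space M. s \<omega> \<le> t \<omega>) \<longrightarrow> (\<forall>Y\<in>Linfty M (pre_sigma t).
            is_ess_sup M (ess_family s t Y) (\<lambda>\<omega>. ereal (Phi s t Y \<omega>))))"
    and "convex_dynamic_process M times pre_sigma Phi"
    and "normalized_process M times Phi"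
    and "time_consistent M times pre_sigma Phi"
proof -
  show "\<forall>s\<in>times. \<forall>t\<in>times. (\<forall>\<omega>\<in>space M. s \<omega> \<le> t \<omega>) \<longrightarrow> (\<forall>Y\<in>Linfty M (pre_sigma t).
            is_ess_sup M (ess_family s t Y) (\<lambda>\<omega>. ereal (Phi s t Y \<omega>)))"
  proof (intro ballI impI)
    fix s t Y assume s: "s \<in> times" "t \<in> times" "\<forall>\<omega>\<in>space M. s \<omega> \<le> t \<omega>" and YL: "Y \<in> Linfty M (pre_sigma t)"
    obtain C where "Y \<in> borel_measurable (pre_sigma t)" "0 \<le> C" "AE \<omega> in M. \<bar>Y \<omega>\<bar> \<le> C" using LinftyE[OF YL] .
    then show "is_ess_sup M (ess_family s t Y) (\<lambda>\<omega>. ereal (Phi s t Y \<omega>))"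
      using Phi_value[OF s] by metis
  qed
  have "Phi s t Y \<in> Linfty M (pre_sigma s)"
    if s: "s \<in> times" "t \<in> times" "\<forall>\<omega>\<in>space M. s \<omega> \<le> t \<omega>" and YL: "Y \<in> Linfty M (pre_sigma t)" for s t Y
  proof -
    obtain C where "Y \<in> borel_measurable (pre_sigma t)" "0 \<le> C" "AE \<omega> in M. \<bar>Y \<omega>\<bar> \<le> C" using LinftyE[OF YL] .
    from Phi_Linfty[OF s this] show ?thesis unfolding Linfty_def by blast
  qed
  then show "convex_dynamic_process M times pre_sigma Phi"
    unfolding convex_dynamic_process_def
    using Phi_monotone Phi_translation Phi_convex Phi_continuous_from_below by blast
  show "normalized_process M times Phi"
    unfolding normalized_process_def using Phi_normalized by blast
  show "time_consistent M times pre_sigma Phi"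
    unfolding time_consistent_def using Phi_time_consistent by blast
qed

end

section \<open>Exponential martingales of the coordinate process\<close>

lemma bounded_bilinear_vector_matrix_mult:
  "bounded_bilinear (\<lambda>(x::real^'m) (A::real^'n^'m). x v* A)"
  unfolding bilinear_conv_bounded_bilinear[symmetric] bilinear_def
  by (auto intro!: linearI simp: vector_matrix_mult_def vec_eq_iff algebra_simps sum.distrib sum_distrib_left)

interpretation vm: bounded_bilinear "\<lambda>(x::real^'m) (A::real^'n^'m). x v* A"
  by (rule bounded_bilinear_vector_matrix_mult)

text \<open>The quadratic form of \<open>\<sigma>\<close> times its transpose is the squared norm of
  the row vector \<open>h v* \<sigma>\<close>; energies of integrands are therefore written with
  this product.\<close>

lemma inner_diffusion_matrix:
  "h \<bullet> (diffusion_matrix \<sigma> u x *v h) = (norm (h v* \<sigma> u x))\<^sup>2"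
  unfolding diffusion_matrix_def power2_norm_eq_inner
  by (simp add: matrix_vector_mul_assoc[symmetric] dot_lmul_matrix[symmetric] transpose_matrix_vector)

lemma norm_set_integral_le_const:
  fixes f :: "real \<Rightarrow> real"
  assumes "\<And>x. x \<in> {a<..b} \<Longrightarrow> \<bar>f x\<bar> \<le> C" "a \<le> b" "0 \<le> C"
  shows "\<bar>LINT x:{a<..b}|lborel. f x\<bar> \<le> C * (b - a)"
proof (cases "set_integrable lborel {a<..b} f")
  case True
  have "norm (LINT x|lborel. indicator {a<..b} x *\<^sub>R f x) \<le> (LINT x|lborel. C * indicator {a<..b} x)"
    using True assms by (intro Bochner_Integration.integral_norm_bound_integral) (auto simp: set_integrable_def split: split_indicator)
  also have "\<dots> = C * (b - a)" using assms(2) by simp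
  finally show ?thesis by (simp add: set_lebesgue_integral_def)
next
  case False
  \<comment> \<open>A function that is not integrable has Bochner integral zero, so the bound holds
    in this case as well.\<close>
  then show ?thesis using assms by (simp add: set_lebesgue_integral_def set_integrable_def not_integrable_integral_eq)
qed

section \<open>The completed path filtration and the exponential identity for constant
  integrands\<close>

lemma coord_measurable: "u \<in> I \<Longrightarrow> (\<lambda>\<omega>. \<omega> u) \<in> borel_measurable (coord_algebra r I)"
proof (rule measurableI)
  fix A :: "(real^'n) set" assume "u \<in> I" "A \<in> sets borel"
  then have "(\<lambda>\<omega>. \<omega> u) -` A \<inter> path_space r \<in> {(\<lambda>\<omega>. \<omega> u) -` A \<inter> path_space r | u A. u \<in> I \<and> A \<in> sets borel}" by blast
  then show "(\<lambda>\<omega>. \<omega> u) -` A \<inter> space (coord_algebra r I) \<in> sets (coord_algebra r I)"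
    unfolding coord_algebra_def by (subst space_measure_of) auto
qed simp

lemma space_coord_algebra [simp]: "space (coord_algebra r I) = path_space r"
  unfolding coord_algebra_def by (rule space_measure_of) auto

lemma sets_coord_algebra: "sets (coord_algebra r I) = sigma_sets (path_space r)
    {(\<lambda>\<omega>. \<omega> u) -` A \<inter> path_space r | u A. u \<in> I \<and> A \<in> sets borel}"
  unfolding coord_algebra_def by (rule sets_measure_of) auto

lemma sets_coord_algebra_mono: "I \<subseteq> J \<Longrightarrow> sets (coord_algebra r I) \<subseteq> sets (coord_algebra r J)"
  unfolding sets_coord_algebra by (rule sigma_sets_mono') blast

locale diffusion =
  fixes \<sigma> :: "real \<Rightarrow> real ^ 'n::finite \<Rightarrow> real ^ 'n ^ 'n"
    and r T :: real and y :: "real ^ 'n" and Q :: "'n path measure"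
  assumes cont_\<sigma>: "continuous_on ({0..} \<times> UNIV) (\<lambda>(t, x). \<sigma> t x)"
    and bounded_\<sigma>: "bounded ((\<lambda>(t, x). \<sigma> t x) ` ({0..} \<times> UNIV))"
    and elliptic: "strictly_elliptic (diffusion_matrix \<sigma>)"
    and r_nonneg: "0 \<le> r" and rT: "r \<le> T"
    and mp: "solves_martingale_problem \<sigma> (\<lambda>_ _. 0) r y Q"
begin

abbreviation M where "M \<equiv> completion Q"
abbreviation F where "F \<equiv> cfilt Q r"
abbreviation \<Omega> :: "'n path set" where "\<Omega> \<equiv> path_space r"

text \<open>The squared norm of \<open>S u \<omega> h\<close> is the rate at which the quadratic
  variation of the integral of \<open>h\<close> against the coordinate process grows.\<close>

definition S :: "real \<Rightarrow> 'n path \<Rightarrow> real ^ 'n \<Rightarrow> real ^ 'n" where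
  "S u \<omega> h = h v* \<sigma> u (\<omega> u)"

lemma ex_S_bound: "\<exists>K>0. \<forall>u\<ge>r. \<forall>\<omega> h. norm (S u \<omega> h) \<le> K * norm h"
proof -
  obtain B where B: "\<And>t x. 0 \<le> t \<Longrightarrow> norm (\<sigma> t x) \<le> B" "B > 0"
    using bounded_\<sigma> unfolding bounded_pos by auto
  obtain L where L: "0 < L" "\<And>(x::real^'n) (A::real^'n^'n). norm (x v* A) \<le> norm x * norm A * L"
    using vm.pos_bounded by auto
  have "norm (S u \<omega> h) \<le> (B * L) * norm h" if "u \<ge> r" for u \<omega> h
  proof -
    have "norm (S u \<omega> h) \<le> norm h * norm (\<sigma> u (\<omega> u)) * L" unfolding S_def by (rule L)
    also have "\<dots> \<le> norm h * B * L"
      using B(1)[of u] that r_nonneg L(1) by (intro mult_right_mono mult_left_mono) auto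
    finally show ?thesis by (simp add: mult_ac)
  qed
  then show ?thesis using B(2) L(1) by (intro exI[of _ "B * L"]) auto
qed

definition K where "K = (SOME K. K > 0 \<and> (\<forall>u\<ge>r. \<forall>\<omega> h. norm (S u \<omega> h) \<le> K * norm h))"

lemma K_pos: "0 < K" and norm_S_le: "r \<le> u \<Longrightarrow> norm (S u \<omega> h) \<le> K * norm h"
proof -
  have "K > 0 \<and> (\<forall>u\<ge>r. \<forall>\<omega> h. norm (S u \<omega> h) \<le> K * norm h)"
    unfolding K_def using ex_S_bound by (rule someI_ex)
  then show "0 < K" "r \<le> u \<Longrightarrow> norm (S u \<omega> h) \<le> K * norm h" by auto
qed

lemma S_add: "S u \<omega> (h + k) = S u \<omega> h + S u \<omega> k"
  and S_diff: "S u \<omega> (h - k) = S u \<omega> h - S u \<omega> k"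
  and S_scaleR: "S u \<omega> (c *\<^sub>R h) = c *\<^sub>R S u \<omega> h"
  and S_zero [simp]: "S u \<omega> 0 = 0"
  unfolding S_def by (simp_all add: vm.add_left vm.diff_left vm.scaleR_left vm.zero_left)

lemma continuous_on_\<sigma>_path: "\<omega> \<in> \<Omega> \<Longrightarrow> continuous_on {r..} (\<lambda>u. \<sigma> u (\<omega> u))"
proof -
  assume "\<omega> \<in> \<Omega>"
  then have "continuous_on {r..} (\<lambda>u. (u, \<omega> u))"
    by (intro continuous_on_Pair continuous_on_id) (simp add: path_space_def)
  moreover have "(\<lambda>u. (u, \<omega> u)) ` {r..} \<subseteq> {0..} \<times> UNIV" using r_nonneg by auto
  ultimately have "continuous_on {r..} (\<lambda>u. case (u, \<omega> u) of (t, x) \<Rightarrow> \<sigma> t x)"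
    using continuous_on_compose2[OF cont_\<sigma>] by blast
  then show ?thesis by simp
qed

lemma continuous_on_S: "\<omega> \<in> \<Omega> \<Longrightarrow> continuous_on {r..} (\<lambda>u. S u \<omega> h)"
  unfolding S_def by (intro vm.continuous_on continuous_on_const continuous_on_\<sigma>_path)

lemma prob_Q: "prob_space Q" and space_Q [simp]: "space Q = \<Omega>"
  and sets_Q: "sets Q = sets (coord_algebra r {r..})"
  using mp by (auto simp: solves_martingale_problem_def)

lemma space_M: "space M = \<Omega>" by simp

lemma prob_M: "prob_space M"
  by (rule prob_space.prob_space_completion[OF prob_Q])

lemma coord_subset_M: "I \<subseteq> {r..} \<Longrightarrow> sets (coord_algebra r I) \<subseteq> sets M"
  using sets_coord_algebra_mono[of I "{r..}" r] sets_Q by auto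

lemma cfilt_generator_subset: "sets (coord_algebra r {r..t}) \<union> null_sets M \<subseteq> sets M"
  using coord_subset_M[of "{r..t}"] by (auto simp: null_sets_def)

lemma cfilt_generator_Pow: "sets (coord_algebra r {r..t}) \<union> null_sets M \<subseteq> Pow \<Omega>"
  by (rule order_trans[OF cfilt_generator_subset sets.space_closed[of M, unfolded space_M]])

lemma space_F [simp]: "space (F t) = \<Omega>"
  unfolding cfilt_def by (rule space_measure_of[OF cfilt_generator_Pow])

lemma sets_F: "sets (F t) = sigma_sets \<Omega> (sets (coord_algebra r {r..t}) \<union> null_sets M)"
  unfolding cfilt_def by (rule sets_measure_of[OF cfilt_generator_Pow])

lemma sets_F_sub_M: "sets (F t) \<subseteq> sets M"
  using sets.sigma_sets_subset[OF cfilt_generator_subset[of t]] by (simp add: sets_F)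

lemma coord_sub_F: "sets (coord_algebra r {r..t}) \<subseteq> sets (F t)"
  unfolding sets_F by (auto intro: sigma_sets.Basic)

lemma F_mono: "s \<le> t \<Longrightarrow> sets (F s) \<subseteq> sets (F t)"
  unfolding sets_F by (intro sigma_sets_mono' Un_mono sets_coord_algebra_mono) auto

sublocale complete_filtration M F r T
proof (intro complete_filtration.intro complete_filtration_axioms.intro prob_M rT sets_F_sub_M)
  show "filtration (space M) F" by unfold_locales (simp_all add: F_mono)
  show "complete_measure M" by unfold_locales
  show "null_sets M \<subseteq> sets (F t)" for t unfolding sets_F by (auto intro: sigma_sets.Basic)
qed

lemma X_measurable: "r \<le> u \<Longrightarrow> u \<le> t \<Longrightarrow> (\<lambda>\<omega>. \<omega> u) \<in> borel_measurable (F t)"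
  using coord_measurable[of u "{r..t}" r] coord_sub_F[of t] by (auto simp: measurable_def)

text \<open>Adjoining null sets changes events by null sets only, so the martingale property, which
  is given for the raw coordinate filtration, carries over to the completed one.\<close>

lemma F_AE_coord:
  assumes "A \<in> sets (F t)"
  shows "\<exists>B\<in>sets (coord_algebra r {r..t}). AE \<omega> in M. \<omega> \<in> A \<longleftrightarrow> \<omega> \<in> B"
  using assms unfolding sets_F
proof (induction rule: sigma_sets.induct)
  case (Basic a)
  then show ?case
  proof
    assume "a \<in> null_sets M"
    then have "AE \<omega> in M. \<omega> \<in> a \<longleftrightarrow> \<omega> \<in> {}" using AE_not_in[of a M] by auto
    then show ?thesis by blast
  qed auto
next
  case Empty then show ?case by (intro bexI[of _ "{}"]) auto
next
  case (Compl a)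
  then obtain B where B: "B \<in> sets (coord_algebra r {r..t})" "AE \<omega> in M. \<omega> \<in> a \<longleftrightarrow> \<omega> \<in> B" by auto
  have "AE \<omega> in M. \<omega> \<in> \<Omega> - a \<longleftrightarrow> \<omega> \<in> \<Omega> - B" using B(2) by eventually_elim auto
  moreover have "\<Omega> - B \<in> sets (coord_algebra r {r..t})" using sets.compl_sets[OF B(1)] by simp
  ultimately show ?case by blast
next
  case (Union a)
  then have "\<forall>i. \<exists>B\<in>sets (coord_algebra r {r..t}). AE \<omega> in M. \<omega> \<in> a i \<longleftrightarrow> \<omega> \<in> B" by auto
  then obtain B where B: "\<And>i. B i \<in> sets (coord_algebra r {r..t})" "\<And>i. AE \<omega> in M. \<omega> \<in> a i \<longleftrightarrow> \<omega> \<in> B i" by metis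
  have "AE \<omega> in M. \<forall>i. \<omega> \<in> a i \<longleftrightarrow> \<omega> \<in> B i" using B(2) by (simp add: AE_all_countable)
  then have "AE \<omega> in M. \<omega> \<in> (\<Union>i. a i) \<longleftrightarrow> \<omega> \<in> (\<Union>i. B i)" by eventually_elim auto
  moreover have "(\<Union>i. B i) \<in> sets (coord_algebra r {r..t})" using B(1) by auto
  ultimately show ?case by blast
qed

text \<open>This is the quadratic variation over \<open>{s<..t}\<close> of the coordinate process in
  direction \<open>\<theta>\<close>.\<close>

definition q\<theta> :: "real \<Rightarrow> real \<Rightarrow> real ^ 'n \<Rightarrow> 'n path \<Rightarrow> real" where
  "q\<theta> s t \<theta> \<omega> = (LINT u:{s<..t}|lborel. (norm (S u \<omega> \<theta>))\<^sup>2)"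

lemma set_integrable_S:
  assumes "\<omega> \<in> \<Omega>" "r \<le> s"
  shows "set_integrable lborel {s..t} (\<lambda>u. (norm (S u \<omega> \<theta>))\<^sup>2)" and "set_integrable lborel {s<..t} (\<lambda>u. (norm (S u \<omega> \<theta>))\<^sup>2)"
proof -
  have "continuous_on {s..t} (\<lambda>u. S u \<omega> \<theta>)"
    using assms by (intro continuous_on_subset[OF continuous_on_S]) auto
  then show 1: "set_integrable lborel {s..t} (\<lambda>u. (norm (S u \<omega> \<theta>))\<^sup>2)"
    unfolding set_integrable_def by (intro borel_integrable_compact continuous_intros) auto
  show "set_integrable lborel {s<..t} (\<lambda>u. (norm (S u \<omega> \<theta>))\<^sup>2)"
    by (rule set_integrable_subset[OF 1]) auto
qed

lemma q\<theta>_le: "r \<le> s \<Longrightarrow> s \<le> t \<Longrightarrow> q\<theta> s t \<theta> \<omega> \<le> (K * norm \<theta>)\<^sup>2 * (t - s)"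
  using norm_set_integral_le_const[of s t "\<lambda>u. (norm (S u \<omega> \<theta>))\<^sup>2" "(K * norm \<theta>)\<^sup>2"]
  unfolding q\<theta>_def by (force intro!: power_mono norm_S_le)

text \<open>The martingale problem provides exponentials started at \<open>r\<close>. Their value at
  \<open>s\<close> is positive and known at \<open>s\<close>; dividing by it leaves the exponential
  of the increment after \<open>s\<close>.\<close>

lemma exp_martingale_Q:
  assumes s: "r \<le> s" "s \<le> t" and B: "B \<in> sets (coord_algebra r {r..s})"
  shows "(\<integral>\<^sup>+\<omega>\<in>B. exp (\<theta> \<bullet> (\<omega> t - \<omega> s) - q\<theta> s t \<theta> \<omega> / 2) \<partial>Q) = emeasure Q B"
proof -
  interpret Q: prob_space Q by (rule prob_Q)
  define Z where "Z t \<omega> = exp (\<theta> \<bullet> (\<omega> t - y) - (LINT u:{r..t}|lborel. \<theta> \<bullet> (\<sigma> u (\<omega> u) *v 0))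
    - (1 / 2) * (LINT u:{r..t}|lborel. \<theta> \<bullet> (diffusion_matrix \<sigma> u (\<omega> u) *v \<theta>)))" for t and \<omega> :: "'n path"
  have mart: "martingale_from Q (\<lambda>t. coord_algebra r {r..t}) r Z"
    using mp unfolding solves_martingale_problem_def Z_def by blast
  have Z: "Z t \<omega> = exp (\<theta> \<bullet> (\<omega> t - y) - (LINT u:{r..t}|lborel. (norm (S u \<omega> \<theta>))\<^sup>2) / 2)" for t \<omega>
    unfolding Z_def S_def by (simp add: inner_diffusion_matrix set_lebesgue_integral_def)
  have sub: "subalgebra Q (coord_algebra r {r..s})" and Zs: "Z s \<in> borel_measurable (coord_algebra r {r..s})"
    and Zi: "integrable Q (Z s)" "integrable Q (Z t)"
    and ce: "AE \<omega> in Q. real_cond_exp Q (coord_algebra r {r..s}) (Z t) \<omega> = Z s \<omega>"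
    using mart s unfolding martingale_from_def by auto
  interpret sigma_finite_subalgebra Q "coord_algebra r {r..s}"
    by (rule Q.sigma_finite_subalgebraI[OF sub])
  have Zpos: "0 < Z t \<omega>" for t \<omega> unfolding Z by simp
  have eq: "(\<integral>\<^sup>+\<omega>\<in>A. Z t \<omega> \<partial>Q) = (\<integral>\<^sup>+\<omega>\<in>A. Z s \<omega> \<partial>Q)" if A: "A \<in> sets (coord_algebra r {r..s})" for A
  proof -
    have AQ: "A \<in> sets Q" using A sub by (auto simp: subalgebra_def)
    have 1: "(\<integral>\<^sup>+\<omega>\<in>A. Z t \<omega> \<partial>Q) = ennreal (LINT \<omega>:A|Q. Z t \<omega>)" if "integrable Q (Z t)" for t
      using integrable_mult_indicator[OF AQ that] AQ Zpos[of t] unfolding set_lebesgue_integral_def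
      by (subst nn_integral_eq_integral[symmetric])
         (auto intro!: nn_integral_cong simp: less_imp_le split: split_indicator)
    have "(LINT \<omega>:A|Q. Z t \<omega>) = (LINT \<omega>:A|Q. real_cond_exp Q (coord_algebra r {r..s}) (Z t) \<omega>)"
      by (rule real_cond_exp_intA[OF Zi(2) A])
    also have "\<dots> = (LINT \<omega>:A|Q. Z s \<omega>)"
      unfolding set_lebesgue_integral_def using ce AQ Zi(1)
      by (intro integral_cong_AE) (auto elim!: eventually_mono)
    finally show ?thesis using 1 Zi by simp
  qed
  have "(\<integral>\<^sup>+\<omega>\<in>B. exp (\<theta> \<bullet> (\<omega> t - \<omega> s) - q\<theta> s t \<theta> \<omega> / 2) \<partial>Q) =
    (\<integral>\<^sup>+\<omega>. (indicator B \<omega> * ennreal (1 / Z s \<omega>)) * ennreal (Z t \<omega>) \<partial>Q)"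
  proof (rule nn_integral_cong)
    fix \<omega> assume "\<omega> \<in> space Q"
    then have \<omega>: "\<omega> \<in> \<Omega>" by (simp add: space_Q)
    have "(LINT u:{r..s} \<union> {s<..t}|lborel. (norm (S u \<omega> \<theta>))\<^sup>2) = (LINT u:{r..s}|lborel. (norm (S u \<omega> \<theta>))\<^sup>2) + q\<theta> s t \<theta> \<omega>"
      unfolding q\<theta>_def using set_integrable_S[OF \<omega>] s by (intro set_integral_Un) auto
    moreover have "{r..s} \<union> {s<..t} = {r..t}" using s by auto
    ultimately have "Z t \<omega> = Z s \<omega> * exp (\<theta> \<bullet> (\<omega> t - \<omega> s) - q\<theta> s t \<theta> \<omega> / 2)"
      unfolding Z exp_add[symmetric] by (simp add: inner_diff_right algebra_simps add_divide_distrib)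
    then show "ennreal (exp (\<theta> \<bullet> (\<omega> t - \<omega> s) - q\<theta> s t \<theta> \<omega> / 2)) * indicator B \<omega> =
      (indicator B \<omega> * ennreal (1 / Z s \<omega>)) * ennreal (Z t \<omega>)"
      using Zpos[of s \<omega>] by (auto simp: ennreal_mult'[symmetric] split: split_indicator)
  qed
  also have "\<dots> = (\<integral>\<^sup>+\<omega>. (indicator B \<omega> * ennreal (1 / Z s \<omega>)) * ennreal (Z s \<omega>) \<partial>Q)"
    using Zi Zs B eq by (intro nn_integral_mult_eq_of_set_eq) auto
  also have "\<dots> = (\<integral>\<^sup>+\<omega>. indicator B \<omega> \<partial>Q)"
    using Zpos[of s] less_imp_neq[OF Zpos[of s]] by (intro nn_integral_cong) (auto simp: ennreal_mult'[symmetric] less_imp_le split: split_indicator)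
  also have "\<dots> = emeasure Q B" using B sub by (auto simp: subalgebra_def)
  finally show ?thesis .
qed

lemma exp_martingale_const:
  assumes s: "r \<le> s" "s \<le> t" and A: "A \<in> sets (F s)"
  shows "(\<integral>\<^sup>+\<omega>\<in>A. exp (\<theta> \<bullet> (\<omega> t - \<omega> s) - q\<theta> s t \<theta> \<omega> / 2) \<partial>M) = emeasure M A"
proof -
  obtain B where B: "B \<in> sets (coord_algebra r {r..s})" "AE \<omega> in M. \<omega> \<in> A \<longleftrightarrow> \<omega> \<in> B"
    using F_AE_coord[OF A] by auto
  have BM: "B \<in> sets M" "B \<in> sets Q" using B(1) coord_subset_M[of "{r..s}"] sets_coord_algebra_mono[of "{r..s}" "{r..}" r] sets_Q by auto
  have "(\<integral>\<^sup>+\<omega>\<in>A. exp (\<theta> \<bullet> (\<omega> t - \<omega> s) - q\<theta> s t \<theta> \<omega> / 2) \<partial>M) =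
    (\<integral>\<^sup>+\<omega>\<in>B. exp (\<theta> \<bullet> (\<omega> t - \<omega> s) - q\<theta> s t \<theta> \<omega> / 2) \<partial>M)"
    using B(2) by (intro nn_integral_cong_AE) (auto elim!: eventually_mono split: split_indicator)
  also have "\<dots> = emeasure Q B"
    using exp_martingale_Q[OF s B(1)] by (simp add: nn_integral_completion)
  also have "\<dots> = emeasure M B" using BM(2) by simp
  also have "\<dots> = emeasure M A"
    using B(2) A sets_F_sub_M BM by (intro emeasure_eq_AE) (auto elim!: eventually_mono)
  finally show ?thesis .
qed

end

section \<open>Uniform grids, left continuous processes and joint measurability\<close>

definition grid :: "real \<Rightarrow> real \<Rightarrow> nat \<Rightarrow> nat \<Rightarrow> real" where
  "grid u v k i = u + (v - u) * real i / real (Suc k)"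

lemma grid_0 [simp]: "grid u v k 0 = u" and grid_last [simp]: "grid u v k (Suc k) = v"
  unfolding grid_def by (simp_all del: of_nat_Suc)

lemma grid_mono: "u \<le> v \<Longrightarrow> i \<le> j \<Longrightarrow> grid u v k i \<le> grid u v k j"
  unfolding grid_def by (intro add_left_mono divide_right_mono mult_left_mono) auto

lemma grid_ge: "u \<le> v \<Longrightarrow> u \<le> grid u v k i"
  unfolding grid_def by simp

lemma grid_le: "u \<le> v \<Longrightarrow> i \<le> Suc k \<Longrightarrow> grid u v k i \<le> v"
  using grid_mono[of u v i "Suc k" k] by simp

lemma grid_less_iff:
  assumes "u < v" shows "grid u v k i < x \<longleftrightarrow> real i < (x - u) * real (Suc k) / (v - u)"
  using assms unfolding grid_def by (simp add: field_simps del: of_nat_Suc)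

lemma grid_step: "grid u v k (Suc i) = grid u v k i + (v - u) / real (Suc k)"
  unfolding grid_def by (simp add: field_simps del: of_nat_Suc) (simp add: field_simps)

lemma grid_cell:
  assumes "u < x" "x \<le> v"
  obtains i where "i \<le> k" "grid u v k i < x" "x \<le> grid u v k (Suc i)"
    "\<And>\<xi> (\<omega>::'a). simple_process (Suc k) (grid u v k) \<xi> x \<omega> = (\<xi> i \<omega> :: real ^ 'n::finite)"
proof -
  have uv: "u < v" using assms by simp
  define z where "z = (x - u) * real (Suc k) / (v - u)"
  have z0: "0 < z" unfolding z_def using assms uv by simp
  have z1: "z \<le> real (Suc k)"
  proof -
    have "(x - u) * real (Suc k) \<le> (v - u) * real (Suc k)" using assms by (intro mult_right_mono) auto
    then show ?thesis unfolding z_def using uv by (simp add: divide_le_eq mult.commute del: of_nat_Suc)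
  qed
  \<comment> \<open>The cells are open on the left and closed on the right, hence the ceiling minus
    one and not the floor.\<close>
  define i where "i = nat (\<lceil>z\<rceil> - 1)"
  have ceil: "1 \<le> \<lceil>z\<rceil>" using z0 by (simp add: le_ceiling_iff)
  have iz: "real i < z" "z \<le> real (Suc i)"
    unfolding i_def using ceil by linarith+
  have ik: "i \<le> k"
  proof -
    have "real i < real (Suc k)" using iz(1) z1 by linarith
    then show ?thesis by linarith
  qed
  have iff: "grid u v k j < x \<longleftrightarrow> real j < z" for j
    unfolding z_def by (rule grid_less_iff[OF uv])
  have cell: "x \<in> {grid u v k j<..grid u v k (Suc j)} \<longleftrightarrow> j = i" for j
    using iff[of j] iff[of "Suc j"] iz by (auto simp: not_less[symmetric])
  have "simple_process (Suc k) (grid u v k) \<xi> x \<omega> = \<xi> i \<omega>" for \<xi> and \<omega> :: 'a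
  proof -
    have "simple_process (Suc k) (grid u v k) \<xi> x \<omega> = (\<Sum>j<Suc k. if j = i then \<xi> i \<omega> else 0)"
      unfolding simple_process_def using cell by (intro sum.cong refl) (auto simp: indicator_def)
    also have "\<dots> = \<xi> i \<omega>" using ik by (subst sum.delta) auto
    finally show ?thesis .
  qed
  then show ?thesis using that[OF ik] cell[of i] by auto
qed

context diffusion
begin

text \<open>A process is used on \<open>(u,v]\<close> only: \<open>jm\<close> is joint measurability there, and \<open>caglad\<close> asks for left
  continuity together with an adapted process \<open>\<rho>\<close> of right limits, whose values at the grid points
  serve as the heights of approximating step processes.\<close>

definition jm :: "real \<Rightarrow> real \<Rightarrow> (real \<Rightarrow> 'n path \<Rightarrow> 'b::{real_normed_vector, second_countable_topology}) \<Rightarrow> bool" where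
  "jm u v H \<longleftrightarrow> (\<lambda>(x, \<omega>). indicator {u<..v} x *\<^sub>R H x \<omega>) \<in> borel_measurable (lborel \<Otimes>\<^sub>M F v)"

definition caglad :: "real \<Rightarrow> real \<Rightarrow> (real \<Rightarrow> 'n path \<Rightarrow> real ^ 'n) \<Rightarrow> (real \<Rightarrow> 'n path \<Rightarrow> real ^ 'n) \<Rightarrow> bool" where
  "caglad u v H \<rho> \<longleftrightarrow> (\<forall>p\<in>{u..v}. \<rho> p \<in> borel_measurable (F p)) \<and>
    (\<forall>\<omega>\<in>\<Omega>. (\<forall>p\<in>{u..<v}. ((\<lambda>x. H x \<omega>) \<longlongrightarrow> \<rho> p \<omega>) (at_right p)) \<and>
      (\<forall>x\<in>{u<..v}. ((\<lambda>x. H x \<omega>) \<longlongrightarrow> H x \<omega>) (at_left x)))"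

text \<open>The heights are right limits at the left ends of the cells: by left continuity the value
  of the process at a grid point belongs to the cell before it.\<close>

definition gp :: "real \<Rightarrow> real \<Rightarrow> (real \<Rightarrow> 'n path \<Rightarrow> real ^ 'n) \<Rightarrow> nat \<Rightarrow> real \<Rightarrow> 'n path \<Rightarrow> real ^ 'n" where
  "gp u v \<rho> k = simple_process (Suc k) (grid u v k) (\<lambda>i. \<rho> (grid u v k i))"

text \<open>The right limit at a grid point shortly before \<open>x\<close> is a limit of values
  \<open>H y \<omega>\<close> with \<open>y < x\<close>, which are close to
  \<open>H x \<omega>\<close> by left continuity.\<close>

lemma gp_tendsto:
  assumes H: "caglad u v H \<rho>" and \<omega>: "\<omega> \<in> \<Omega>" and x: "u < x" "x \<le> v"
  shows "(\<lambda>k. gp u v \<rho> k x \<omega>) \<longlonglongrightarrow> H x \<omega>"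
proof (rule metric_LIMSEQ_I)
  fix e :: real assume e: "0 < e"
  have "((\<lambda>x. H x \<omega>) \<longlongrightarrow> H x \<omega>) (at_left x)" using H \<omega> x by (auto simp: caglad_def)
  then have "eventually (\<lambda>y. dist (H y \<omega>) (H x \<omega>) < e / 2) (at_left x)" using e by (intro tendstoD) auto
  then obtain b where b: "b < x" "\<And>y. b < y \<Longrightarrow> y < x \<Longrightarrow> dist (H y \<omega>) (H x \<omega>) < e / 2"
    unfolding eventually_at_left_field by auto
  have rho: "dist (\<rho> p \<omega>) (H x \<omega>) < e" if p: "u \<le> p" "b < p" "p < x" for p
  proof -
    have "((\<lambda>x. H x \<omega>) \<longlongrightarrow> \<rho> p \<omega>) (at_right p)" using H \<omega> p x by (auto simp: caglad_def)
    then have l: "((\<lambda>y. dist (H y \<omega>) (H x \<omega>)) \<longlongrightarrow> dist (\<rho> p \<omega>) (H x \<omega>)) (at_right p)"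
      by (intro tendsto_intros)
    have "eventually (\<lambda>y. dist (H y \<omega>) (H x \<omega>) \<le> e / 2) (at_right p)"
      unfolding eventually_at_right_field using b(2) p by (intro exI[of _ x]) (auto simp: less_imp_le)
    then have "dist (\<rho> p \<omega>) (H x \<omega>) \<le> e / 2" by (rule tendsto_upperbound[OF l]) simp
    then show ?thesis using e by simp
  qed
  \<comment> \<open>From \<open>n\<close> on the mesh is smaller than \<open>x - b\<close>, so the
    left end of the cell containing \<open>x\<close> lies beyond \<open>b\<close>.\<close>
  obtain n :: nat where n: "(v - u) / (x - b) < real n" using reals_Archimedean2 by blast
  have "dist (gp u v \<rho> k x \<omega>) (H x \<omega>) < e" if "k \<ge> n" for k
  proof -
    obtain i where i: "i \<le> k" "grid u v k i < x" "x \<le> grid u v k (Suc i)"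
      "simple_process (Suc k) (grid u v k) (\<lambda>i. \<rho> (grid u v k i)) x \<omega> = \<rho> (grid u v k i) \<omega>"
      using grid_cell[OF x] by metis
    have "(v - u) / (x - b) < real (Suc k)" using n that by linarith
    then have "(v - u) / real (Suc k) < x - b" using b(1) by (simp add: field_simps del: of_nat_Suc)
    then have "b < grid u v k i" using i(3) unfolding grid_step by linarith
    moreover have "u \<le> grid u v k i" using x by (intro grid_ge) auto
    ultimately show ?thesis unfolding gp_def i(4) using i(2) by (intro rho) auto
  qed
  then show "\<exists>n. \<forall>k\<ge>n. dist (gp u v \<rho> k x \<omega>) (H x \<omega>) < e" by blast
qed

lemma jm_simple:
  assumes "\<And>i. i < N \<Longrightarrow> \<xi> i \<in> borel_measurable (F v)"
  shows "jm u v (simple_process N p (\<xi> :: nat \<Rightarrow> 'n path \<Rightarrow> real ^ 'n))"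
proof -
  have "(\<lambda>z. indicator {u<..v} (fst z) *\<^sub>R (\<Sum>i<N. indicator {p i<..p (Suc i)} (fst z) *\<^sub>R \<xi> i (snd z)))
    \<in> borel_measurable (lborel \<Otimes>\<^sub>M F v)"
  proof (intro borel_measurable_scaleR borel_measurable_sum)
    fix i assume "i \<in> {..<N}"
    then have "\<xi> i \<in> borel_measurable (F v)" using assms by simp
    then show "(\<lambda>z. \<xi> i (snd z)) \<in> borel_measurable (lborel \<Otimes>\<^sub>M F v)" by measurable
  qed measurable
  then show ?thesis unfolding jm_def simple_process_def by (simp add: case_prod_beta')
qed

lemma jm_LIMSEQ:
  fixes H :: "real \<Rightarrow> 'n path \<Rightarrow> 'b::{real_normed_vector, second_countable_topology}"
  assumes "\<And>k. jm u v (Hk k)" and "\<And>x \<omega>. u < x \<Longrightarrow> x \<le> v \<Longrightarrow> \<omega> \<in> \<Omega> \<Longrightarrow> (\<lambda>k. Hk k x \<omega>) \<longlonglongrightarrow> H x \<omega>"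
  shows "jm u v H"
  unfolding jm_def
proof (rule borel_measurable_LIMSEQ_metric)
  show "(\<lambda>(x, \<omega>). indicator {u<..v} x *\<^sub>R Hk k x \<omega>) \<in> borel_measurable (lborel \<Otimes>\<^sub>M F v)" for k
    using assms(1) unfolding jm_def .
  fix z :: "real \<times> 'n path" assume "z \<in> space (lborel \<Otimes>\<^sub>M F v)"
  then have "snd z \<in> \<Omega>" by (auto simp: space_pair_measure)
  then show "(\<lambda>k. case z of (x, \<omega>) \<Rightarrow> indicator {u<..v} x *\<^sub>R Hk k x \<omega>) \<longlonglongrightarrow>
    (case z of (x, \<omega>) \<Rightarrow> indicator {u<..v} x *\<^sub>R H x \<omega>)"
    using assms(2)[of "fst z" "snd z"] by (cases "fst z \<in> {u<..v}") (auto simp: case_prod_beta)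
qed

lemma caglad_jm: "caglad u v H \<rho> \<Longrightarrow> jm u v H"
proof -
  assume H: "caglad u v H \<rho>"
  show "jm u v H"
  proof (cases "u < v")
    case True
    show ?thesis
    proof (rule jm_LIMSEQ[OF _ gp_tendsto[OF H]])
      fix k
      show "jm u v (gp u v \<rho> k)"
        unfolding gp_def
      proof (rule jm_simple)
        fix i assume "i < Suc k"
        then have "grid u v k i \<in> {u..v}" using True grid_ge grid_le by auto
        then show "\<rho> (grid u v k i) \<in> borel_measurable (F v)"
          using H measurable_F_mono[of "\<rho> (grid u v k i)" "grid u v k i" borel v] by (auto simp: caglad_def)
      qed
    qed auto
  qed (simp add: jm_def)
qed

lemma caglad_X: "r \<le> u \<Longrightarrow> caglad u v (\<lambda>x \<omega>. \<omega> x) (\<lambda>p \<omega>. \<omega> p)"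
  unfolding caglad_def
proof (intro conjI ballI)
  fix p assume "r \<le> u" "p \<in> {u..v}"
  then show "(\<lambda>\<omega>. \<omega> p) \<in> borel_measurable (F p)" by (intro X_measurable) auto
next
  fix \<omega> :: "'n path" and p assume "r \<le> u" "\<omega> \<in> \<Omega>" "p \<in> {u..<v}"
  then have "(\<omega> \<longlongrightarrow> \<omega> p) (at p within {r..})" by (auto simp: path_space_def continuous_on_def)
  then show "(\<omega> \<longlongrightarrow> \<omega> p) (at_right p)"
    by (rule tendsto_within_subset) (use \<open>r \<le> u\<close> \<open>p \<in> {u..<v}\<close> in auto)
next
  fix \<omega> :: "'n path" and x assume "r \<le> u" "\<omega> \<in> \<Omega>" "x \<in> {u<..v}"
  then have "isCont \<omega> x"
    by (intro continuous_on_interior[of "{r..}"]) (auto simp: path_space_def)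
  then show "(\<omega> \<longlongrightarrow> \<omega> x) (at_left x)"
    unfolding isCont_def by (rule tendsto_within_subset) auto
qed

lemma jm_X: "r \<le> u \<Longrightarrow> jm u v (\<lambda>x \<omega>. \<omega> x)"
  by (rule caglad_jm[OF caglad_X])

lemma jm_\<sigma>:
  assumes "r \<le> u"
  shows "jm u v (\<lambda>x \<omega>. \<sigma> x (\<omega> x))"
proof -
  \<comment> \<open>Continuity of \<open>\<sigma>\<close> is known for nonnegative times; continued
    by zero it is Borel everywhere.\<close>
  define \<sigma>' where "\<sigma>' z = indicator ({0..} \<times> UNIV) z *\<^sub>R (\<lambda>(t, x). \<sigma> t x) z" for z
  have "\<sigma>' \<in> borel_measurable borel"
    unfolding \<sigma>'_def[abs_def]
    by (rule borel_measurable_continuous_on_indicator[OF _ cont_\<sigma>]) (auto intro!: borel_closed closed_Times)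
  then have \<sigma>': "\<sigma>' \<in> borel_measurable (borel \<Otimes>\<^sub>M borel)" by (simp add: borel_prod)
  have X: "(\<lambda>z. indicator {u<..v} (fst z) *\<^sub>R (snd z) (fst z)) \<in> borel_measurable (lborel \<Otimes>\<^sub>M F v)"
    using jm_X[OF assms, of v] unfolding jm_def by (simp add: case_prod_beta')
  have "(\<lambda>z. (fst z, indicator {u<..v} (fst z) *\<^sub>R (snd z) (fst z))) \<in> (lborel \<Otimes>\<^sub>M F v) \<rightarrow>\<^sub>M (borel \<Otimes>\<^sub>M borel)"
    using X by measurable
  from measurable_compose[OF this \<sigma>']
  have "(\<lambda>z. indicator {u<..v} (fst z) *\<^sub>R \<sigma>' (fst z, indicator {u<..v} (fst z) *\<^sub>R (snd z) (fst z))) \<in> borel_measurable (lborel \<Otimes>\<^sub>M F v)"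
    by measurable
  moreover have "(\<lambda>z. indicator {u<..v} (fst z) *\<^sub>R \<sigma>' (fst z, indicator {u<..v} (fst z) *\<^sub>R (snd z) (fst z))) =
    (\<lambda>(x, \<omega>). indicator {u<..v} x *\<^sub>R \<sigma> x (\<omega> x))"
    using assms r_nonneg by (auto simp: \<sigma>'_def fun_eq_iff indicator_def)
  ultimately show ?thesis unfolding jm_def by simp
qed

lemma jm_S:
  assumes "r \<le> u" "jm u v H"
  shows "jm u v (\<lambda>x \<omega>. S x \<omega> (H x \<omega>))"
proof -
  have "(\<lambda>z. (case z of (x, \<omega>) \<Rightarrow> indicator {u<..v} x *\<^sub>R H x \<omega>) v* (case z of (x, \<omega>) \<Rightarrow> indicator {u<..v} x *\<^sub>R \<sigma> x (\<omega> x)))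
    \<in> borel_measurable (lborel \<Otimes>\<^sub>M F v)"
  proof (rule borel_measurable_continuous_Pair[where H="\<lambda>x A. x v* A"])
    show "continuous_on UNIV (\<lambda>x :: (real^'n) \<times> (real^'n^'n). fst x v* snd x)"
      by (intro vm.continuous_on continuous_intros)
  qed (use assms jm_\<sigma>[OF assms(1), of v] in \<open>simp_all add: jm_def\<close>)
  moreover have "(\<lambda>z. (case z of (x, \<omega>) \<Rightarrow> indicator {u<..v} x *\<^sub>R H x \<omega>) v* (case z of (x, \<omega>) \<Rightarrow> indicator {u<..v} x *\<^sub>R \<sigma> x (\<omega> x)))
    = (\<lambda>(x, \<omega>). indicator {u<..v} x *\<^sub>R S x \<omega> (H x \<omega>))"
    by (auto simp: fun_eq_iff S_def indicator_def vm.zero_left)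
  ultimately show ?thesis unfolding jm_def by simp
qed

definition en :: "real \<Rightarrow> real \<Rightarrow> (real \<Rightarrow> 'n path \<Rightarrow> real ^ 'n) \<Rightarrow> 'n path \<Rightarrow> real" where
  "en u v H \<omega> = (LINT x:{u<..v}|lborel. (norm (S x \<omega> (H x \<omega>)))\<^sup>2)"

lemma q\<theta>_en: "q\<theta> u v \<theta> = en u v (\<lambda>_ _. \<theta>)"
  unfolding q\<theta>_def en_def by simp

lemma en_nonneg: "0 \<le> en u v H \<omega>"
  unfolding en_def set_lebesgue_integral_def by (rule integral_nonneg_AE) auto

lemma jm_const: "h \<in> borel_measurable (F v) \<Longrightarrow> jm u v (\<lambda>_. h)"
proof -
  assume [measurable]: "h \<in> borel_measurable (F v)"
  show ?thesis unfolding jm_def by measurable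
qed

lemma en_measurable:
  assumes "r \<le> u" "jm u v H"
  shows "en u v H \<in> borel_measurable (F v)"
proof -
  have m: "(\<lambda>(x, \<omega>). indicator {u<..v} x *\<^sub>R S x \<omega> (H x \<omega>)) \<in> borel_measurable (lborel \<Otimes>\<^sub>M F v)"
    using jm_S[OF assms] by (simp add: jm_def)
  have m2: "(\<lambda>z. indicator {u<..v} (snd z) *\<^sub>R S (snd z) (fst z) (H (snd z) (fst z))) \<in> borel_measurable (F v \<Otimes>\<^sub>M lborel)"
    using measurable_pair_swap[OF m] by (simp add: case_prod_beta')
  have "(\<lambda>z. (norm (indicator {u<..v} (snd z) *\<^sub>R S (snd z) (fst z) (H (snd z) (fst z))))\<^sup>2) \<in> borel_measurable (F v \<Otimes>\<^sub>M lborel)"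
    using m2 by measurable
  then have "(\<lambda>\<omega>. LINT x|lborel. (norm (indicator {u<..v} x *\<^sub>R S x \<omega> (H x \<omega>)))\<^sup>2) \<in> borel_measurable (F v)"
    by (intro lborel.borel_measurable_lebesgue_integral) (simp add: case_prod_beta')
  moreover have "(norm (indicator {u<..v} x *\<^sub>R S x \<omega> (H x \<omega>)))\<^sup>2 = indicator {u<..v} x *\<^sub>R (norm (S x \<omega> (H x \<omega>)))\<^sup>2" for x \<omega>
    by (simp split: split_indicator)
  ultimately show ?thesis unfolding en_def[abs_def] set_lebesgue_integral_def by simp
qed

lemma jm_section:
  assumes "jm u v H" "\<omega> \<in> \<Omega>"
  shows "(\<lambda>x. indicator {u<..v} x *\<^sub>R H x \<omega>) \<in> borel_measurable lborel"
proof -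
  have "(\<lambda>x::real. (x, \<omega>)) \<in> lborel \<rightarrow>\<^sub>M (lborel \<Otimes>\<^sub>M F v)" using assms(2) by (intro measurable_Pair2') simp
  from measurable_compose[OF this assms(1)[unfolded jm_def]] show ?thesis by simp
qed

end

section \<open>Moments from exponential identities\<close>

lemma exp_norm_le_sum:
  fixes x :: "real ^ 'n::finite"
  assumes "0 \<le> c"
  shows "exp (c * norm x) \<le> (\<Sum>i\<in>UNIV. exp ((c * CARD('n)) * x $ i) + exp (- (c * CARD('n)) * x $ i))"
proof -
  have "\<exists>i. \<forall>j. \<bar>x $ j\<bar> \<le> \<bar>x $ i\<bar>"
  proof -
    have "Max (range (\<lambda>j. \<bar>x $ j\<bar>)) \<in> range (\<lambda>j. \<bar>x $ j\<bar>)" by (intro Max_in) auto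
    then obtain i where "Max (range (\<lambda>j. \<bar>x $ j\<bar>)) = \<bar>x $ i\<bar>" by (elim rangeE)
    then show ?thesis by (metis Max_ge finite_imageI finite rangeI)
  qed
  then obtain i where i: "\<And>j. \<bar>x $ j\<bar> \<le> \<bar>x $ i\<bar>" by blast
  have "norm x \<le> (\<Sum>j\<in>UNIV. \<bar>x $ j\<bar>)" by (rule norm_le_l1_cart)
  also have "\<dots> \<le> of_nat CARD('n) * \<bar>x $ i\<bar>" using i by (intro sum_bounded_above) auto
  finally have "c * norm x \<le> (c * CARD('n)) * \<bar>x $ i\<bar>" using assms by (simp add: mult_left_mono mult.assoc)
  then have "exp (c * norm x) \<le> exp ((c * CARD('n)) * \<bar>x $ i\<bar>)" by simp
  also have "\<dots> \<le> exp ((c * CARD('n)) * x $ i) + exp (- (c * CARD('n)) * x $ i)"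
    by (cases "0 \<le> x $ i") (auto simp: add_increasing add_increasing2)
  also have "\<dots> \<le> (\<Sum>i\<in>UNIV. exp ((c * CARD('n)) * x $ i) + exp (- (c * CARD('n)) * x $ i))"
    by (rule member_le_sum[of i UNIV "\<lambda>i. exp ((c * CARD('n)) * x $ i) + exp (- (c * CARD('n)) * x $ i)"]) (auto intro: add_nonneg_nonneg)
  finally show ?thesis .
qed

lemma exp_taylor2: "\<bar>exp z - 1 - z\<bar> \<le> z\<^sup>2 * exp \<bar>z\<bar>" for z :: real
proof -
  obtain t where t: "\<bar>t\<bar> \<le> \<bar>z\<bar>" "exp z = (\<Sum>m<2. z ^ m / fact m) + exp t / fact 2 * z ^ 2"
    using Maclaurin_exp_le[of z 2] by blast
  have eq: "exp z - 1 - z = exp t / 2 * z\<^sup>2" using t(2) by (simp add: numeral_2_eq_2)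
  have "\<bar>exp z - 1 - z\<bar> = exp t / 2 * z\<^sup>2" unfolding eq by (simp add: abs_mult)
  also have "\<dots> \<le> exp \<bar>z\<bar> * z\<^sup>2"
  proof (rule mult_right_mono)
    have "exp t \<le> exp \<bar>z\<bar>" using t(1) by simp
    then show "exp t / 2 \<le> exp \<bar>z\<bar>" using exp_gt_zero[of t] by linarith
  qed simp
  finally show ?thesis by (simp add: mult.commute)
qed

lemma exp_taylor3: "\<bar>exp z - 1 - z - z\<^sup>2 / 2\<bar> \<le> \<bar>z\<bar> ^ 3 * exp \<bar>z\<bar>" for z :: real
proof -
  obtain t where t: "\<bar>t\<bar> \<le> \<bar>z\<bar>" "exp z = (\<Sum>m<3. z ^ m / fact m) + exp t / fact 3 * z ^ 3"
    using Maclaurin_exp_le[of z 3] by blast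
  have eq: "exp z - 1 - z - z\<^sup>2 / 2 = exp t / 6 * z ^ 3"
    using t(2) by (simp add: numeral_3_eq_3 fact_reduce power2_eq_square)
  have "\<bar>exp z - 1 - z - z\<^sup>2 / 2\<bar> = exp t / 6 * \<bar>z\<bar> ^ 3" unfolding eq by (simp add: abs_mult power_abs)
  also have "\<dots> \<le> exp \<bar>z\<bar> * \<bar>z\<bar> ^ 3"
  proof (rule mult_right_mono)
    have "exp t \<le> exp \<bar>z\<bar>" using t(1) by simp
    then show "exp t / 6 \<le> exp \<bar>z\<bar>" using exp_gt_zero[of t] by linarith
  qed simp
  finally show ?thesis by (simp add: mult.commute)
qed

lemma power_le_exp: "0 \<le> a \<Longrightarrow> a ^ n \<le> fact n * exp a" for a :: real
proof -
  assume a: "0 \<le> a"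
  obtain t where t: "exp a = (\<Sum>m<Suc n. a ^ m / fact m) + exp t / fact (Suc n) * a ^ Suc n"
    using Maclaurin_exp_le[of a "Suc n"] by blast
  have "a ^ n / fact n \<le> (\<Sum>m<Suc n. a ^ m / fact m)"
    using a by (intro member_le_sum[of n "{..<Suc n}" "\<lambda>m. a ^ m / fact m"]) auto
  also have "\<dots> \<le> exp a" unfolding t using a by simp
  finally show ?thesis by (simp add: divide_le_eq mult.commute)
qed

lemma le_zero_if_le_eps:
  fixes c D :: real
  assumes "\<And>\<epsilon>. 0 < \<epsilon> \<Longrightarrow> \<epsilon> \<le> 1 \<Longrightarrow> c \<le> \<epsilon> * D"
  shows "c \<le> 0"
proof (rule ccontr)
  assume "\<not> c \<le> 0"
  define \<epsilon> where "\<epsilon> = min 1 (c / (2 * (\<bar>D\<bar> + 1)))"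
  have e: "0 < \<epsilon>" "\<epsilon> \<le> 1" unfolding \<epsilon>_def using \<open>\<not> c \<le> 0\<close> by auto
  have "\<epsilon> * D \<le> \<epsilon> * (\<bar>D\<bar> + 1)" using e by (intro mult_left_mono) auto
  also have "\<dots> \<le> c / (2 * (\<bar>D\<bar> + 1)) * (\<bar>D\<bar> + 1)" unfolding \<epsilon>_def by (intro mult_right_mono) auto
  also have "\<dots> = c / 2" by (simp add: field_simps)
  finally have "c \<le> c / 2" using assms[OF e] by linarith
  with \<open>\<not> c \<le> 0\<close> show False by simp
qed

lemma norm_integral_le:
  fixes f :: "'a \<Rightarrow> real"
  assumes "\<And>x. x \<in> space M \<Longrightarrow> norm (f x) \<le> g x" "integrable M f" "integrable M g"
  shows "norm (integral\<^sup>L M f) \<le> integral\<^sup>L M g"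
  using assms by (intro order_trans[OF integral_norm_bound] integral_mono integrable_norm)

text \<open>The first two moments are read off the exponential martingale identity by expanding in
  \<open>\<epsilon>\<close> up to second order.\<close>

lemma (in prob_space) moments_from_exponential:
  fixes x q :: "'a \<Rightarrow> real"
  assumes [measurable]: "x \<in> borel_measurable M" "q \<in> borel_measurable M"
    and q: "\<And>\<omega>. \<omega> \<in> space M \<Longrightarrow> 0 \<le> q \<omega>" "\<And>\<omega>. \<omega> \<in> space M \<Longrightarrow> q \<omega> \<le> q0" and q0: "0 \<le> q0"
    and ex: "\<And>\<epsilon>. (\<integral>\<^sup>+\<omega>. exp (\<epsilon> * x \<omega> - \<epsilon>\<^sup>2 * q \<omega> / 2) \<partial>M) = 1"
  shows "integrable M x" "expectation x = 0" "integrable M (\<lambda>\<omega>. (x \<omega>)\<^sup>2)"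
    "expectation (\<lambda>\<omega>. (x \<omega>)\<^sup>2) = expectation q" "integrable M q"
proof -
  let ?W = "\<lambda>\<epsilon> \<omega>. exp (\<epsilon> * x \<omega> - \<epsilon>\<^sup>2 * q \<omega> / 2)"
  have W: "integrable M (?W \<epsilon>)" "expectation (?W \<epsilon>) = 1" for \<epsilon>
  proof -
    show "integrable M (?W \<epsilon>)" by (rule integrableI_nonneg) (simp_all add: ex)
    show "expectation (?W \<epsilon>) = 1" by (subst integral_eq_nn_integral) (simp_all add: ex)
  qed
  \<comment> \<open>The exponentials for \<open>c\<close> and \<open>- c\<close> together dominate
    \<open>exp (c * \<bar>x \<omega>\<bar>)\<close>, the bound \<open>q0\<close> paying for the
    compensating term.\<close>
  have ie: "integrable M (\<lambda>\<omega>. exp (c * \<bar>x \<omega>\<bar>))" if "0 \<le> c" for c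
  proof (rule Bochner_Integration.integrable_bound)
    show "integrable M (\<lambda>\<omega>. exp (c\<^sup>2 * q0 / 2) * (?W c \<omega> + ?W (- c) \<omega>))"
      using W by (intro integrable_mult_right Bochner_Integration.integrable_add)
    show "AE \<omega> in M. norm (exp (c * \<bar>x \<omega>\<bar>)) \<le> norm (exp (c\<^sup>2 * q0 / 2) * (?W c \<omega> + ?W (- c) \<omega>))"
    proof (rule AE_I2)
      fix \<omega> assume \<omega>: "\<omega> \<in> space M"
      have 1: "c\<^sup>2 * q \<omega> / 2 \<le> c\<^sup>2 * q0 / 2" using q(2)[OF \<omega>] by (intro divide_right_mono mult_left_mono) auto
      have "exp (c * \<bar>x \<omega>\<bar>) \<le> exp (c * x \<omega>) + exp (- c * x \<omega>)"
        by (cases "0 \<le> x \<omega>") (auto simp: add_increasing add_increasing2)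
      also have "\<dots> \<le> exp (c\<^sup>2 * q0 / 2) * ?W c \<omega> + exp (c\<^sup>2 * q0 / 2) * ?W (- c) \<omega>"
        unfolding exp_add[symmetric] using 1 by (intro add_mono) auto
      finally show "norm (exp (c * \<bar>x \<omega>\<bar>)) \<le> norm (exp (c\<^sup>2 * q0 / 2) * (?W c \<omega> + ?W (- c) \<omega>))"
        by (simp add: distrib_left add_nonneg_nonneg)
    qed
  qed simp
  \<comment> \<open>For \<open>\<bar>\<epsilon>\<bar> \<le> 1\<close> the exponent is at most
    \<open>\<bar>\<epsilon>\<bar> * a \<omega>\<close>, so powers and exponentials of
    \<open>a\<close> give integrable majorants of the Taylor remainders, uniform in
    \<open>\<epsilon>\<close>.\<close>
  define a where "a \<omega> = \<bar>x \<omega>\<bar> + q0" for \<omega>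
  have ia: "integrable M (\<lambda>\<omega>. exp (2 * a \<omega>))"
    unfolding a_def distrib_left exp_add using ie[of 2] by (intro integrable_mult_left) simp
  show ix: "integrable M x"
  proof (rule Bochner_Integration.integrable_bound[OF ie[of 1]])
    have "norm (x \<omega>) \<le> norm (exp (1 * \<bar>x \<omega>\<bar>))" for \<omega>
      using power_le_exp[of "\<bar>x \<omega>\<bar>" 1] by simp
    then show "AE \<omega> in M. norm (x \<omega>) \<le> norm (exp (1 * \<bar>x \<omega>\<bar>))" by simp
  qed simp_all
  show ix2: "integrable M (\<lambda>\<omega>. (x \<omega>)\<^sup>2)"
  proof (rule Bochner_Integration.integrable_bound[OF integrable_mult_right[OF ie[of 1], of 2]])
    have "norm ((x \<omega>)\<^sup>2) \<le> norm (2 * exp (1 * \<bar>x \<omega>\<bar>))" for \<omega>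
      using power_le_exp[of "\<bar>x \<omega>\<bar>" 2] by (simp add: fact_2)
    then show "AE \<omega> in M. norm ((x \<omega>)\<^sup>2) \<le> norm (2 * exp (1 * \<bar>x \<omega>\<bar>))" by simp
  qed simp_all
  show iq: "integrable M q"
    by (rule integrable_const_bound[of _ q0]) (use q in \<open>auto simp: AE_I2\<close>)
  have z_le: "\<bar>\<epsilon> * x \<omega> - \<epsilon>\<^sup>2 * q \<omega> / 2\<bar> \<le> \<bar>\<epsilon>\<bar> * a \<omega>" "\<bar>\<epsilon> * x \<omega> - \<epsilon>\<^sup>2 * q \<omega> / 2\<bar> \<le> a \<omega>"
    if "\<bar>\<epsilon>\<bar> \<le> 1" "\<omega> \<in> space M" for \<epsilon> \<omega>
  proof -
    have "\<epsilon>\<^sup>2 * q \<omega> / 2 \<le> \<bar>\<epsilon>\<bar> * q0"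
    proof -
      have "\<epsilon>\<^sup>2 = \<bar>\<epsilon>\<bar> * \<bar>\<epsilon>\<bar>" by (simp add: power2_eq_square)
      also have "\<dots> \<le> \<bar>\<epsilon>\<bar>" using that(1) by (intro mult_left_le) auto
      finally have "\<epsilon>\<^sup>2 * q \<omega> \<le> \<bar>\<epsilon>\<bar> * q0" using q[OF that(2)] by (intro mult_mono) auto
      moreover have "0 \<le> \<epsilon>\<^sup>2 * q \<omega>" using q[OF that(2)] by simp
      ultimately show ?thesis by linarith
    qed
    moreover have "0 \<le> \<epsilon>\<^sup>2 * q \<omega> / 2" using q[OF that(2)] by simp
    ultimately have "\<bar>\<epsilon> * x \<omega> - \<epsilon>\<^sup>2 * q \<omega> / 2\<bar> \<le> \<bar>\<epsilon> * x \<omega>\<bar> + \<bar>\<epsilon>\<bar> * q0" by linarith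
    then show 1: "\<bar>\<epsilon> * x \<omega> - \<epsilon>\<^sup>2 * q \<omega> / 2\<bar> \<le> \<bar>\<epsilon>\<bar> * a \<omega>" by (simp add: a_def abs_mult distrib_left)
    have "\<bar>\<epsilon>\<bar> * a \<omega> \<le> a \<omega>" using that(1) q0 by (intro mult_left_le_one_le) (auto simp: a_def)
    with 1 show "\<bar>\<epsilon> * x \<omega> - \<epsilon>\<^sup>2 * q \<omega> / 2\<bar> \<le> a \<omega>" by linarith
  qed
  have a0: "0 \<le> a \<omega>" for \<omega> using q0 by (simp add: a_def)
  have "\<bar>expectation x\<bar> \<le> 0"
  proof (rule le_zero_if_le_eps)
    fix \<epsilon> :: real assume e: "0 < \<epsilon>" "\<epsilon> \<le> 1"
    have "expectation (\<lambda>\<omega>. x \<omega> - (?W \<epsilon> \<omega> - 1) / \<epsilon>) = expectation x"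
      using ix W by (simp add: prob_space)
    moreover have "norm (expectation (\<lambda>\<omega>. x \<omega> - (?W \<epsilon> \<omega> - 1) / \<epsilon>)) \<le> expectation (\<lambda>\<omega>. \<epsilon> * (q0 + 2 * exp (2 * a \<omega>)))"
    proof (rule norm_integral_le)
      fix \<omega> assume \<omega>: "\<omega> \<in> space M"
      let ?z = "\<epsilon> * x \<omega> - \<epsilon>\<^sup>2 * q \<omega> / 2"
      note z = z_le[of \<epsilon> \<omega>] 
      have "?z\<^sup>2 \<le> (\<epsilon> * a \<omega>)\<^sup>2" using z e \<omega> a0[of \<omega>] by (intro power2_le_iff_abs_le[THEN iffD2]) auto
      moreover have "exp \<bar>?z\<bar> \<le> exp (a \<omega>)" using z e \<omega> by simp
      ultimately have "?z\<^sup>2 * exp \<bar>?z\<bar> \<le> (\<epsilon> * a \<omega>)\<^sup>2 * exp (a \<omega>)" by (intro mult_mono) auto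
      also have "\<dots> \<le> \<epsilon>\<^sup>2 * ((2 * exp (a \<omega>)) * exp (a \<omega>))"
        unfolding power_mult_distrib mult.assoc
        using power_le_exp[OF a0, of \<omega> 2] by (intro mult_left_mono) (auto simp: fact_2 mult.assoc[symmetric])
      also have "\<dots> = \<epsilon>\<^sup>2 * (2 * exp (2 * a \<omega>))" by (simp add: exp_add[symmetric])
      finally have r: "\<bar>exp ?z - 1 - ?z\<bar> \<le> \<epsilon>\<^sup>2 * (2 * exp (2 * a \<omega>))" using exp_taylor2[of ?z] by linarith
      have "x \<omega> - (?W \<epsilon> \<omega> - 1) / \<epsilon> = (\<epsilon>\<^sup>2 * q \<omega> / 2 - (exp ?z - 1 - ?z)) / \<epsilon>"
        using e by (simp add: field_simps)
      also have "\<bar>\<dots>\<bar> \<le> (\<epsilon>\<^sup>2 * q0 + \<epsilon>\<^sup>2 * (2 * exp (2 * a \<omega>))) / \<epsilon>"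
      proof -
        have "\<epsilon>\<^sup>2 * q \<omega> \<le> \<epsilon>\<^sup>2 * q0" "0 \<le> \<epsilon>\<^sup>2 * q \<omega>" using q[OF \<omega>] by (auto intro: mult_left_mono)
        then have "\<bar>\<epsilon>\<^sup>2 * q \<omega> / 2 - (exp ?z - 1 - ?z)\<bar> \<le> \<epsilon>\<^sup>2 * q0 + \<epsilon>\<^sup>2 * (2 * exp (2 * a \<omega>))" using r by linarith
        then show ?thesis using e by (simp add: abs_divide divide_right_mono)
      qed
      also have "\<dots> = \<epsilon> * (q0 + 2 * exp (2 * a \<omega>))" using e by (simp add: field_simps power2_eq_square)
      finally show "norm (x \<omega> - (?W \<epsilon> \<omega> - 1) / \<epsilon>) \<le> \<epsilon> * (q0 + 2 * exp (2 * a \<omega>))" by simp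
    qed (use ix W ia in auto)
    ultimately show "\<bar>expectation x\<bar> \<le> \<epsilon> * expectation (\<lambda>\<omega>. q0 + 2 * exp (2 * a \<omega>))" by simp
  qed
  then show "expectation x = 0" by simp
  have "\<bar>expectation (\<lambda>\<omega>. (x \<omega>)\<^sup>2 - q \<omega>)\<bar> \<le> 0"
  proof (rule le_zero_if_le_eps)
    fix \<epsilon> :: real assume e: "0 < \<epsilon>" "\<epsilon> \<le> 1"
    \<comment> \<open>A symmetric second difference quotient: terms odd in \<open>\<epsilon>\<close>
      cancel and \<open>(x \<omega>)\<^sup>2 - q \<omega>\<close> is left up to an error of order
      \<open>\<epsilon>\<close>, while its expectation is exactly zero.\<close>
    let ?h = "\<lambda>\<omega>. (?W \<epsilon> \<omega> + ?W (- \<epsilon>) \<omega> - 2) / \<epsilon>\<^sup>2"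
    have ih: "integrable M ?h" using W(1)[of \<epsilon>] W(1)[of "- \<epsilon>"] by simp
    have "expectation (\<lambda>\<omega>. (x \<omega>)\<^sup>2 - q \<omega> - ?h \<omega>) = expectation (\<lambda>\<omega>. (x \<omega>)\<^sup>2 - q \<omega>) - expectation ?h"
      using ix2 iq by (intro Bochner_Integration.integral_diff[OF _ ih]) auto
    also have "expectation ?h = 0" using W[of \<epsilon>] W[of "-\<epsilon>"] by (simp add: prob_space)
    finally have "expectation (\<lambda>\<omega>. (x \<omega>)\<^sup>2 - q \<omega> - ?h \<omega>) = expectation (\<lambda>\<omega>. (x \<omega>)\<^sup>2 - q \<omega>)" by simp
    moreover have "norm (expectation (\<lambda>\<omega>. (x \<omega>)\<^sup>2 - q \<omega> - ?h \<omega>)) \<le> expectation (\<lambda>\<omega>. \<epsilon> * (q0\<^sup>2 + 12 * exp (2 * a \<omega>)))"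
    proof (rule norm_integral_le)
      fix \<omega> assume \<omega>: "\<omega> \<in> space M"
      let ?z = "\<epsilon> * x \<omega> - \<epsilon>\<^sup>2 * q \<omega> / 2" and ?z' = "(- \<epsilon>) * x \<omega> - (- \<epsilon>)\<^sup>2 * q \<omega> / 2"
      let ?R = "\<lambda>z::real. exp z - 1 - z - z\<^sup>2 / 2"
      have R: "\<bar>?R z\<bar> \<le> \<epsilon> ^ 3 * (6 * exp (2 * a \<omega>))" if "\<bar>z\<bar> \<le> \<epsilon> * a \<omega>" "\<bar>z\<bar> \<le> a \<omega>" for z
      proof -
        have "\<bar>z\<bar> ^ 3 * exp \<bar>z\<bar> \<le> (\<epsilon> * a \<omega>) ^ 3 * exp (a \<omega>)"
          using that a0[of \<omega>] e by (intro mult_mono power_mono) auto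
        also have "\<dots> \<le> \<epsilon> ^ 3 * ((6 * exp (a \<omega>)) * exp (a \<omega>))"
          unfolding power_mult_distrib mult.assoc
          using power_le_exp[OF a0, of \<omega> 3] e by (intro mult_left_mono) (auto simp: fact_numeral mult.assoc[symmetric])
        also have "\<dots> = \<epsilon> ^ 3 * (6 * exp (2 * a \<omega>))" by (simp add: exp_add[symmetric])
        finally show ?thesis using exp_taylor3[of z] by linarith
      qed
      have R1: "\<bar>?R ?z\<bar> \<le> \<epsilon> ^ 3 * (6 * exp (2 * a \<omega>))" using z_le[of \<epsilon> \<omega>] e \<omega> by (intro R) auto
      have R2: "\<bar>?R ?z'\<bar> \<le> \<epsilon> ^ 3 * (6 * exp (2 * a \<omega>))" using z_le[of "- \<epsilon>" \<omega>] e \<omega> by (intro R) auto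
      define d where "d = (x \<omega>)\<^sup>2 - q \<omega> - ?h \<omega>"
      have d_eq: "d = - (\<epsilon> ^ 4 * (q \<omega>)\<^sup>2 / 4 + ?R ?z + ?R ?z') / \<epsilon>\<^sup>2"
        unfolding d_def using e by (simp add: field_simps power2_eq_square power4_eq_xxxx)
      have "\<bar>d\<bar> \<le> (\<epsilon> ^ 3 * q0\<^sup>2 + 2 * (\<epsilon> ^ 3 * (6 * exp (2 * a \<omega>)))) / \<epsilon>\<^sup>2"
      proof -
        have "\<epsilon> ^ 4 \<le> \<epsilon> ^ 3" using e by (intro power_decreasing) auto
        then have "\<epsilon> ^ 4 * (q \<omega>)\<^sup>2 \<le> \<epsilon> ^ 3 * q0\<^sup>2" using q[OF \<omega>] e by (intro mult_mono power_mono) auto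
        moreover have "0 \<le> \<epsilon> ^ 4 * (q \<omega>)\<^sup>2" by simp
        ultimately have "\<bar>- (\<epsilon> ^ 4 * (q \<omega>)\<^sup>2 / 4 + ?R ?z + ?R ?z')\<bar> \<le> \<epsilon> ^ 3 * q0\<^sup>2 + 2 * (\<epsilon> ^ 3 * (6 * exp (2 * a \<omega>)))"
          using R1 R2 by linarith
        then show ?thesis unfolding d_eq using e by (simp add: abs_divide divide_right_mono)
      qed
      also have "\<dots> = \<epsilon> * (q0\<^sup>2 + 12 * exp (2 * a \<omega>))"
      proof -
        have "\<epsilon> ^ 3 * A + 2 * (\<epsilon> ^ 3 * (6 * B)) = (\<epsilon> * (A + 12 * B)) * \<epsilon>\<^sup>2" for A B
          by (simp add: algebra_simps power2_eq_square power3_eq_cube)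
        from this[of "q0\<^sup>2" "exp (2 * a \<omega>)"] show ?thesis using e by (simp only: nonzero_mult_div_cancel_right power_not_zero less_imp_neq[THEN not_sym] not_False_eq_True)
      qed
      finally show "norm ((x \<omega>)\<^sup>2 - q \<omega> - ?h \<omega>) \<le> \<epsilon> * (q0\<^sup>2 + 12 * exp (2 * a \<omega>))" unfolding d_def by simp
    next
      show "integrable M (\<lambda>\<omega>. (x \<omega>)\<^sup>2 - q \<omega> - ?h \<omega>)"
        by (rule Bochner_Integration.integrable_diff[OF Bochner_Integration.integrable_diff[OF ix2 iq] ih])
      show "integrable M (\<lambda>\<omega>. \<epsilon> * (q0\<^sup>2 + 12 * exp (2 * a \<omega>)))" using ia by simp
    qed
    ultimately show "\<bar>expectation (\<lambda>\<omega>. (x \<omega>)\<^sup>2 - q \<omega>)\<bar> \<le> \<epsilon> * expectation (\<lambda>\<omega>. q0\<^sup>2 + 12 * exp (2 * a \<omega>))" by simp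
  qed
  then show "expectation (\<lambda>\<omega>. (x \<omega>)\<^sup>2) = expectation q" using ix2 iq by simp
qed

lemma set_integrable_bounded_interval:
  fixes f :: "real \<Rightarrow> real"
  assumes "(\<lambda>x. indicator {u<..v} x *\<^sub>R f x) \<in> borel_measurable lborel"
    and "\<And>x. u < x \<Longrightarrow> x \<le> v \<Longrightarrow> \<bar>f x\<bar> \<le> B"
  shows "set_integrable lborel {u<..v} f"
  unfolding set_integrable_def
proof (rule Bochner_Integration.integrable_bound[OF _ assms(1)])
  show "integrable lborel (\<lambda>x. B * indicator {u<..v} x)"
    by (rule integrable_mult_right) (cases "u \<le> v"; simp)
  show "AE x in lborel. norm (indicator {u<..v} x *\<^sub>R f x) \<le> norm (B * indicator {u<..v} x)"
  proof (rule AE_I2)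
    fix x
    show "norm (indicator {u<..v} x *\<^sub>R f x) \<le> norm (B * indicator {u<..v} x)"
      using assms(2)[of x] by (auto split: split_indicator)
  qed
qed

section \<open>Exponential identity and moments for heights known at the left end point\<close>

context diffusion
begin

lemma dX_measurable: "r \<le> s \<Longrightarrow> s \<le> t \<Longrightarrow> t \<le> v \<Longrightarrow> (\<lambda>\<omega>. \<omega> t - \<omega> s) \<in> borel_measurable (F v)"
  using X_measurable[of t v] X_measurable[of s v] by simp

lemma S_sq_section_measurable:
  assumes "r \<le> u" "jm u v H" "\<omega> \<in> \<Omega>"
  shows "(\<lambda>x. indicator {u<..v} x *\<^sub>R (norm (S x \<omega> (H x \<omega>)))\<^sup>2) \<in> borel_measurable lborel"
proof -
  have "(\<lambda>x. (norm (indicator {u<..v} x *\<^sub>R S x \<omega> (H x \<omega>)))\<^sup>2) \<in> borel_measurable lborel"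
    using jm_section[OF jm_S[OF assms(1,2)] assms(3)] by measurable
  moreover have "(norm (indicator {u<..v} x *\<^sub>R S x \<omega> (H x \<omega>)))\<^sup>2 = indicator {u<..v} x *\<^sub>R (norm (S x \<omega> (H x \<omega>)))\<^sup>2" for x
    by (simp split: split_indicator)
  ultimately show ?thesis by simp
qed

lemma en_integrable:
  assumes "r \<le> u" "jm u v H" "\<omega> \<in> \<Omega>" and B: "\<And>x. u < x \<Longrightarrow> x \<le> v \<Longrightarrow> norm (S x \<omega> (H x \<omega>)) \<le> B"
  shows "set_integrable lborel {u<..v} (\<lambda>x. (norm (S x \<omega> (H x \<omega>)))\<^sup>2)"
proof (rule set_integrable_bounded_interval[OF S_sq_section_measurable[OF assms(1-3)]])
  fix x assume "u < x" "x \<le> v"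
  then show "\<bar>(norm (S x \<omega> (H x \<omega>)))\<^sup>2\<bar> \<le> B\<^sup>2" using B[of x] by (simp add: power_mono)
qed

lemma en_le:
  assumes "u \<le> v" "\<And>x. u < x \<Longrightarrow> x \<le> v \<Longrightarrow> norm (S x \<omega> (H x \<omega>)) \<le> B"
  shows "en u v H \<omega> \<le> B\<^sup>2 * (v - u)"
proof -
  have "\<bar>en u v H \<omega>\<bar> \<le> B\<^sup>2 * (v - u)"
    unfolding en_def using assms by (intro norm_set_integral_le_const) (auto simp: power_mono)
  then show ?thesis by simp
qed

lemma en_tendsto:
  assumes u: "r \<le> u" and \<omega>: "\<omega> \<in> \<Omega>" and jm: "\<And>k. jm u v (Hk k)" "jm u v H"
    and lim: "\<And>x. u < x \<Longrightarrow> x \<le> v \<Longrightarrow> (\<lambda>k. S x \<omega> (Hk k x \<omega>)) \<longlonglongrightarrow> S x \<omega> (H x \<omega>)"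
    and B: "\<And>k x. u < x \<Longrightarrow> x \<le> v \<Longrightarrow> norm (S x \<omega> (Hk k x \<omega>)) \<le> B"
  shows "(\<lambda>k. en u v (Hk k) \<omega>) \<longlonglongrightarrow> en u v H \<omega>"
  unfolding en_def set_lebesgue_integral_def
proof (rule integral_dominated_convergence[where w="\<lambda>x. B\<^sup>2 * indicator {u<..v} x"])
  show "integrable lborel (\<lambda>x. B\<^sup>2 * indicator {u<..v} x)"
    by (rule integrable_mult_right) (cases "u \<le> v"; simp)
  show "AE x in lborel. (\<lambda>k. indicator {u<..v} x *\<^sub>R (norm (S x \<omega> (Hk k x \<omega>)))\<^sup>2) \<longlonglongrightarrow> indicator {u<..v} x *\<^sub>R (norm (S x \<omega> (H x \<omega>)))\<^sup>2"
  proof (rule AE_I2)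
    fix x
    show "(\<lambda>k. indicator {u<..v} x *\<^sub>R (norm (S x \<omega> (Hk k x \<omega>)))\<^sup>2) \<longlonglongrightarrow> indicator {u<..v} x *\<^sub>R (norm (S x \<omega> (H x \<omega>)))\<^sup>2"
      using lim[of x] by (cases "x \<in> {u<..v}") (auto intro!: tendsto_intros)
  qed
  show "AE x in lborel. norm (indicator {u<..v} x *\<^sub>R (norm (S x \<omega> (Hk k x \<omega>)))\<^sup>2) \<le> B\<^sup>2 * indicator {u<..v} x" for k
    using B[of _ k] by (intro AE_I2) (auto intro!: power_mono split: split_indicator)
qed (use S_sq_section_measurable[OF u jm(1) \<omega>] S_sq_section_measurable[OF u jm(2) \<omega>] in simp_all)

lemma tendsto_S: "(f \<longlongrightarrow> h) G \<Longrightarrow> ((\<lambda>k. S x \<omega> (f k)) \<longlongrightarrow> S x \<omega> h) G"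
  unfolding S_def by (intro vm.tendsto tendsto_const)

lemma integrable_exp_inner:
  assumes s: "r \<le> s" "s \<le> t"
  shows "integrable M (\<lambda>\<omega>. exp (\<theta> \<bullet> (\<omega> t - \<omega> s)))"
proof (rule integrableI_nonneg)
  have [measurable]: "(\<lambda>\<omega>. \<omega> t - \<omega> s) \<in> borel_measurable M"
    by (rule measurable_F_M[OF dX_measurable[OF s order_refl]])
  show "(\<lambda>\<omega>. exp (\<theta> \<bullet> (\<omega> t - \<omega> s))) \<in> borel_measurable M" by measurable
  have [measurable]: "q\<theta> s t \<theta> \<in> borel_measurable M"
    unfolding q\<theta>_en by (rule measurable_F_M[OF en_measurable[OF s(1)]]) (rule jm_const, simp)
  \<comment> \<open>The quadratic variation has a deterministic bound, so removing the compensator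
    costs this constant factor.\<close>
  let ?C = "exp ((K * norm \<theta>)\<^sup>2 * (t - s) / 2)"
  have "(\<integral>\<^sup>+\<omega>. exp (\<theta> \<bullet> (\<omega> t - \<omega> s)) \<partial>M) \<le> (\<integral>\<^sup>+\<omega>. ennreal ?C * (ennreal (exp (\<theta> \<bullet> (\<omega> t - \<omega> s) - q\<theta> s t \<theta> \<omega> / 2)) * indicator \<Omega> \<omega>) \<partial>M)"
  proof (rule nn_integral_mono)
    fix \<omega> assume "\<omega> \<in> space M"
    moreover have "exp (\<theta> \<bullet> (\<omega> t - \<omega> s)) \<le> ?C * exp (\<theta> \<bullet> (\<omega> t - \<omega> s) - q\<theta> s t \<theta> \<omega> / 2)"
      unfolding exp_add[symmetric] using q\<theta>_le[OF s, of \<theta> \<omega>] by simp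
    ultimately show "ennreal (exp (\<theta> \<bullet> (\<omega> t - \<omega> s))) \<le> ennreal ?C * (ennreal (exp (\<theta> \<bullet> (\<omega> t - \<omega> s) - q\<theta> s t \<theta> \<omega> / 2)) * indicator \<Omega> \<omega>)"
      by (simp add: ennreal_mult'[symmetric] ennreal_leI)
  qed
  also have "\<dots> = ennreal ?C * emeasure M \<Omega>"
    using exp_martingale_const[OF s, of \<Omega> \<theta>] sets.top[of "F s"] sets.top[of M] by (subst nn_integral_cmult) auto
  also have "\<dots> < \<infinity>" using emeasure_space_1 by (simp add: ennreal_mult_less_top)
  finally show "(\<integral>\<^sup>+\<omega>. exp (\<theta> \<bullet> (\<omega> t - \<omega> s)) \<partial>M) < \<infinity>" .
qed auto

text \<open>The norm is at most \<open>CARD('n)\<close> times the largest coordinate in absolute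
  value, so its exponential moments reduce to those in the directions \<open>axis i ?c\<close> and
  \<open>axis i (- ?c)\<close>.\<close>

lemma integrable_exp_norm:
  assumes s: "r \<le> s" "s \<le> t" and c: "0 \<le> c"
  shows "integrable M (\<lambda>\<omega>. exp (c * norm (\<omega> t - \<omega> s)))"
proof (rule Bochner_Integration.integrable_bound)
  let ?c = "c * CARD('n)"
  show "integrable M (\<lambda>\<omega>. \<Sum>i\<in>UNIV. exp (?c * (\<omega> t - \<omega> s) $ i) + exp (- ?c * (\<omega> t - \<omega> s) $ i))"
  proof (intro Bochner_Integration.integrable_sum Bochner_Integration.integrable_add)
    fix i :: 'n
    show "integrable M (\<lambda>\<omega>. exp (?c * (\<omega> t - \<omega> s) $ i))" "integrable M (\<lambda>\<omega>. exp (- ?c * (\<omega> t - \<omega> s) $ i))"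
      using integrable_exp_inner[OF s, of "axis i ?c"] integrable_exp_inner[OF s, of "axis i (- ?c)"]
      by (simp_all add: inner_axis')
  qed
  have [measurable]: "(\<lambda>\<omega>. \<omega> t - \<omega> s) \<in> borel_measurable M"
    by (rule measurable_F_M[OF dX_measurable[OF s order_refl]])
  show "(\<lambda>\<omega>. exp (c * norm (\<omega> t - \<omega> s))) \<in> borel_measurable M" by measurable
  show "AE \<omega> in M. norm (exp (c * norm (\<omega> t - \<omega> s))) \<le> norm (\<Sum>i\<in>UNIV. exp (?c * (\<omega> t - \<omega> s) $ i) + exp (- ?c * (\<omega> t - \<omega> s) $ i))"
  proof (rule AE_I2)
    fix \<omega> :: "'n path"
    have "exp (c * norm (\<omega> t - \<omega> s)) \<le> (\<Sum>i\<in>UNIV. exp (?c * (\<omega> t - \<omega> s) $ i) + exp (- ?c * (\<omega> t - \<omega> s) $ i))"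
      by (rule exp_norm_le_sum[OF c])
    also have "\<dots> \<le> norm (\<Sum>i\<in>UNIV. exp (?c * (\<omega> t - \<omega> s) $ i) + exp (- ?c * (\<omega> t - \<omega> s) $ i))" by simp
    finally show "norm (exp (c * norm (\<omega> t - \<omega> s))) \<le> norm (\<Sum>i\<in>UNIV. exp (?c * (\<omega> t - \<omega> s) $ i) + exp (- ?c * (\<omega> t - \<omega> s) $ i))" by simp
  qed
qed

text \<open>This is the stochastic exponential over \<open>{s<..t}\<close> of the step process with
  height \<open>\<xi>\<close>.\<close>

definition W :: "real \<Rightarrow> real \<Rightarrow> ('n path \<Rightarrow> real ^ 'n) \<Rightarrow> 'n path \<Rightarrow> real" where
  "W s t \<xi> \<omega> = exp (\<xi> \<omega> \<bullet> (\<omega> t - \<omega> s) - en s t (\<lambda>_. \<xi>) \<omega> / 2)"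

lemma en_const: "en s t (\<lambda>_. \<xi>) \<omega> = q\<theta> s t (\<xi> \<omega>) \<omega>"
  by (simp add: en_def q\<theta>_def)

lemma W_measurable:
  assumes s: "r \<le> s" "s \<le> t" and \<xi>: "\<xi> \<in> borel_measurable (F t)"
  shows "W s t \<xi> \<in> borel_measurable (F t)"
proof -
  note [measurable] = \<xi> dX_measurable[OF s order_refl] en_measurable[OF s(1) jm_const[OF \<xi>]]
  show ?thesis unfolding W_def[abs_def] by measurable
qed

text \<open>On each level set of \<open>f\<close>, an event known at \<open>s\<close>, the height is
  a constant vector and the identity for constants applies.\<close>

lemma exp_martingale_simple:
  assumes s: "r \<le> s" "s \<le> t" and f: "simple_function (F s) f" and A: "A \<in> sets (F s)"
  shows "(\<integral>\<^sup>+\<omega>\<in>A. W s t f \<omega> \<partial>M) = emeasure M A"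
proof -
  have fin: "finite (f ` \<Omega>)" using f by (simp add: simple_function_def)
  have AF: "A \<inter> f -` {v} \<in> sets (F s)" for v
  proof -
    have "f -` {v} \<inter> space (F s) \<in> sets (F s)" using f by (rule simple_functionD)
    then have "A \<inter> (f -` {v} \<inter> space (F s)) \<in> sets (F s)" using A by (rule sets.Int[rotated])
    moreover have "A \<inter> (f -` {v} \<inter> space (F s)) = A \<inter> f -` {v}" using sets.sets_into_space[OF A] by auto
    ultimately show ?thesis by simp
  qed
  have AFM [measurable]: "A \<inter> f -` {v} \<in> sets M" for v using AF[of v] sets_F_sub_M[of s] by (rule subsetD[rotated])
  have fm: "f \<in> borel_measurable (F s)" by (rule borel_measurable_simple_function[OF f])
  have Wm: "W s t g \<in> borel_measurable M" if "g \<in> borel_measurable (F s)" for g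
    by (rule measurable_F_M[OF W_measurable[OF s measurable_F_mono[OF that s(2)]]])
  have sum: "h \<omega> * indicator A \<omega> = (\<Sum>v\<in>f ` \<Omega>. h \<omega> * indicator (A \<inter> f -` {v}) \<omega>)"
    if "\<omega> \<in> \<Omega>" for h :: "'n path \<Rightarrow> ennreal" and \<omega>
  proof -
    have "(\<Sum>v\<in>f ` \<Omega>. h \<omega> * indicator (A \<inter> f -` {v}) \<omega>) = (\<Sum>v\<in>f ` \<Omega>. if v = f \<omega> then h \<omega> * indicator A \<omega> else 0)"
      by (intro sum.cong) (auto split: split_indicator)
    also have "\<dots> = h \<omega> * indicator A \<omega>" using that fin by (subst sum.delta) auto
    finally show ?thesis ..
  qed
  have "(\<integral>\<^sup>+\<omega>\<in>A. W s t f \<omega> \<partial>M) = (\<integral>\<^sup>+\<omega>. (\<Sum>v\<in>f ` \<Omega>. ennreal (W s t f \<omega>) * indicator (A \<inter> f -` {v}) \<omega>) \<partial>M)"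
    by (intro nn_integral_cong sum) simp
  also have "\<dots> = (\<Sum>v\<in>f ` \<Omega>. \<integral>\<^sup>+\<omega>\<in>A \<inter> f -` {v}. W s t f \<omega> \<partial>M)"
    using AFM Wm[OF fm] by (intro nn_integral_sum) auto
  also have "\<dots> = (\<Sum>v\<in>f ` \<Omega>. emeasure M (A \<inter> f -` {v}))"
  proof (intro sum.cong refl)
    fix v
    have "(\<integral>\<^sup>+\<omega>\<in>A \<inter> f -` {v}. W s t f \<omega> \<partial>M) = (\<integral>\<^sup>+\<omega>\<in>A \<inter> f -` {v}. exp (v \<bullet> (\<omega> t - \<omega> s) - q\<theta> s t v \<omega> / 2) \<partial>M)"
      by (intro nn_integral_cong) (auto simp: W_def en_const split: split_indicator)
    also have "\<dots> = emeasure M (A \<inter> f -` {v})" by (rule exp_martingale_const[OF s AF])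
    finally show "(\<integral>\<^sup>+\<omega>\<in>A \<inter> f -` {v}. W s t f \<omega> \<partial>M) = emeasure M (A \<inter> f -` {v})" .
  qed
  also have "\<dots> = (\<Sum>v\<in>f ` \<Omega>. \<integral>\<^sup>+\<omega>. 1 * indicator (A \<inter> f -` {v}) \<omega> \<partial>M)"
    using AFM by (intro sum.cong) (auto simp: nn_integral_indicator)
  also have "\<dots> = (\<integral>\<^sup>+\<omega>. (\<Sum>v\<in>f ` \<Omega>. 1 * indicator (A \<inter> f -` {v}) \<omega>) \<partial>M)"
    using AFM by (intro nn_integral_sum[symmetric]) auto
  also have "\<dots> = (\<integral>\<^sup>+\<omega>. 1 * indicator A \<omega> \<partial>M)"
    using sum[of _ "\<lambda>_. 1"] by (intro nn_integral_cong) simp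
  also have "\<dots> = emeasure M A" using A sets_F_sub_M[of s] by auto
  finally show ?thesis .
qed

text \<open>\<open>\<xi>\<close> is a pointwise limit of simple functions of at most twice its norm,
  whence the constant \<open>2 * b\<close>. Exponential moments of the increment supply the
  dominating function.\<close>

lemma exp_martingale:
  assumes s: "r \<le> s" "s \<le> t" and \<xi>: "\<xi> \<in> borel_measurable (F s)" "\<And>\<omega>. \<omega> \<in> \<Omega> \<Longrightarrow> norm (\<xi> \<omega>) \<le> b"
    and A: "A \<in> sets (F s)"
  shows "(\<integral>\<^sup>+\<omega>\<in>A. W s t \<xi> \<omega> \<partial>M) = emeasure M A"
proof -
  obtain f where f: "\<And>i. simple_function (F s) (f i)" "\<And>\<omega>. \<omega> \<in> \<Omega> \<Longrightarrow> (\<lambda>i. f i \<omega>) \<longlonglongrightarrow> \<xi> \<omega>"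
    "\<And>i \<omega>. \<omega> \<in> \<Omega> \<Longrightarrow> dist (f i \<omega>) 0 \<le> 2 * dist (\<xi> \<omega>) 0"
    using borel_measurable_implies_sequence_metric[OF \<xi>(1), of 0] by (metis space_F)
  have fb: "norm (f i \<omega>) \<le> 2 * b" if "\<omega> \<in> \<Omega>" for i \<omega> using f(3)[OF that, of i] \<xi>(2)[OF that] by simp
  have "\<Omega> \<noteq> {}" using not_empty by simp
  then have b: "0 \<le> b" using \<xi>(2) norm_ge_zero order_trans by blast
  have fm: "f i \<in> borel_measurable (F t)" for i
    by (rule measurable_F_mono[OF borel_measurable_simple_function[OF f(1)] s(2)])
  have Wm: "W s t (f i) \<in> borel_measurable M" "W s t \<xi> \<in> borel_measurable M" for i
    using measurable_F_M[OF W_measurable[OF s fm]] measurable_F_M[OF W_measurable[OF s measurable_F_mono[OF \<xi>(1) s(2)]]] by auto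
  have AM: "A \<in> sets M" using A sets_F_sub_M by auto
  have "(\<lambda>i. \<integral>\<^sup>+\<omega>\<in>A. W s t (f i) \<omega> \<partial>M) \<longlonglongrightarrow> (\<integral>\<^sup>+\<omega>\<in>A. W s t \<xi> \<omega> \<partial>M)"
  proof (rule nn_integral_dominated_convergence[where w="\<lambda>\<omega>. ennreal (exp (2 * b * norm (\<omega> t - \<omega> s)))"])
    show "AE \<omega> in M. ennreal (W s t (f i) \<omega>) * indicator A \<omega> \<le> ennreal (exp (2 * b * norm (\<omega> t - \<omega> s)))" for i
    proof (rule AE_I2)
      fix \<omega> assume "\<omega> \<in> space M"
      then have \<omega>: "\<omega> \<in> \<Omega>" by simp
      have "f i \<omega> \<bullet> (\<omega> t - \<omega> s) \<le> norm (f i \<omega>) * norm (\<omega> t - \<omega> s)" by (rule norm_cauchy_schwarz)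
      also have "\<dots> \<le> 2 * b * norm (\<omega> t - \<omega> s)" using fb[OF \<omega>, of i] by (intro mult_right_mono) auto
      finally have "W s t (f i) \<omega> \<le> exp (2 * b * norm (\<omega> t - \<omega> s))"
        unfolding W_def using en_nonneg[of s t "\<lambda>_. f i" \<omega>] by simp
      then show "ennreal (W s t (f i) \<omega>) * indicator A \<omega> \<le> ennreal (exp (2 * b * norm (\<omega> t - \<omega> s)))"
        by (auto simp: ennreal_leI split: split_indicator)
    qed
    show "AE \<omega> in M. (\<lambda>i. ennreal (W s t (f i) \<omega>) * indicator A \<omega>) \<longlonglongrightarrow> ennreal (W s t \<xi> \<omega>) * indicator A \<omega>"
    proof (rule AE_I2)
      fix \<omega> assume "\<omega> \<in> space M"
      then have \<omega>: "\<omega> \<in> \<Omega>" by simp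
      have "(\<lambda>i. en s t (\<lambda>_ _. f i \<omega>) \<omega>) \<longlonglongrightarrow> en s t (\<lambda>_ _. \<xi> \<omega>) \<omega>"
      proof (rule en_tendsto[OF s(1) \<omega>, where B="K * (2 * b)"])
        fix k x assume "s < x"
        then have "norm (S x \<omega> (f k \<omega>)) \<le> K * norm (f k \<omega>)" using s by (intro norm_S_le) auto
        also have "\<dots> \<le> K * (2 * b)" using fb[OF \<omega>] K_pos by (intro mult_left_mono) auto
        finally show "norm (S x \<omega> (f k \<omega>)) \<le> K * (2 * b)" .
      qed (auto intro!: jm_const tendsto_S f(2)[OF \<omega>])
      then have "(\<lambda>i. en s t (\<lambda>_. f i) \<omega>) \<longlonglongrightarrow> en s t (\<lambda>_. \<xi>) \<omega>" by (simp add: en_def)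
      then have "(\<lambda>i. W s t (f i) \<omega>) \<longlonglongrightarrow> W s t \<xi> \<omega>"
        unfolding W_def using f(2)[OF \<omega>] by (intro tendsto_intros) auto
      then show "(\<lambda>i. ennreal (W s t (f i) \<omega>) * indicator A \<omega>) \<longlonglongrightarrow> ennreal (W s t \<xi> \<omega>) * indicator A \<omega>"
        by (auto intro!: tendsto_ennrealI split: split_indicator)
    qed
    show "(\<integral>\<^sup>+\<omega>. ennreal (exp (2 * b * norm (\<omega> t - \<omega> s))) \<partial>M) < \<infinity>"
      using integrable_exp_norm[OF s, of "2 * b"] b by (simp add: integrable_iff_bounded)
    show "(\<lambda>\<omega>. ennreal (exp (2 * b * norm (\<omega> t - \<omega> s)))) \<in> borel_measurable M"
      using measurable_F_M[OF dX_measurable[OF s order_refl]] by measurable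
  qed (use Wm AM in auto)
  then show ?thesis
    unfolding exp_martingale_simple[OF s f(1) A] using LIMSEQ_unique tendsto_const by blast
qed

lemma nn_integral_mult_W:
  assumes s: "r \<le> s" "s \<le> t" and \<xi>: "\<xi> \<in> borel_measurable (F s)" "\<And>\<omega>. \<omega> \<in> \<Omega> \<Longrightarrow> norm (\<xi> \<omega>) \<le> b"
    and f: "f \<in> borel_measurable (F s)"
  shows "(\<integral>\<^sup>+\<omega>. (f \<omega> :: ennreal) * ennreal (W s t \<xi> \<omega>) \<partial>M) = (\<integral>\<^sup>+\<omega>. f \<omega> \<partial>M)"
proof -
  interpret sigma_finite_subalgebra M "F s" by (rule sigma_finite_subalgebraI[OF subalgebra_F])
  have "(\<integral>\<^sup>+\<omega>. f \<omega> * ennreal (W s t \<xi> \<omega>) \<partial>M) = (\<integral>\<^sup>+\<omega>. f \<omega> * 1 \<partial>M)"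
  proof (rule nn_integral_mult_eq_of_set_eq[OF _ _ _ f])
    fix A assume A: "A \<in> sets (F s)"
    then have "A \<in> sets M" using sets_F_sub_M by auto
    then show "(\<integral>\<^sup>+\<omega>\<in>A. W s t \<xi> \<omega> \<partial>M) = (\<integral>\<^sup>+\<omega>\<in>A. 1 \<partial>M)"
      using exp_martingale[OF s \<xi> A] by simp
  qed (use measurable_F_M[OF W_measurable[OF s measurable_F_mono[OF \<xi>(1) s(2)]]] in simp_all)
  then show ?thesis by simp
qed

lemma en_scaleR: "en u v (\<lambda>x \<omega>. c *\<^sub>R H x \<omega>) \<omega> = c\<^sup>2 * en u v H \<omega>"
  unfolding en_def by (simp add: S_scaleR power_mult_distrib)

text \<open>Multiples of \<open>\<xi>\<close> are again bounded and known at \<open>s\<close>, so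
  the exponential identity holds for every \<open>\<epsilon>\<close> and can be expanded.\<close>

lemma dX_moments:
  assumes s: "r \<le> s" "s \<le> t" and \<xi>: "\<xi> \<in> borel_measurable (F s)" "\<And>\<omega>. \<omega> \<in> \<Omega> \<Longrightarrow> norm (\<xi> \<omega>) \<le> b"
  shows "integrable M (\<lambda>\<omega>. \<xi> \<omega> \<bullet> (\<omega> t - \<omega> s))" "(\<integral>\<omega>. \<xi> \<omega> \<bullet> (\<omega> t - \<omega> s) \<partial>M) = 0"
    "integrable M (\<lambda>\<omega>. (\<xi> \<omega> \<bullet> (\<omega> t - \<omega> s))\<^sup>2)"
    "(\<integral>\<omega>. (\<xi> \<omega> \<bullet> (\<omega> t - \<omega> s))\<^sup>2 \<partial>M) = (\<integral>\<omega>. en s t (\<lambda>_. \<xi>) \<omega> \<partial>M)"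
    "integrable M (en s t (\<lambda>_. \<xi>))"
proof -
  have \<xi>t: "\<xi> \<in> borel_measurable (F t)" by (rule measurable_F_mono[OF \<xi>(1) s(2)])
  have m: "(\<lambda>\<omega>. \<xi> \<omega> \<bullet> (\<omega> t - \<omega> s)) \<in> borel_measurable M"
    using measurable_F_M[OF dX_measurable[OF s order_refl]] measurable_F_M[OF \<xi>t] by measurable
  have m2: "en s t (\<lambda>_. \<xi>) \<in> borel_measurable M"
    by (rule measurable_F_M[OF en_measurable[OF s(1) jm_const[OF \<xi>t]]])
  have le: "en s t (\<lambda>_. \<xi>) \<omega> \<le> (K * b)\<^sup>2 * (t - s)" if "\<omega> \<in> space M" for \<omega>
  proof (rule en_le[OF s(2)])
    fix x assume "s < x"
    then have "norm (S x \<omega> (\<xi> \<omega>)) \<le> K * norm (\<xi> \<omega>)" using s by (intro norm_S_le) auto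
    also have "\<dots> \<le> K * b" using \<xi>(2) that K_pos by (intro mult_left_mono) auto
    finally show "norm (S x \<omega> (\<xi> \<omega>)) \<le> K * b" .
  qed
  have ex: "(\<integral>\<^sup>+\<omega>. exp (\<epsilon> * (\<xi> \<omega> \<bullet> (\<omega> t - \<omega> s)) - \<epsilon>\<^sup>2 * en s t (\<lambda>_. \<xi>) \<omega> / 2) \<partial>M) = 1" for \<epsilon>
  proof -
    have "(\<integral>\<^sup>+\<omega>. ennreal (W s t (\<lambda>\<omega>. \<epsilon> *\<^sub>R \<xi> \<omega>) \<omega>) * indicator \<Omega> \<omega> \<partial>M) = emeasure M \<Omega>"
    proof (rule exp_martingale[OF s])
      show "norm (\<epsilon> *\<^sub>R \<xi> \<omega>) \<le> \<bar>\<epsilon>\<bar> * b" if "\<omega> \<in> \<Omega>" for \<omega> using \<xi>(2)[OF that] by (simp add: mult_left_mono)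
      show "\<Omega> \<in> sets (F s)" using sets.top[of "F s"] by simp
    qed (use \<xi>(1) in simp)
    moreover have "(\<integral>\<^sup>+\<omega>. ennreal (W s t (\<lambda>\<omega>. \<epsilon> *\<^sub>R \<xi> \<omega>) \<omega>) * indicator \<Omega> \<omega> \<partial>M) =
      (\<integral>\<^sup>+\<omega>. exp (\<epsilon> * (\<xi> \<omega> \<bullet> (\<omega> t - \<omega> s)) - \<epsilon>\<^sup>2 * en s t (\<lambda>_. \<xi>) \<omega> / 2) \<partial>M)"
      by (intro nn_integral_cong) (simp add: W_def en_scaleR[of s t \<epsilon> "\<lambda>_. \<xi>"])
    ultimately show ?thesis using emeasure_space_1 by simp
  qed
  have q0: "0 \<le> (K * b)\<^sup>2 * (t - s)" using s by simp
  note mom = moments_from_exponential[OF m m2 en_nonneg le q0 ex]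
  show "integrable M (\<lambda>\<omega>. \<xi> \<omega> \<bullet> (\<omega> t - \<omega> s))" by (rule mom(1))
  show "(\<integral>\<omega>. \<xi> \<omega> \<bullet> (\<omega> t - \<omega> s) \<partial>M) = 0" by (rule mom(2))
  show "integrable M (\<lambda>\<omega>. (\<xi> \<omega> \<bullet> (\<omega> t - \<omega> s))\<^sup>2)" by (rule mom(3))
  show "(\<integral>\<omega>. (\<xi> \<omega> \<bullet> (\<omega> t - \<omega> s))\<^sup>2 \<partial>M) = (\<integral>\<omega>. en s t (\<lambda>_. \<xi>) \<omega> \<partial>M)" by (rule mom(4))
  show "integrable M (en s t (\<lambda>_. \<xi>))" by (rule mom(5))
qed

section \<open>The isometry for elementary integrals\<close>

text \<open>The isometry holds in a norm weighted by \<open>\<sigma>\<close>. Multiplication by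
  \<open>\<sigma>\<close> beforehand turns it into the plain \<open>L\<^sup>2\<close> norm over
  \<open>PM\<close>.\<close>

definition SP :: "(real \<Rightarrow> 'n path \<Rightarrow> real ^ 'n) \<Rightarrow> real \<times> 'n path \<Rightarrow> real ^ 'n" where
  "SP h z = indicator {r<..T} (fst z) *\<^sub>R S (fst z) (snd z) (h (fst z) (snd z))"

abbreviation PM :: "(real \<times> 'n path) measure" where "PM \<equiv> lborel \<Otimes>\<^sub>M M"

lemma measurable_lborel_F_M:
  assumes "f \<in> measurable (lborel \<Otimes>\<^sub>M F v) N"
  shows "f \<in> measurable PM N"
proof -
  have 1: "(\<lambda>\<omega>. \<omega>) \<in> M \<rightarrow>\<^sub>M F v" using sets_F_sub_M[of v] by (intro measurableI) auto
  have "(\<lambda>z. (fst z, snd z)) \<in> PM \<rightarrow>\<^sub>M lborel \<Otimes>\<^sub>M F v"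
    by (intro measurable_Pair measurable_fst'' measurable_compose[OF measurable_snd 1]) simp_all
  from measurable_compose[OF this assms] show ?thesis by simp
qed

lemma SP_measurable:
  assumes "jm r T h" shows "SP h \<in> borel_measurable PM"
  using measurable_lborel_F_M[OF jm_S[OF order_refl assms, unfolded jm_def]]
  unfolding SP_def[abs_def] by (simp add: case_prod_beta')

lemma \<Omega>_sets [simp]: "\<Omega> \<in> sets M" "\<Omega> \<in> sets (F t)"
  using sets.top[of M] sets.top[of "F t"] by simp_all

lemma SP_add: "SP (\<lambda>x \<omega>. h x \<omega> + k x \<omega>) z = SP h z + SP k z"
  and SP_diff: "SP (\<lambda>x \<omega>. h x \<omega> - k x \<omega>) z = SP h z - SP k z"
  unfolding SP_def by (simp_all add: S_add S_diff scaleR_add_right scaleR_diff_right)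

lemma SP_bound:
  assumes "snd z \<in> \<Omega>" "\<And>x \<omega>. r < x \<Longrightarrow> x \<le> T \<Longrightarrow> \<omega> \<in> \<Omega> \<Longrightarrow> norm (h x \<omega>) \<le> b"
  shows "norm (SP h z) \<le> (K * b) * indicator {r<..T} (fst z)"
proof (cases "fst z \<in> {r<..T}")
  case True
  have "norm (S (fst z) (snd z) (h (fst z) (snd z))) \<le> K * norm (h (fst z) (snd z))"
    using True by (intro norm_S_le) auto
  also have "\<dots> \<le> K * b" using K_pos assms True by (intro mult_left_mono) auto
  finally show ?thesis using True by (simp add: SP_def)
qed (simp add: SP_def)

lemma integrable_SP_inner:
  assumes h: "jm r T h" "\<And>x \<omega>. r < x \<Longrightarrow> x \<le> T \<Longrightarrow> \<omega> \<in> \<Omega> \<Longrightarrow> norm (h x \<omega>) \<le> b"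
    and k: "jm r T k" "\<And>x \<omega>. r < x \<Longrightarrow> x \<le> T \<Longrightarrow> \<omega> \<in> \<Omega> \<Longrightarrow> norm (k x \<omega>) \<le> b'"
  shows "integrable PM (\<lambda>z. SP h z \<bullet> SP k z)"
proof (rule Bochner_Integration.integrable_bound)
  have "emeasure PM ({r<..T} \<times> space M) = emeasure lborel {r<..T} * emeasure M (space M)"
    by (rule emeasure_pair_measure_Times) auto
  also have "\<dots> < \<infinity>" using emeasure_space_1 rT by simp
  finally have "integrable PM (indicator ({r<..T} \<times> space M) :: _ \<Rightarrow> real)"
    by (intro integrable_real_indicator) auto
  then show "integrable PM (\<lambda>z. (K * b) * (K * b') * indicator ({r<..T} \<times> space M) z)"
    by (rule integrable_mult_right)
  show "(\<lambda>z. SP h z \<bullet> SP k z) \<in> borel_measurable PM"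
    using SP_measurable[OF h(1)] SP_measurable[OF k(1)] by measurable
  show "AE z in PM. norm (SP h z \<bullet> SP k z) \<le> norm ((K * b) * (K * b') * indicator ({r<..T} \<times> space M) z)"
  proof (rule AE_I2)
    fix z assume "z \<in> space PM"
    then have z: "snd z \<in> \<Omega>" by (auto simp: space_pair_measure)
    have "norm (SP h z \<bullet> SP k z) \<le> norm (SP h z) * norm (SP k z)" by (simp add: Cauchy_Schwarz_ineq2)
    also have "\<dots> \<le> ((K * b) * indicator {r<..T} (fst z)) * ((K * b') * indicator {r<..T} (fst z))"
      using SP_bound[OF z h(2)] SP_bound[OF z k(2)] order_trans[OF norm_ge_zero SP_bound[OF z h(2)]]
      by (intro mult_mono) auto
    also have "\<dots> \<le> norm ((K * b) * (K * b') * indicator ({r<..T} \<times> space M) z)"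
      using z by (cases z) (auto split: split_indicator)
    finally show "norm (SP h z \<bullet> SP k z) \<le> norm ((K * b) * (K * b') * indicator ({r<..T} \<times> space M) z)" .
  qed
qed

lemma pair_sigma_finite_PM: "pair_sigma_finite (lborel :: real measure) M"
  by (intro pair_sigma_finite.intro sigma_finite_lborel) unfold_locales

text \<open>The isometry is stated in polarised form because equality of inner products, unlike
  equality of norms, is additive in each argument.\<close>

definition iso :: "(real \<Rightarrow> 'n path \<Rightarrow> real ^ 'n) \<Rightarrow> ('n path \<Rightarrow> real) \<Rightarrow> (real \<Rightarrow> 'n path \<Rightarrow> real ^ 'n) \<Rightarrow> ('n path \<Rightarrow> real) \<Rightarrow> bool" where
  "iso h I k J \<longleftrightarrow> integrable M (\<lambda>\<omega>. I \<omega> * J \<omega>) \<and> integrable PM (\<lambda>z. SP h z \<bullet> SP k z) \<and>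
     (\<integral>\<omega>. I \<omega> * J \<omega> \<partial>M) = (\<integral>z. SP h z \<bullet> SP k z \<partial>PM)"

lemma iso_sym: "iso h I k J \<Longrightarrow> iso k J h I"
  unfolding iso_def by (simp add: inner_commute mult.commute)

lemma iso_add:
  assumes "iso h I k J" "iso h' I' k J"
  shows "iso (\<lambda>x \<omega>. h x \<omega> + h' x \<omega>) (\<lambda>\<omega>. I \<omega> + I' \<omega>) k J"
  using assms unfolding iso_def by (simp add: SP_add inner_add_left distrib_right)

lemma iso_add_right: "iso k J h I \<Longrightarrow> iso k J h' I' \<Longrightarrow> iso k J (\<lambda>x \<omega>. h x \<omega> + h' x \<omega>) (\<lambda>\<omega>. I \<omega> + I' \<omega>)"
  by (rule iso_sym[OF iso_add[OF iso_sym iso_sym]])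

definition at_h :: "real \<Rightarrow> real \<Rightarrow> ('n path \<Rightarrow> real ^ 'n) \<Rightarrow> real \<Rightarrow> 'n path \<Rightarrow> real ^ 'n" where
  "at_h s t \<xi> = (\<lambda>x \<omega>. indicator {s<..t} x *\<^sub>R \<xi> \<omega>)"

definition at_i :: "real \<Rightarrow> real \<Rightarrow> ('n path \<Rightarrow> real ^ 'n) \<Rightarrow> 'n path \<Rightarrow> real" where
  "at_i s t \<xi> = (\<lambda>\<omega>. \<xi> \<omega> \<bullet> (\<omega> t - \<omega> s))"

lemma at_split:
  assumes "a \<le> b" "b \<le> c"
  shows "at_h a c \<xi> = (\<lambda>x \<omega>. at_h a b \<xi> x \<omega> + at_h b c \<xi> x \<omega>)" "at_i a c \<xi> = (\<lambda>\<omega>. at_i a b \<xi> \<omega> + at_i b c \<xi> \<omega>)"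
  using assms by (auto simp: at_h_def at_i_def fun_eq_iff indicator_def inner_diff_right)

definition bdF :: "real \<Rightarrow> ('n path \<Rightarrow> real ^ 'n) \<Rightarrow> bool" where
  "bdF s \<xi> \<longleftrightarrow> \<xi> \<in> borel_measurable (F s) \<and> (\<exists>b. \<forall>\<omega>\<in>\<Omega>. norm (\<xi> \<omega>) \<le> b)"

lemma bdF_mono: "bdF s \<xi> \<Longrightarrow> s \<le> t \<Longrightarrow> bdF t \<xi>"
  unfolding bdF_def using measurable_F_mono by blast

lemma jm_at: "bdF s \<xi> \<Longrightarrow> s \<le> t \<Longrightarrow> t \<le> v \<Longrightarrow> jm u v (at_h s t \<xi>)"
proof -
  assume "bdF s \<xi>" "s \<le> t" "t \<le> v"
  then have [measurable]: "\<xi> \<in> borel_measurable (F v)" unfolding bdF_def by (meson measurable_F_mono order_trans)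
  show ?thesis unfolding jm_def at_h_def by measurable
qed

text \<open>Fubini turns the integral over \<open>PM\<close> into the expected energy on
  \<open>{s<..t}\<close>, which is the second moment of the increment by
  \<open>dX_moments\<close>.\<close>

lemma iso_diag:
  assumes st: "r \<le> s" "s \<le> t" "t \<le> T" and \<xi>: "bdF s \<xi>"
  shows "iso (at_h s t \<xi>) (at_i s t \<xi>) (at_h s t \<xi>) (at_i s t \<xi>)"
proof -
  interpret P: pair_sigma_finite "lborel :: real measure" M by (rule pair_sigma_finite_PM)
  obtain b where b: "\<And>\<omega>. \<omega> \<in> \<Omega> \<Longrightarrow> norm (\<xi> \<omega>) \<le> b" and m: "\<xi> \<in> borel_measurable (F s)" using \<xi> by (auto simp: bdF_def)
  note mom = dX_moments[OF st(1,2) m b]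
  have bd: "norm (at_h s t \<xi> x \<omega>) \<le> b" if "\<omega> \<in> \<Omega>" for x \<omega>
    using b[OF that] order_trans[OF norm_ge_zero b[OF that]] by (auto simp: at_h_def split: split_indicator)
  have i: "integrable PM (\<lambda>z. SP (at_h s t \<xi>) z \<bullet> SP (at_h s t \<xi>) z)"
    by (intro integrable_SP_inner[where b=b and b'=b] jm_at \<xi> st bd)
  have "(\<integral>z. SP (at_h s t \<xi>) z \<bullet> SP (at_h s t \<xi>) z \<partial>PM) =
    (\<integral>z. (case z of (x, \<omega>) \<Rightarrow> SP (at_h s t \<xi>) (x, \<omega>) \<bullet> SP (at_h s t \<xi>) (x, \<omega>)) \<partial>PM)"
    by (simp add: case_prod_beta')
  also have "\<dots> = (\<integral>\<omega>. (\<integral>x. SP (at_h s t \<xi>) (x, \<omega>) \<bullet> SP (at_h s t \<xi>) (x, \<omega>) \<partial>lborel) \<partial>M)"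
    by (rule P.integral_snd[symmetric]) (use i in \<open>simp add: case_prod_beta'\<close>)
  also have "\<dots> = (\<integral>\<omega>. en s t (\<lambda>_. \<xi>) \<omega> \<partial>M)"
    unfolding en_def set_lebesgue_integral_def
    by (intro Bochner_Integration.integral_cong refl)
       (use st in \<open>auto simp: SP_def at_h_def S_scaleR power2_norm_eq_inner split: split_indicator\<close>)
  also have "\<dots> = (\<integral>\<omega>. at_i s t \<xi> \<omega> * at_i s t \<xi> \<omega> \<partial>M)"
    unfolding at_i_def using mom(4) by (simp add: power2_eq_square)
  finally show ?thesis
    unfolding iso_def using mom(3) i by (simp add: at_i_def power2_eq_square)
qed

text \<open>Polarisation of the diagonal case, applied to \<open>\<xi>\<close>,
  \<open>\<eta>\<close> and their sum, which is again bounded and known at \<open>s\<close>.\<close>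

lemma iso_same:
  assumes st: "r \<le> s" "s \<le> t" "t \<le> T" and \<xi>: "bdF s \<xi>" and \<eta>: "bdF s \<eta>"
  shows "iso (at_h s t \<xi>) (at_i s t \<xi>) (at_h s t \<eta>) (at_i s t \<eta>)"
proof -
  have sum: "bdF s (\<lambda>\<omega>. \<xi> \<omega> + \<eta> \<omega>)"
  proof -
    obtain b b' where "\<And>\<omega>. \<omega> \<in> \<Omega> \<Longrightarrow> norm (\<xi> \<omega>) \<le> b" "\<And>\<omega>. \<omega> \<in> \<Omega> \<Longrightarrow> norm (\<eta> \<omega>) \<le> b'"
      using \<xi> \<eta> by (auto simp: bdF_def)
    then have "\<And>\<omega>. \<omega> \<in> \<Omega> \<Longrightarrow> norm (\<xi> \<omega> + \<eta> \<omega>) \<le> b + b'" by (intro norm_triangle_mono) auto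
    then show ?thesis using \<xi> \<eta> unfolding bdF_def by auto
  qed
  let ?a = "at_i s t \<xi>" and ?b = "at_i s t \<eta>" and ?X = "SP (at_h s t \<xi>)" and ?Y = "SP (at_h s t \<eta>)"
  have si: "at_i s t (\<lambda>\<omega>. \<xi> \<omega> + \<eta> \<omega>) \<omega> = ?a \<omega> + ?b \<omega>" for \<omega> by (simp add: at_i_def inner_add_left)
  have sh: "SP (at_h s t (\<lambda>\<omega>. \<xi> \<omega> + \<eta> \<omega>)) z = ?X z + ?Y z" for z
    by (simp add: at_h_def SP_def S_add scaleR_add_right)
  note d = iso_diag[OF st sum, unfolded iso_def si sh] iso_diag[OF st \<xi>, unfolded iso_def] iso_diag[OF st \<eta>, unfolded iso_def]
  have e1: "?a \<omega> * ?b \<omega> = ((?a \<omega> + ?b \<omega>) * (?a \<omega> + ?b \<omega>) - ?a \<omega> * ?a \<omega> - ?b \<omega> * ?b \<omega>) / 2" for \<omega>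
    by (simp add: algebra_simps)
  have e2: "?X z \<bullet> ?Y z = ((?X z + ?Y z) \<bullet> (?X z + ?Y z) - ?X z \<bullet> ?X z - ?Y z \<bullet> ?Y z) / 2" for z
    by (simp add: inner_add_left inner_add_right inner_commute)
  have i1: "integrable M (\<lambda>\<omega>. ((?a \<omega> + ?b \<omega>) * (?a \<omega> + ?b \<omega>) - ?a \<omega> * ?a \<omega> - ?b \<omega> * ?b \<omega>) / 2)"
    using d by (intro integrable_divide Bochner_Integration.integrable_diff) auto
  have i2: "integrable PM (\<lambda>z. ((?X z + ?Y z) \<bullet> (?X z + ?Y z) - ?X z \<bullet> ?X z - ?Y z \<bullet> ?Y z) / 2)"
    using d by (intro integrable_divide Bochner_Integration.integrable_diff) auto
  have "(\<integral>\<omega>. ?a \<omega> * ?b \<omega> \<partial>M) = ((\<integral>\<omega>. (?a \<omega> + ?b \<omega>) * (?a \<omega> + ?b \<omega>) \<partial>M) - (\<integral>\<omega>. ?a \<omega> * ?a \<omega> \<partial>M) - (\<integral>\<omega>. ?b \<omega> * ?b \<omega> \<partial>M)) / 2"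
    unfolding e1 using d by (simp add: Bochner_Integration.integral_diff Bochner_Integration.integrable_diff)
  also have "\<dots> = (\<integral>z. ?X z \<bullet> ?Y z \<partial>PM)"
    unfolding e2 using d by (simp add: Bochner_Integration.integral_diff Bochner_Integration.integrable_diff)
  finally have "(\<integral>\<omega>. ?a \<omega> * ?b \<omega> \<partial>M) = (\<integral>z. ?X z \<bullet> ?Y z \<partial>PM)" .
  moreover have "integrable M (\<lambda>\<omega>. ?a \<omega> * ?b \<omega>)" unfolding e1 by (rule i1)
  moreover have "integrable PM (\<lambda>z. ?X z \<bullet> ?Y z)" unfolding e2 by (rule i2)
  ultimately show ?thesis unfolding iso_def by blast
qed

text \<open>A later increment is centred given the past. The earlier increment is known at
  \<open>u\<close> but unbounded; it is truncated, absorbed into the height \<open>\<eta>\<close>,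
  and the truncation is removed by dominated convergence.\<close>

lemma iso_disjoint:
  assumes s: "r \<le> s" "s \<le> t" "t \<le> u" "u \<le> v" and \<xi>: "bdF s \<xi>" and \<eta>: "bdF u \<eta>"
  shows "iso (at_h s t \<xi>) (at_i s t \<xi>) (at_h u v \<eta>) (at_i u v \<eta>)"
proof -
  obtain b where b: "\<And>\<omega>. \<omega> \<in> \<Omega> \<Longrightarrow> norm (\<xi> \<omega>) \<le> b" and m: "\<xi> \<in> borel_measurable (F s)" using \<xi> by (auto simp: bdF_def)
  obtain b' where b': "\<And>\<omega>. \<omega> \<in> \<Omega> \<Longrightarrow> norm (\<eta> \<omega>) \<le> b'" and m': "\<eta> \<in> borel_measurable (F u)" using \<eta> by (auto simp: bdF_def)
  have ru: "r \<le> u" using s by linarith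
  let ?x = "at_i s t \<xi>" and ?y = "at_i u v \<eta>"
  note momx = dX_moments[OF s(1,2) m b] and momy = dX_moments[OF ru s(4) m' b']
  have ix: "integrable M (\<lambda>\<omega>. (?x \<omega>)\<^sup>2)" and iy: "integrable M (\<lambda>\<omega>. (?y \<omega>)\<^sup>2)"
    using momx(3) momy(3) by (simp_all add: at_i_def)
  have xu: "?x \<in> borel_measurable (F u)"
  proof -
    have [measurable]: "\<xi> \<in> borel_measurable (F u)" "(\<lambda>\<omega>. \<omega> t - \<omega> s) \<in> borel_measurable (F u)"
      using dX_measurable[OF s(1-3)] measurable_F_mono[OF m, of u] s by auto
    show ?thesis unfolding at_i_def by measurable
  qed
  note xM = measurable_F_M[OF xu]
  have yM: "?y \<in> borel_measurable M" using momy(1) by (auto simp: at_i_def)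
  have "(\<lambda>k. \<integral>\<omega>. (if \<bar>?x \<omega>\<bar> \<le> real k then ?x \<omega> else 0) * ?y \<omega> \<partial>M) \<longlonglongrightarrow> (\<integral>\<omega>. ?x \<omega> * ?y \<omega> \<partial>M)"
    and ixy: "integrable M (\<lambda>\<omega>. ?x \<omega> * ?y \<omega>)"
  proof -
    have ww: "integrable M (\<lambda>\<omega>. (?x \<omega>)\<^sup>2 + (?y \<omega>)\<^sup>2)" using ix iy by simp
    have le: "\<bar>a * b\<bar> \<le> a\<^sup>2 + b\<^sup>2" for a b :: real
    proof -
      have "2 * (\<bar>a\<bar> * \<bar>b\<bar>) \<le> a\<^sup>2 + b\<^sup>2" using sum_squares_bound[of "\<bar>a\<bar>" "\<bar>b\<bar>"] by simp
      moreover have "0 \<le> \<bar>a\<bar> * \<bar>b\<bar>" by simp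
      ultimately show ?thesis unfolding abs_mult by linarith
    qed
    show "integrable M (\<lambda>\<omega>. ?x \<omega> * ?y \<omega>)"
      by (rule Bochner_Integration.integrable_bound[OF ww]) (use xM yM le in auto)
    show "(\<lambda>k. \<integral>\<omega>. (if \<bar>?x \<omega>\<bar> \<le> real k then ?x \<omega> else 0) * ?y \<omega> \<partial>M) \<longlonglongrightarrow> (\<integral>\<omega>. ?x \<omega> * ?y \<omega> \<partial>M)"
    proof (rule integral_dominated_convergence[OF _ _ ww])
      show "AE \<omega> in M. (\<lambda>k. (if \<bar>?x \<omega>\<bar> \<le> real k then ?x \<omega> else 0) * ?y \<omega>) \<longlonglongrightarrow> ?x \<omega> * ?y \<omega>"
      proof (rule AE_I2)
        fix \<omega>
        obtain N :: nat where "\<bar>?x \<omega>\<bar> \<le> real N" using real_arch_simple by blast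
        then have "eventually (\<lambda>k. (if \<bar>?x \<omega>\<bar> \<le> real k then ?x \<omega> else 0) * ?y \<omega> = ?x \<omega> * ?y \<omega>) sequentially"
          by (intro eventually_sequentiallyI[of N]) auto
        then show "(\<lambda>k. (if \<bar>?x \<omega>\<bar> \<le> real k then ?x \<omega> else 0) * ?y \<omega>) \<longlonglongrightarrow> ?x \<omega> * ?y \<omega>"
          by (rule tendsto_eventually)
      qed
      show "AE \<omega> in M. norm ((if \<bar>?x \<omega>\<bar> \<le> real k then ?x \<omega> else 0) * ?y \<omega>) \<le> (?x \<omega>)\<^sup>2 + (?y \<omega>)\<^sup>2" for k
        using le by (intro AE_I2) simp
    qed (use xM yM in measurable)
  qed
  moreover have "(\<integral>\<omega>. (if \<bar>?x \<omega>\<bar> \<le> real k then ?x \<omega> else 0) * ?y \<omega> \<partial>M) = 0" for k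
  proof -
    let ?\<eta> = "\<lambda>\<omega>. (if \<bar>?x \<omega>\<bar> \<le> real k then ?x \<omega> else 0) *\<^sub>R \<eta> \<omega>"
    have "(\<integral>\<omega>. ?\<eta> \<omega> \<bullet> (\<omega> v - \<omega> u) \<partial>M) = 0"
    proof (rule dX_moments(2)[OF ru s(4)])
      show "?\<eta> \<in> borel_measurable (F u)" using xu m' by measurable
      show "norm (?\<eta> \<omega>) \<le> real k * b'" if "\<omega> \<in> \<Omega>" for \<omega>
        using b'[OF that] order_trans[OF norm_ge_zero b'[OF that]] by (auto intro!: mult_mono)
    qed
    then show ?thesis by (simp add: at_i_def[of u])
  qed
  ultimately have z: "(\<integral>\<omega>. ?x \<omega> * ?y \<omega> \<partial>M) = 0" and "integrable M (\<lambda>\<omega>. ?x \<omega> * ?y \<omega>)"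
    using LIMSEQ_unique[OF _ tendsto_const] by auto
  moreover have "SP (at_h s t \<xi>) z \<bullet> SP (at_h u v \<eta>) z = 0" for z
    using s by (auto simp: SP_def at_h_def split: split_indicator)
  ultimately show ?thesis unfolding iso_def by simp
qed

text \<open>Overlapping intervals are cut at \<open>u\<close> and at the smaller right end, which
  leaves equal or disjoint ones; a height known at \<open>s\<close> stays known at the later
  cuts.\<close>

lemma iso_atoms_le:
  assumes "r \<le> s" "s \<le> t" "t \<le> T" "s \<le> u" "u \<le> v" "v \<le> T" and \<xi>: "bdF s \<xi>" and \<eta>: "bdF u \<eta>"
  shows "iso (at_h s t \<xi>) (at_i s t \<xi>) (at_h u v \<eta>) (at_i u v \<eta>)"
proof (cases "t \<le> u")
  case True
  then show ?thesis using assms by (intro iso_disjoint) auto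
next
  case False
  then have ut: "u \<le> t" by simp
  have ru: "r \<le> u" using assms by linarith
  have \<xi>u: "bdF u \<xi>" by (rule bdF_mono[OF \<xi> assms(4)])
  have A: "iso (at_h s u \<xi>) (at_i s u \<xi>) (at_h u v \<eta>) (at_i u v \<eta>)"
    using assms by (intro iso_disjoint) auto
  have B: "iso (at_h u t \<xi>) (at_i u t \<xi>) (at_h u v \<eta>) (at_i u v \<eta>)"
  proof (cases "t \<le> v")
    case True
    have "iso (at_h u t \<xi>) (at_i u t \<xi>) (at_h u t \<eta>) (at_i u t \<eta>)"
      using assms ru ut \<xi>u by (intro iso_same) auto
    moreover have "iso (at_h u t \<xi>) (at_i u t \<xi>) (at_h t v \<eta>) (at_i t v \<eta>)"
      using assms ru ut \<xi>u True bdF_mono[OF \<eta> ut] by (intro iso_disjoint) auto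
    ultimately show ?thesis unfolding at_split[OF ut True, of \<eta>] by (rule iso_add_right)
  next
    case False
    then have vt: "v \<le> t" by simp
    have "iso (at_h u v \<xi>) (at_i u v \<xi>) (at_h u v \<eta>) (at_i u v \<eta>)"
      using assms ru \<xi>u by (intro iso_same) auto
    moreover have "iso (at_h v t \<xi>) (at_i v t \<xi>) (at_h u v \<eta>) (at_i u v \<eta>)"
      using assms ru vt bdF_mono[OF \<xi>u assms(5)] by (intro iso_sym[OF iso_disjoint]) auto
    ultimately show ?thesis unfolding at_split[OF assms(5) vt, of \<xi>] by (rule iso_add)
  qed
  show ?thesis unfolding at_split[OF assms(4) ut, of \<xi>] by (rule iso_add[OF A B])
qed

lemma iso_atoms:
  assumes "r \<le> s" "s \<le> t" "t \<le> T" "r \<le> u" "u \<le> v" "v \<le> T" and \<xi>: "bdF s \<xi>" and \<eta>: "bdF u \<eta>"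
  shows "iso (at_h s t \<xi>) (at_i s t \<xi>) (at_h u v \<eta>) (at_i u v \<eta>)"
proof (cases "s \<le> u")
  case False
  then show ?thesis using assms by (intro iso_sym[OF iso_atoms_le]) auto
qed (use assms in \<open>intro iso_atoms_le; auto\<close>)

text \<open>Pairs of an elementary process and its integral. Working with the additive closure of the one-step
  processes instead of with partitions avoids common refinements in the proof of the isometry.\<close>

inductive_set elem :: "((real \<Rightarrow> 'n path \<Rightarrow> real ^ 'n) \<times> ('n path \<Rightarrow> real)) set" where
  atom: "r \<le> s \<Longrightarrow> s \<le> t \<Longrightarrow> t \<le> T \<Longrightarrow> bdF s \<xi> \<Longrightarrow> (at_h s t \<xi>, at_i s t \<xi>) \<in> elem"
| add: "(h, I) \<in> elem \<Longrightarrow> (h', I') \<in> elem \<Longrightarrow> (\<lambda>x \<omega>. h x \<omega> + h' x \<omega>, \<lambda>\<omega>. I \<omega> + I' \<omega>) \<in> elem"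

lemma elem_iso_atom:
  assumes st: "r \<le> s" "s \<le> t" "t \<le> T" "bdF s \<xi>"
  shows "(k, J) \<in> elem \<Longrightarrow> iso (at_h s t \<xi>) (at_i s t \<xi>) k J"
  by (induction rule: elem.induct) (auto intro!: iso_atoms iso_add_right st)

lemma elem_iso: "(h, I) \<in> elem \<Longrightarrow> (k, J) \<in> elem \<Longrightarrow> iso h I k J"
  by (induction rule: elem.induct) (auto intro!: elem_iso_atom iso_add)

lemma elem_uminus: "(h, I) \<in> elem \<Longrightarrow> (\<lambda>x \<omega>. - h x \<omega>, \<lambda>\<omega>. - I \<omega>) \<in> elem"
proof (induction rule: elem.induct)
  case (atom s t \<xi>)
  have "bdF s (\<lambda>\<omega>. - \<xi> \<omega>)" using atom by (auto simp: bdF_def)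
  from elem.atom[OF atom(1-3) this] show ?case by (simp add: at_h_def at_i_def)
next
  case (add h I h' I')
  from elem.add[OF add.IH] show ?case by simp
qed

lemma elem_diff: "(h, I) \<in> elem \<Longrightarrow> (h', I') \<in> elem \<Longrightarrow> (\<lambda>x \<omega>. h x \<omega> - h' x \<omega>, \<lambda>\<omega>. I \<omega> - I' \<omega>) \<in> elem"
  using elem.add[OF _ elem_uminus[of h' I'], of h I] by simp

lemma elem_measurable: "(h, I) \<in> elem \<Longrightarrow> jm r T h \<and> I \<in> borel_measurable M"
proof (induction rule: elem.induct)
  case (atom s t \<xi>)
  have "\<xi> \<in> borel_measurable (F t)" using atom measurable_F_mono by (auto simp: bdF_def)
  then have "at_i s t \<xi> \<in> borel_measurable (F t)"
    unfolding at_i_def using dX_measurable[OF atom(1,2) order_refl] by measurable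
  then show ?case using atom by (auto intro: jm_at measurable_F_M)
next
  case (add h I h' I')
  then have "jm r T (\<lambda>x \<omega>. h x \<omega> + h' x \<omega>)"
    unfolding jm_def by (auto simp: case_prod_beta' scaleR_add_right intro!: borel_measurable_add)
  with add show ?case by auto
qed

lemma elem_isometry:
  assumes "(h, I) \<in> elem"
  shows "(\<integral>\<^sup>+\<omega>. ennreal ((I \<omega>)\<^sup>2) \<partial>M) = (\<integral>\<^sup>+z. ennreal ((norm (SP h z))\<^sup>2) \<partial>PM)"
proof -
  have "iso h I h I" by (rule elem_iso[OF assms assms])
  then have i: "integrable M (\<lambda>\<omega>. (I \<omega>)\<^sup>2)" "integrable PM (\<lambda>z. (norm (SP h z))\<^sup>2)"
    and eq: "(\<integral>\<omega>. (I \<omega>)\<^sup>2 \<partial>M) = (\<integral>z. (norm (SP h z))\<^sup>2 \<partial>PM)"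
    by (simp_all add: iso_def power2_norm_eq_inner power2_eq_square[of "I _"])
  show ?thesis
    by (subst nn_integral_eq_integral[OF i(1)], simp, subst nn_integral_eq_integral[OF i(2)], simp, simp add: eq)
qed

lemma simple_in_elem:
  assumes "r \<le> p 0" "p N \<le> T" "\<And>i. i < N \<Longrightarrow> p i \<le> p (Suc i) \<and> bdF (p i) (\<xi> i)"
  shows "(simple_process N p \<xi>, simple_integral N p \<xi>) \<in> elem"
  using assms
proof (induction N)
  case 0
  \<comment> \<open>The empty sum has to be generated too: it is the atom of height zero on a
    degenerate interval.\<close>
  have "bdF r (\<lambda>_. 0)" by (auto simp: bdF_def)
  from elem.atom[OF order_refl order_refl rT this]
  have "((\<lambda>x \<omega>. 0), (\<lambda>\<omega>. 0)) \<in> elem" by (simp add: at_h_def at_i_def)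
  moreover have "simple_process 0 p \<xi> = (\<lambda>x \<omega>. 0)" "simple_integral 0 p \<xi> = (\<lambda>\<omega>. 0)"
    by (auto simp: simple_process_def simple_integral_def fun_eq_iff)
  ultimately show ?case by simp
next
  case (Suc N)
  have mono: "p 0 \<le> p i" if "i \<le> N" for i
    using that Suc.prems(3) by (induction i) (auto intro: order_trans)
  have "p N \<le> p (Suc N)" using Suc.prems(3)[of N] by simp
  then have IH: "(simple_process N p \<xi>, simple_integral N p \<xi>) \<in> elem"
    using Suc.prems order_trans[OF \<open>p N \<le> p (Suc N)\<close> Suc.prems(2)] by (intro Suc.IH) auto
  have "r \<le> p N" using mono[of N] Suc.prems by auto
  then have "(at_h (p N) (p (Suc N)) (\<xi> N), at_i (p N) (p (Suc N)) (\<xi> N)) \<in> elem"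
    using Suc.prems by (intro elem.atom) auto
  moreover have "simple_process (Suc N) p \<xi> = (\<lambda>x \<omega>. simple_process N p \<xi> x \<omega> + at_h (p N) (p (Suc N)) (\<xi> N) x \<omega>)"
    "simple_integral (Suc N) p \<xi> = (\<lambda>\<omega>. simple_integral N p \<xi> \<omega> + at_i (p N) (p (Suc N)) (\<xi> N) \<omega>)"
    by (intro ext, simp only: simple_process_def simple_integral_def at_h_def at_i_def sum.lessThan_Suc)+
  ultimately show ?case using elem.add[OF IH] by simp
qed

text \<open>Given time \<open>p N\<close>, at which all earlier factors are known, the last factor
  has conditional expectation one; the induction peels the factors off from the right.\<close>

lemma nn_integral_mult_prod_W:
  assumes "r \<le> p 0" "\<And>i. i < N \<Longrightarrow> p i \<le> p (Suc i) \<and> bdF (p i) (\<xi> i)"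
    and f: "f \<in> borel_measurable (F (p 0))"
  shows "(\<integral>\<^sup>+\<omega>. (f \<omega> :: ennreal) * ennreal (\<Prod>i<N. W (p i) (p (Suc i)) (\<xi> i) \<omega>) \<partial>M) = (\<integral>\<^sup>+\<omega>. f \<omega> \<partial>M)"
  using assms(2)
proof (induction N)
  case (Suc N)
  have mono: "i \<le> j \<Longrightarrow> j \<le> Suc N \<Longrightarrow> p i \<le> p j" for i j
    using Suc.prems by (induction j) (auto simp: le_Suc_eq intro: order_trans)
  have rN: "r \<le> p N" using mono[of 0 N] assms(1) by auto
  have Wi: "W (p i) (p (Suc i)) (\<xi> i) \<in> borel_measurable (F (p N))" if "i < N" for i
  proof -
    have "r \<le> p i" using mono[of 0 i] assms(1) that by auto
    then have "W (p i) (p (Suc i)) (\<xi> i) \<in> borel_measurable (F (p (Suc i)))"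
      using Suc.prems[of i] that by (intro W_measurable) (auto simp: bdF_def intro: measurable_F_mono)
    then show ?thesis using mono[of "Suc i" N] that by (auto intro: measurable_F_mono)
  qed
  have fN: "f \<in> borel_measurable (F (p N))" using measurable_F_mono[OF f] mono[of 0 N] by auto
  have g: "(\<lambda>\<omega>. f \<omega> * ennreal (\<Prod>i<N. W (p i) (p (Suc i)) (\<xi> i) \<omega>)) \<in> borel_measurable (F (p N))"
  proof -
    have "(\<lambda>\<omega>. \<Prod>i<N. W (p i) (p (Suc i)) (\<xi> i) \<omega>) \<in> borel_measurable (F (p N))"
      using Wi by (intro borel_measurable_prod) auto
    then show ?thesis using fN by measurable
  qed
  obtain b where b: "\<And>\<omega>. \<omega> \<in> \<Omega> \<Longrightarrow> norm (\<xi> N \<omega>) \<le> b" "\<xi> N \<in> borel_measurable (F (p N))"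
    using Suc.prems[of N] by (auto simp: bdF_def)
  have "(\<integral>\<^sup>+\<omega>. f \<omega> * ennreal (\<Prod>i<Suc N. W (p i) (p (Suc i)) (\<xi> i) \<omega>) \<partial>M) =
    (\<integral>\<^sup>+\<omega>. (f \<omega> * ennreal (\<Prod>i<N. W (p i) (p (Suc i)) (\<xi> i) \<omega>)) * ennreal (W (p N) (p (Suc N)) (\<xi> N) \<omega>) \<partial>M)"
    by (intro nn_integral_cong) (simp add: mult.assoc ennreal_mult'[symmetric] prod_nonneg W_def)
  also have "\<dots> = (\<integral>\<^sup>+\<omega>. f \<omega> * ennreal (\<Prod>i<N. W (p i) (p (Suc i)) (\<xi> i) \<omega>) \<partial>M)"
    using Suc.prems[of N] by (intro nn_integral_mult_W[OF rN _ b(2) b(1) g]) auto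
  also have "\<dots> = (\<integral>\<^sup>+\<omega>. f \<omega> \<partial>M)" using Suc by auto
  finally show ?case .
qed simp

lemma en_simple_process:
  assumes "r \<le> p 0" "\<And>i. i < N \<Longrightarrow> p i \<le> p (Suc i) \<and> bdF (p i) (\<xi> i)" and \<omega>: "\<omega> \<in> \<Omega>"
  shows "en (p 0) (p N) (simple_process N p \<xi>) \<omega> = (\<Sum>i<N. en (p i) (p (Suc i)) (\<lambda>_. \<xi> i) \<omega>)"
  using assms(2)
proof (induction N)
  case 0 then show ?case by (simp add: en_def set_lebesgue_integral_def)
next
  case (Suc N)
  have mono: "i \<le> j \<Longrightarrow> j \<le> Suc N \<Longrightarrow> p i \<le> p j" for i j
    using Suc.prems by (induction j) (auto simp: le_Suc_eq intro: order_trans)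
  let ?h = "simple_process (Suc N) p \<xi>" and ?f = "\<lambda>x. (norm (S x \<omega> (simple_process (Suc N) p \<xi> x \<omega>)))\<^sup>2"
  have e1: "?h x \<omega> = simple_process N p \<xi> x \<omega>" if "x \<le> p N" for x
    using that by (simp add: simple_process_def)
  have e2: "?h x \<omega> = \<xi> N \<omega>" if "p N < x" "x \<le> p (Suc N)" for x
  proof -
    have "indicator {p i<..p (Suc i)} x *\<^sub>R \<xi> i \<omega> = 0" if "i < N" for i
      using mono[of "Suc i" N] that \<open>p N < x\<close> by auto
    then have "(\<Sum>i<N. indicator {p i<..p (Suc i)} x *\<^sub>R \<xi> i \<omega>) = 0" by (intro sum.neutral) auto
    then show ?thesis unfolding simple_process_def sum.lessThan_Suc using that by simp
  qed
  have jm: "jm (p 0) (p (Suc N)) ?h"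
    using Suc.prems mono[of _ "Suc N"] by (intro jm_simple) (auto simp: bdF_def intro!: measurable_F_mono[of _ "p _" _ "p (Suc N)"])
  \<comment> \<open>Along a fixed path the heights are finitely many vectors, and the sum of their
    norms bounds the step process.\<close>
  have bdd: "norm (S x \<omega> (?h x \<omega>)) \<le> K * (\<Sum>i<Suc N. norm (\<xi> i \<omega>))" if "p 0 < x" for x
  proof -
    have "norm (?h x \<omega>) \<le> (\<Sum>i<Suc N. norm (\<xi> i \<omega>))"
      unfolding simple_process_def by (intro order_trans[OF norm_sum] sum_mono) (auto split: split_indicator)
    then have "K * norm (?h x \<omega>) \<le> K * (\<Sum>i<Suc N. norm (\<xi> i \<omega>))" using K_pos by (intro mult_left_mono) auto
    then show ?thesis using norm_S_le[of x \<omega> "?h x \<omega>"] that assms(1) by linarith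
  qed
  have i: "set_integrable lborel {p 0<..p (Suc N)} ?f"
    by (rule en_integrable[OF assms(1) jm \<omega> bdd])
  have un: "{p 0<..p (Suc N)} = {p 0<..p N} \<union> {p N<..p (Suc N)}" using mono[of 0 N] mono[of N "Suc N"] by auto
  have "en (p 0) (p (Suc N)) ?h \<omega> = (LINT x:{p 0<..p N} \<union> {p N<..p (Suc N)}|lborel. ?f x)"
    unfolding en_def un ..
  also have "\<dots> = (LINT x:{p 0<..p N}|lborel. ?f x) + (LINT x:{p N<..p (Suc N)}|lborel. ?f x)"
    using un by (intro set_integral_Un set_integrable_subset[OF i]) auto
  also have "(LINT x:{p 0<..p N}|lborel. ?f x) = en (p 0) (p N) (simple_process N p \<xi>) \<omega>"
    unfolding en_def by (intro set_lebesgue_integral_cong) (auto simp: e1)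
  also have "(LINT x:{p N<..p (Suc N)}|lborel. ?f x) = en (p N) (p (Suc N)) (\<lambda>_. \<xi> N) \<omega>"
    unfolding en_def by (intro set_lebesgue_integral_cong) (auto simp: e2)
  finally show ?case using Suc by simp
qed

end

section \<open>Mean square convergence\<close>

lemma ennreal_le_add_eps:
  fixes a b :: ennreal
  assumes "\<And>e::real. 0 < e \<Longrightarrow> a \<le> b + ennreal (c * e)" "0 < c"
  shows "a \<le> b"
proof (rule ennreal_le_epsilon)
  fix e :: real assume "0 < e"
  then show "a \<le> b + ennreal e" using assms(1)[of "e / c"] assms(2) by simp
qed

lemma norm_add_sq_le: "(norm (a + b))\<^sup>2 \<le> 2 * (norm a)\<^sup>2 + 2 * (norm b)\<^sup>2"
  for a b :: "'a::real_normed_vector"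
proof -
  have "(norm (a + b))\<^sup>2 \<le> (norm a + norm b)\<^sup>2" by (intro power_mono norm_triangle_ineq) simp
  also have "\<dots> \<le> 2 * (norm a)\<^sup>2 + 2 * (norm b)\<^sup>2"
    using sum_squares_bound[of "norm a" "norm b"] by (simp add: power2_sum)
  finally show ?thesis .
qed

text \<open>The squared \<open>L\<^sup>2\<close> norm stays in \<open>ennreal\<close>; the triangle
  inequality then costs a factor \<open>2\<close>, which is harmless for convergence.\<close>

definition nsq :: "'a measure \<Rightarrow> ('a \<Rightarrow> 'b::real_normed_vector) \<Rightarrow> ennreal" where
  "nsq M f = (\<integral>\<^sup>+x. ennreal ((norm (f x))\<^sup>2) \<partial>M)"

lemma nsq_add:
  fixes f g :: "'a \<Rightarrow> 'b::{real_normed_vector, second_countable_topology}"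
  assumes [measurable]: "f \<in> borel_measurable M" "g \<in> borel_measurable M"
  shows "nsq M (\<lambda>x. f x + g x) \<le> 2 * nsq M f + 2 * nsq M g"
proof -
  have "nsq M (\<lambda>x. f x + g x) \<le> (\<integral>\<^sup>+x. 2 * ennreal ((norm (f x))\<^sup>2) + 2 * ennreal ((norm (g x))\<^sup>2) \<partial>M)"
    unfolding nsq_def
  proof (rule nn_integral_mono)
    fix x
    have "ennreal ((norm (f x + g x))\<^sup>2) \<le> ennreal (2 * (norm (f x))\<^sup>2 + 2 * (norm (g x))\<^sup>2)"
      by (intro ennreal_leI norm_add_sq_le)
    also have "\<dots> = 2 * ennreal ((norm (f x))\<^sup>2) + 2 * ennreal ((norm (g x))\<^sup>2)"
      by (simp add: ennreal_plus ennreal_mult')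
    finally show "ennreal ((norm (f x + g x))\<^sup>2) \<le> 2 * ennreal ((norm (f x))\<^sup>2) + 2 * ennreal ((norm (g x))\<^sup>2)" .
  qed
  also have "\<dots> = 2 * nsq M f + 2 * nsq M g"
    unfolding nsq_def by (simp add: nn_integral_add nn_integral_cmult)
  finally show ?thesis .
qed

lemma nsq_minus_commute: "nsq M (\<lambda>x. f x - g x) = nsq M (\<lambda>x. g x - f x)"
  by (simp add: nsq_def norm_minus_commute)

lemma nsq_triangle:
  fixes f g h :: "'a \<Rightarrow> 'b::{real_normed_vector, second_countable_topology}"
  assumes [measurable]: "f \<in> borel_measurable M" "g \<in> borel_measurable M" "h \<in> borel_measurable M"
  shows "nsq M (\<lambda>x. f x - h x) \<le> 2 * nsq M (\<lambda>x. f x - g x) + 2 * nsq M (\<lambda>x. g x - h x)"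
  using nsq_add[of "\<lambda>x. f x - g x" M "\<lambda>x. g x - h x"] by simp

lemma nsq_AE_zero:
  fixes f :: "'a \<Rightarrow> real"
  assumes "f \<in> borel_measurable M" "nsq M f = 0"
  shows "AE x in M. f x = 0"
  using assms unfolding nsq_def by (subst (asm) nn_integral_0_iff_AE) (auto elim!: eventually_mono)

text \<open>Riesz-Fischer: a subsequence with summable \<open>L\<^sup>1\<close> increments converges
  almost surely, and Fatou turns the Cauchy bounds into convergence of the whole sequence. Taking
  \<open>lim\<close> pathwise keeps the limit measurable in \<open>G\<close>.\<close>

lemma (in prob_space) L2_complete:
  fixes I :: "nat \<Rightarrow> 'a \<Rightarrow> real"
  assumes G: "subalgebra M G" and IG: "\<And>k. I k \<in> borel_measurable G"
    and cauchy: "\<And>e::real. 0 < e \<Longrightarrow> \<exists>N. \<forall>m\<ge>N. \<forall>n\<ge>N. nsq M (\<lambda>\<omega>. I m \<omega> - I n \<omega>) < ennreal e"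
  shows "\<exists>J s. strict_mono (s :: nat \<Rightarrow> nat) \<and> J \<in> borel_measurable G \<and> (AE \<omega> in M. (\<lambda>k. I (s k) \<omega>) \<longlonglongrightarrow> J \<omega>) \<and>
    (\<lambda>k. nsq M (\<lambda>\<omega>. I k \<omega> - J \<omega>)) \<longlonglongrightarrow> 0"
proof -
  have IM[measurable]: "I k \<in> borel_measurable M" for k by (rule measurable_from_subalg[OF G IG])
  have "\<exists>s. \<forall>k. (\<forall>m\<ge>s k. \<forall>n\<ge>s k. nsq M (\<lambda>\<omega>. I m \<omega> - I n \<omega>) < ennreal ((1/4)^k)) \<and> s k < (s (Suc k) :: nat)"
  proof (rule dependent_nat_choice)
    show "\<exists>x. \<forall>m\<ge>x. \<forall>n\<ge>x. nsq M (\<lambda>\<omega>. I m \<omega> - I n \<omega>) < ennreal ((1/4)^0)"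
      by (rule cauchy) simp
    fix x k
    obtain N where N: "\<forall>m\<ge>N. \<forall>n\<ge>N. nsq M (\<lambda>\<omega>. I m \<omega> - I n \<omega>) < ennreal ((1/4)^Suc k)"
      using cauchy[of "(1/4)^Suc k"] by auto
    then show "\<exists>y. (\<forall>m\<ge>y. \<forall>n\<ge>y. nsq M (\<lambda>\<omega>. I m \<omega> - I n \<omega>) < ennreal ((1/4)^Suc k)) \<and> x < y"
      by (intro exI[of _ "max N (Suc x)"]) auto
  qed
  then obtain s where s: "\<And>k m n. s k \<le> m \<Longrightarrow> s k \<le> n \<Longrightarrow> nsq M (\<lambda>\<omega>. I m \<omega> - I n \<omega>) < ennreal ((1/4)^k)"
    and s_inc: "\<And>k. s k < (s (Suc k) :: nat)" by blast
  have sm: "strict_mono s" using s_inc by (simp add: strict_mono_Suc_iff)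
  define d where "d k \<omega> = I (s (Suc k)) \<omega> - I (s k) \<omega>" for k \<omega>
  have [measurable]: "d k \<in> borel_measurable M" for k unfolding d_def by measurable
  have dk: "(\<integral>\<^sup>+\<omega>. ennreal \<bar>d k \<omega>\<bar> \<partial>M) \<le> ennreal (2 * (1/2)^k)" for k
  proof -
    \<comment> \<open>The weight \<open>2^k\<close> balances the rate \<open>(1/4)^k\<close> of the
      squared norms against the summable \<open>(1/2)^k\<close>.\<close>
    have le: "\<bar>a\<bar> \<le> (1/2)^k + 2^k * a\<^sup>2" for a :: real
    proof (cases "\<bar>a\<bar> \<le> (1/2)^k")
      case True then show ?thesis by (simp add: add_increasing2)
    next
      case False
      then have "1 \<le> 2^k * \<bar>a\<bar>" by (simp add: field_simps power_divide not_le less_imp_le)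
      then have "\<bar>a\<bar> * 1 \<le> \<bar>a\<bar> * (2^k * \<bar>a\<bar>)" by (intro mult_left_mono) auto
      also have "\<dots> = 2^k * a\<^sup>2" by (simp add: power2_eq_square abs_mult_self_eq mult.left_commute)
      finally show ?thesis by (simp add: add_increasing)
    qed
    have "(\<integral>\<^sup>+\<omega>. ennreal \<bar>d k \<omega>\<bar> \<partial>M) \<le> (\<integral>\<^sup>+\<omega>. ennreal ((1/2)^k) + ennreal (2^k) * ennreal ((norm (d k \<omega>))\<^sup>2) \<partial>M)"
    proof (rule nn_integral_mono)
      fix \<omega>
      have "ennreal \<bar>d k \<omega>\<bar> \<le> ennreal ((1/2)^k + 2^k * (d k \<omega>)\<^sup>2)" by (rule ennreal_leI[OF le])
      then show "ennreal \<bar>d k \<omega>\<bar> \<le> ennreal ((1/2)^k) + ennreal (2^k) * ennreal ((norm (d k \<omega>))\<^sup>2)"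
        by (simp add: ennreal_plus ennreal_mult' del: ennreal_power)
    qed
    also have "\<dots> = ennreal ((1/2)^k) + ennreal (2^k) * nsq M (d k)"
      unfolding nsq_def by (simp add: nn_integral_add nn_integral_cmult emeasure_space_1 del: ennreal_power)
    also have "\<dots> \<le> ennreal ((1/2)^k) + ennreal (2^k) * ennreal ((1/4)^k)"
      unfolding d_def using s[of k "s (Suc k)" "s k"] s_inc[of k]
      by (intro add_left_mono mult_left_mono) auto
    also have "\<dots> = ennreal ((1/2)^k + 2^k * (1/4)^k)"
      by (simp add: ennreal_plus ennreal_mult' del: ennreal_power)
    also have "(1/2)^k + 2^k * (1/4)^k = 2 * ((1/2)^k :: real)"
      by (simp add: power_mult_distrib[symmetric])
    finally show ?thesis .
  qed
  have "(\<integral>\<^sup>+\<omega>. (\<Sum>k. ennreal \<bar>d k \<omega>\<bar>) \<partial>M) = (\<Sum>k. \<integral>\<^sup>+\<omega>. ennreal \<bar>d k \<omega>\<bar> \<partial>M)"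
    by (rule nn_integral_suminf) simp
  also have "\<dots> \<le> (\<Sum>k. ennreal (2 * (1/2)^k))" by (intro suminf_le dk summableI)
  also have "\<dots> = ennreal (\<Sum>k. 2 * (1/2)^k)"
    by (intro suminf_ennreal2 summable_mult summable_geometric) auto
  also have "\<dots> < \<infinity>" by simp
  finally have "AE \<omega> in M. (\<Sum>k. ennreal \<bar>d k \<omega>\<bar>) \<noteq> \<infinity>"
    by (intro nn_integral_noteq_infinite) auto
  then have conv: "AE \<omega> in M. convergent (\<lambda>k. I (s k) \<omega>)"
  proof eventually_elim
    case (elim \<omega>)
    have "summable (\<lambda>k. \<bar>d k \<omega>\<bar>)" by (rule summable_suminf_not_top) (use elim in auto)
    then have "summable (\<lambda>k. d k \<omega>)" by (rule summable_rabs_cancel)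
    then have "(\<lambda>n. I (s 0) \<omega> + (\<Sum>k<n. d k \<omega>)) \<longlonglongrightarrow> I (s 0) \<omega> + (\<Sum>k. d k \<omega>)"
      by (intro tendsto_intros summable_LIMSEQ)
    moreover have "I (s 0) \<omega> + (\<Sum>k<n. d k \<omega>) = I (s n) \<omega>" for n
      by (induction n) (simp_all add: d_def)
    ultimately show ?case by (auto simp: convergent_def)
  qed
  define J where "J \<omega> = lim (\<lambda>k. I (s k) \<omega>)" for \<omega>
  have JG: "J \<in> borel_measurable G" unfolding J_def[abs_def] by (rule borel_measurable_lim_metric[OF IG])
  have JM[measurable]: "J \<in> borel_measurable M" by (rule measurable_from_subalg[OF G JG])
  have ae: "AE \<omega> in M. (\<lambda>k. I (s k) \<omega>) \<longlonglongrightarrow> J \<omega>"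
    using conv by eventually_elim (simp add: J_def convergent_LIMSEQ_iff)
  have fatou: "nsq M (\<lambda>\<omega>. I m \<omega> - J \<omega>) \<le> ennreal ((1/4)^j)" if m: "s j \<le> m" for m j
  proof -
    have "nsq M (\<lambda>\<omega>. I m \<omega> - J \<omega>) = (\<integral>\<^sup>+\<omega>. liminf (\<lambda>k. ennreal ((norm (I m \<omega> - I (s k) \<omega>))\<^sup>2)) \<partial>M)"
      unfolding nsq_def
    proof (rule nn_integral_cong_AE)
      show "AE \<omega> in M. ennreal ((norm (I m \<omega> - J \<omega>))\<^sup>2) = liminf (\<lambda>k. ennreal ((norm (I m \<omega> - I (s k) \<omega>))\<^sup>2))"
        using ae
      proof eventually_elim
        case (elim \<omega>)
        then have "(\<lambda>k. ennreal ((norm (I m \<omega> - I (s k) \<omega>))\<^sup>2)) \<longlonglongrightarrow> ennreal ((norm (I m \<omega> - J \<omega>))\<^sup>2)"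
          by (intro tendsto_ennrealI tendsto_intros)
        then show ?case by (rule lim_imp_Liminf[OF trivial_limit_sequentially, symmetric])
      qed
    qed
    also have "\<dots> \<le> liminf (\<lambda>k. nsq M (\<lambda>\<omega>. I m \<omega> - I (s k) \<omega>))"
      unfolding nsq_def by (rule nn_integral_liminf) simp
    also have "\<dots> \<le> liminf (\<lambda>k::nat. ennreal ((1/4)^j))"
    proof (rule Liminf_mono, rule eventually_sequentiallyI[of j])
      fix k assume "j \<le> k"
      then have "s j \<le> s k" using sm by (simp add: strict_mono_less_eq)
      then show "nsq M (\<lambda>\<omega>. I m \<omega> - I (s k) \<omega>) \<le> ennreal ((1/4)^j)" using s[OF m] by (simp add: less_imp_le)
    qed
    also have "\<dots> = ennreal ((1/4)^j)" by (simp add: Liminf_const)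
    finally show ?thesis .
  qed
  have "(\<lambda>k. nsq M (\<lambda>\<omega>. I k \<omega> - J \<omega>)) \<longlonglongrightarrow> 0"
  proof (rule order_tendstoI)
    fix a :: ennreal assume "0 < a"
    have "(\<lambda>j. ennreal ((1/4)^j)) \<longlonglongrightarrow> ennreal 0" by (intro tendsto_ennrealI LIMSEQ_power_zero) simp
    then have "eventually (\<lambda>j. ennreal ((1/4)^j) < a) sequentially"
      using \<open>0 < a\<close> by (intro order_tendstoD(2)) auto
    then obtain j where "ennreal ((1/4)^j) < a" by (auto simp: eventually_sequentially)
    then show "eventually (\<lambda>k. nsq M (\<lambda>\<omega>. I k \<omega> - J \<omega>) < a) sequentially"
      using fatou by (intro eventually_sequentiallyI[of "s j"]) (auto intro: le_less_trans)
  qed simp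
  with sm JG ae show ?thesis by blast
qed

text \<open>Fatou gives one inequality. Boundedness in \<open>L\<^sup>2\<close> means uniform
  integrability, which rules out a loss of mass and gives the other.\<close>

lemma (in prob_space) nn_integral_limit_L2_bounded:
  fixes f :: "nat \<Rightarrow> 'a \<Rightarrow> real"
  assumes [measurable]: "\<And>k. f k \<in> borel_measurable M" "g \<in> borel_measurable M" "A \<in> sets M"
    and nn: "\<And>k \<omega>. 0 \<le> f k \<omega>" "\<And>\<omega>. 0 \<le> g \<omega>"
    and lim: "AE \<omega> in M. (\<lambda>k. f k \<omega>) \<longlonglongrightarrow> g \<omega>"
    and C: "\<And>k. (\<integral>\<^sup>+\<omega>. ennreal ((f k \<omega>)\<^sup>2) \<partial>M) \<le> ennreal C" "0 < C"
    and m: "\<And>k. (\<integral>\<^sup>+\<omega>\<in>A. f k \<omega> \<partial>M) = m"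
  shows "(\<integral>\<^sup>+\<omega>\<in>A. g \<omega> \<partial>M) = m"
proof (rule antisym)
  have "(\<integral>\<^sup>+\<omega>\<in>A. g \<omega> \<partial>M) = (\<integral>\<^sup>+\<omega>. liminf (\<lambda>k. ennreal (f k \<omega>) * indicator A \<omega>) \<partial>M)"
  proof (rule nn_integral_cong_AE)
    show "AE \<omega> in M. ennreal (g \<omega>) * indicator A \<omega> = liminf (\<lambda>k. ennreal (f k \<omega>) * indicator A \<omega>)"
      using lim
    proof eventually_elim
      case (elim \<omega>)
      then have "(\<lambda>k. ennreal (f k \<omega>) * indicator A \<omega>) \<longlonglongrightarrow> ennreal (g \<omega>) * indicator A \<omega>"
        by (auto intro!: tendsto_ennrealI split: split_indicator)
      then show ?case by (rule lim_imp_Liminf[OF trivial_limit_sequentially, symmetric])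
    qed
  qed
  also have "\<dots> \<le> liminf (\<lambda>k. \<integral>\<^sup>+\<omega>\<in>A. f k \<omega> \<partial>M)" by (rule nn_integral_liminf) simp
  also have "\<dots> = m" unfolding m by (simp add: Liminf_const)
  finally show "(\<integral>\<^sup>+\<omega>\<in>A. g \<omega> \<partial>M) \<le> m" .
  show "m \<le> (\<integral>\<^sup>+\<omega>\<in>A. g \<omega> \<partial>M)"
  proof (rule ennreal_le_add_eps[where c=C])
    fix e :: real assume e: "0 < e"
    \<comment> \<open>Above the level \<open>L\<close> one has
      \<open>f k \<omega> \<le> e * (f k \<omega>)\<^sup>2\<close>, so truncation at
      \<open>L\<close> loses at most \<open>C * e\<close>.\<close>
    define L where "L = 1 / e"
    have L: "0 < L" using e by (simp add: L_def)
    have lim2: "(\<lambda>k. \<integral>\<^sup>+\<omega>\<in>A. min (f k \<omega>) L \<partial>M) \<longlonglongrightarrow> (\<integral>\<^sup>+\<omega>\<in>A. min (g \<omega>) L \<partial>M)"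
    proof (rule nn_integral_dominated_convergence[where w="\<lambda>_. ennreal L"])
      show "AE \<omega> in M. ennreal (min (f k \<omega>) L) * indicator A \<omega> \<le> ennreal L" for k
        by (auto intro!: AE_I2 ennreal_leI split: split_indicator)
      show "AE \<omega> in M. (\<lambda>k. ennreal (min (f k \<omega>) L) * indicator A \<omega>) \<longlonglongrightarrow> ennreal (min (g \<omega>) L) * indicator A \<omega>"
        using lim by eventually_elim (auto intro!: tendsto_ennrealI tendsto_min split: split_indicator)
    qed (auto simp: emeasure_space_1)
    have "m \<le> (\<integral>\<^sup>+\<omega>\<in>A. min (f k \<omega>) L \<partial>M) + ennreal (C * e)" for k
    proof -
      have "m \<le> (\<integral>\<^sup>+\<omega>. ennreal (min (f k \<omega>) L) * indicator A \<omega> + ennreal e * ennreal ((f k \<omega>)\<^sup>2) \<partial>M)"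
        unfolding m[of k, symmetric]
      proof (rule nn_integral_mono)
        fix \<omega>
        have "f k \<omega> \<le> min (f k \<omega>) L + e * (f k \<omega>)\<^sup>2"
        proof (cases "f k \<omega> \<le> L")
          case False
          then have "1 \<le> e * f k \<omega>" using e by (simp add: L_def field_simps)
          then have "f k \<omega> * 1 \<le> f k \<omega> * (e * f k \<omega>)" using nn(1)[of k \<omega>] by (intro mult_left_mono) auto
          then have "f k \<omega> \<le> e * (f k \<omega>)\<^sup>2" by (simp add: power2_eq_square mult_ac)
          then show ?thesis using L False by linarith
        qed (use e in simp)
        then have "ennreal (f k \<omega>) \<le> ennreal (min (f k \<omega>) L) + ennreal e * ennreal ((f k \<omega>)\<^sup>2)"
          using nn(1)[of k \<omega>] L e by (simp add: ennreal_plus[symmetric] ennreal_mult'[symmetric] ennreal_leI del: ennreal_plus)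
        then show "ennreal (f k \<omega>) * indicator A \<omega> \<le> ennreal (min (f k \<omega>) L) * indicator A \<omega> + ennreal e * ennreal ((f k \<omega>)\<^sup>2)"
          by (auto split: split_indicator)
      qed
      also have "\<dots> = (\<integral>\<^sup>+\<omega>\<in>A. min (f k \<omega>) L \<partial>M) + ennreal e * (\<integral>\<^sup>+\<omega>. ennreal ((f k \<omega>)\<^sup>2) \<partial>M)"
        by (simp add: nn_integral_add nn_integral_cmult)
      also have "\<dots> \<le> (\<integral>\<^sup>+\<omega>\<in>A. min (f k \<omega>) L \<partial>M) + ennreal e * ennreal C"
        by (intro add_left_mono mult_left_mono C) simp
      also have "ennreal e * ennreal C = ennreal (C * e)" using e C(2) by (simp add: ennreal_mult'[symmetric] mult.commute)
      finally show ?thesis .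
    qed
    then have "m \<le> (\<integral>\<^sup>+\<omega>\<in>A. min (g \<omega>) L \<partial>M) + ennreal (C * e)"
      by (intro tendsto_lowerbound[OF tendsto_add[OF lim2 tendsto_const]]) auto
    also have "(\<integral>\<^sup>+\<omega>\<in>A. min (g \<omega>) L \<partial>M) \<le> (\<integral>\<^sup>+\<omega>\<in>A. g \<omega> \<partial>M)"
      by (intro nn_integral_mono) (auto intro!: ennreal_leI split: split_indicator)
    finally show "m \<le> (\<integral>\<^sup>+\<omega>\<in>A. g \<omega> \<partial>M) + ennreal (C * e)" by (simp add: add_right_mono)
  qed (rule C(2))
qed

text \<open>By Fatou the liminf of the sum of both squared errors vanishes almost surely, so both
  approximations are close at common indices. \<open>P\<close> enters pathwise, as it will be a
  condition on uncountably many times.\<close>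

lemma nsq_limits_AE_eq:
  fixes I I' :: "nat \<Rightarrow> 'a \<Rightarrow> real"
  assumes [measurable]: "\<And>k. I k \<in> borel_measurable M" "\<And>k. I' k \<in> borel_measurable M"
      "J \<in> borel_measurable M" "J' \<in> borel_measurable M"
    and lim: "(\<lambda>k. nsq M (\<lambda>\<omega>. I k \<omega> - J \<omega>)) \<longlonglongrightarrow> 0" "(\<lambda>k. nsq M (\<lambda>\<omega>. I' k \<omega> - J' \<omega>)) \<longlonglongrightarrow> 0"
    and eq: "\<And>k. AE \<omega> in M. P \<omega> \<longrightarrow> I k \<omega> = I' k \<omega>"
  shows "AE \<omega> in M. P \<omega> \<longrightarrow> J \<omega> = J' \<omega>"
proof -
  let ?d = "\<lambda>k \<omega>. ennreal ((norm (I k \<omega> - J \<omega>))\<^sup>2) + ennreal ((norm (I' k \<omega> - J' \<omega>))\<^sup>2)"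
  have "(\<integral>\<^sup>+\<omega>. liminf (\<lambda>k. ?d k \<omega>) \<partial>M) \<le> liminf (\<lambda>k. \<integral>\<^sup>+\<omega>. ?d k \<omega> \<partial>M)"
    by (rule nn_integral_liminf) simp
  also have "(\<lambda>k. \<integral>\<^sup>+\<omega>. ?d k \<omega> \<partial>M) = (\<lambda>k. nsq M (\<lambda>\<omega>. I k \<omega> - J \<omega>) + nsq M (\<lambda>\<omega>. I' k \<omega> - J' \<omega>))"
    unfolding nsq_def by (intro ext nn_integral_add) auto
  also have "liminf \<dots> = 0"
    using tendsto_add[OF lim] by (intro lim_imp_Liminf) auto
  finally have "(\<integral>\<^sup>+\<omega>. liminf (\<lambda>k. ?d k \<omega>) \<partial>M) = 0" by simp
  then have "AE \<omega> in M. liminf (\<lambda>k. ?d k \<omega>) = 0"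
    by (subst (asm) nn_integral_0_iff_AE) auto
  moreover have "AE \<omega> in M. \<forall>k. P \<omega> \<longrightarrow> I k \<omega> = I' k \<omega>" unfolding AE_all_countable using eq by blast
  ultimately show ?thesis
  proof eventually_elim
    case (elim \<omega>)
    show ?case
    proof
      assume P: "P \<omega>"
      have "ennreal ((J \<omega> - J' \<omega>)\<^sup>2 / 2) \<le> ?d k \<omega>" for k
      proof -
        have "J \<omega> - J' \<omega> = (J \<omega> - I k \<omega>) + (I' k \<omega> - J' \<omega>)" using elim P by simp
        then have "(J \<omega> - J' \<omega>)\<^sup>2 \<le> 2 * (norm (J \<omega> - I k \<omega>))\<^sup>2 + 2 * (norm (I' k \<omega> - J' \<omega>))\<^sup>2"
          using norm_add_sq_le[of "J \<omega> - I k \<omega>" "I' k \<omega> - J' \<omega>"] by simp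
        then have "(J \<omega> - J' \<omega>)\<^sup>2 / 2 \<le> (norm (I k \<omega> - J \<omega>))\<^sup>2 + (norm (I' k \<omega> - J' \<omega>))\<^sup>2"
          by (simp add: power2_commute[of "J \<omega>" "I k \<omega>"])
        then have "ennreal ((J \<omega> - J' \<omega>)\<^sup>2 / 2) \<le> ennreal ((norm (I k \<omega> - J \<omega>))\<^sup>2 + (norm (I' k \<omega> - J' \<omega>))\<^sup>2)"
          by (rule ennreal_leI)
        then show ?thesis by (simp only: ennreal_plus zero_le_power2)
      qed
      then have "liminf (\<lambda>k::nat. ennreal ((J \<omega> - J' \<omega>)\<^sup>2 / 2)) \<le> liminf (\<lambda>k. ?d k \<omega>)"
        by (intro Liminf_mono) auto
      then have "ennreal ((J \<omega> - J' \<omega>)\<^sup>2 / 2) \<le> 0" using elim by (simp add: Liminf_const)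
      then show "J \<omega> = J' \<omega>" by (simp add: ennreal_eq_0_iff)
    qed
  qed
qed

section \<open>Energy distance and integrals of approximable processes\<close>

context diffusion
begin

definition cut :: "real \<Rightarrow> real \<Rightarrow> (real \<Rightarrow> 'n path \<Rightarrow> real ^ 'n) \<Rightarrow> real \<Rightarrow> 'n path \<Rightarrow> real ^ 'n" where
  "cut u v H = (\<lambda>x \<omega>. indicator {u<..v} x *\<^sub>R H x \<omega>)"

text \<open>This is the squared energy distance that occurs in \<open>is_ito_integral\<close>,
  rewritten with \<open>S\<close>; see \<open>Dist_ito\<close>.\<close>

definition Dist :: "real \<Rightarrow> real \<Rightarrow> (real \<Rightarrow> 'n path \<Rightarrow> real ^ 'n) \<Rightarrow> (real \<Rightarrow> 'n path \<Rightarrow> real ^ 'n) \<Rightarrow> ennreal" where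
  "Dist u v H h = (\<integral>\<^sup>+\<omega>. (\<integral>\<^sup>+x\<in>{u<..v}. ennreal ((norm (S x \<omega> (H x \<omega> - h x \<omega>)))\<^sup>2) \<partial>lborel) \<partial>M)"

lemma SP_cut: "r \<le> u \<Longrightarrow> v \<le> T \<Longrightarrow> SP (cut u v H) z = indicator {u<..v} (fst z) *\<^sub>R S (fst z) (snd z) (H (fst z) (snd z))"
  by (auto simp: SP_def cut_def split: split_indicator)

lemma SP_cut_measurable:
  assumes "r \<le> u" "v \<le> T" "jm u v H"
  shows "SP (cut u v H) \<in> borel_measurable PM"
  using measurable_lborel_F_M[OF jm_S[OF assms(1,3), unfolded jm_def]]
  unfolding SP_cut[OF assms(1,2), abs_def] by (simp add: case_prod_beta')

lemma Dist_nsq: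
  assumes "r \<le> u" "v \<le> T" "jm u v H" "jm u v h"
  shows "Dist u v H h = nsq PM (\<lambda>z. SP (cut u v H) z - SP (cut u v h) z)"
proof -
  interpret P: pair_sigma_finite "lborel :: real measure" M by (rule pair_sigma_finite_PM)
  have eq: "ennreal ((norm (S x \<omega> (H x \<omega> - h x \<omega>)))\<^sup>2) * indicator {u<..v} x =
    ennreal ((norm (SP (cut u v H) (x, \<omega>) - SP (cut u v h) (x, \<omega>)))\<^sup>2)" for x \<omega>
    unfolding SP_cut[OF assms(1,2)] S_diff by (auto split: split_indicator)
  show ?thesis
    unfolding Dist_def eq nsq_def
    using SP_cut_measurable[OF assms(1,2,3)] SP_cut_measurable[OF assms(1,2,4)]
    by (intro P.nn_integral_snd) auto
qed

lemma Dist_commute: "Dist u v H h = Dist u v h H"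
  unfolding Dist_def S_diff by (simp add: norm_minus_commute)

lemma Dist_triangle:
  assumes "r \<le> u" "v \<le> T" "jm u v H" "jm u v h" "jm u v k"
  shows "Dist u v H k \<le> 2 * Dist u v H h + 2 * Dist u v h k"
  using assms SP_cut_measurable[OF assms(1,2)] by (simp add: Dist_nsq nsq_triangle)

lemma Dist_tendsto:
  assumes u: "r \<le> u" "u \<le> v" "v \<le> T" and jm: "\<And>k. jm u v (Hk k)" "jm u v H"
    and lim: "\<And>x \<omega>. u < x \<Longrightarrow> x \<le> v \<Longrightarrow> \<omega> \<in> \<Omega> \<Longrightarrow> (\<lambda>k. S x \<omega> (Hk k x \<omega>)) \<longlonglongrightarrow> S x \<omega> (H x \<omega>)"
    and B: "\<And>k x \<omega>. u < x \<Longrightarrow> x \<le> v \<Longrightarrow> \<omega> \<in> \<Omega> \<Longrightarrow> norm (S x \<omega> (Hk k x \<omega>)) \<le> B"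
      "\<And>x \<omega>. u < x \<Longrightarrow> x \<le> v \<Longrightarrow> \<omega> \<in> \<Omega> \<Longrightarrow> norm (S x \<omega> (H x \<omega>)) \<le> B"
  shows "(\<lambda>k. Dist u v (Hk k) H) \<longlonglongrightarrow> 0"
proof -
  have m: "SP (cut u v (Hk k)) \<in> borel_measurable PM" "SP (cut u v H) \<in> borel_measurable PM" for k
    using SP_cut_measurable[OF u(1,3)] jm by auto
  have "(\<lambda>k. \<integral>\<^sup>+z. ennreal ((norm (SP (cut u v (Hk k)) z - SP (cut u v H) z))\<^sup>2) \<partial>PM) \<longlonglongrightarrow> (\<integral>\<^sup>+z. 0 \<partial>PM)"
  proof (rule nn_integral_dominated_convergence[where w="\<lambda>z. ennreal ((2 * B)\<^sup>2) * indicator ({u<..v} \<times> space M) z"])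
    have "(\<integral>\<^sup>+z. ennreal ((2 * B)\<^sup>2) * indicator ({u<..v} \<times> space M) z \<partial>PM) = ennreal ((2 * B)\<^sup>2) * (emeasure lborel {u<..v} * emeasure M (space M))"
      by (subst nn_integral_cmult_indicator) (auto simp: emeasure_pair_measure_Times)
    also have "\<dots> < \<infinity>" using emeasure_space_1 u by (auto simp: ennreal_mult_less_top)
    finally show "(\<integral>\<^sup>+z. ennreal ((2 * B)\<^sup>2) * indicator ({u<..v} \<times> space M) z \<partial>PM) < \<infinity>" .
    show "AE z in PM. ennreal ((norm (SP (cut u v (Hk k)) z - SP (cut u v H) z))\<^sup>2) \<le> ennreal ((2 * B)\<^sup>2) * indicator ({u<..v} \<times> space M) z" for k
    proof (rule AE_I2)
      fix z assume "z \<in> space PM"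
      then obtain x \<omega> where z: "z = (x, \<omega>)" "\<omega> \<in> \<Omega>" by (cases z) (auto simp: space_pair_measure)
      show "ennreal ((norm (SP (cut u v (Hk k)) z - SP (cut u v H) z))\<^sup>2) \<le> ennreal ((2 * B)\<^sup>2) * indicator ({u<..v} \<times> space M) z"
      proof (cases "x \<in> {u<..v}")
        case True
        have "norm (S x \<omega> (Hk k x \<omega>) - S x \<omega> (H x \<omega>)) \<le> B + B"
          using B True z(2) by (intro order_trans[OF norm_triangle_ineq4] add_mono) auto
        then have "(norm (S x \<omega> (Hk k x \<omega>) - S x \<omega> (H x \<omega>)))\<^sup>2 \<le> (2 * B)\<^sup>2" by (intro power_mono) auto
        then show ?thesis using True z by (simp add: SP_cut[OF u(1,3)] ennreal_leI)
      qed (simp add: z SP_cut[OF u(1,3)])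
    qed
    show "AE z in PM. (\<lambda>k. ennreal ((norm (SP (cut u v (Hk k)) z - SP (cut u v H) z))\<^sup>2)) \<longlonglongrightarrow> 0"
    proof (rule AE_I2)
      fix z assume "z \<in> space PM"
      then obtain x \<omega> where z: "z = (x, \<omega>)" "\<omega> \<in> \<Omega>" by (cases z) (auto simp: space_pair_measure)
      have "(\<lambda>k. (norm (SP (cut u v (Hk k)) z - SP (cut u v H) z))\<^sup>2) \<longlonglongrightarrow> 0"
      proof (cases "x \<in> {u<..v}")
        case True
        have "(\<lambda>k. (norm (S x \<omega> (Hk k x \<omega>) - S x \<omega> (H x \<omega>)))\<^sup>2) \<longlonglongrightarrow> (norm (S x \<omega> (H x \<omega>) - S x \<omega> (H x \<omega>)))\<^sup>2"
          using lim[of x \<omega>] True z(2) by (intro tendsto_intros) auto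
        then show ?thesis using True z by (simp add: SP_cut[OF u(1,3)])
      qed (simp add: z SP_cut[OF u(1,3)])
      then show "(\<lambda>k. ennreal ((norm (SP (cut u v (Hk k)) z - SP (cut u v H) z))\<^sup>2)) \<longlonglongrightarrow> 0"
        using tendsto_ennrealI by fastforce
    qed
  qed (use m in measurable)
  then show ?thesis using jm by (simp add: Dist_nsq[OF u(1,3)] nsq_def)
qed

definition approx :: "real \<Rightarrow> real \<Rightarrow> (real \<Rightarrow> 'n path \<Rightarrow> real ^ 'n) \<Rightarrow> ('n path \<Rightarrow> real) \<Rightarrow> bool" where
  "approx u v H J \<longleftrightarrow> (\<forall>e>0. \<exists>N p \<xi>. simple_integrand F \<Omega> u v N p \<xi> \<and>
     Dist u v H (simple_process N p \<xi>) < ennreal e \<and> nsq M (\<lambda>\<omega>. simple_integral N p \<xi> \<omega> - J \<omega>) < ennreal e)"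

section \<open>Stochastic integrals of left continuous processes\<close>

text \<open>\<open>good u v H J\<close> says that \<open>J\<close> is the integral of \<open>H\<close> over \<open>(u,v]\<close>. The exponential identity is
  carried along because it passes to limits with bounded energy \<open>en u v H\<close>, the families in question
  being bounded in \<open>L\<^sup>2\<close> (apply the identity with \<open>2 * c\<close>), and makes Novikov's criterion unnecessary.\<close>

definition good :: "real \<Rightarrow> real \<Rightarrow> (real \<Rightarrow> 'n path \<Rightarrow> real ^ 'n) \<Rightarrow> ('n path \<Rightarrow> real) \<Rightarrow> bool" where
  "good u v H J \<longleftrightarrow> jm u v H \<and> J \<in> borel_measurable (F v) \<and> approx u v H J \<and>
     (\<forall>c. \<forall>A\<in>sets (F u). (\<integral>\<^sup>+\<omega>\<in>A. exp (c * J \<omega> - c\<^sup>2 * en u v H \<omega> / 2) \<partial>M) = emeasure M A)"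

lemma simple_integrandD:
  assumes s: "simple_integrand F \<Omega> u v N p \<xi>" and u: "r \<le> u" "v \<le> T"
  shows "p 0 = u" "p N = v" "\<And>i. i < N \<Longrightarrow> p i \<le> p (Suc i) \<and> bdF (p i) (\<xi> i)"
    "(simple_process N p \<xi>, simple_integral N p \<xi>) \<in> elem" "jm u v (simple_process N p \<xi>)"
    "cut u v (simple_process N p \<xi>) = simple_process N p \<xi>" "simple_integral N p \<xi> \<in> borel_measurable (F v)"
proof -
  show p0: "p 0 = u" and pN: "p N = v" and st: "\<And>i. i < N \<Longrightarrow> p i \<le> p (Suc i) \<and> bdF (p i) (\<xi> i)"
    using s by (auto simp: simple_integrand_def bdF_def bounded_iff)
  have mono: "p i \<le> p j" if "i \<le> j" "j \<le> N" for i j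
    using that
  proof (induction j)
    case (Suc j)
    then show ?case using st[of j] by (cases "i = Suc j") (auto intro: order_trans)
  qed simp
  show "(simple_process N p \<xi>, simple_integral N p \<xi>) \<in> elem"
    using u p0 pN st by (intro simple_in_elem) auto
  have \<xi>v: "\<xi> i \<in> borel_measurable (F v)" if "i < N" for i
    using st[OF that] mono[of i N] pN that measurable_F_mono by (auto simp: bdF_def)
  then show "jm u v (simple_process N p \<xi>)" by (rule jm_simple)
  show "cut u v (simple_process N p \<xi>) = simple_process N p \<xi>"
  proof (intro ext)
    fix x \<omega>
    show "cut u v (simple_process N p \<xi>) x \<omega> = simple_process N p \<xi> x \<omega>"
    proof (cases "x \<in> {u<..v}")
      case False
      have "indicator {p i<..p (Suc i)} x *\<^sub>R \<xi> i \<omega> = 0" if "i < N" for i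
        using mono[of 0 i] mono[of "Suc i" N] that False p0 pN by auto
      then have "simple_process N p \<xi> x \<omega> = 0" unfolding simple_process_def by (intro sum.neutral) auto
      then show ?thesis by (simp add: cut_def)
    qed (simp add: cut_def)
  qed
  show "simple_integral N p \<xi> \<in> borel_measurable (F v)"
    unfolding simple_integral_def
  proof (intro borel_measurable_sum borel_measurable_inner)
    fix i assume "i \<in> {..<N}"
    then have i: "i < N" by simp
    show "\<xi> i \<in> borel_measurable (F v)" by (rule \<xi>v[OF i])
    show "(\<lambda>\<omega>. \<omega> (p (Suc i)) - \<omega> (p i)) \<in> borel_measurable (F v)"
      using mono[of 0 i] mono[of i "Suc i"] mono[of "Suc i" N] i p0 pN u by (intro dX_measurable) auto
  qed
qed

text \<open>The exponent is a sum over the steps, so the exponential is a product of factors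
  \<open>W\<close>; the constant \<open>c\<close> is absorbed by scaling the heights.\<close>

lemma good_simple:
  assumes s: "simple_integrand F \<Omega> u v N p \<xi>" and u: "r \<le> u" "u \<le> v" "v \<le> T"
  shows "good u v (simple_process N p \<xi>) (simple_integral N p \<xi>)"
proof -
  note d = simple_integrandD[OF s u(1,3)]
  have "approx u v (simple_process N p \<xi>) (simple_integral N p \<xi>)"
    unfolding approx_def
  proof (intro allI impI exI conjI)
    fix e :: real assume "0 < e"
    then show "Dist u v (simple_process N p \<xi>) (simple_process N p \<xi>) < ennreal e"
      "nsq M (\<lambda>\<omega>. simple_integral N p \<xi> \<omega> - simple_integral N p \<xi> \<omega>) < ennreal e"
      by (simp_all add: Dist_def nsq_def)
  qed (rule s)
  moreover have "(\<integral>\<^sup>+\<omega>\<in>A. exp (c * simple_integral N p \<xi> \<omega> - c\<^sup>2 * en u v (simple_process N p \<xi>) \<omega> / 2) \<partial>M) = emeasure M A"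
    if A: "A \<in> sets (F u)" for c A
  proof -
    let ?\<xi> = "\<lambda>i \<omega>. c *\<^sub>R \<xi> i \<omega>"
    have b: "p i \<le> p (Suc i) \<and> bdF (p i) (?\<xi> i)" if i: "i < N" for i
    proof -
      obtain b where "\<forall>\<omega>\<in>\<Omega>. norm (\<xi> i \<omega>) \<le> b" using d(3)[OF i] by (auto simp: bdF_def)
      then have "\<forall>\<omega>\<in>\<Omega>. norm (c *\<^sub>R \<xi> i \<omega>) \<le> \<bar>c\<bar> * b" by (auto intro: mult_left_mono)
      then show ?thesis using d(3)[OF i] by (auto simp: bdF_def)
    qed
    have "(\<integral>\<^sup>+\<omega>\<in>A. exp (c * simple_integral N p \<xi> \<omega> - c\<^sup>2 * en u v (simple_process N p \<xi>) \<omega> / 2) \<partial>M) =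
      (\<integral>\<^sup>+\<omega>. indicator A \<omega> * ennreal (\<Prod>i<N. W (p i) (p (Suc i)) (?\<xi> i) \<omega>) \<partial>M)"
    proof (rule nn_integral_cong)
      fix \<omega> assume "\<omega> \<in> space M"
      then have \<omega>: "\<omega> \<in> \<Omega>" by simp
      have "(\<Prod>i<N. W (p i) (p (Suc i)) (?\<xi> i) \<omega>) =
        exp (\<Sum>i<N. c * (\<xi> i \<omega> \<bullet> (\<omega> (p (Suc i)) - \<omega> (p i))) - c\<^sup>2 * en (p i) (p (Suc i)) (\<lambda>_. \<xi> i) \<omega> / 2)"
        unfolding W_def en_scaleR[of _ _ c "\<lambda>_. \<xi> _"] by (simp add: exp_sum)
      also have "(\<Sum>i<N. c * (\<xi> i \<omega> \<bullet> (\<omega> (p (Suc i)) - \<omega> (p i))) - c\<^sup>2 * en (p i) (p (Suc i)) (\<lambda>_. \<xi> i) \<omega> / 2) =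
        c * simple_integral N p \<xi> \<omega> - c\<^sup>2 * en u v (simple_process N p \<xi>) \<omega> / 2"
        using en_simple_process[of p N \<xi> \<omega>] d(1,2,3) u \<omega>
        by (simp add: simple_integral_def sum_subtractf sum_distrib_left sum_divide_distrib)
      finally show "ennreal (exp (c * simple_integral N p \<xi> \<omega> - c\<^sup>2 * en u v (simple_process N p \<xi>) \<omega> / 2)) * indicator A \<omega> =
        indicator A \<omega> * ennreal (\<Prod>i<N. W (p i) (p (Suc i)) (?\<xi> i) \<omega>)" by (simp add: mult.commute)
    qed
    also have "\<dots> = (\<integral>\<^sup>+\<omega>. indicator A \<omega> \<partial>M)"
      using A u d(1) b by (intro nn_integral_mult_prod_W) auto
    also have "\<dots> = emeasure M A" using A sets_F_sub_M[of u] by (subst nn_integral_indicator) auto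
    finally show ?thesis .
  qed
  ultimately show ?thesis unfolding good_def using d by blast
qed

text \<open>The closure of the elementary pairs in \<open>L\<^sup>2\<close>. It does not mention partitions, so integrals over
  different intervals can be compared in it.\<close>

definition L2el :: "(real \<times> 'n path \<Rightarrow> real ^ 'n) \<Rightarrow> ('n path \<Rightarrow> real) \<Rightarrow> bool" where
  "L2el G J \<longleftrightarrow> G \<in> borel_measurable PM \<and> J \<in> borel_measurable M \<and>
     (\<forall>e>0. \<exists>h I. (h, I) \<in> elem \<and> nsq PM (\<lambda>z. G z - SP h z) < ennreal e \<and> nsq M (\<lambda>\<omega>. J \<omega> - I \<omega>) < ennreal e)"

lemma good_L2el:
  assumes g: "good u v H J" and u: "r \<le> u" "u \<le> v" "v \<le> T"
  shows "L2el (SP (cut u v H)) J"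
  unfolding L2el_def
proof (intro conjI allI impI)
  have jm: "jm u v H" and J: "J \<in> borel_measurable (F v)" and a: "approx u v H J" using g by (auto simp: good_def)
  show "SP (cut u v H) \<in> borel_measurable PM" by (rule SP_cut_measurable[OF u(1,3) jm])
  show "J \<in> borel_measurable M" by (rule measurable_F_M[OF J])
  fix e :: real assume "0 < e"
  then obtain N p \<xi> where s: "simple_integrand F \<Omega> u v N p \<xi>"
    and d: "Dist u v H (simple_process N p \<xi>) < ennreal e" "nsq M (\<lambda>\<omega>. simple_integral N p \<xi> \<omega> - J \<omega>) < ennreal e"
    using a unfolding approx_def by blast
  note sd = simple_integrandD[OF s u(1,3)]
  have "nsq PM (\<lambda>z. SP (cut u v H) z - SP (simple_process N p \<xi>) z) < ennreal e"
    using d(1) Dist_nsq[OF u(1,3) jm sd(5)] by (simp add: sd(6))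
  moreover have "nsq M (\<lambda>\<omega>. J \<omega> - simple_integral N p \<xi> \<omega>) < ennreal e"
    using d(2) by (subst nsq_minus_commute)
  ultimately show "\<exists>h I. (h, I) \<in> elem \<and> nsq PM (\<lambda>z. SP (cut u v H) z - SP h z) < ennreal e \<and> nsq M (\<lambda>\<omega>. J \<omega> - I \<omega>) < ennreal e"
    using sd(4) by blast
qed

lemma L2el_diff:
  assumes "L2el G J" "L2el G' J'"
  shows "L2el (\<lambda>z. G z - G' z) (\<lambda>\<omega>. J \<omega> - J' \<omega>)"
  unfolding L2el_def
proof (intro conjI allI impI)
  have [measurable]: "G \<in> borel_measurable PM" "G' \<in> borel_measurable PM" "J \<in> borel_measurable M" "J' \<in> borel_measurable M"
    using assms by (auto simp: L2el_def)
  show "(\<lambda>z. G z - G' z) \<in> borel_measurable PM" "(\<lambda>\<omega>. J \<omega> - J' \<omega>) \<in> borel_measurable M" by measurable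
  fix e :: real assume "0 < e"
  then have e4: "0 < e / 4" by simp
  obtain h I where h: "(h, I) \<in> elem" "nsq PM (\<lambda>z. G z - SP h z) < ennreal (e / 4)" "nsq M (\<lambda>\<omega>. J \<omega> - I \<omega>) < ennreal (e / 4)"
    using assms(1) e4 unfolding L2el_def by blast
  obtain h' I' where h': "(h', I') \<in> elem" "nsq PM (\<lambda>z. G' z - SP h' z) < ennreal (e / 4)" "nsq M (\<lambda>\<omega>. J' \<omega> - I' \<omega>) < ennreal (e / 4)"
    using assms(2) e4 unfolding L2el_def by blast
  have [measurable]: "SP h \<in> borel_measurable PM" "SP h' \<in> borel_measurable PM" "I \<in> borel_measurable M" "I' \<in> borel_measurable M"
    using elem_measurable[OF h(1)] elem_measurable[OF h'(1)] SP_measurable by auto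
  have sum: "2 * a + 2 * b < ennreal e" if ab: "a < ennreal (e / 4)" "b < ennreal (e / 4)" for a b
  proof -
    obtain x y where xy: "a = ennreal x" "b = ennreal y" "0 \<le> x" "0 \<le> y"
      using ab by (cases a; cases b) auto
    then have "x < e / 4" "y < e / 4" using ab by (auto simp: ennreal_less_iff)
    then have "ennreal (2 * x + 2 * y) < ennreal e" using xy by (intro ennreal_lessI) auto
    moreover have "2 * a + 2 * b = ennreal (2 * x + 2 * y)" using xy by (simp add: ennreal_plus ennreal_mult')
    ultimately show ?thesis by simp
  qed
  have "nsq PM (\<lambda>z. (G z - G' z) - SP (\<lambda>x \<omega>. h x \<omega> - h' x \<omega>) z) \<le> 2 * nsq PM (\<lambda>z. G z - SP h z) + 2 * nsq PM (\<lambda>z. SP h' z - G' z)"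
    using nsq_add[of "\<lambda>z. G z - SP h z" PM "\<lambda>z. SP h' z - G' z"] by (simp add: SP_diff algebra_simps)
  also have "\<dots> < ennreal e" using h(2) h'(2) nsq_minus_commute[of PM G' "SP h'"] by (intro sum) auto
  finally have 1: "nsq PM (\<lambda>z. (G z - G' z) - SP (\<lambda>x \<omega>. h x \<omega> - h' x \<omega>) z) < ennreal e" .
  have "nsq M (\<lambda>\<omega>. (J \<omega> - J' \<omega>) - (I \<omega> - I' \<omega>)) \<le> 2 * nsq M (\<lambda>\<omega>. J \<omega> - I \<omega>) + 2 * nsq M (\<lambda>\<omega>. I' \<omega> - J' \<omega>)"
    using nsq_add[of "\<lambda>z. J z - I z" M "\<lambda>z. I' z - J' z"] by (simp add: algebra_simps)
  also have "\<dots> < ennreal e" using h(3) h'(3) nsq_minus_commute[of M J' I'] by (intro sum) auto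
  finally have 2: "nsq M (\<lambda>\<omega>. (J \<omega> - J' \<omega>) - (I \<omega> - I' \<omega>)) < ennreal e" .
  show "\<exists>k L. (k, L) \<in> elem \<and> nsq PM (\<lambda>z. (G z - G' z) - SP k z) < ennreal e \<and> nsq M (\<lambda>\<omega>. (J \<omega> - J' \<omega>) - L \<omega>) < ennreal e"
    using elem_diff[OF h(1) h'(1)] 1 2 by blast
qed

text \<open>The isometry of an approximating pair is sandwiched between two triangle inequalities.
  They account for the factor \<open>4\<close>, where one would be sharp, and for the errors
  \<open>2 e\<close> and \<open>4 e\<close> in the constant \<open>6\<close>. It suffices that small
  integrands have small integrals.\<close>

lemma L2el_bound:
  assumes "L2el G J"
  shows "nsq M J \<le> 4 * nsq PM G"
proof (rule ennreal_le_add_eps[where c=6])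
  have [measurable]: "G \<in> borel_measurable PM" "J \<in> borel_measurable M" using assms by (auto simp: L2el_def)
  fix e :: real assume "0 < e"
  then obtain h I where h: "(h, I) \<in> elem" "nsq PM (\<lambda>z. G z - SP h z) < ennreal e" "nsq M (\<lambda>\<omega>. J \<omega> - I \<omega>) < ennreal e"
    using assms unfolding L2el_def by blast
  have [measurable]: "SP h \<in> borel_measurable PM" "I \<in> borel_measurable M"
    using elem_measurable[OF h(1)] SP_measurable by auto
  have iso: "nsq M I = nsq PM (SP h)" using elem_isometry[OF h(1)] by (simp add: nsq_def)
  have "nsq PM (SP h) \<le> 2 * nsq PM (\<lambda>z. SP h z - G z) + 2 * nsq PM G"
    using nsq_add[of "\<lambda>z. SP h z - G z" PM G] by simp
  also have "\<dots> \<le> 2 * ennreal e + 2 * nsq PM G"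
    using h(2) nsq_minus_commute[of PM G "SP h"] by (intro add_right_mono mult_left_mono) auto
  finally have 1: "nsq PM (SP h) \<le> 2 * ennreal e + 2 * nsq PM G" .
  have "nsq M J \<le> 2 * nsq M (\<lambda>\<omega>. J \<omega> - I \<omega>) + 2 * nsq M I"
    using nsq_add[of "\<lambda>z. J z - I z" M I] by simp
  also have "\<dots> \<le> 2 * ennreal e + 2 * (2 * ennreal e + 2 * nsq PM G)"
    using h(3) 1 unfolding iso by (intro add_mono mult_left_mono) auto
  also have "\<dots> = 4 * nsq PM G + 6 * ennreal e" by (simp add: distrib_left mult.assoc[symmetric] add_ac distrib_right[symmetric])
  also have "6 * ennreal e = ennreal (6 * e)" by (simp add: ennreal_mult')
  finally show "nsq M J \<le> 4 * nsq PM G + ennreal (6 * e)" .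
qed simp

text \<open>Uniqueness of the integral. Together with \<open>L2el_diff\<close> it identifies
  integrals obtained from different approximations or over different intervals.\<close>

lemma L2el_zero:
  assumes "L2el G J" "\<And>z. z \<in> space PM \<Longrightarrow> G z = 0"
  shows "AE \<omega> in M. J \<omega> = 0"
proof (rule nsq_AE_zero)
  have "nsq PM G = (\<integral>\<^sup>+z. 0 \<partial>PM)" unfolding nsq_def by (rule nn_integral_cong) (simp add: assms(2))
  then show "nsq M J = 0" using L2el_bound[OF assms(1)] by simp
qed (use assms in \<open>simp add: L2el_def\<close>)

end

text \<open>The tolerance \<open>e / 16\<close> serves two estimates at once, with and without the
  factor \<open>4\<close> of \<open>L2el_bound\<close>.\<close>

lemma ennreal_two_eps:
  fixes a b :: ennreal
  assumes "0 < e" "a < ennreal (e / 16)" "b < ennreal (e / 16)"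
  shows "4 * (2 * a + 2 * b) < ennreal e" "2 * a + 2 * b < ennreal e"
proof -
  obtain x z where xz: "a = ennreal x" "b = ennreal z" "0 \<le> x" "0 \<le> z"
    using assms by (cases a; cases b) auto
  then have lt: "x < e / 16" "z < e / 16" using assms by (auto simp: ennreal_less_iff)
  have "4 * (2 * a + 2 * b) = ennreal (8 * x + 8 * z)"
    using xz by (simp add: ennreal_plus ennreal_mult' distrib_left mult.assoc[symmetric])
  also have "\<dots> < ennreal e" using lt xz by (intro ennreal_lessI) auto
  finally show "4 * (2 * a + 2 * b) < ennreal e" .
  have "2 * a + 2 * b = ennreal (2 * x + 2 * z)" using xz by (simp add: ennreal_plus ennreal_mult')
  also have "\<dots> < ennreal e" using lt xz by (intro ennreal_lessI) auto
  finally show "2 * a + 2 * b < ennreal e" .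
qed

text \<open>Radial truncation is continuous, so it preserves left continuity and right limits, and
  it scales by a factor of at most one, so it does not enlarge the energy.\<close>

definition clip :: "real \<Rightarrow> 'a::real_normed_vector \<Rightarrow> 'a" where
  "clip m x = (m / max m (norm x)) *\<^sub>R x"

lemma clip_factor: "0 < m \<Longrightarrow> 0 \<le> m / max m (norm x) \<and> m / max m (norm x) \<le> 1"
  by (auto simp: divide_le_eq_1)

lemma norm_clip_le: "0 < m \<Longrightarrow> norm (clip m x) \<le> m"
proof -
  assume m: "0 < m"
  have "m * norm x \<le> m * max m (norm x)" using m by (intro mult_left_mono) auto
  then show ?thesis using m by (simp add: clip_def divide_le_eq max_def)
qed

lemma clip_id: "0 < m \<Longrightarrow> norm x \<le> m \<Longrightarrow> clip m x = x"
  by (simp add: clip_def max_def)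

lemma continuous_on_clip: "0 < m \<Longrightarrow> continuous_on UNIV (clip m)"
  unfolding clip_def[abs_def] by (intro continuous_intros) (auto simp: max_def)

section \<open>Limits, locality and additivity of the integral\<close>

context diffusion
begin

text \<open>The integrals form a Cauchy sequence because \<open>L2el_bound\<close> controls their
  differences by the energy distance. The exponential identity is passed to the limit along the
  subsequence that converges almost surely.\<close>

lemma good_limit:
  assumes u: "r \<le> u" "u \<le> v" "v \<le> T"
    and g: "\<And>k. good u v (Hk k) (Jk k)" and jm: "jm u v H"
    and dist: "(\<lambda>k. Dist u v (Hk k) H) \<longlonglongrightarrow> 0"
    and en: "\<And>\<omega>. \<omega> \<in> \<Omega> \<Longrightarrow> (\<lambda>k. en u v (Hk k) \<omega>) \<longlonglongrightarrow> en u v H \<omega>"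
    and B: "\<And>k \<omega>. \<omega> \<in> \<Omega> \<Longrightarrow> en u v (Hk k) \<omega> \<le> B"
  shows "\<exists>J. good u v H J \<and> (\<lambda>k. nsq M (\<lambda>\<omega>. Jk k \<omega> - J \<omega>)) \<longlonglongrightarrow> 0"
proof -
  have jk: "jm u v (Hk k)" and JF: "Jk k \<in> borel_measurable (F v)" for k using g by (auto simp: good_def)
  have [measurable]: "Jk k \<in> borel_measurable M" for k by (rule measurable_F_M[OF JF])
  have [measurable]: "en u v (Hk k) \<in> borel_measurable M" "en u v H \<in> borel_measurable M" for k
    using measurable_F_M[OF en_measurable[OF u(1) jk]] measurable_F_M[OF en_measurable[OF u(1) jm]] by auto
  have "\<exists>J s. strict_mono (s :: nat \<Rightarrow> nat) \<and> J \<in> borel_measurable (F v) \<and> (AE \<omega> in M. (\<lambda>k. Jk (s k) \<omega>) \<longlonglongrightarrow> J \<omega>) \<and>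
    (\<lambda>k. nsq M (\<lambda>\<omega>. Jk k \<omega> - J \<omega>)) \<longlonglongrightarrow> 0"
  proof (rule L2_complete[OF subalgebra_F JF])
    fix e :: real assume e: "0 < e"
    have "eventually (\<lambda>k. Dist u v (Hk k) H < ennreal (e / 16)) sequentially"
      using dist e by (intro order_tendstoD(2)) auto
    then obtain N where N: "\<And>k. N \<le> k \<Longrightarrow> Dist u v (Hk k) H < ennreal (e / 16)"
      by (auto simp: eventually_sequentially)
    have "nsq M (\<lambda>\<omega>. Jk m \<omega> - Jk n \<omega>) < ennreal e" if "N \<le> m" "N \<le> n" for m n
    proof -
      have "nsq M (\<lambda>\<omega>. Jk m \<omega> - Jk n \<omega>) \<le> 4 * Dist u v (Hk m) (Hk n)"
        unfolding Dist_nsq[OF u(1,3) jk jk]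
        by (rule L2el_bound[OF L2el_diff[OF good_L2el[OF g u] good_L2el[OF g u]]])
      also have "\<dots> \<le> 4 * (2 * Dist u v (Hk m) H + 2 * Dist u v H (Hk n))"
        by (intro mult_left_mono Dist_triangle[OF u(1,3) jk jm jk]) simp
      also have "\<dots> < ennreal e"
        using N[OF that(1)] N[OF that(2)] e by (intro ennreal_two_eps) (auto simp: Dist_commute[of u v H])
      finally show ?thesis .
    qed
    then show "\<exists>N. \<forall>m\<ge>N. \<forall>n\<ge>N. nsq M (\<lambda>\<omega>. Jk m \<omega> - Jk n \<omega>) < ennreal e" by blast
  qed
  then obtain J s where s: "strict_mono (s :: nat \<Rightarrow> nat)" and J: "J \<in> borel_measurable (F v)"
    and ae: "AE \<omega> in M. (\<lambda>k. Jk (s k) \<omega>) \<longlonglongrightarrow> J \<omega>" and lim: "(\<lambda>k. nsq M (\<lambda>\<omega>. Jk k \<omega> - J \<omega>)) \<longlonglongrightarrow> 0" by blast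
  have [measurable]: "J \<in> borel_measurable M" by (rule measurable_F_M[OF J])
  have "approx u v H J"
    unfolding approx_def
  proof (intro allI impI)
    fix e :: real assume e: "0 < e"
    have "eventually (\<lambda>k. Dist u v (Hk k) H < ennreal (e / 16) \<and> nsq M (\<lambda>\<omega>. Jk k \<omega> - J \<omega>) < ennreal (e / 16)) sequentially"
      using dist lim e by (intro eventually_conj order_tendstoD(2)) auto
    then obtain k where k: "Dist u v (Hk k) H < ennreal (e / 16)" "nsq M (\<lambda>\<omega>. Jk k \<omega> - J \<omega>) < ennreal (e / 16)"
      by (auto simp: eventually_sequentially)
    obtain N p \<xi> where p: "simple_integrand F \<Omega> u v N p \<xi>" "Dist u v (Hk k) (simple_process N p \<xi>) < ennreal (e / 16)"
      "nsq M (\<lambda>\<omega>. simple_integral N p \<xi> \<omega> - Jk k \<omega>) < ennreal (e / 16)"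
      using g[of k] e unfolding good_def approx_def by (meson divide_pos_pos zero_less_numeral)
    note d = simple_integrandD[OF p(1) u(1,3)]
    have [measurable]: "simple_integral N p \<xi> \<in> borel_measurable M" by (rule measurable_F_M[OF d(7)])
    have "Dist u v H (simple_process N p \<xi>) \<le> 2 * Dist u v H (Hk k) + 2 * Dist u v (Hk k) (simple_process N p \<xi>)"
      by (rule Dist_triangle[OF u(1,3) jm jk d(5)])
    also have "\<dots> < ennreal e" using k p e by (intro ennreal_two_eps) (auto simp: Dist_commute[of u v H])
    finally have 1: "Dist u v H (simple_process N p \<xi>) < ennreal e" .
    have "nsq M (\<lambda>\<omega>. simple_integral N p \<xi> \<omega> - J \<omega>) \<le> 2 * nsq M (\<lambda>\<omega>. simple_integral N p \<xi> \<omega> - Jk k \<omega>) + 2 * nsq M (\<lambda>\<omega>. Jk k \<omega> - J \<omega>)"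
      by (rule nsq_triangle) auto
    also have "\<dots> < ennreal e" using k p e by (intro ennreal_two_eps) auto
    finally show "\<exists>N p \<xi>. simple_integrand F \<Omega> u v N p \<xi> \<and> Dist u v H (simple_process N p \<xi>) < ennreal e \<and>
      nsq M (\<lambda>\<omega>. simple_integral N p \<xi> \<omega> - J \<omega>) < ennreal e" using 1 p(1) by blast
  qed
  moreover have "(\<integral>\<^sup>+\<omega>\<in>A. exp (c * J \<omega> - c\<^sup>2 * en u v H \<omega> / 2) \<partial>M) = emeasure M A" if A: "A \<in> sets (F u)" for c A
  proof (rule nn_integral_limit_L2_bounded[where C="exp (c\<^sup>2 * B)"])
    let ?f = "\<lambda>k \<omega>. exp (c * Jk (s k) \<omega> - c\<^sup>2 * en u v (Hk (s k)) \<omega> / 2)"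
    show "A \<in> sets M" using A sets_F_sub_M by blast
    show "(\<integral>\<^sup>+\<omega>\<in>A. ?f k \<omega> \<partial>M) = emeasure M A" for k using g[of "s k"] A unfolding good_def by blast
    show "AE \<omega> in M. (\<lambda>k. ?f k \<omega>) \<longlonglongrightarrow> exp (c * J \<omega> - c\<^sup>2 * en u v H \<omega> / 2)"
      using ae AE_space
    proof eventually_elim
      case (elim \<omega>)
      then have "(\<lambda>k. en u v (Hk (s k)) \<omega>) \<longlonglongrightarrow> en u v H \<omega>"
        using LIMSEQ_subseq_LIMSEQ[OF en s] by (simp add: o_def)
      with elim show ?case by (intro tendsto_intros) auto
    qed
    show "(\<integral>\<^sup>+\<omega>. ennreal ((?f k \<omega>)\<^sup>2) \<partial>M) \<le> ennreal (exp (c\<^sup>2 * B))" for k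
    proof -
      \<comment> \<open>Compared with the exponential for \<open>2 * c\<close>, squaring leaves
        \<open>c\<^sup>2\<close> times the energy uncompensated; this is the origin of the constant
        \<open>exp (c\<^sup>2 * B)\<close>.\<close>
      let ?h = "\<lambda>\<omega>. ennreal (exp ((2 * c) * Jk (s k) \<omega> - (2 * c)\<^sup>2 * en u v (Hk (s k)) \<omega> / 2))"
      have "(\<integral>\<^sup>+\<omega>. ennreal ((?f k \<omega>)\<^sup>2) \<partial>M) \<le> (\<integral>\<^sup>+\<omega>. ennreal (exp (c\<^sup>2 * B)) * (?h \<omega> * indicator \<Omega> \<omega>) \<partial>M)"
      proof (rule nn_integral_mono)
        fix \<omega> assume "\<omega> \<in> space M"
        then have \<omega>: "\<omega> \<in> \<Omega>" by simp
        have "c\<^sup>2 * en u v (Hk (s k)) \<omega> \<le> c\<^sup>2 * B" using B[OF \<omega>] by (intro mult_left_mono) auto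
        then have "(?f k \<omega>)\<^sup>2 \<le> exp (c\<^sup>2 * B) * exp ((2 * c) * Jk (s k) \<omega> - (2 * c)\<^sup>2 * en u v (Hk (s k)) \<omega> / 2)"
          by (simp add: power2_eq_square exp_add[symmetric])
        then show "ennreal ((?f k \<omega>)\<^sup>2) \<le> ennreal (exp (c\<^sup>2 * B)) * (?h \<omega> * indicator \<Omega> \<omega>)"
          using \<omega> by (simp add: ennreal_mult'[symmetric] ennreal_leI del: ennreal_power)
      qed
      also have "\<dots> = ennreal (exp (c\<^sup>2 * B)) * (\<integral>\<^sup>+\<omega>\<in>\<Omega>. ?h \<omega> \<partial>M)"
        by (intro nn_integral_cmult borel_measurable_times_ennreal borel_measurable_indicator \<Omega>_sets) measurable
      also have "(\<integral>\<^sup>+\<omega>\<in>\<Omega>. ?h \<omega> \<partial>M) = emeasure M \<Omega>"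
        using g[of "s k"] \<Omega>_sets(2)[of u] unfolding good_def by blast
      also have "emeasure M \<Omega> = 1" using emeasure_space_1 by simp
      finally show ?thesis by simp
    qed
  qed auto
  ultimately show ?thesis using lim J jm unfolding good_def by blast
qed

lemma caglad_compose:
  assumes "caglad u v H \<rho>" "continuous_on UNIV f"
  shows "caglad u v (\<lambda>x \<omega>. f (H x \<omega>)) (\<lambda>p \<omega>. f (\<rho> p \<omega>))"
proof -
  have f: "(h \<longlongrightarrow> l) G \<Longrightarrow> ((\<lambda>x. f (h x)) \<longlongrightarrow> f l) G" for h :: "real \<Rightarrow> real ^ 'n" and l G
    using continuous_on_tendsto_compose[OF assms(2)] by auto
  have m: "h \<in> borel_measurable G \<Longrightarrow> (\<lambda>x. f (h x)) \<in> borel_measurable G" for h :: "'n path \<Rightarrow> real ^ 'n" and G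
    using measurable_compose[OF _ borel_measurable_continuous_onI[OF assms(2)]] .
  show ?thesis using assms(1) unfolding caglad_def by (auto intro!: f m)
qed

definition gi :: "real \<Rightarrow> real \<Rightarrow> (real \<Rightarrow> 'n path \<Rightarrow> real ^ 'n) \<Rightarrow> nat \<Rightarrow> 'n path \<Rightarrow> real" where
  "gi u v \<rho> k = simple_integral (Suc k) (grid u v k) (\<lambda>i. \<rho> (grid u v k i))"

text \<open>The grid processes converge pointwise under the common bound \<open>K * m\<close>, so
  distance and energy converge by domination. The conclusion names the grid sums because locality is
  read off from them.\<close>

lemma good_caglad_bounded:
  assumes u: "r \<le> u" "u \<le> v" "v \<le> T" and H: "caglad u v H \<rho>"
    and b: "\<And>p \<omega>. p \<in> {u..v} \<Longrightarrow> \<omega> \<in> \<Omega> \<Longrightarrow> norm (\<rho> p \<omega>) \<le> m" "\<And>x \<omega>. u < x \<Longrightarrow> x \<le> v \<Longrightarrow> \<omega> \<in> \<Omega> \<Longrightarrow> norm (H x \<omega>) \<le> m"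
  shows "\<exists>J. good u v H J \<and> (\<lambda>k. nsq M (\<lambda>\<omega>. gi u v \<rho> k \<omega> - J \<omega>)) \<longlonglongrightarrow> 0 \<and> (\<forall>k. gi u v \<rho> k \<in> borel_measurable M)"
proof -
  have si: "simple_integrand F \<Omega> u v (Suc k) (grid u v k) (\<lambda>i. \<rho> (grid u v k i))" for k
    unfolding simple_integrand_def
  proof (intro conjI allI impI)
    fix i assume "i < Suc k"
    then have g: "grid u v k i \<in> {u..v}" using u grid_ge[of u v k i] grid_le[of u v i k] by auto
    show "grid u v k i \<le> grid u v k (Suc i)" using u by (intro grid_mono) auto
    show "\<rho> (grid u v k i) \<in> borel_measurable (F (grid u v k i))" using H g by (auto simp: caglad_def)
    show "bounded (\<rho> (grid u v k i) ` \<Omega>)" using b(1)[OF g] by (auto simp: bounded_iff)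
  qed auto
  have g: "good u v (gp u v \<rho> k) (gi u v \<rho> k)" for k
    unfolding gp_def gi_def by (rule good_simple[OF si u])
  then have jk: "jm u v (gp u v \<rho> k)" and gF: "gi u v \<rho> k \<in> borel_measurable (F v)" for k
    by (auto simp: good_def)
  note gm = measurable_F_M[OF gF]
  have lim: "(\<lambda>k. S x \<omega> (gp u v \<rho> k x \<omega>)) \<longlonglongrightarrow> S x \<omega> (H x \<omega>)" if "u < x" "x \<le> v" "\<omega> \<in> \<Omega>" for x \<omega>
    using that by (intro tendsto_S gp_tendsto[OF H])
  have bk: "norm (S x \<omega> (gp u v \<rho> k x \<omega>)) \<le> K * m" if x: "u < x" "x \<le> v" "\<omega> \<in> \<Omega>" for x \<omega> k
  proof -
    obtain i where i: "i \<le> k" "simple_process (Suc k) (grid u v k) (\<lambda>i. \<rho> (grid u v k i)) x \<omega> = \<rho> (grid u v k i) \<omega>"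
      using grid_cell[OF x(1,2)] by metis
    have "grid u v k i \<in> {u..v}" using u i grid_ge[of u v k i] grid_le[of u v i k] by auto
    then have "norm (gp u v \<rho> k x \<omega>) \<le> m" unfolding gp_def i(2) using b(1) x(3) by blast
    then have "K * norm (gp u v \<rho> k x \<omega>) \<le> K * m" using K_pos by (intro mult_left_mono) auto
    then show ?thesis using norm_S_le[of x \<omega> "gp u v \<rho> k x \<omega>"] x(1) u(1) by simp
  qed
  have bH: "norm (S x \<omega> (H x \<omega>)) \<le> K * m" if x: "u < x" "x \<le> v" "\<omega> \<in> \<Omega>" for x \<omega>
  proof -
    have "K * norm (H x \<omega>) \<le> K * m" using K_pos b(2)[OF x] by (intro mult_left_mono) auto
    then show ?thesis using norm_S_le[of x \<omega> "H x \<omega>"] x(1) u(1) by simp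
  qed
  have "\<exists>J. good u v H J \<and> (\<lambda>k. nsq M (\<lambda>\<omega>. gi u v \<rho> k \<omega> - J \<omega>)) \<longlonglongrightarrow> 0"
  proof (rule good_limit[OF u g caglad_jm[OF H]])
    show "(\<lambda>k. Dist u v (gp u v \<rho> k) H) \<longlonglongrightarrow> 0"
      by (rule Dist_tendsto[OF u jk caglad_jm[OF H] lim bk bH])
    show "(\<lambda>k. en u v (gp u v \<rho> k) \<omega>) \<longlonglongrightarrow> en u v H \<omega>" if "\<omega> \<in> \<Omega>" for \<omega>
      by (rule en_tendsto[OF u(1) that jk caglad_jm[OF H] lim[OF _ _ that] bk[OF _ _ that]])
    show "en u v (gp u v \<rho> k) \<omega> \<le> (K * m)\<^sup>2 * (v - u)" if "\<omega> \<in> \<Omega>" for k \<omega>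
      by (rule en_le[OF u(2)]) (rule bk[OF _ _ that])
  qed
  then show ?thesis using gm by blast
qed

lemma caglad_right_limit_unique:
  assumes "caglad u v H1 \<rho>1" "caglad u v H2 \<rho>2" "\<omega> \<in> \<Omega>" "\<forall>x\<in>{u<..v}. H1 x \<omega> = H2 x \<omega>" "p \<in> {u..<v}"
  shows "\<rho>1 p \<omega> = \<rho>2 p \<omega>"
proof -
  have 1: "((\<lambda>x. H1 x \<omega>) \<longlongrightarrow> \<rho>1 p \<omega>) (at_right p)" and 2: "((\<lambda>x. H2 x \<omega>) \<longlongrightarrow> \<rho>2 p \<omega>) (at_right p)"
    using assms by (auto simp: caglad_def)
  have "eventually (\<lambda>x. H1 x \<omega> = H2 x \<omega>) (at_right p)"
    unfolding eventually_at_right_field using assms(4,5) by (intro exI[of _ v]) auto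
  then have "((\<lambda>x. H2 x \<omega>) \<longlongrightarrow> \<rho>1 p \<omega>) (at_right p)" using 1 by (rule Lim_transform_eventually[rotated])
  then show ?thesis using 2 by (intro tendsto_unique[of "at_right p"]) auto
qed

text \<open>A grid sum sees right limits at points strictly before \<open>v\<close>, and these are
  determined by the path of the process on \<open>{u<..v}\<close>. The map \<open>f\<close> makes
  room for truncation.\<close>

lemma gi_local:
  assumes "caglad u v H1 \<rho>1" "caglad u v H2 \<rho>2" "\<omega> \<in> \<Omega>" "\<forall>x\<in>{u<..v}. H1 x \<omega> = H2 x \<omega>" "u \<le> v"
    and f: "\<And>p. \<rho>1' p \<omega> = f (\<rho>1 p \<omega>)" "\<And>p. \<rho>2' p \<omega> = f (\<rho>2 p \<omega>)"
  shows "gi u v \<rho>1' k \<omega> = gi u v \<rho>2' k \<omega>"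
proof (cases "u < v")
  case True
  have "\<rho>1' (grid u v k i) \<omega> = \<rho>2' (grid u v k i) \<omega>" if "i < Suc k" for i
  proof -
    have "real i < real (Suc k)" using that by linarith
    then have "grid u v k i < v" using grid_less_iff[OF True, of k i v] True by simp
    then have "grid u v k i \<in> {u..<v}" using True by (simp add: grid_ge)
    then show ?thesis unfolding f using caglad_right_limit_unique[OF assms(1-4)] by simp
  qed
  then show ?thesis unfolding gi_def simple_integral_def by (intro sum.cong) auto
next
  case False
  then have "u = v" using assms(5) by simp
  then show ?thesis unfolding gi_def simple_integral_def grid_def by simp
qed

text \<open>The approximation is in two stages: the inverse of \<open>\<sigma>\<close> may be unbounded, so grid processes are only
  taken of truncated integrands, and truncation is then removed using that \<open>S x \<omega> (H x \<omega>)\<close> is bounded.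
  Both stages are explicit in the paths of \<open>H\<close>, which gives the locality of the integral.\<close>

definition clip_approx where
  "clip_approx u v H \<rho> I J \<longleftrightarrow> good u v H J \<and>
     (\<forall>m. good u v (\<lambda>x \<omega>. clip (Suc m) (H x \<omega>)) (I m) \<and>
       (\<lambda>k. nsq M (\<lambda>\<omega>. gi u v (\<lambda>p \<omega>. clip (Suc m) (\<rho> p \<omega>)) k \<omega> - I m \<omega>)) \<longlonglongrightarrow> 0 \<and>
       (\<forall>k. gi u v (\<lambda>p \<omega>. clip (Suc m) (\<rho> p \<omega>)) k \<in> borel_measurable M)) \<and>
     (\<lambda>m. nsq M (\<lambda>\<omega>. I m \<omega> - J \<omega>)) \<longlonglongrightarrow> 0"

lemma ex_clip_approx:
  assumes u: "r \<le> u" "u \<le> v" "v \<le> T" and H: "caglad u v H \<rho>"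
    and b: "\<And>x \<omega>. u < x \<Longrightarrow> x \<le> v \<Longrightarrow> \<omega> \<in> \<Omega> \<Longrightarrow> norm (S x \<omega> (H x \<omega>)) \<le> B"
  shows "\<exists>I J. clip_approx u v H \<rho> I J"
proof -
  have pos: "0 < real (Suc m)" for m by simp
  define Hc where "Hc m x \<omega> = clip (Suc m) (H x \<omega>)" for m x \<omega>
  have c: "caglad u v (Hc m) (\<lambda>p \<omega>. clip (Suc m) (\<rho> p \<omega>))" for m
    unfolding Hc_def by (rule caglad_compose[OF H continuous_on_clip[OF pos]])
  let ?P = "\<lambda>m J. good u v (Hc m) J \<and>
    (\<lambda>k. nsq M (\<lambda>\<omega>. gi u v (\<lambda>p \<omega>. clip (Suc m) (\<rho> p \<omega>)) k \<omega> - J \<omega>)) \<longlonglongrightarrow> 0 \<and>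
    (\<forall>k. gi u v (\<lambda>p \<omega>. clip (Suc m) (\<rho> p \<omega>)) k \<in> borel_measurable M)"
  have "\<exists>J. ?P m J" for m
    by (rule good_caglad_bounded[OF u c, where m="real (Suc m)"]) (unfold Hc_def, (rule norm_clip_le[OF pos])+)
  then have "\<forall>m. \<exists>J. ?P m J" ..
  from choice[OF this] obtain I where I: "\<forall>m. ?P m (I m)" ..
  \<comment> \<open>For a fixed time and path the truncation is eventually inactive.\<close>
  have lim: "(\<lambda>m. S x \<omega> (Hc m x \<omega>)) \<longlonglongrightarrow> S x \<omega> (H x \<omega>)" for x \<omega>
    unfolding Hc_def
  proof (rule tendsto_S, rule tendsto_eventually)
    obtain n :: nat where "norm (H x \<omega>) \<le> real n" using real_arch_simple by blast
    then show "eventually (\<lambda>m. clip (Suc m) (H x \<omega>) = H x \<omega>) sequentially"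
      by (intro eventually_sequentiallyI[of n] clip_id pos) auto
  qed
  \<comment> \<open>Truncation is a scalar factor of at most one, so the bound on
    \<open>S x \<omega> (H x \<omega>)\<close> survives although \<open>H\<close> itself may be
    unbounded.\<close>
  have bc: "norm (S x \<omega> (Hc m x \<omega>)) \<le> B" if x: "u < x" "x \<le> v" "\<omega> \<in> \<Omega>" for x \<omega> m
  proof -
    have "norm (S x \<omega> (Hc m x \<omega>)) = (Suc m / max (Suc m) (norm (H x \<omega>))) * norm (S x \<omega> (H x \<omega>))"
      unfolding Hc_def clip_def S_scaleR using clip_factor[OF pos, of m "H x \<omega>"] by simp
    also have "\<dots> \<le> 1 * norm (S x \<omega> (H x \<omega>))"
      using clip_factor[OF pos, of m "H x \<omega>"] by (intro mult_right_mono) auto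
    finally show ?thesis using b[OF x] by simp
  qed
  have g: "good u v (Hc k) (I k)" for k using I by blast
  have d: "(\<lambda>k. Dist u v (Hc k) H) \<longlonglongrightarrow> 0"
    by (rule Dist_tendsto[OF u caglad_jm[OF c] caglad_jm[OF H] lim bc b])
  have e: "(\<lambda>k. en u v (Hc k) \<omega>) \<longlonglongrightarrow> en u v H \<omega>" if "\<omega> \<in> \<Omega>" for \<omega>
    by (rule en_tendsto[where Hk=Hc and H=H and B=B, OF u(1) that caglad_jm[OF c] caglad_jm[OF H]])
       (rule lim bc[OF _ _ that]; assumption)+
  have "en u v (Hc k) \<omega> \<le> B\<^sup>2 * (v - u)" if "\<omega> \<in> \<Omega>" for k \<omega>
    by (rule en_le[OF u(2)]) (rule bc[OF _ _ that])
  from good_limit[OF u g caglad_jm[OF H] d e this]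
  obtain J where "good u v H J" "(\<lambda>k. nsq M (\<lambda>\<omega>. I k \<omega> - J \<omega>)) \<longlonglongrightarrow> 0" by blast
  then have "clip_approx u v H \<rho> I J" using I unfolding clip_approx_def Hc_def by blast
  then show ?thesis by blast
qed

text \<open>The equality on paths is carried through both limits: from grid sums to integrals of
  truncations, and from there to the integrals. Both integrals are produced in one statement with
  their common exceptional null set.\<close>

lemma good_caglad_local:
  assumes u: "r \<le> u" "u \<le> v" "v \<le> T" and H: "caglad u v H1 \<rho>1" "caglad u v H2 \<rho>2"
    and b: "\<And>x \<omega>. u < x \<Longrightarrow> x \<le> v \<Longrightarrow> \<omega> \<in> \<Omega> \<Longrightarrow> norm (S x \<omega> (H1 x \<omega>)) \<le> B"
      "\<And>x \<omega>. u < x \<Longrightarrow> x \<le> v \<Longrightarrow> \<omega> \<in> \<Omega> \<Longrightarrow> norm (S x \<omega> (H2 x \<omega>)) \<le> B"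
  shows "\<exists>J1 J2. good u v H1 J1 \<and> good u v H2 J2 \<and> (AE \<omega> in M. (\<forall>x\<in>{u<..v}. H1 x \<omega> = H2 x \<omega>) \<longrightarrow> J1 \<omega> = J2 \<omega>)"
proof -
  let ?E = "\<lambda>\<omega>. \<forall>x\<in>{u<..v}. H1 x \<omega> = H2 x \<omega>"
  obtain I1 J1 where 1: "clip_approx u v H1 \<rho>1 I1 J1" using ex_clip_approx[OF u H(1) b(1)] by blast
  obtain I2 J2 where 2: "clip_approx u v H2 \<rho>2 I2 J2" using ex_clip_approx[OF u H(2) b(2)] by blast
  have gM: "good u v H J \<Longrightarrow> J \<in> borel_measurable M" for H J using measurable_F_M unfolding good_def by blast
  have D: "good u v H J" "\<And>m. I m \<in> borel_measurable M"
    "\<And>m. (\<lambda>k. nsq M (\<lambda>\<omega>. gi u v (\<lambda>p \<omega>. clip (Suc m) (\<rho> p \<omega>)) k \<omega> - I m \<omega>)) \<longlonglongrightarrow> 0"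
    "\<And>m k. gi u v (\<lambda>p \<omega>. clip (Suc m) (\<rho> p \<omega>)) k \<in> borel_measurable M"
    "(\<lambda>m. nsq M (\<lambda>\<omega>. I m \<omega> - J \<omega>)) \<longlonglongrightarrow> 0"
    if "clip_approx u v H \<rho> I J" for H \<rho> I J
    using that gM unfolding clip_approx_def by blast+
  have "AE \<omega> in M. ?E \<omega> \<longrightarrow> I1 m \<omega> = I2 m \<omega>" for m
  proof (rule nsq_limits_AE_eq[OF D(4)[OF 1] D(4)[OF 2] D(2)[OF 1] D(2)[OF 2] D(3)[OF 1] D(3)[OF 2]])
    fix k
    have "gi u v (\<lambda>p \<omega>. clip (Suc m) (\<rho>1 p \<omega>)) k \<omega> = gi u v (\<lambda>p \<omega>. clip (Suc m) (\<rho>2 p \<omega>)) k \<omega>"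
      if "\<omega> \<in> \<Omega>" "?E \<omega>" for \<omega> by (rule gi_local[OF H that u(2), where f="clip (Suc m)"]) (rule refl)+
    then show "AE \<omega> in M. ?E \<omega> \<longrightarrow> gi u v (\<lambda>p \<omega>. clip (Suc m) (\<rho>1 p \<omega>)) k \<omega> = gi u v (\<lambda>p \<omega>. clip (Suc m) (\<rho>2 p \<omega>)) k \<omega>"
      by (intro AE_I2) simp
  qed
  then have "AE \<omega> in M. ?E \<omega> \<longrightarrow> J1 \<omega> = J2 \<omega>"
    by (rule nsq_limits_AE_eq[OF D(2)[OF 1] D(2)[OF 2] gM[OF D(1)[OF 1]] gM[OF D(1)[OF 2]] D(5)[OF 1] D(5)[OF 2]])
  then show ?thesis using D(1)[OF 1] D(1)[OF 2] by blast
qed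

text \<open>The integrands cut to the two adjacent intervals add up exactly to the one cut to the
  whole, so the difference of the integrals belongs to the zero integrand.\<close>

lemma good_additive:
  assumes u: "r \<le> u" "u \<le> v" "v \<le> T" and g: "good r u H J1" "good u v H J2" "good r v H J3"
  shows "AE \<omega> in M. J3 \<omega> = J1 \<omega> + J2 \<omega>"
proof -
  have "AE \<omega> in M. J3 \<omega> - J1 \<omega> - J2 \<omega> = 0"
  proof (rule L2el_zero)
    show "L2el (\<lambda>z. SP (cut r v H) z - SP (cut r u H) z - SP (cut u v H) z) (\<lambda>\<omega>. J3 \<omega> - J1 \<omega> - J2 \<omega>)"
      using u by (intro L2el_diff good_L2el g) auto
    fix z :: "real \<times> 'n path"
    show "SP (cut r v H) z - SP (cut r u H) z - SP (cut u v H) z = 0"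
      using u by (auto simp: SP_cut split: split_indicator)
  qed
  then show ?thesis by eventually_elim simp
qed

lemma good_trivial: "good r r H J \<Longrightarrow> AE \<omega> in M. J \<omega> = 0"
  using rT by (intro L2el_zero[OF good_L2el[of r r H J]]) (auto simp: SP_cut)

lemma good_expectation:
  assumes g: "good u v H J" and A: "A \<in> sets (F u)"
  shows "(\<integral>\<^sup>+\<omega>\<in>A. exp (J \<omega> - en u v H \<omega> / 2) \<partial>M) = emeasure M A"
proof -
  have "(\<integral>\<^sup>+\<omega>\<in>A. exp (1 * J \<omega> - 1\<^sup>2 * en u v H \<omega> / 2) \<partial>M) = emeasure M A"
    using g A unfolding good_def by blast
  then show ?thesis by simp
qed

section \<open>Identification with the Ito integral\<close>

lemma Dist_ito:
  "Dist u v H h = (\<integral>\<^sup>+\<omega>. (\<integral>\<^sup>+x\<in>{u<..v}. (let h = H x \<omega> - h x \<omega>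
     in ennreal (h \<bullet> (diffusion_matrix \<sigma> x (\<omega> x) *v h))) \<partial>lborel) \<partial>M)"
  unfolding Dist_def Let_def S_def inner_diffusion_matrix ..

lemma nsq_ito: "nsq M (\<lambda>\<omega>. f \<omega> - Z \<omega>) = (\<integral>\<^sup>+\<omega>. ennreal ((f \<omega> - Z \<omega>)\<^sup>2) \<partial>M)" for f Z :: "'n path \<Rightarrow> real"
  by (simp add: nsq_def)

text \<open>Any admissible value of the Ito integral is an \<open>L2el\<close> limit for the same
  integrand and thus equals \<open>J\<close> almost surely, which makes the choice in
  \<open>ito_integral\<close> harmless.\<close>

lemma is_ito_integral_good:
  assumes g: "good r T H J" and Z: "is_ito_integral Q \<sigma> r T H Z"
  shows "AE \<omega> in M. Z \<omega> = J \<omega>" and "Z \<in> borel_measurable (F T)"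
proof -
  show ZF: "Z \<in> borel_measurable (F T)" using Z by (simp add: is_ito_integral_def)
  obtain N p \<xi> where s: "\<And>k. simple_integrand F \<Omega> r T (N k) (p k) (\<xi> k)"
    and l: "(\<lambda>k. Dist r T H (simple_process (N k) (p k) (\<xi> k))) \<longlonglongrightarrow> 0"
      "(\<lambda>k. nsq M (\<lambda>\<omega>. simple_integral (N k) (p k) (\<xi> k) \<omega> - Z \<omega>)) \<longlonglongrightarrow> 0"
    using Z unfolding is_ito_integral_def Dist_ito nsq_ito by blast
  have jm: "jm r T H" using g by (simp add: good_def)
  have "L2el (SP (cut r T H)) Z"
    unfolding L2el_def
  proof (intro conjI allI impI)
    show "SP (cut r T H) \<in> borel_measurable PM" by (rule SP_cut_measurable[OF order_refl order_refl jm])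
    show "Z \<in> borel_measurable M" by (rule measurable_F_M[OF ZF])
    fix e :: real assume e: "0 < e"
    have "eventually (\<lambda>k. Dist r T H (simple_process (N k) (p k) (\<xi> k)) < ennreal e \<and>
      nsq M (\<lambda>\<omega>. simple_integral (N k) (p k) (\<xi> k) \<omega> - Z \<omega>) < ennreal e) sequentially"
      using l e by (intro eventually_conj order_tendstoD(2)) auto
    then obtain k where k: "Dist r T H (simple_process (N k) (p k) (\<xi> k)) < ennreal e"
      "nsq M (\<lambda>\<omega>. simple_integral (N k) (p k) (\<xi> k) \<omega> - Z \<omega>) < ennreal e" by (auto simp: eventually_sequentially)
    note d = simple_integrandD[OF s[of k] order_refl order_refl]
    have "nsq PM (\<lambda>z. SP (cut r T H) z - SP (simple_process (N k) (p k) (\<xi> k)) z) < ennreal e"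
      using k(1) Dist_nsq[OF order_refl order_refl jm d(5)] by (simp add: d(6))
    moreover have "nsq M (\<lambda>\<omega>. Z \<omega> - simple_integral (N k) (p k) (\<xi> k) \<omega>) < ennreal e"
      using k(2) by (subst nsq_minus_commute)
    ultimately show "\<exists>h I. (h, I) \<in> elem \<and> nsq PM (\<lambda>z. SP (cut r T H) z - SP h z) < ennreal e \<and> nsq M (\<lambda>\<omega>. Z \<omega> - I \<omega>) < ennreal e"
      using d(4) by blast
  qed
  then have "AE \<omega> in M. Z \<omega> - J \<omega> = 0"
    using rT by (intro L2el_zero[OF L2el_diff[OF _ good_L2el[OF g]]]) auto
  then show "AE \<omega> in M. Z \<omega> = J \<omega>" by eventually_elim simp
qed

lemma good_is_ito_integral:
  assumes g: "good r T H J"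
    and p: "(\<lambda>(u, \<omega>). H u \<omega>) \<in> borel_measurable (predictable_algebra F \<Omega> r T)"
  shows "is_ito_integral Q \<sigma> r T H J"
proof -
  let ?P = "\<lambda>k w. simple_integrand F \<Omega> r T (fst w) (fst (snd w)) (snd (snd w)) \<and>
    Dist r T H (simple_process (fst w) (fst (snd w)) (snd (snd w))) < ennreal (1 / Suc k) \<and>
    nsq M (\<lambda>\<omega>. simple_integral (fst w) (fst (snd w)) (snd (snd w)) \<omega> - J \<omega>) < ennreal (1 / Suc k)"
  have ex: "\<exists>w. ?P k w" for k
  proof -
    have pos: "0 < 1 / real (Suc k)" and a: "approx r T H J" using g by (simp, simp add: good_def)
    have "\<exists>N p \<xi>. ?P k (N, p, \<xi>)"
      unfolding fst_conv snd_conv by (rule a[unfolded approx_def, rule_format, OF pos])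
    then show ?thesis by (elim exE) (rule exI)
  qed
  have "\<forall>k. \<exists>w. ?P k w" by (intro allI ex)
  from choice[OF this] obtain w where w: "\<forall>k. ?P k (w k)" ..
  define N where "N k = fst (w k)" for k
  define p' where "p' k = fst (snd (w k))" for k
  define \<xi> where "\<xi> k = snd (snd (w k))" for k
  have s: "\<forall>k. simple_integrand F \<Omega> r T (N k) (p' k) (\<xi> k)"
    and d: "\<And>k. Dist r T H (simple_process (N k) (p' k) (\<xi> k)) < ennreal (1 / Suc k)"
      "\<And>k. nsq M (\<lambda>\<omega>. simple_integral (N k) (p' k) (\<xi> k) \<omega> - J \<omega>) < ennreal (1 / Suc k)"
    unfolding N_def p'_def \<xi>_def using w by blast+
  have "(\<lambda>k. 1 / real (Suc k)) \<longlonglongrightarrow> 0"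
    using LIMSEQ_inverse_real_of_nat by (simp only: inverse_eq_divide)
  then have z: "(\<lambda>k. ennreal (1 / real (Suc k))) \<longlonglongrightarrow> 0"
    using tendsto_ennrealI[of "\<lambda>k. 1 / real (Suc k)" 0] by simp
  have sq: "f \<longlonglongrightarrow> 0" if "\<And>k. f k < ennreal (1 / real (Suc k))" for f :: "nat \<Rightarrow> ennreal"
  proof (rule tendsto_sandwich[OF _ _ tendsto_const z])
    show "eventually (\<lambda>k. f k \<le> ennreal (1 / real (Suc k))) sequentially"
      using that by (intro always_eventually allI less_imp_le)
  qed simp
  show ?thesis
    unfolding is_ito_integral_def Dist_ito[symmetric] nsq_ito[symmetric]
  proof (intro conjI exI)
    show "J \<in> borel_measurable (F T)" using g by (simp add: good_def)
    show "\<forall>k. simple_integrand F \<Omega> r T (N k) (p' k) (\<xi> k)" by (rule s)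
  qed (rule p sq d)+
qed

lemma predictable_rectangle:
  assumes st: "r \<le> s" "s \<le> t" "t \<le> T" and \<xi>: "\<xi> \<in> borel_measurable (F s)"
  shows "(\<lambda>(x, \<omega>). indicator {s<..t} x *\<^sub>R (\<xi> \<omega> :: real ^ 'n)) \<in> borel_measurable (predictable_algebra F \<Omega> r T)"
proof -
  let ?\<G> = "{{s<..t} \<times> A | s t A. r \<le> s \<and> s \<le> t \<and> t \<le> T \<and> A \<in> sets (F s)}"
  have sub: "?\<G> \<subseteq> Pow ({r<..T} \<times> \<Omega>)" using sets.sets_into_space[of _ "F _"] by fastforce
  have sp: "space (predictable_algebra F \<Omega> r T) = {r<..T} \<times> \<Omega>"
    unfolding predictable_algebra_def by (rule space_measure_of[OF sub])
  have gen: "{s<..t} \<times> A \<in> sets (predictable_algebra F \<Omega> r T)" if "A \<in> sets (F s)" for A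
    unfolding predictable_algebra_def sets_measure_of[OF sub] using st that by (intro sigma_sets.Basic) blast
  show ?thesis
  proof (rule measurableI)
    fix B :: "(real ^ 'n) set" assume B: "B \<in> sets borel"
    have m: "\<xi> -` B \<inter> \<Omega> \<in> sets (F s)" if "B \<in> sets borel" for B :: "(real ^ 'n) set"
      using measurable_sets[OF \<xi> that] by simp
    \<comment> \<open>Off the rectangle the function vanishes, so the preimage of a set containing
      \<open>0\<close> is described by its complement.\<close>
    let ?f = "\<lambda>(x, \<omega>). indicator {s<..t} x *\<^sub>R \<xi> \<omega>"
    show "?f -` B \<inter> space (predictable_algebra F \<Omega> r T) \<in> sets (predictable_algebra F \<Omega> r T)"
    proof (cases "0 \<in> B")
      case False
      then have "?f -` B \<inter> space (predictable_algebra F \<Omega> r T) = {s<..t} \<times> (\<xi> -` B \<inter> \<Omega>)"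
        unfolding sp using st by (auto simp: indicator_def of_bool_def split: if_splits)
      then show ?thesis using gen[OF m[OF B]] by simp
    next
      case True
      then have "?f -` B \<inter> space (predictable_algebra F \<Omega> r T) = space (predictable_algebra F \<Omega> r T) - {s<..t} \<times> (\<xi> -` (- B) \<inter> \<Omega>)"
        unfolding sp using st by (auto simp: indicator_def of_bool_def split: if_splits)
      then show ?thesis using sets.compl_sets[OF gen[OF m[of "- B"]]] B by simp
    qed
  qed simp
qed

text \<open>By left continuity the process is a pointwise limit of grid step processes, which are
  finite sums over predictable rectangles.\<close>

lemma caglad_predictable:
  assumes H: "caglad r T H \<rho>"
  shows "(\<lambda>(u, \<omega>). H u \<omega>) \<in> borel_measurable (predictable_algebra F \<Omega> r T)"
proof (rule borel_measurable_LIMSEQ_metric)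
  fix k
  have "(\<lambda>z. \<Sum>i<Suc k. (case z of (x, \<omega>) \<Rightarrow> indicator {grid r T k i<..grid r T k (Suc i)} x *\<^sub>R \<rho> (grid r T k i) \<omega>))
    \<in> borel_measurable (predictable_algebra F \<Omega> r T)"
  proof (intro borel_measurable_sum predictable_rectangle)
    fix i assume "i \<in> {..<Suc k}"
    then have i: "i \<le> Suc k" "Suc i \<le> Suc k" by auto
    show "r \<le> grid r T k i" "grid r T k i \<le> grid r T k (Suc i)" "grid r T k (Suc i) \<le> T"
      using rT i grid_ge grid_mono grid_le by auto
    show "\<rho> (grid r T k i) \<in> borel_measurable (F (grid r T k i))"
      using H rT i(1) grid_ge grid_le by (auto simp: caglad_def)
  qed
  then show "(\<lambda>(u, \<omega>). gp r T \<rho> k u \<omega>) \<in> borel_measurable (predictable_algebra F \<Omega> r T)"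
    unfolding gp_def simple_process_def by (simp add: case_prod_beta')
next
  have sub: "{{s<..t} \<times> A | s t A. r \<le> s \<and> s \<le> t \<and> t \<le> T \<and> A \<in> sets (F s)} \<subseteq> Pow ({r<..T} \<times> \<Omega>)"
    using sets.sets_into_space[of _ "F _"] by fastforce
  fix z assume "z \<in> space (predictable_algebra F \<Omega> r T)"
  then have "z \<in> {r<..T} \<times> \<Omega>" unfolding predictable_algebra_def space_measure_of[OF sub] .
  then show "(\<lambda>k. case z of (u, \<omega>) \<Rightarrow> gp r T \<rho> k u \<omega>) \<longlonglongrightarrow> (case z of (u, \<omega>) \<Rightarrow> H u \<omega>)"
    using gp_tendsto[OF H] by (auto simp: case_prod_beta)
qed

lemma good_ito_integral:
  assumes "good r T H J" "caglad r T H \<rho>"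
  shows "AE \<omega> in M. ito_integral Q \<sigma> r T H \<omega> = J \<omega>" and "ito_integral Q \<sigma> r T H \<in> borel_measurable (F T)"
proof -
  have "is_ito_integral Q \<sigma> r T H (ito_integral Q \<sigma> r T H)"
    unfolding ito_integral_def by (rule someI[where P="is_ito_integral Q \<sigma> r T H", OF good_is_ito_integral[OF assms(1) caglad_predictable[OF assms(2)]]])
  from is_ito_integral_good[OF assms(1) this]
  show "AE \<omega> in M. ito_integral Q \<sigma> r T H \<omega> = J \<omega>" "ito_integral Q \<sigma> r T H \<in> borel_measurable (F T)" by auto
qed

end

section \<open>Girsanov densities of simple controls\<close>

lemma matrix_inv_both:
  fixes A :: "real ^ 'n::finite ^ 'n"
  assumes "det A \<noteq> 0"
  shows "A ** matrix_inv A = mat 1" "matrix_inv A ** A = mat 1"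
proof -
  have "\<exists>B. A ** B = mat 1 \<and> B ** A = mat 1"
    using assms by (simp add: invertible_det_nz[symmetric] invertible_def)
  from someI_ex[OF this] show "A ** matrix_inv A = mat 1" "matrix_inv A ** A = mat 1"
    by (simp_all add: matrix_inv_def)
qed

text \<open>\<open>matrix_inv\<close> is defined by a choice; Cramer's rule replaces it by quotients
  of determinants, whose continuity in the entries is plain.\<close>

lemma matrix_inv_cramer:
  fixes A :: "real ^ 'n::finite ^ 'n"
  assumes "det A \<noteq> 0"
  shows "matrix_inv A = (\<chi> k j. det (\<chi> i l. if l = k then axis j 1 $ i else A $ i $ l) / det A)"
proof -
  have "matrix_inv A *v axis j 1 = (\<chi> k. det (\<chi> i l. if l = k then axis j 1 $ i else A $ i $ l) / det A)" for j
    using cramer[OF assms, of "matrix_inv A *v axis j 1" "axis j 1"] matrix_inv_both(1)[OF assms]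
    by (simp add: matrix_vector_mul_assoc)
  then have "matrix_inv A $ k $ j = det (\<chi> i l. if l = k then axis j 1 $ i else A $ i $ l) / det A" for k j
    by (simp add: matrix_vector_mul_component inner_axis vec_eq_iff matrix_vector_mult_basis column_def)
  then show ?thesis by (simp add: vec_eq_iff)
qed

lemma continuous_on_det:
  fixes f :: "'a::topological_space \<Rightarrow> real ^ 'n::finite ^ 'n"
  assumes "\<And>i l. continuous_on S (\<lambda>z. f z $ i $ l)"
  shows "continuous_on S (\<lambda>z. det (f z))"
  unfolding det_def by (intro continuous_intros assms)

lemma continuous_on_matrix_inv:
  fixes f :: "'a::topological_space \<Rightarrow> real ^ 'n::finite ^ 'n"
  assumes f: "continuous_on S f" and nz: "\<And>z. z \<in> S \<Longrightarrow> det (f z) \<noteq> 0"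
  shows "continuous_on S (\<lambda>z. matrix_inv (f z))"
proof -
  have c: "continuous_on S (\<lambda>z. f z $ i $ l)" for i l by (intro continuous_intros f)
  have "continuous_on S (\<lambda>z. \<chi> k j. det (\<chi> i l. if l = k then axis j 1 $ i else f z $ i $ l) / det (f z))"
  proof (intro continuous_on_vec_lambda continuous_on_divide continuous_on_det c ballI nz)
    fix k j i l :: 'n
    show "continuous_on S (\<lambda>z. (\<chi> i l. if l = k then axis j 1 $ i else f z $ i $ l) $ i $ l)"
      using c[of i l] by (cases "l = k") auto
  qed auto
  then show ?thesis
    by (rule continuous_on_eq) (simp add: matrix_inv_cramer[OF nz])
qed

context diffusion
begin

text \<open>A positive definite diffusion matrix has trivial kernel, hence nonzero determinant, and
  this determinant factors into those of \<open>\<sigma> t x\<close> and its transpose.\<close>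

lemma det_\<sigma>: "0 \<le> t \<Longrightarrow> det (\<sigma> t x) \<noteq> 0"
proof -
  assume "0 \<le> t"
  then have pd: "v \<noteq> 0 \<Longrightarrow> 0 < v \<bullet> (diffusion_matrix \<sigma> t x *v v)" for v
    using elliptic by (simp add: strictly_elliptic_def positive_definite_def)
  have "v = 0" if "diffusion_matrix \<sigma> t x *v v = 0" for v using pd[of v] that by auto
  then have "\<exists>B. B ** diffusion_matrix \<sigma> t x = mat 1" by (simp add: matrix_left_invertible_ker)
  then have "invertible (diffusion_matrix \<sigma> t x)" by (simp add: invertible_left_inverse)
  then show ?thesis by (simp add: invertible_det_nz diffusion_matrix_def det_mul)
qed

lemma continuous_on_inv_\<sigma>: "continuous_on ({0..} \<times> UNIV) (\<lambda>z. matrix_inv (\<sigma> (fst z) (snd z)))"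
  by (rule continuous_on_matrix_inv) (use cont_\<sigma> det_\<sigma> in \<open>auto simp: case_prod_beta'\<close>)

text \<open>Dividing by \<open>\<sigma>\<close> makes the energy of the integrand the squared norm
  of the control, see \<open>S_Hm\<close>. For bounded \<open>\<mu>\<close> the integrand may be
  unbounded, its energy is not.\<close>

definition Hm :: "(real \<Rightarrow> 'n path \<Rightarrow> real ^ 'n) \<Rightarrow> real \<Rightarrow> 'n path \<Rightarrow> real ^ 'n" where
  "Hm \<mu> = (\<lambda>u \<omega>. \<mu> u \<omega> v* matrix_inv (\<sigma> u (\<omega> u)))"

lemma S_Hm: "0 \<le> x \<Longrightarrow> S x \<omega> (Hm \<mu> x \<omega>) = \<mu> x \<omega>"
  using matrix_inv_both(2)[OF det_\<sigma>] by (simp add: S_def Hm_def vector_matrix_mul_assoc)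

lemma en_Hm: "r \<le> u \<Longrightarrow> en u v (Hm \<mu>) \<omega> = (LINT x:{u<..v}|lborel. (norm (\<mu> x \<omega>))\<^sup>2)"
  unfolding en_def using r_nonneg by (intro set_lebesgue_integral_cong) (auto simp: S_Hm)

lemma caglad_Hm:
  assumes \<mu>: "caglad u v \<mu> \<rho>" and u: "r \<le> u"
  shows "caglad u v (Hm \<mu>) (\<lambda>p \<omega>. \<rho> p \<omega> v* matrix_inv (\<sigma> p (\<omega> p)))"
proof -
  have cp: "continuous_on {r..} (\<lambda>x. matrix_inv (\<sigma> x (\<omega> x)))" if "\<omega> \<in> \<Omega>" for \<omega> :: "'n path"
  proof -
    have "continuous_on {r..} (\<lambda>x. (x, \<omega> x))"
      using that by (intro continuous_on_Pair continuous_on_id) (simp add: path_space_def)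
    then have "continuous_on {r..} (\<lambda>x. matrix_inv (\<sigma> (fst (x, \<omega> x)) (snd (x, \<omega> x))))"
      using r_nonneg by (intro continuous_on_compose2[OF continuous_on_inv_\<sigma>]) auto
    then show ?thesis by simp
  qed
  have "(\<lambda>\<omega>. \<rho> p \<omega> v* matrix_inv (\<sigma> p (\<omega> p))) \<in> borel_measurable (F p)" if p: "p \<in> {u..v}" for p
  proof (rule borel_measurable_continuous_Pair[where H="\<lambda>x A. x v* A"])
    show "\<rho> p \<in> borel_measurable (F p)" using \<mu> p by (auto simp: caglad_def)
    have "continuous_on UNIV (\<lambda>x. matrix_inv (\<sigma> (fst (p, x)) (snd (p, x))))"
      using p u r_nonneg by (intro continuous_on_compose2[OF continuous_on_inv_\<sigma>] continuous_intros) auto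
    then have "(\<lambda>x. matrix_inv (\<sigma> p x)) \<in> borel_measurable borel" by (simp add: borel_measurable_continuous_onI)
    from measurable_compose[OF X_measurable this] show "(\<lambda>\<omega>. matrix_inv (\<sigma> p (\<omega> p))) \<in> borel_measurable (F p)"
      using p u by simp
    show "continuous_on UNIV (\<lambda>x :: (real^'n) \<times> (real^'n^'n). fst x v* snd x)"
      by (intro vm.continuous_on continuous_intros)
  qed
  moreover have "((\<lambda>x. Hm \<mu> x \<omega>) \<longlongrightarrow> \<rho> p \<omega> v* matrix_inv (\<sigma> p (\<omega> p))) (at_right p)"
    if "\<omega> \<in> \<Omega>" "p \<in> {u..<v}" for \<omega> p
  proof -
    have "((\<lambda>x. matrix_inv (\<sigma> x (\<omega> x))) \<longlongrightarrow> matrix_inv (\<sigma> p (\<omega> p))) (at p within {r..})"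
      using cp[OF that(1)] that(2) u by (auto simp: continuous_on_def)
    then have "((\<lambda>x. matrix_inv (\<sigma> x (\<omega> x))) \<longlongrightarrow> matrix_inv (\<sigma> p (\<omega> p))) (at_right p)"
      by (rule tendsto_within_subset) (use that(2) u in auto)
    moreover have "((\<lambda>x. \<mu> x \<omega>) \<longlongrightarrow> \<rho> p \<omega>) (at_right p)" using \<mu> that by (auto simp: caglad_def)
    ultimately show ?thesis unfolding Hm_def by (intro vm.tendsto)
  qed
  moreover have "((\<lambda>x. Hm \<mu> x \<omega>) \<longlongrightarrow> Hm \<mu> x \<omega>) (at_left x)"
    if "\<omega> \<in> \<Omega>" "x \<in> {u<..v}" for \<omega> x
  proof -
    have "isCont (\<lambda>x. matrix_inv (\<sigma> x (\<omega> x))) x"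
      using that(2) u by (intro continuous_on_interior[OF cp[OF that(1)]]) auto
    then have "((\<lambda>x. matrix_inv (\<sigma> x (\<omega> x))) \<longlongrightarrow> matrix_inv (\<sigma> x (\<omega> x))) (at_left x)"
      unfolding isCont_def by (rule tendsto_within_subset) auto
    moreover have "((\<lambda>x. \<mu> x \<omega>) \<longlongrightarrow> \<mu> x \<omega>) (at_left x)" using \<mu> that by (auto simp: caglad_def)
    ultimately show ?thesis unfolding Hm_def by (intro vm.tendsto)
  qed
  ultimately show ?thesis unfolding caglad_def by blast
qed

section \<open>The density process of a regular control\<close>

definition regular :: "(real \<Rightarrow> 'n path \<Rightarrow> real ^ 'n) \<Rightarrow> bool" where
  "regular \<mu> \<longleftrightarrow> (\<exists>\<rho> b. caglad r T \<mu> \<rho> \<and> (\<forall>x\<in>{r<..T}. \<forall>\<omega>\<in>\<Omega>. norm (\<mu> x \<omega>) \<le> b))"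

lemma caglad_subinterval: "caglad u v H \<rho> \<Longrightarrow> u \<le> u' \<Longrightarrow> v' \<le> v \<Longrightarrow> caglad u' v' H \<rho>"
  unfolding caglad_def by auto

lemma regular_good_local:
  assumes \<mu>: "regular \<mu>" and \<nu>: "regular \<nu>" and u: "r \<le> u" "u \<le> v" "v \<le> T"
  shows "\<exists>J1 J2. good u v (Hm \<mu>) J1 \<and> good u v (Hm \<nu>) J2 \<and>
    (AE \<omega> in M. (\<forall>x\<in>{u<..v}. \<mu> x \<omega> = \<nu> x \<omega>) \<longrightarrow> J1 \<omega> = J2 \<omega>)"
proof -
  obtain \<rho>1 b1 where 1: "caglad r T \<mu> \<rho>1" "\<forall>x\<in>{r<..T}. \<forall>\<omega>\<in>\<Omega>. norm (\<mu> x \<omega>) \<le> b1"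
    using \<mu> unfolding regular_def by blast
  obtain \<rho>2 b2 where 2: "caglad r T \<nu> \<rho>2" "\<forall>x\<in>{r<..T}. \<forall>\<omega>\<in>\<Omega>. norm (\<nu> x \<omega>) \<le> b2"
    using \<nu> unfolding regular_def by blast
  have b: "norm (S x \<omega> (Hm \<mu> x \<omega>)) \<le> max b1 b2" "norm (S x \<omega> (Hm \<nu> x \<omega>)) \<le> max b1 b2"
    if "u < x" "x \<le> v" "\<omega> \<in> \<Omega>" for x \<omega>
  proof -
    have "x \<in> {r<..T}" using that u by auto
    then have "norm (\<mu> x \<omega>) \<le> b1" "norm (\<nu> x \<omega>) \<le> b2" using 1(2) 2(2) that(3) by blast+
    then show "norm (S x \<omega> (Hm \<mu> x \<omega>)) \<le> max b1 b2" "norm (S x \<omega> (Hm \<nu> x \<omega>)) \<le> max b1 b2"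
      using that u r_nonneg by (simp_all add: S_Hm)
  qed
  obtain J1 J2 where J: "good u v (Hm \<mu>) J1" "good u v (Hm \<nu>) J2"
    and ae: "AE \<omega> in M. (\<forall>x\<in>{u<..v}. Hm \<mu> x \<omega> = Hm \<nu> x \<omega>) \<longrightarrow> J1 \<omega> = J2 \<omega>"
    using good_caglad_local[OF u caglad_Hm[OF caglad_subinterval[OF 1(1) u(1,3)] u(1)]
      caglad_Hm[OF caglad_subinterval[OF 2(1) u(1,3)] u(1)] b] by blast
  have "AE \<omega> in M. (\<forall>x\<in>{u<..v}. \<mu> x \<omega> = \<nu> x \<omega>) \<longrightarrow> J1 \<omega> = J2 \<omega>"
    using ae by eventually_elim (simp add: Hm_def)
  then show ?thesis using J by blast
qed

text \<open>The integral is chosen separately for each \<open>v\<close>; \<open>Dm_split\<close>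
  relates the choices for each pair of times almost surely.\<close>

definition Jm :: "(real \<Rightarrow> 'n path \<Rightarrow> real ^ 'n) \<Rightarrow> real \<Rightarrow> 'n path \<Rightarrow> real" where
  "Jm \<mu> v = (SOME J. good r v (Hm \<mu>) J)"

definition Dm :: "(real \<Rightarrow> 'n path \<Rightarrow> real ^ 'n) \<Rightarrow> real \<Rightarrow> 'n path \<Rightarrow> real" where
  "Dm \<mu> v \<omega> = exp (Jm \<mu> v \<omega> - en r v (Hm \<mu>) \<omega> / 2)"

lemma Dm_pos: "0 < Dm \<mu> v \<omega>"
  by (simp add: Dm_def)

lemma good_Jm: "regular \<mu> \<Longrightarrow> r \<le> v \<Longrightarrow> v \<le> T \<Longrightarrow> good r v (Hm \<mu>) (Jm \<mu> v)"
  unfolding Jm_def using regular_good_local[of \<mu> \<mu> r v] by (auto intro: someI[where P="good r v (Hm \<mu>)"])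

lemma Dm_measurable: "regular \<mu> \<Longrightarrow> r \<le> v \<Longrightarrow> v \<le> T \<Longrightarrow> Dm \<mu> v \<in> borel_measurable (F v)"
proof -
  assume "regular \<mu>" "r \<le> v" "v \<le> T"
  then have g: "good r v (Hm \<mu>) (Jm \<mu> v)" by (rule good_Jm)
  have [measurable]: "Jm \<mu> v \<in> borel_measurable (F v)" "en r v (Hm \<mu>) \<in> borel_measurable (F v)"
    using g en_measurable[of r v "Hm \<mu>"] by (simp_all add: good_def)
  show ?thesis unfolding Dm_def[abs_def] by measurable
qed

lemma Dm_start: "regular \<mu> \<Longrightarrow> AE \<omega> in M. Dm \<mu> r \<omega> = 1"
proof -
  assume "regular \<mu>"
  from good_trivial[OF good_Jm[OF this order_refl rT]] show ?thesis
    by eventually_elim (simp add: Dm_def en_def set_lebesgue_integral_def)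
qed

lemma en_additive:
  assumes \<mu>: "regular \<mu>" and u: "r \<le> u" "u \<le> v" "v \<le> T" and \<omega>: "\<omega> \<in> \<Omega>"
  shows "en r v (Hm \<mu>) \<omega> = en r u (Hm \<mu>) \<omega> + en u v (Hm \<mu>) \<omega>"
proof -
  obtain \<rho> b where b: "\<forall>x\<in>{r<..T}. \<forall>\<omega>\<in>\<Omega>. norm (\<mu> x \<omega>) \<le> b" using \<mu> unfolding regular_def by blast
  have jm: "jm r v (Hm \<mu>)" using good_Jm[OF \<mu>, of v] u by (simp add: good_def)
  have i: "set_integrable lborel {r<..v} (\<lambda>x. (norm (S x \<omega> (Hm \<mu> x \<omega>)))\<^sup>2)"
  proof (rule en_integrable[OF order_refl jm \<omega>])
    fix x assume "r < x" "x \<le> v"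
    then show "norm (S x \<omega> (Hm \<mu> x \<omega>)) \<le> b" using b \<omega> u r_nonneg by (simp add: S_Hm)
  qed
  have "{r<..v} = {r<..u} \<union> {u<..v}" using u by auto
  then show ?thesis
    unfolding en_def using set_integrable_subset[OF i, of "{r<..u}"] set_integrable_subset[OF i, of "{u<..v}"] u
    by (auto intro!: set_integral_Un)
qed

text \<open>Additivity of integral and energy over adjacent intervals becomes multiplicativity of
  the density, and the new factor is formed from the control on \<open>{u<..v}\<close>.\<close>

lemma Dm_split:
  assumes \<mu>: "regular \<mu>" and u: "r \<le> u" "u \<le> v" "v \<le> T" and g: "good u v (Hm \<mu>) J"
  shows "AE \<omega> in M. Dm \<mu> v \<omega> = Dm \<mu> u \<omega> * exp (J \<omega> - en u v (Hm \<mu>) \<omega> / 2)"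
proof -
  have "AE \<omega> in M. Jm \<mu> v \<omega> = Jm \<mu> u \<omega> + J \<omega>"
    using u by (intro good_additive[OF u _ g] good_Jm[OF \<mu>]) auto
  then show ?thesis
    using AE_space
  proof eventually_elim
    case (elim \<omega>)
    then have "en r v (Hm \<mu>) \<omega> = en r u (Hm \<mu>) \<omega> + en u v (Hm \<mu>) \<omega>" by (intro en_additive[OF \<mu> u]) simp
    with elim(1) show ?case unfolding Dm_def exp_add[symmetric] by (simp add: field_simps)
  qed
qed

text \<open>The factor over \<open>{u<..T}\<close> has integral \<open>emeasure M B\<close> over
  every event \<open>B\<close> known at \<open>u\<close>, by the exponential identity carried along
  in \<open>good\<close>.\<close>

lemma Dm_martingale:
  assumes \<mu>: "regular \<mu>" and u: "r \<le> u" "u \<le> T" and A: "A \<in> sets (F u)"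
  shows "(\<integral>\<^sup>+\<omega>\<in>A. Dm \<mu> T \<omega> \<partial>M) = (\<integral>\<^sup>+\<omega>\<in>A. Dm \<mu> u \<omega> \<partial>M)"
proof -
  obtain J where g: "good u T (Hm \<mu>) J" using regular_good_local[OF \<mu> \<mu> u order_refl] by blast
  have sfs: "sigma_finite_subalgebra M (F u)" by (rule sigma_finite_subalgebraI[OF subalgebra_F])
  have [measurable]: "Dm \<mu> u \<in> borel_measurable (F u)" by (rule Dm_measurable[OF \<mu> u])
  have [measurable]: "A \<in> sets (F u)" by (rule A)
  have [measurable]: "J \<in> borel_measurable M" "en u T (Hm \<mu>) \<in> borel_measurable M"
    using g measurable_F_M[OF en_measurable[of u T "Hm \<mu>"]] u(1) measurable_F_M by (auto simp: good_def)
  have "(\<integral>\<^sup>+\<omega>\<in>A. Dm \<mu> T \<omega> \<partial>M) = (\<integral>\<^sup>+\<omega>. (ennreal (Dm \<mu> u \<omega>) * indicator A \<omega>) * ennreal (exp (J \<omega> - en u T (Hm \<mu>) \<omega> / 2)) \<partial>M)"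
  proof (rule nn_integral_cong_AE)
    show "AE \<omega> in M. ennreal (Dm \<mu> T \<omega>) * indicator A \<omega> = (ennreal (Dm \<mu> u \<omega>) * indicator A \<omega>) * ennreal (exp (J \<omega> - en u T (Hm \<mu>) \<omega> / 2))"
      using Dm_split[OF \<mu> u order_refl g]
      by eventually_elim (simp add: ennreal_mult Dm_pos less_imp_le mult_ac split: split_indicator)
  qed
  also have "\<dots> = (\<integral>\<^sup>+\<omega>. (ennreal (Dm \<mu> u \<omega>) * indicator A \<omega>) * 1 \<partial>M)"
  proof (rule sigma_finite_subalgebra.nn_integral_mult_eq_of_set_eq[OF sfs])
    fix B assume B: "B \<in> sets (F u)"
    then show "(\<integral>\<^sup>+\<omega>\<in>B. exp (J \<omega> - en u T (Hm \<mu>) \<omega> / 2) \<partial>M) = (\<integral>\<^sup>+\<omega>\<in>B. 1 \<partial>M)"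
      using good_expectation[OF g B] sets_F_sub_M[of u] by auto
  qed measurable
  finally show ?thesis by simp
qed

text \<open>By \<open>Dm_split\<close> both ratios are exponentials over \<open>{u<..v}\<close>. On
  paths where the controls agree there, the integrals agree by locality and the energies
  trivially.\<close>

lemma Dm_local:
  assumes \<mu>: "regular \<mu>" and \<nu>: "regular \<nu>" and u: "r \<le> u" "u \<le> v" "v \<le> T"
  shows "AE \<omega> in M. (\<forall>x\<in>{u<..v}. \<mu> x \<omega> = \<nu> x \<omega>) \<longrightarrow> Dm \<mu> v \<omega> * Dm \<nu> u \<omega> = Dm \<nu> v \<omega> * Dm \<mu> u \<omega>"
proof -
  obtain J1 J2 where J: "good u v (Hm \<mu>) J1" "good u v (Hm \<nu>) J2"
    and ae: "AE \<omega> in M. (\<forall>x\<in>{u<..v}. \<mu> x \<omega> = \<nu> x \<omega>) \<longrightarrow> J1 \<omega> = J2 \<omega>"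
    using regular_good_local[OF \<mu> \<nu> u] by blast
  show ?thesis
    using Dm_split[OF \<mu> u J(1)] Dm_split[OF \<nu> u J(2)] ae
  proof eventually_elim
    case (elim \<omega>)
    show ?case
    proof
      assume eq: "\<forall>x\<in>{u<..v}. \<mu> x \<omega> = \<nu> x \<omega>"
      then have "en u v (Hm \<mu>) \<omega> = en u v (Hm \<nu>) \<omega>"
        unfolding en_def by (intro set_lebesgue_integral_cong) (auto simp: Hm_def)
      then show "Dm \<mu> v \<omega> * Dm \<nu> u \<omega> = Dm \<nu> v \<omega> * Dm \<mu> u \<omega>" using elim eq by simp
    qed
  qed
qed

text \<open>The chosen Ito integral and \<open>Jm \<mu> T\<close> agree almost surely in
  \<open>M\<close>; both are measurable at \<open>T\<close>, so the exceptional set lies in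
  \<open>F T\<close>, where the density is taken.\<close>

lemma girsanov_measure_eq:
  assumes \<mu>: "regular \<mu>"
  shows "girsanov_measure Q \<sigma> r T \<mu> = density (restr_to_subalg M (F T)) (\<lambda>\<omega>. ennreal (Dm \<mu> T \<omega>))"
proof -
  obtain \<rho> b where c: "caglad r T \<mu> \<rho>" using \<mu> unfolding regular_def by blast
  note g = good_Jm[OF \<mu> rT order_refl]
  let ?Z = "ito_integral Q \<sigma> r T (\<lambda>u \<omega>. \<mu> u \<omega> v* matrix_inv (\<sigma> u (\<omega> u)))"
  have Z: "AE \<omega> in M. ?Z \<omega> = Jm \<mu> T \<omega>" and [measurable]: "?Z \<in> borel_measurable (F T)"
    using good_ito_integral[OF g caglad_Hm[OF c order_refl]] unfolding Hm_def by auto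
  have jm: "jm r T (Hm \<mu>)" and [measurable]: "Jm \<mu> T \<in> borel_measurable (F T)" using g by (simp_all add: good_def)
  have [measurable]: "(\<lambda>\<omega>. LINT u:{r<..T}|lborel. (norm (\<mu> u \<omega>))\<^sup>2) \<in> borel_measurable (F T)"
    using en_measurable[OF order_refl jm] by (simp add: en_Hm[OF order_refl, abs_def])
  have [measurable]: "Dm \<mu> T \<in> borel_measurable (F T)" by (rule Dm_measurable[OF \<mu> rT order_refl])
  let ?f = "\<lambda>\<omega>. exp (?Z \<omega> - (1 / 2) * (LINT u:{r<..T}|lborel. (norm (\<mu> u \<omega>))\<^sup>2))"
  have fm: "?f \<in> borel_measurable (F T)" by measurable
  have "AE \<omega> in M. ?f \<omega> = Dm \<mu> T \<omega>"
    using Z by eventually_elim (simp add: Dm_def en_Hm)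
  moreover have "{\<omega>\<in>space M. ?f \<omega> \<noteq> Dm \<mu> T \<omega>} \<in> sets (F T)"
    using borel_measurable_neq[OF fm Dm_measurable[OF \<mu> rT order_refl]] by (simp add: vimage_def Int_def)
  ultimately have "AE \<omega> in restr_to_subalg M (F T). ?f \<omega> = Dm \<mu> T \<omega>"
    using subalgebra_F[of T] sets_F_sub_M[of T]
    by (subst AE_iff_measurable[OF _ refl]; subst (asm) AE_iff_measurable[OF _ refl])
       (auto simp: space_restr_to_subalg sets_restr_to_subalg emeasure_restr_to_subalg)
  then show ?thesis
    unfolding girsanov_measure_def using subalgebra_F[of T] fm
    by (intro density_cong) (auto simp: measurable_in_subalg' elim!: eventually_mono)
qed

end

section \<open>Refinement, pasting and regularity of simple controls\<close>

lemma find_cell_left: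
  fixes s :: "nat \<Rightarrow> real"
  shows "s 0 < x \<Longrightarrow> x \<le> s N \<Longrightarrow> \<exists>i<N. s i < x \<and> x \<le> s (Suc i)"
proof (induction N)
  case (Suc N)
  then show ?case by (cases "x \<le> s N") (auto intro: less_SucI)
qed simp

lemma find_cell_right:
  fixes s :: "nat \<Rightarrow> real"
  shows "s 0 \<le> x \<Longrightarrow> x < s N \<Longrightarrow> \<exists>i<N. s i \<le> x \<and> x < s (Suc i)"
proof (induction N)
  case (Suc N)
  then show ?case by (cases "x < s N") (auto intro: less_SucI)
qed simp

lemma steps_mono:
  fixes s :: "nat \<Rightarrow> real"
  assumes "\<forall>i<N. s i < s (Suc i)"
  shows "i \<le> j \<Longrightarrow> j \<le> N \<Longrightarrow> s i \<le> s j"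
proof (induction j)
  case (Suc j)
  then show ?case using assms by (cases "i = Suc j") (auto simp: less_imp_le intro: order_trans)
qed simp

text \<open>The mesh is the sorted list of \<open>U\<close>. For \<open>r = T\<close> this list has
  one element and the mesh has no step.\<close>

lemma finite_mesh:
  fixes r T :: real
  assumes U: "finite U" "r \<in> U" "T \<in> U" "U \<subseteq> {r..T}"
  shows "\<exists>N s. s 0 = r \<and> s N = T \<and> (\<forall>i<N. s i < s (Suc i)) \<and> (\<forall>i<N. {s i<..<s (Suc i)} \<inter> U = {})"
proof -
  define l where "l = sorted_list_of_set U"
  have l: "sorted_wrt (<) l" "set l = U" "length l = card U"
    using U(1) by (simp_all add: l_def strict_sorted_list_of_set)
  have pos: "0 < length l" using U l by (auto simp: card_gt_0_iff)
  have less: "i < j \<Longrightarrow> j < length l \<Longrightarrow> l ! i < l ! j" for i j using l(1) by (rule sorted_wrt_nth_less)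
  have range: "i < length l \<Longrightarrow> r \<le> l ! i \<and> l ! i \<le> T" for i using U(4) l(2) nth_mem[of i l] by auto
  obtain k where k: "k < length l" "l ! k = r" using U(2) l(2) by (metis in_set_conv_nth)
  have "k = 0" using less[of 0 k] range[OF pos] k by (cases "k = 0") auto
  obtain m where m: "m < length l" "l ! m = T" using U(3) l(2) by (metis in_set_conv_nth)
  have "m = length l - 1" using less[of m "length l - 1"] range[of "length l - 1"] m pos by (cases "m < length l - 1") auto
  have "{l ! i<..<l ! Suc i} \<inter> U = {}" if i: "i < length l - 1" for i
  proof (rule ccontr)
    assume "{l ! i<..<l ! Suc i} \<inter> U \<noteq> {}"
    then obtain x where "x \<in> U" "l ! i < x" "x < l ! Suc i" by auto
    moreover then obtain j where "j < length l" "l ! j = x" using l(2) by (metis in_set_conv_nth)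
    ultimately have j: "j < length l" "l ! i < l ! j" "l ! j < l ! Suc i" by auto
    have il: "i < length l" "Suc i < length l" using i by auto
    have "i < j" using less[of j i] j il by (cases i j rule: linorder_cases) auto
    moreover have "j < Suc i" using less[of "Suc i" j] j il by (cases j "Suc i" rule: linorder_cases) auto
    ultimately show False by simp
  qed
  then show ?thesis
    using k m less \<open>k = 0\<close> \<open>m = length l - 1\<close> by (intro exI[of _ "length l - 1"] exI[of _ "\<lambda>i. l ! i"]) auto
qed

context diffusion
begin

definition piece_by where
  "piece_by \<Lambda> p q \<mu> I A lam \<longleftrightarrow> finite (I :: nat set) \<and> disjoint_family_on A I \<and> (\<Union>j\<in>I. A j) = \<Omega> \<and>
     (\<forall>j\<in>I. A j \<in> sets (F p) \<and> lam j \<in> bounded_selections \<Lambda> \<and> continuous_on ({0..} \<times> UNIV) (\<lambda>(t, x). lam j t x)) \<and>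
     (\<forall>u\<in>{p<..q}. \<forall>\<omega>\<in>\<Omega>. \<mu> u \<omega> = (\<Sum>j\<in>I. indicator (A j) \<omega> *\<^sub>R lam j u (\<omega> u)))"

text \<open>The data of a piece are packed into one triple so that they can be chosen for all cells
  by a single application of choice.\<close>

definition piece :: "(real \<Rightarrow> real ^ 'n \<Rightarrow> (real ^ 'n) set) \<Rightarrow> real \<Rightarrow> real \<Rightarrow> (real \<Rightarrow> 'n path \<Rightarrow> real ^ 'n) \<Rightarrow> bool" where
  "piece \<Lambda> p q \<mu> \<longleftrightarrow> (\<exists>w. piece_by \<Lambda> p q \<mu> (fst w) (fst (snd w)) (snd (snd w)))"

lemma simple_controls_iff:
  "\<mu> \<in> simple_controls Q \<Lambda> r T \<longleftrightarrow> (\<exists>N s. s 0 = r \<and> s N = T \<and> (\<forall>i<N. s i < s (Suc i)) \<and>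
     (\<forall>i<N. piece \<Lambda> (s i) (s (Suc i)) \<mu>))"
proof
  assume "\<mu> \<in> simple_controls Q \<Lambda> r T"
  then show "\<exists>N s. s 0 = r \<and> s N = T \<and> (\<forall>i<N. s i < s (Suc i)) \<and> (\<forall>i<N. piece \<Lambda> (s i) (s (Suc i)) \<mu>)"
    unfolding simple_controls_def
  proof (elim CollectE exE conjE)
    fix N s I A lam
    assume s: "s 0 = r" "s N = T" "\<forall>i<N. s i < s (Suc i)"
      and 1: "\<forall>i<N. finite (I i :: nat set) \<and> disjoint_family_on (A i) (I i) \<and> (\<Union>j\<in>I i. A i j) = \<Omega> \<and>
             (\<forall>j\<in>I i. A i j \<in> sets (F (s i)) \<and> lam i j \<in> bounded_selections \<Lambda> \<and>
                continuous_on ({0..} \<times> UNIV) (\<lambda>(t, x). lam i j t x))"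
      and 2: "\<forall>i<N. \<forall>u\<in>{s i<..s (Suc i)}. \<forall>\<omega>\<in>\<Omega>. \<mu> u \<omega> = (\<Sum>j\<in>I i. indicator (A i j) \<omega> *\<^sub>R lam i j u (\<omega> u))"
    have "piece_by \<Lambda> (s i) (s (Suc i)) \<mu> (I i) (A i) (lam i)" if "i < N" for i
      unfolding piece_by_def using 1[rule_format, OF that] 2[rule_format, OF that] by simp
    then have "piece \<Lambda> (s i) (s (Suc i)) \<mu>" if "i < N" for i
      unfolding piece_def using that by (intro exI[of _ "(I i, A i, lam i)"]) simp
    with s show ?thesis by (intro exI[of _ N] exI[of _ s]) simp
  qed
next
  assume "\<exists>N s. s 0 = r \<and> s N = T \<and> (\<forall>i<N. s i < s (Suc i)) \<and> (\<forall>i<N. piece \<Lambda> (s i) (s (Suc i)) \<mu>)"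
  then obtain N s where s: "s 0 = r" "s N = T" "\<forall>i<N. s i < s (Suc i)"
    and p: "\<forall>i<N. piece \<Lambda> (s i) (s (Suc i)) \<mu>" by blast
  have "\<forall>i. \<exists>w. i < N \<longrightarrow> piece_by \<Lambda> (s i) (s (Suc i)) \<mu> (fst w) (fst (snd w)) (snd (snd w))"
    using p unfolding piece_def by blast
  from choice[OF this] obtain w where
    w: "\<forall>i. i < N \<longrightarrow> piece_by \<Lambda> (s i) (s (Suc i)) \<mu> (fst (w i)) (fst (snd (w i))) (snd (snd (w i)))" ..
  show "\<mu> \<in> simple_controls Q \<Lambda> r T"
    unfolding simple_controls_def
    by (intro CollectI exI[of _ N] exI[of _ s] exI[of _ "\<lambda>i. fst (w i)"] exI[of _ "\<lambda>i. fst (snd (w i))"]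
        exI[of _ "\<lambda>i. snd (snd (w i))"] conjI s) (use w in \<open>simp_all add: piece_by_def\<close>)
qed

text \<open>Events known at \<open>p\<close> remain known at a later start, so the same partition
  and maps describe the control on a smaller interval.\<close>

lemma piece_mono: "piece \<Lambda> p q \<mu> \<Longrightarrow> p \<le> p' \<Longrightarrow> q' \<le> q \<Longrightarrow> piece \<Lambda> p' q' \<mu>"
proof -
  assume "piece \<Lambda> p q \<mu>" and le: "p \<le> p'" "q' \<le> q"
  then obtain w where w: "piece_by \<Lambda> p q \<mu> (fst w) (fst (snd w)) (snd (snd w))" unfolding piece_def by blast
  have "piece_by \<Lambda> p' q' \<mu> (fst w) (fst (snd w)) (snd (snd w))"
    using w le subsetD[OF F_mono[OF le(1)]] unfolding piece_by_def by simp
  then show ?thesis unfolding piece_def ..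
qed

lemma piece_cong:
  assumes "piece \<Lambda> p q \<mu>" "\<And>u \<omega>. p < u \<Longrightarrow> u \<le> q \<Longrightarrow> \<omega> \<in> \<Omega> \<Longrightarrow> \<nu> u \<omega> = \<mu> u \<omega>"
  shows "piece \<Lambda> p q \<nu>"
proof -
  obtain w where w: "piece_by \<Lambda> p q \<mu> (fst w) (fst (snd w)) (snd (snd w))" using assms(1) unfolding piece_def by blast
  have "piece_by \<Lambda> p q \<nu> (fst w) (fst (snd w)) (snd (snd w))"
    using w assms(2) unfolding piece_by_def by simp
  then show ?thesis unfolding piece_def ..
qed

text \<open>The index sets of the two partitions are made disjoint by passing to even and odd numbers.\<close>

lemma piece_if:
  assumes \<mu>: "piece \<Lambda> p q \<mu>" and \<nu>: "piece \<Lambda> p q \<nu>" and B: "B \<in> sets (F p)"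
  shows "piece \<Lambda> p q (\<lambda>u \<omega>. if \<omega> \<in> B then \<nu> u \<omega> else \<mu> u \<omega>)"
proof -
  obtain I1 A1 l1 where 1: "piece_by \<Lambda> p q \<mu> I1 A1 l1" using \<mu> unfolding piece_def by blast
  obtain I2 A2 l2 where 2: "piece_by \<Lambda> p q \<nu> I2 A2 l2" using \<nu> unfolding piece_def by blast
  let ?I1 = "(\<lambda>j. 2 * j) ` I1" and ?I2 = "(\<lambda>j. Suc (2 * j)) ` I2"
  define A where "A k = (if even k then A1 (k div 2) - B else A2 (k div 2) \<inter> B)" for k
  define l where "l k = (if even k then l1 (k div 2) else l2 (k div 2))" for k
  have A: "A (2 * j) = A1 j - B" "A (Suc (2 * j)) = A2 j \<inter> B" and l: "l (2 * j) = l1 j" "l (Suc (2 * j)) = l2 j" for j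
    unfolding A_def l_def by simp_all
  have fin: "finite I1" "finite I2" and dis: "disjoint_family_on A1 I1" "disjoint_family_on A2 I2"
    and un: "(\<Union>j\<in>I1. A1 j) = \<Omega>" "(\<Union>j\<in>I2. A2 j) = \<Omega>"
    using 1 2 by (simp_all add: piece_by_def)
  have "piece_by \<Lambda> p q (\<lambda>u \<omega>. if \<omega> \<in> B then \<nu> u \<omega> else \<mu> u \<omega>) (?I1 \<union> ?I2) A l"
    unfolding piece_by_def
  proof (intro conjI)
    show "finite (?I1 \<union> ?I2)" using fin by simp
    show "disjoint_family_on A (?I1 \<union> ?I2)"
      unfolding disjoint_family_on_def
    proof (intro ballI impI)
      fix m n assume mn: "m \<in> ?I1 \<union> ?I2" "n \<in> ?I1 \<union> ?I2" "m \<noteq> n"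
      have d: "i \<in> I1 \<Longrightarrow> j \<in> I1 \<Longrightarrow> i \<noteq> j \<Longrightarrow> A1 i \<inter> A1 j = {}" "i \<in> I2 \<Longrightarrow> j \<in> I2 \<Longrightarrow> i \<noteq> j \<Longrightarrow> A2 i \<inter> A2 j = {}" for i j
        using dis by (simp_all add: disjoint_family_on_def)
      from mn(1) show "A m \<inter> A n = {}"
      proof
        assume "m \<in> ?I1"
        then obtain i where i: "m = 2 * i" "i \<in> I1" by auto
        from mn(2) show ?thesis
        proof
          assume "n \<in> ?I1"
          then obtain j where j: "n = 2 * j" "j \<in> I1" by auto
          then show ?thesis using d(1)[OF i(2) j(2)] mn(3) i(1) by (auto simp: A)
        qed (use i in \<open>auto simp: A\<close>)
      next
        assume "m \<in> ?I2"
        then obtain i where i: "m = Suc (2 * i)" "i \<in> I2" by auto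
        from mn(2) show ?thesis
        proof
          assume "n \<in> ?I2"
          then obtain j where j: "n = Suc (2 * j)" "j \<in> I2" by auto
          then show ?thesis using d(2)[OF i(2) j(2)] mn(3) i(1) by (auto simp: A)
        qed (use i in \<open>auto simp: A\<close>)
      qed
    qed
    have B\<Omega>: "B \<subseteq> \<Omega>" using sets.sets_into_space[OF B] by simp
    have "(\<Union>j\<in>?I1 \<union> ?I2. A j) = ((\<Union>j\<in>I1. A1 j) - B) \<union> ((\<Union>j\<in>I2. A2 j) \<inter> B)" by (auto simp: A)
    then show "(\<Union>j\<in>?I1 \<union> ?I2. A j) = \<Omega>" unfolding un using B\<Omega> by auto
    show "\<forall>j\<in>?I1 \<union> ?I2. A j \<in> sets (F p) \<and> l j \<in> bounded_selections \<Lambda> \<and> continuous_on ({0..} \<times> UNIV) (\<lambda>(t, x). l j t x)"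
      using 1 2 B unfolding piece_by_def by (simp add: ball_Un A l sets.Diff sets.Int)
    show "\<forall>u\<in>{p<..q}. \<forall>\<omega>\<in>\<Omega>. (if \<omega> \<in> B then \<nu> u \<omega> else \<mu> u \<omega>) = (\<Sum>j\<in>?I1 \<union> ?I2. indicator (A j) \<omega> *\<^sub>R l j u (\<omega> u))"
    proof (intro ballI)
      fix u and \<omega> :: "'n path" assume u: "u \<in> {p<..q}" "\<omega> \<in> \<Omega>"
      have "?I1 \<inter> ?I2 = {}"
      proof (rule ccontr)
        assume "?I1 \<inter> ?I2 \<noteq> {}"
        then obtain i j :: nat where "2 * i = Suc (2 * j)" by auto
        then show False by presburger
      qed
      then have "(\<Sum>j\<in>?I1 \<union> ?I2. indicator (A j) \<omega> *\<^sub>R l j u (\<omega> u)) =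
        (\<Sum>j\<in>?I1. indicator (A j) \<omega> *\<^sub>R l j u (\<omega> u)) + (\<Sum>j\<in>?I2. indicator (A j) \<omega> *\<^sub>R l j u (\<omega> u))"
        using fin by (intro sum.union_disjoint) auto
      also have "(\<Sum>j\<in>?I1. indicator (A j) \<omega> *\<^sub>R l j u (\<omega> u)) = (\<Sum>j\<in>I1. indicator (A1 j - B) \<omega> *\<^sub>R l1 j u (\<omega> u))"
        by (subst sum.reindex) (auto simp: inj_on_def A l)
      also have "(\<Sum>j\<in>?I2. indicator (A j) \<omega> *\<^sub>R l j u (\<omega> u)) = (\<Sum>j\<in>I2. indicator (A2 j \<inter> B) \<omega> *\<^sub>R l2 j u (\<omega> u))"
        by (subst sum.reindex) (auto simp: inj_on_def A l)
      also have "(\<Sum>j\<in>I1. indicator (A1 j - B) \<omega> *\<^sub>R l1 j u (\<omega> u)) = (if \<omega> \<in> B then 0 else \<mu> u \<omega>)"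
        using 1 u by (auto simp: piece_by_def indicator_def intro!: sum.cong)
      also have "(\<Sum>j\<in>I2. indicator (A2 j \<inter> B) \<omega> *\<^sub>R l2 j u (\<omega> u)) = (if \<omega> \<in> B then \<nu> u \<omega> else 0)"
        using 2 u by (auto simp: piece_by_def indicator_def intro!: sum.cong)
      finally show "(if \<omega> \<in> B then \<nu> u \<omega> else \<mu> u \<omega>) = (\<Sum>j\<in>?I1 \<union> ?I2. indicator (A j) \<omega> *\<^sub>R l j u (\<omega> u))"
        by simp
    qed
  qed
  then show ?thesis unfolding piece_def by (intro exI[of _ "(?I1 \<union> ?I2, A, l)"]) simp
qed

lemma piece_between:
  assumes s: "s 0 = r" "s N = T" and p: "\<forall>i<N. piece \<Lambda> (s i) (s (Suc i)) \<mu>"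
    and ab: "r \<le> a" "a < b" "b \<le> T" and U: "{a<..<b} \<inter> s ` {..N} = {}"
  shows "piece \<Lambda> a b \<mu>"
proof -
  obtain i where i: "i < N" "s i \<le> a" "a < s (Suc i)" using find_cell_right[of s a N] s ab by auto
  have "s (Suc i) \<in> s ` {..N}" using i(1) by auto
  then have "b \<le> s (Suc i)" using U i(3) by (force simp: not_less[symmetric])
  then show ?thesis using piece_mono p i by blast
qed

text \<open>Both subdivisions are refined jointly with the finitely many values of
  \<open>\<tau>\<close>. On a cell of this mesh it is settled at the left end whether
  \<open>\<tau>\<close> has passed, so the switch is made along an event known there and
  \<open>piece_if\<close> applies.\<close>

lemma simple_controls_paste:
  assumes \<mu>: "\<mu> \<in> simple_controls Q \<Lambda> r T" and \<nu>: "\<nu> \<in> simple_controls Q \<Lambda> r T"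
    and \<tau>: "\<tau> \<in> times" and A: "A \<in> sets (pre_sigma \<tau>)"
  shows "(\<lambda>u \<omega>. if \<tau> \<omega> < u \<and> \<omega> \<in> A then \<nu> u \<omega> else \<mu> u \<omega>) \<in> simple_controls Q \<Lambda> r T"
proof -
  obtain N1 s1 where 1: "s1 0 = r" "s1 N1 = T" "\<forall>i<N1. s1 i < s1 (Suc i)" "\<forall>i<N1. piece \<Lambda> (s1 i) (s1 (Suc i)) \<mu>"
    using \<mu> unfolding simple_controls_iff by blast
  obtain N2 s2 where 2: "s2 0 = r" "s2 N2 = T" "\<forall>i<N2. s2 i < s2 (Suc i)" "\<forall>i<N2. piece \<Lambda> (s2 i) (s2 (Suc i)) \<nu>"
    using \<nu> unfolding simple_controls_iff by blast
  define U where "U = s1 ` {..N1} \<union> s2 ` {..N2} \<union> \<tau> ` \<Omega>"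
  have "s1 ` {..N1} \<subseteq> {r..T}" "s2 ` {..N2} \<subseteq> {r..T}"
    using steps_mono[OF 1(3), of 0] steps_mono[OF 1(3), of _ N1] steps_mono[OF 2(3), of 0] steps_mono[OF 2(3), of _ N2]
      1(1,2) 2(1,2) by auto
  moreover have "\<tau> ` \<Omega> \<subseteq> {r..T}" and fin: "finite (\<tau> ` \<Omega>)" using timesD[OF \<tau>] by auto
  ultimately have "U \<subseteq> {r..T}" "finite U" by (auto simp: U_def)
  moreover have "s1 0 \<in> U" "s1 N1 \<in> U" unfolding U_def by blast+
  ultimately obtain N s where s: "s 0 = r" "s N = T" "\<forall>i<N. s i < s (Suc i)"
    and gap: "\<forall>i<N. {s i<..<s (Suc i)} \<inter> U = {}" using finite_mesh[of U r T] 1(1,2) by auto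
  have "piece \<Lambda> (s i) (s (Suc i)) (\<lambda>u \<omega>. if \<tau> \<omega> < u \<and> \<omega> \<in> A then \<nu> u \<omega> else \<mu> u \<omega>)" if i: "i < N" for i
  proof -
    have ab: "r \<le> s i" "s i < s (Suc i)" "s (Suc i) \<le> T"
      using steps_mono[OF s(3), of 0 i] steps_mono[OF s(3), of "Suc i" N] s i by auto
    have g: "{s i<..<s (Suc i)} \<inter> s1 ` {..N1} = {}" "{s i<..<s (Suc i)} \<inter> s2 ` {..N2} = {}" "{s i<..<s (Suc i)} \<inter> \<tau> ` \<Omega> = {}"
      using gap i unfolding U_def by blast+
    \<comment> \<open>The paths of \<open>A\<close> on which the switch has occurred by the time
      \<open>s i\<close>.\<close>
    define B where "B = (\<Union>v\<in>\<tau> ` \<Omega> \<inter> {..s i}. {\<omega>\<in>A. \<tau> \<omega> = v})"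
    have "{\<omega>\<in>A. \<tau> \<omega> = v} \<in> sets (F (s i))" if "v \<in> \<tau> ` \<Omega>" "v \<le> s i" for v
      using A that(1) F_mono[OF that(2)] unfolding sets_pre_sigma_iff[OF \<tau>] by auto
    then have B: "B \<in> sets (F (s i))" unfolding B_def using fin by (intro sets.finite_UN) auto
    have A\<Omega>: "A \<subseteq> \<Omega>" using A unfolding sets_pre_sigma_iff[OF \<tau>] by simp
    have "piece \<Lambda> (s i) (s (Suc i)) (\<lambda>u \<omega>. if \<omega> \<in> B then \<nu> u \<omega> else \<mu> u \<omega>)"
      by (intro piece_if B piece_between[OF 1(1,2,4) ab g(1)] piece_between[OF 2(1,2,4) ab g(2)])
    then show ?thesis
    proof (rule piece_cong)
      fix u and \<omega> :: "'n path" assume u: "s i < u" "u \<le> s (Suc i)" "\<omega> \<in> \<Omega>"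
      have "\<tau> \<omega> \<in> \<tau> ` \<Omega>" using u(3) by simp
      then have "\<tau> \<omega> \<notin> {s i<..<s (Suc i)}" using g(3) by blast
      \<comment> \<open>A value of \<open>\<tau>\<close> at the right end of the cell is not below
        any \<open>u\<close> of the cell, and a value at the left end is below all of them;
        half-open cells fit the strict inequality.\<close>
      then have "\<tau> \<omega> < u \<longleftrightarrow> \<tau> \<omega> \<le> s i" using u by auto
      then have "\<tau> \<omega> < u \<and> \<omega> \<in> A \<longleftrightarrow> \<omega> \<in> B" unfolding B_def using u(3) by auto
      then show "(if \<tau> \<omega> < u \<and> \<omega> \<in> A then \<nu> u \<omega> else \<mu> u \<omega>) = (if \<omega> \<in> B then \<nu> u \<omega> else \<mu> u \<omega>)" by simp
    qed
  qed
  then show ?thesis unfolding simple_controls_iff using s by blast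
qed

lemma simple_controls_zero:
  assumes "multivalued_borel \<Lambda>"
  shows "(\<lambda>_ _. 0) \<in> simple_controls Q \<Lambda> r T"
proof -
  have b: "bounded ((\<lambda>z. 0 :: real ^ 'n) ` U)" for U :: "(real \<times> (real ^ 'n)) set"
    by (rule bounded_subset[of "{0}"]) auto
  have "(\<lambda>_ _. 0 :: real ^ 'n) \<in> bounded_selections \<Lambda>"
    using assms b unfolding bounded_selections_def multivalued_borel_def by (simp add: case_prod_beta')
  then have "piece_by \<Lambda> p q (\<lambda>_ _. 0) {0} (\<lambda>_. \<Omega>) (\<lambda>_ _ _. 0)" for p q
    by (simp add: piece_by_def disjoint_family_on_def case_prod_beta')
  then have "piece \<Lambda> p q (\<lambda>_ _. 0)" for p q
    unfolding piece_def by (intro exI[of _ "({0}, \<lambda>_. \<Omega>, \<lambda>_ _ _. 0)"]) simp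
  moreover obtain N s where "s 0 = r" "s N = T" "\<forall>i<N. s i < s (Suc i :: nat)"
    using finite_mesh[of "{r, T}" r T] rT by auto
  ultimately show ?thesis unfolding simple_controls_iff by blast
qed

text \<open>The formula of a piece makes sense at all times from \<open>r\<close> on and extends the
  control continuously and boundedly beyond its cell. The extension supplies the right limit at the
  left end \<open>p\<close>, where the control itself follows the preceding piece.\<close>

lemma piece_function:
  assumes "piece \<Lambda> p q \<mu>" "r \<le> p"
  shows "\<exists>w. (\<forall>u\<in>{p<..q}. \<forall>\<omega>\<in>\<Omega>. \<mu> u \<omega> = fst w u \<omega>) \<and> (\<forall>u\<ge>p. fst w u \<in> borel_measurable (F u)) \<and>
    (\<forall>\<omega>\<in>\<Omega>. continuous_on {r..} (\<lambda>u. fst w u \<omega>)) \<and> 0 \<le> snd w \<and> (\<forall>u\<ge>r. \<forall>\<omega>\<in>\<Omega>. norm (fst w u \<omega>) \<le> snd w)"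
proof -
  obtain I A l where 1: "piece_by \<Lambda> p q \<mu> I A l" using assms(1) unfolding piece_def by blast
  define f where "f u \<omega> = (\<Sum>j\<in>I. indicator (A j) \<omega> *\<^sub>R l j u (\<omega> u))" for u and \<omega> :: "'n path"
  have c: "j \<in> I \<Longrightarrow> continuous_on ({0..} \<times> UNIV) (\<lambda>(t, x). l j t x)"
    and A: "j \<in> I \<Longrightarrow> A j \<in> sets (F p)" and bs: "j \<in> I \<Longrightarrow> l j \<in> bounded_selections \<Lambda>" for j
    using 1 by (simp_all add: piece_by_def)
  have "\<forall>j. \<exists>b. j \<in> I \<longrightarrow> (\<forall>t\<ge>0. \<forall>x. norm (l j t x) \<le> b)"
    using bs unfolding bounded_selections_def bounded_iff by fastforce
  from choice[OF this] obtain b where b: "\<forall>j. j \<in> I \<longrightarrow> (\<forall>t\<ge>0. \<forall>x. norm (l j t x) \<le> b j)" ..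
  have b0: "0 \<le> b j" if "j \<in> I" for j
    using b that norm_ge_zero[of "l j 0 0"] order_trans by blast
  have m: "f u \<in> borel_measurable (F u)" if "p \<le> u" for u
    unfolding f_def[abs_def]
  proof (intro borel_measurable_sum borel_measurable_scaleR)
    fix j assume j: "j \<in> I"
    have "A j \<in> sets (F u)" using A[OF j] F_mono[OF that] by blast
    then show "indicator (A j) \<in> borel_measurable (F u)" by (rule borel_measurable_indicator)
    have "continuous_on UNIV (\<lambda>x. (\<lambda>(t, x). l j t x) (u, x))"
      using that assms(2) r_nonneg by (intro continuous_on_compose2[OF c[OF j]] continuous_intros) auto
    then have "l j u \<in> borel_measurable borel" by (simp add: borel_measurable_continuous_onI)
    from measurable_compose[OF X_measurable this] show "(\<lambda>\<omega>. l j u (\<omega> u)) \<in> borel_measurable (F u)"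
      using that assms(2) by simp
  qed
  have cf: "continuous_on {r..} (\<lambda>u. f u \<omega>)" if "\<omega> \<in> \<Omega>" for \<omega>
    unfolding f_def
  proof (intro continuous_on_sum continuous_on_scaleR continuous_on_const)
    fix j assume j: "j \<in> I"
    have "continuous_on {r..} (\<lambda>x. (x, \<omega> x))"
      using that by (intro continuous_on_Pair continuous_on_id) (simp add: path_space_def)
    then have "continuous_on {r..} (\<lambda>u. (\<lambda>(t, x). l j t x) (u, \<omega> u))"
      using r_nonneg by (intro continuous_on_compose2[OF c[OF j]]) auto
    then show "continuous_on {r..} (\<lambda>u. l j u (\<omega> u))" by simp
  qed
  have bf: "norm (f u \<omega>) \<le> sum b I" if "r \<le> u" for u \<omega>
    unfolding f_def
  proof (rule sum_norm_le)
    fix j assume "j \<in> I"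
    then have "norm (l j u (\<omega> u)) \<le> b j" "0 \<le> b j" using b b0 that r_nonneg by auto
    then show "norm (indicator (A j) \<omega> *\<^sub>R l j u (\<omega> u)) \<le> b j" by (simp split: split_indicator)
  qed
  show ?thesis
    using 1 m cf bf b0 by (intro exI[of _ "(f, sum b I)"]) (auto simp: f_def piece_by_def intro: sum_nonneg)
qed

lemma simple_controls_regular:
  assumes "\<mu> \<in> simple_controls Q \<Lambda> r T"
  shows "regular \<mu>"
proof -
  obtain N s where s: "s 0 = r" "s N = T" "\<forall>i<N. s i < s (Suc i)" and p: "\<forall>i<N. piece \<Lambda> (s i) (s (Suc i)) \<mu>"
    using assms unfolding simple_controls_iff by blast
  have sr: "r \<le> s i" if "i < N" for i using steps_mono[OF s(3), of 0 i] s(1) that by simp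
  let ?P = "\<lambda>i w. (\<forall>u\<in>{s i<..s (Suc i)}. \<forall>\<omega>\<in>\<Omega>. \<mu> u \<omega> = fst w u \<omega>) \<and> (\<forall>u\<ge>s i. fst w u \<in> borel_measurable (F u)) \<and>
    (\<forall>\<omega>\<in>\<Omega>. continuous_on {r..} (\<lambda>u. fst w u \<omega>)) \<and> 0 \<le> snd w \<and> (\<forall>u\<ge>r. \<forall>\<omega>\<in>\<Omega>. norm (fst w u \<omega>) \<le> snd w)"
  have "\<exists>w. i < N \<longrightarrow> ?P i w" for i
  proof (cases "i < N")
    case True
    then show ?thesis using piece_function[OF p[rule_format, OF True] sr[OF True]] by simp
  qed simp
  then have "\<forall>i. \<exists>w. i < N \<longrightarrow> ?P i w" ..
  from choice[OF this] obtain w where w: "\<forall>i. i < N \<longrightarrow> ?P i (w i)" ..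
  have eq: "\<mu> u \<omega> = fst (w i) u \<omega>" if "i < N" "s i < u" "u \<le> s (Suc i)" "\<omega> \<in> \<Omega>" for i u \<omega>
    using w that by simp
  have meas: "fst (w i) u \<in> borel_measurable (F u)" if "i < N" "s i \<le> u" for i u using w that by blast
  have cont: "continuous_on {r..} (\<lambda>u. fst (w i) u \<omega>)" if "i < N" "\<omega> \<in> \<Omega>" for i \<omega> using w that by blast
  have bnd: "norm (fst (w i) u \<omega>) \<le> snd (w i)" if "i < N" "r \<le> u" "\<omega> \<in> \<Omega>" for i u \<omega> using w that by blast
  have bnd0: "0 \<le> snd (w i)" if "i < N" for i using w that by blast
  \<comment> \<open>Right limits look into the cell to the right of \<open>p\<close>, so here the
    cells are closed on the left.\<close>
  define ix where "ix p = (SOME i. i < N \<and> s i \<le> p \<and> p < s (Suc i))" for p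
  have ix: "ix p < N" "s (ix p) \<le> p" "p < s (Suc (ix p))" if "r \<le> p" "p < T" for p
    using someI_ex[OF find_cell_right[of s p N]] that s unfolding ix_def by auto
  \<comment> \<open>There is no cell to the right of \<open>T\<close>. The filler \<open>0\<close>
    keeps \<open>\<rho> T\<close> measurable, while right limits are asked for before
    \<open>T\<close> only.\<close>
  define \<rho> where "\<rho> p \<omega> = (if p < T then fst (w (ix p)) p \<omega> else 0)" for p and \<omega> :: "'n path"
  have "caglad r T \<mu> \<rho>"
    unfolding caglad_def
  proof (intro conjI ballI)
    fix p assume p: "p \<in> {r..T}"
    show "\<rho> p \<in> borel_measurable (F p)"
    proof (cases "p < T")
      case True
      then show ?thesis using meas[OF ix(1,2)[of p]] p unfolding \<rho>_def[abs_def] by simp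
    qed (simp add: \<rho>_def[abs_def])
  next
    fix \<omega> :: "'n path" and p assume \<omega>: "\<omega> \<in> \<Omega>" and p: "p \<in> {r..<T}"
    then have i: "ix p < N" "s (ix p) \<le> p" "p < s (Suc (ix p))" using ix[of p] by auto
    have "((\<lambda>u. fst (w (ix p)) u \<omega>) \<longlongrightarrow> fst (w (ix p)) p \<omega>) (at p within {r..})"
      using cont[OF i(1) \<omega>] p by (auto simp: continuous_on_def)
    then have "((\<lambda>u. fst (w (ix p)) u \<omega>) \<longlongrightarrow> fst (w (ix p)) p \<omega>) (at_right p)"
      by (rule tendsto_within_subset) (use p in auto)
    then have l: "((\<lambda>u. fst (w (ix p)) u \<omega>) \<longlongrightarrow> \<rho> p \<omega>) (at_right p)"
      using p by (simp add: \<rho>_def)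
    have "fst (w (ix p)) u \<omega> = \<mu> u \<omega>" if "p < u" "u < s (Suc (ix p))" for u
      using eq[OF i(1) _ _ \<omega>, of u] that i(2) by simp
    then have "eventually (\<lambda>u. fst (w (ix p)) u \<omega> = \<mu> u \<omega>) (at_right p)"
      unfolding eventually_at_right_field using i(3) by blast
    then show "((\<lambda>u. \<mu> u \<omega>) \<longlongrightarrow> \<rho> p \<omega>) (at_right p)" using l by (rule Lim_transform_eventually[rotated])
  next
    fix \<omega> :: "'n path" and x assume \<omega>: "\<omega> \<in> \<Omega>" and x: "x \<in> {r<..T}"
    obtain i where i: "i < N" "s i < x" "x \<le> s (Suc i)" using find_cell_left[of s x N] s x by auto
    have "isCont (\<lambda>u. fst (w i) u \<omega>) x"
      using x by (intro continuous_on_interior[OF cont[OF i(1) \<omega>]]) auto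
    then have l: "((\<lambda>u. fst (w i) u \<omega>) \<longlongrightarrow> \<mu> x \<omega>) (at_left x)"
      unfolding isCont_def eq[OF i \<omega>] by (rule tendsto_within_subset) auto
    have "fst (w i) u \<omega> = \<mu> u \<omega>" if "s i < u" "u < x" for u
      using eq[OF i(1) _ _ \<omega>, of u] that i(3) by simp
    then have "eventually (\<lambda>u. fst (w i) u \<omega> = \<mu> u \<omega>) (at_left x)"
      unfolding eventually_at_left_field using i(2) by blast
    then show "((\<lambda>u. \<mu> u \<omega>) \<longlongrightarrow> \<mu> x \<omega>) (at_left x)" using l by (rule Lim_transform_eventually[rotated])
  qed
  moreover have "norm (\<mu> x \<omega>) \<le> (\<Sum>i<N. snd (w i))" if x: "x \<in> {r<..T}" "\<omega> \<in> \<Omega>" for x \<omega>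
  proof -
    obtain i where i: "i < N" "s i < x" "x \<le> s (Suc i)" using find_cell_left[of s x N] s x by auto
    have "norm (\<mu> x \<omega>) \<le> snd (w i)" unfolding eq[OF i x(2)] using x by (intro bnd i) auto
    also have "\<dots> \<le> (\<Sum>i<N. snd (w i))" using i(1) bnd0 by (intro member_le_sum) auto
    finally show ?thesis .
  qed
  ultimately show ?thesis unfolding regular_def by blast
qed

lemma cost_measurable_F:
  assumes g: "(\<lambda>(u, x, v). g u x v) \<in> borel_measurable (restrict_space borel ({0..} \<times> UNIV \<times> UNIV))"
    and \<mu>: "regular \<mu>" and v: "r \<le> v" "v \<le> T"
  shows "(\<lambda>(u, \<omega>). indicator {r<..v} u * (g u (\<omega> u) (\<mu> u \<omega>) :: ennreal)) \<in> borel_measurable (lborel \<Otimes>\<^sub>M F v)"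
proof -
  \<comment> \<open>\<open>g\<close> is Borel on nonnegative times; continued by zero it can be
    composed with measurable maps into the whole space.\<close>
  define g' where "g' z = (case z of (u, x, h) \<Rightarrow> g u x h) * indicator ({0..} \<times> UNIV \<times> UNIV) z" for z :: "real \<times> (real ^ 'n) \<times> (real ^ 'n)"
  have "{0..} \<times> UNIV \<times> UNIV \<in> sets (borel :: (real \<times> (real ^ 'n) \<times> (real ^ 'n)) measure)"
    by (intro borel_closed closed_Times) auto
  then have "g' \<in> borel_measurable borel"
    using g unfolding g'_def[abs_def] by (subst (asm) borel_measurable_restrict_space_iff_ennreal) auto
  then have g': "g' \<in> borel_measurable (borel \<Otimes>\<^sub>M (borel \<Otimes>\<^sub>M borel))" by (simp add: borel_prod)
  obtain \<rho> b where c: "caglad r T \<mu> \<rho>" using \<mu> unfolding regular_def by blast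
  have [measurable]: "(\<lambda>z. indicator {r<..v} (fst z) *\<^sub>R (snd z) (fst z)) \<in> borel_measurable (lborel \<Otimes>\<^sub>M F v)"
    using jm_X[OF order_refl, of v] unfolding jm_def by (simp add: case_prod_beta')
  have [measurable]: "(\<lambda>z. indicator {r<..v} (fst z) *\<^sub>R \<mu> (fst z) (snd z)) \<in> borel_measurable (lborel \<Otimes>\<^sub>M F v)"
    using caglad_jm[OF caglad_subinterval[OF c order_refl v(2)]] unfolding jm_def by (simp add: case_prod_beta')
  let ?h = "\<lambda>z. (fst z, indicator {r<..v} (fst z) *\<^sub>R (snd z) (fst z), indicator {r<..v} (fst z) *\<^sub>R \<mu> (fst z) (snd z))"
  have "?h \<in> (lborel \<Otimes>\<^sub>M F v) \<rightarrow>\<^sub>M (borel \<Otimes>\<^sub>M (borel \<Otimes>\<^sub>M borel))" by measurable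
  from measurable_compose[OF this g']
  have "(\<lambda>z. indicator {r<..v} (fst z) * g' (?h z)) \<in> borel_measurable (lborel \<Otimes>\<^sub>M F v)" by measurable
  moreover have "(\<lambda>z. indicator {r<..v} (fst z) * g' (?h z)) = (\<lambda>(u, \<omega>). indicator {r<..v} u * g u (\<omega> u) (\<mu> u \<omega>))"
    using r_nonneg by (auto simp: fun_eq_iff g'_def indicator_def)
  ultimately show ?thesis by simp
qed

end

text \<open>\<open>ess_sup\<close> is a choice and \<open>real_of_ereal\<close> sends infinite
  values to zero. The first conjunct certifies that an essential supremum exists and is finite
  almost surely, so that the properties asserted next concern the intended object.\<close>

theorem proposition3p5:
  fixes \<sigma> :: "real \<Rightarrow> real ^ 'n::finite \<Rightarrow> real ^ 'n ^ 'n"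
    and \<Lambda> :: "real \<Rightarrow> real ^ 'n \<Rightarrow> (real ^ 'n) set"
    and g :: "real \<Rightarrow> real ^ 'n \<Rightarrow> real ^ 'n \<Rightarrow> ennreal"
    and r T :: real and y :: "real ^ 'n"
    and Q :: "'n path measure"
  assumes "continuous_on ({0..} \<times> UNIV) (\<lambda>(t, x). \<sigma> t x)"
    and "bounded ((\<lambda>(t, x). \<sigma> t x) ` ({0..} \<times> UNIV))"
    and "strictly_elliptic (diffusion_matrix \<sigma>)"
    and "multivalued_borel \<Lambda>"
    and "\<And>t x. t \<ge> 0 \<Longrightarrow> closed (\<Lambda> t x)"
    and "\<And>t x. t \<ge> 0 \<Longrightarrow> convex (\<Lambda> t x)"
    and "(\<lambda>(u, x, v). g u x v) \<in> borel_measurable (restrict_space borel ({0..} \<times> UNIV \<times> UNIV))"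
    and "\<And>u x. u \<ge> 0 \<Longrightarrow> {v. g u x v < \<infinity>} = \<Lambda> u x"
    and "\<And>u x. u \<ge> 0 \<Longrightarrow> g u x 0 = 0"
    and "0 \<le> r" and "r \<le> T"
    and "solves_martingale_problem \<sigma> (\<lambda>_ _. 0) r y Q"
  defines "M \<equiv> completion Q"
    and "\<T> \<equiv> simple_stopping_times Q r T"
    and "\<B> \<equiv> stopped_algebra Q r"
    and "\<Phi> \<equiv> penalized_process Q \<sigma> \<Lambda> g r T"
  shows "(\<forall>s\<in>\<T>. \<forall>t\<in>\<T>. (\<forall>\<omega>\<in>path_space r. s \<omega> \<le> t \<omega>) \<longrightarrow> (\<forall>Y\<in>Linfty M (\<B> t).
            is_ess_sup M (penalized_expectations Q \<sigma> \<Lambda> g r T s t Y) (\<lambda>\<omega>. ereal (\<Phi> s t Y \<omega>))))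
       \<and> convex_dynamic_process M \<T> \<B> \<Phi>
       \<and> normalized_process M \<T> \<Phi>
       \<and> time_consistent M \<T> \<B> \<Phi>
       \<and> (\<forall>s\<in>\<T>. \<forall>t\<in>\<T>. (\<forall>\<omega>\<in>path_space r. s \<omega> \<le> t \<omega>) \<longrightarrow>
            convex_on_Linfty M (\<B> t) (\<Phi> s t) \<and>
            monotone_on_Linfty M (\<B> t) (\<Phi> s t) \<and>
            continuous_from_below_on_Linfty M (\<B> t) (\<Phi> s t))"
proof -
  interpret X: diffusion \<sigma> r T y Q by unfold_locales (fact assms)+
  interpret P: controlled_densities "completion Q" "cfilt Q r" r T "simple_controls Q \<Lambda> r T" X.Dm
    "\<lambda>u \<omega> v. g u (\<omega> u) v" "girsanov_measure Q \<sigma> r T"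
  proof
    fix \<mu> \<nu> assume \<mu>: "\<mu> \<in> simple_controls Q \<Lambda> r T" and \<nu>: "\<nu> \<in> simple_controls Q \<Lambda> r T"
    note reg = X.simple_controls_regular[OF \<mu>] X.simple_controls_regular[OF \<nu>]
    show "0 < X.Dm \<mu> t \<omega>" for t \<omega> by (rule X.Dm_pos)
    show "X.Dm \<mu> t \<in> borel_measurable (cfilt Q r t)" if "r \<le> t" "t \<le> T" for t
      using X.Dm_measurable[OF reg(1) that] .
    show "AE \<omega> in completion Q. X.Dm \<mu> r \<omega> = 1" by (rule X.Dm_start[OF reg(1)])
    show "(\<integral>\<^sup>+\<omega>\<in>A. X.Dm \<mu> T \<omega> \<partial>completion Q) = (\<integral>\<^sup>+\<omega>\<in>A. X.Dm \<mu> u \<omega> \<partial>completion Q)"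
      if "r \<le> u" "u \<le> T" "A \<in> sets (cfilt Q r u)" for u A using X.Dm_martingale[OF reg(1) that] .
    show "AE \<omega> in completion Q. (\<forall>x\<in>{u<..v}. \<mu> x \<omega> = \<nu> x \<omega>) \<longrightarrow> X.Dm \<mu> v \<omega> * X.Dm \<nu> u \<omega> = X.Dm \<nu> v \<omega> * X.Dm \<mu> u \<omega>"
      if "r \<le> u" "u \<le> v" "v \<le> T" for u v using X.Dm_local[OF reg that] .
    show "(\<lambda>(u, \<omega>). indicator {r<..v} u * g u (\<omega> u) (\<mu> u \<omega>)) \<in> borel_measurable (lborel \<Otimes>\<^sub>M cfilt Q r v)"
      if "r \<le> v" "v \<le> T" for v by (rule X.cost_measurable_F[OF assms(7) reg(1) that])
    show "girsanov_measure Q \<sigma> r T \<mu> = density (restr_to_subalg (completion Q) (cfilt Q r T)) (\<lambda>\<omega>. ennreal (X.Dm \<mu> T \<omega>))"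
      by (rule X.girsanov_measure_eq[OF reg(1)])
    show "(\<lambda>u \<omega>. if s \<omega> < u \<and> \<omega> \<in> A then \<nu> u \<omega> else \<mu> u \<omega>) \<in> simple_controls Q \<Lambda> r T"
      if "s \<in> X.times" "A \<in> sets (X.pre_sigma s)" for s A using X.simple_controls_paste[OF \<mu> \<nu> that] .
  next
    show "(\<lambda>_ _. 0) \<in> simple_controls Q \<Lambda> r T" by (rule X.simple_controls_zero[OF assms(4)])
    show "g u (\<omega> u) 0 = 0" if "r < u" for u \<omega> using assms(9,10) that by simp
  qed
  have times: "X.times = \<T>" unfolding X.times_def \<T>_def simple_stopping_times_def by simp
  have pre: "X.pre_sigma = \<B>" unfolding \<B>_def stopped_algebra_def[abs_def] by simp
  have fam: "P.ess_family s t Y = penalized_expectations Q \<sigma> \<Lambda> g r T s t Y" for s t Y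
    unfolding P.ess_family_def penalized_expectations_def penalty_def P.G_def pre \<B>_def ..
  have Phi: "P.Phi = \<Phi>"
    unfolding P.Phi_def[abs_def] fam \<Phi>_def penalized_process_def[abs_def] ..
  note * = P.Phi_properties[unfolded times pre fam Phi, unfolded X.space_M]
  have "convex_on_Linfty M (\<B> t) (\<Phi> s t) \<and> monotone_on_Linfty M (\<B> t) (\<Phi> s t) \<and> continuous_from_below_on_Linfty M (\<B> t) (\<Phi> s t)"
    if "s \<in> \<T>" "t \<in> \<T>" "\<forall>\<omega>\<in>path_space r. s \<omega> \<le> t \<omega>" for s t
    using *(2) that unfolding convex_dynamic_process_def M_def X.space_M by simp
  then show ?thesis using * unfolding M_def by blast
qed

end
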